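(* Let $n\ge2$ and let $h$ be a Euclidean harmonic $K$-quasiconformal mapping from the unit ball $\mathbb{B}\subset\mathbb{R}^n$ onto a bounded convex domain $D=h(\mathbb{B})$ which contains the ball $B(h(0);R_0)$. If $K_O(h)<3^{n-1}$, then $h$ is co-Lipschitz on $\mathbb{B}$.
   Context: A Euclidean harmonic mapping is one whose coordinate functions are harmonic. For a differentiable map $f$, $|f'(x)|=\max_{|v|=1}|f'(x)v|$, $\ell(f'(x))=\min_{|v|=1}|f'(x)v|$ and $J(x,f)$ is the Jacobian determinant. An injective $C^1$ map $f$ is $K$-quasiconformal if $|f'(x)|^n/K\le|J(x,f)|\le K\,\ell(f'(x))^n$ for every $x$. The outer dilatation $K_O(f)$ is the smallest constant $K'$ with $|f'(x)|^n\le K'|J(x,f)|$ for almost every $x$. The map $h$ is co-Lipschitz on $\mathbb{B}$ if there is $c>0$ with $|h(x)-h(y)|\ge c|x-y|$ for all $x,y\in\mathbb{B}$. *)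

theory Defs
  imports "HOL-Analysis.Analysis"
begin

text \<open>
  All notions below are meant for functions on an open set \<open>U\<close>, where the
  Frechet derivative is unique.
\<close>

definition C1_on :: "'a::real_normed_vector set \<Rightarrow> ('a \<Rightarrow> 'b::real_normed_vector) \<Rightarrow> bool" where
  "C1_on U f \<longleftrightarrow>
     (\<exists>D :: 'a \<Rightarrow> 'a \<Rightarrow>\<^sub>L 'b.
        (\<forall>x\<in>U. (f has_derivative blinfun_apply (D x)) (at x)) \<and> continuous_on U D)"

definition partial_deriv :: "'n::finite \<Rightarrow> (real ^ 'n \<Rightarrow> real) \<Rightarrow> real ^ 'n \<Rightarrow> real" where
  "partial_deriv i u x = frechet_derivative u (at x) (axis i 1)"

definition C2_on :: "(real ^ 'n::finite) set \<Rightarrow> (real ^ 'n \<Rightarrow> real) \<Rightarrow> bool" where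
  "C2_on U u \<longleftrightarrow> C1_on U u \<and> (\<forall>i. C1_on U (partial_deriv i u))"

definition laplacian :: "(real ^ 'n::finite \<Rightarrow> real) \<Rightarrow> real ^ 'n \<Rightarrow> real" where
  "laplacian u x = (\<Sum>i\<in>UNIV. partial_deriv i (partial_deriv i u) x)"

definition harmonic_on :: "(real ^ 'n::finite) set \<Rightarrow> (real ^ 'n \<Rightarrow> real) \<Rightarrow> bool" where
  "harmonic_on U u \<longleftrightarrow> C2_on U u \<and> (\<forall>x\<in>U. laplacian u x = 0)"

definition harmonic_mapping_on ::
  "(real ^ 'n::finite) set \<Rightarrow> (real ^ 'n \<Rightarrow> real ^ 'm::finite) \<Rightarrow> bool" where
  "harmonic_mapping_on U f \<longleftrightarrow> (\<forall>i. harmonic_on U (\<lambda>x. f x $ i))"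

text \<open>
  The maximal and minimal stretch \<open>|f'(x)|\<close> and \<open>\<ell>(f'(x))\<close>. Supremum and infimum
  are attained because the unit sphere is compact.
\<close>

definition max_stretch :: "(real ^ 'n::finite \<Rightarrow> real ^ 'n) \<Rightarrow> real ^ 'n \<Rightarrow> real" where
  "max_stretch f x = (SUP v\<in>sphere 0 1. norm (frechet_derivative f (at x) v))"

definition min_stretch :: "(real ^ 'n::finite \<Rightarrow> real ^ 'n) \<Rightarrow> real ^ 'n \<Rightarrow> real" where
  "min_stretch f x = (INF v\<in>sphere 0 1. norm (frechet_derivative f (at x) v))"

lemma stretch_attained:
  fixes f :: "real ^ 'n::finite \<Rightarrow> real ^ 'n"
  assumes "f differentiable (at x)"
  shows "\<exists>v\<in>sphere 0 1. norm (frechet_derivative f (at x) v) = max_stretch f x"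
    and "\<exists>v\<in>sphere 0 1. norm (frechet_derivative f (at x) v) = min_stretch f x"
    and "\<And>v. v \<in> sphere 0 1 \<Longrightarrow> norm (frechet_derivative f (at x) v) \<le> max_stretch f x"
    and "\<And>v. v \<in> sphere 0 1 \<Longrightarrow> min_stretch f x \<le> norm (frechet_derivative f (at x) v)"
proof -
  let ?g = "\<lambda>v. norm (frechet_derivative f (at x) v)"
  let ?S = "sphere 0 1 :: (real ^ 'n) set"
  have "bounded_linear (frechet_derivative f (at x))"
    using assms frechet_derivative_works has_derivative_bounded_linear by blast
  then have cont: "continuous_on ?S ?g"
    by (intro continuous_on_norm linear_continuous_on)
  have ne: "?S \<noteq> {}" by simp
  obtain v where v: "v \<in> ?S" "\<forall>w\<in>?S. ?g w \<le> ?g v"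
    using continuous_attains_sup[OF compact_sphere ne cont] by blast
  obtain u where u: "u \<in> ?S" "\<forall>w\<in>?S. ?g u \<le> ?g w"
    using continuous_attains_inf[OF compact_sphere ne cont] by blast
  have mx: "max_stretch f x = ?g v"
    unfolding max_stretch_def by (intro cSup_eq_maximum) (use v in auto)
  have mn: "min_stretch f x = ?g u"
    unfolding min_stretch_def by (intro cInf_eq_minimum) (use u in auto)
  show "\<exists>v\<in>?S. ?g v = max_stretch f x" using mx v(1) by metis
  show "\<exists>v\<in>?S. ?g v = min_stretch f x" using mn u(1) by metis
  show "?g w \<le> max_stretch f x" if "w \<in> ?S" for w using mx v(2) that by simp
  show "min_stretch f x \<le> ?g w" if "w \<in> ?S" for w using mn u(2) that by simp
qed

definition jacobian_det :: "(real ^ 'n::finite \<Rightarrow> real ^ 'n) \<Rightarrow> real ^ 'n \<Rightarrow> real" where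
  "jacobian_det f x = det (matrix (frechet_derivative f (at x)))"

text \<open>\<open>0 < K\<close> only excludes the degenerate reading of the division by \<open>K\<close>.\<close>

definition quasiconformal_on ::
  "real \<Rightarrow> (real ^ 'n::finite) set \<Rightarrow> (real ^ 'n \<Rightarrow> real ^ 'n) \<Rightarrow> bool" where
  "quasiconformal_on K U f \<longleftrightarrow>
     0 < K \<and> inj_on f U \<and> C1_on U f \<and>
     (\<forall>x\<in>U. max_stretch f x ^ CARD('n) / K \<le> \<bar>jacobian_det f x\<bar> \<and>
            \<bar>jacobian_det f x\<bar> \<le> K * min_stretch f x ^ CARD('n))"

text \<open>Extended-real valued, so that the value is \<open>\<infinity>\<close> if no constant is admissible.\<close>

definition outer_dilatation ::
  "(real ^ 'n::finite) set \<Rightarrow> (real ^ 'n \<Rightarrow> real ^ 'n) \<Rightarrow> ereal" where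
  "outer_dilatation U f =
     (INF K'\<in>{K'::real. 0 \<le> K' \<and>
        (AE x in lebesgue_on U. max_stretch f x ^ CARD('n) \<le> K' * \<bar>jacobian_det f x\<bar>)}.
      ereal K')"

definition co_Lipschitz_on ::
  "'a::real_normed_vector set \<Rightarrow> ('a \<Rightarrow> 'b::real_normed_vector) \<Rightarrow> bool" where
  "co_Lipschitz_on U f \<longleftrightarrow>
     (\<exists>c>0. \<forall>x\<in>U. \<forall>y\<in>U. norm (f x - f y) \<ge> c * norm (x - y))"

end

theory Submission
  imports Defs "HOL-Complex_Analysis.Great_Picard"
begin

text \<open>
  The proof bounds the derivative from below: there is a constant \<open>c > 0\<close> such that at every point
  \<open>x\<close> of the ball some vector \<open>v\<close> satisfies \<open>c |v| < |h'(x) v|\<close> (\<open>derivative_lower_bound\<close>).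
  Quasiconformality turns this into a positive lower bound for the minimal stretch, and since the image
  \<open>D\<close> is convex, the derivative of the inverse can be integrated along segments, which is the
  co-Lipschitz inequality (\<open>co_Lipschitz_on_derivative\<close>).

  The lower bound is proved by contradiction and rescaling. Suppose that \<open>h'(x_k)\<close> tends to \<open>0\<close>, let
  \<open>d_k = 1 - |x_k|\<close>, and let \<open>\<rho>_k\<close> be the distance from \<open>h(x_k)\<close> to the complement of \<open>D\<close>. A supporting
  functional of the convex set \<open>D\<close> turns \<open>h\<close> into a positive harmonic function. The Hopf barrier
  bounds this function from below and gives \<open>\<rho>_k \<ge> c d_k\<close>. The Harnack inequality bounds one component of
  \<open>h'\<close> near \<open>x_k\<close> by a multiple of \<open>\<rho>_k / d_k\<close>, and quasiconformality extends the bound to all of \<open>h'\<close>.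
  Hence the maps \<open>g_k(z) = (h(x_k + d_k z) - h(x_k)) / \<rho>_k\<close> are uniformly bounded, \<open>g_k'(0)\<close> tends to
  \<open>0\<close>, and a subsequence converges to a harmonic map \<open>g\<close> with \<open>g(0) = 0\<close> and \<open>g'(0) = 0\<close>. A capacity
  estimate (\<open>oscillation_lower_bound\<close>) keeps the oscillation of \<open>g_k\<close> on a fixed ball bounded away from
  \<open>0\<close>, so \<open>g\<close> is not zero. This contradicts \<open>critical_point_imp_zero\<close>: a limit of injective harmonic
  maps with distortion constant \<open>K < 3 ^ (n - 1)\<close> that vanishes together with its derivative at a
  point is identically zero.

  To prove the latter, blow up such a limit at its critical point. By the monotonicity of the Almgren
  frequency, suitable rescalings converge to a nonzero map \<open>P\<close>, homogeneous of some degree \<open>m\<close>, which is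
  again a limit of injective maps with the same distortion constant. Such a \<open>P\<close> vanishes only at the
  origin (\<open>homogeneous_nonzero\<close>), and comparing the volume covered by \<open>P\<close> with the volume covered by the
  radial stretching \<open>z \<mapsto> |P(z)| z / |z|\<close> gives \<open>m ^ (n - 1) \<le> K\<close> (\<open>homogeneity_degree_bound\<close>). So
  \<open>m < 3\<close>. But \<open>P'(0) = 0\<close>, so the odd part of \<open>P\<close> vanishes to third order at the origin and is
  therefore zero: \<open>P\<close> is even. An even map with an invertible derivative somewhere takes a value stably at
  two antipodal points and is not a limit of injective maps.

  Harmonicity enters through a mean value property over balls with the weight \<open>(1 - |z|\<^sup>2)\<^sup>2\<close>
  (\<open>mean_value_on\<close>). It passes to uniform limits at once, and since the weight is continuously differentiable and
  vanishes on the sphere, smoothness, gradient estimates and integration by parts all follow from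
  it without boundary terms.
\<close>

section \<open>Integrals over compact sets\<close>

lemma integrable_on_compact:
  fixes f :: "'a::euclidean_space \<Rightarrow> 'b::euclidean_space"
  assumes "compact C" "continuous_on C f"
  shows "f integrable_on C"
proof -
  have "set_integrable lborel C f"
    unfolding set_integrable_def using borel_integrable_compact[OF assms] .
  then show ?thesis by (rule set_borel_integral_eq_integral)
qed

lemma continuous_on_integral_param:
  fixes f :: "'c::metric_space \<Rightarrow> 'a::euclidean_space \<Rightarrow> 'b::euclidean_space"
  assumes C: "compact C" and cont: "continuous_on (X \<times> C) (\<lambda>(x,z). f x z)"
  shows "continuous_on X (\<lambda>x. integral C (f x))"
proof -
  have fint: "f x integrable_on C" if "x \<in> X" for x
  proof (rule integrable_on_compact[OF C])
    have "continuous_on C (\<lambda>z. (\<lambda>(x,z). f x z) (x,z))"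
      by (rule continuous_on_compose2[OF cont]) (use that in \<open>auto intro!: continuous_intros\<close>)
    then show "continuous_on C (f x)" by simp
  qed
  have cint: "(\<lambda>z. 1::real) integrable_on C"
    by (rule integrable_on_compact[OF C]) auto
  define V where "V = integral C (\<lambda>z. 1::real)"
  have V0: "V \<ge> 0" unfolding V_def by (rule integral_nonneg[OF cint]) auto
  show ?thesis unfolding continuous_on_iff
  proof (intro ballI allI impI)
    fix x0 e assume x0: "x0 \<in> X" and e: "(0::real) < e"
    define e' where "e' = e / (2 * (V + 1))"
    have e': "e' > 0" using e V0 by (auto simp: e'_def)
    obtain X0 where X0: "x0 \<in> X0" "open X0"
      "\<forall>x\<in>X0 \<inter> X. \<forall>t\<in>C. dist (f x t) (f x0 t) \<le> e'"
      using continuous_on_prod_compactE[OF cont C x0 e'] by auto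
    obtain d where d: "d > 0" "ball x0 d \<subseteq> X0" using X0(1,2) open_contains_ball by blast
    have "dist (integral C (f x)) (integral C (f x0)) < e" if "x \<in> X" "dist x x0 < d" for x
    proof -
      have "x \<in> X0" using d that by (auto simp: dist_commute)
      then have b: "\<forall>t\<in>C. norm (f x t - f x0 t) \<le> e'" using X0(3) that by (auto simp: dist_norm)
      have "integral C (f x) - integral C (f x0) = integral C (\<lambda>t. f x t - f x0 t)"
        by (rule integral_diff[symmetric]) (use fint that x0 in auto)
      moreover have "norm (integral C (\<lambda>t. f x t - f x0 t)) \<le> integral C (\<lambda>t. e' * 1)"
        by (rule integral_norm_bound_integral)
           (use fint that x0 b in \<open>auto intro!: integrable_diff integrable_on_compact[OF C, of "\<lambda>_. e'"]\<close>)
      moreover have "integral C (\<lambda>t. e' * 1) = e' * V"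
        unfolding V_def by (rule integral_mult_right)
      moreover have "e' * V < e" using V0 e by (auto simp: e'_def field_simps add_nonneg_pos)
      ultimately show ?thesis by (simp add: dist_norm)
    qed
    then show "\<exists>d>0. \<forall>x'\<in>X. dist x' x0 < d \<longrightarrow> dist (integral C (f x')) (integral C (f x0)) < e"
      using d by blast
  qed
qed

lemma has_vector_derivative_integral_compact:
  fixes f :: "real \<Rightarrow> 'a::euclidean_space \<Rightarrow> 'b::euclidean_space"
  assumes C: "compact C" and U: "convex U" "x0 \<in> U"
    and der: "\<And>x z. x \<in> U \<Longrightarrow> z \<in> C \<Longrightarrow> ((\<lambda>x. f x z) has_vector_derivative f' x z) (at x within U)"
    and cont: "\<And>x. x \<in> U \<Longrightarrow> continuous_on C (f x)"
    and cont': "continuous_on (U \<times> C) (\<lambda>(x,z). f' x z)"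
  shows "((\<lambda>x. integral C (f x)) has_vector_derivative integral C (f' x0)) (at x0 within U)"
proof -
  have fint: "f x integrable_on C" if "x \<in> U" for x
    using integrable_on_compact[OF C] cont that by blast
  have f'int: "f' x integrable_on C" if "x \<in> U" for x
  proof (rule integrable_on_compact[OF C])
    have "continuous_on C (\<lambda>z. (\<lambda>(x,z). f' x z) (x,z))"
      by (rule continuous_on_compose2[OF cont']) (use that in \<open>auto intro!: continuous_intros\<close>)
    then show "continuous_on C (f' x)" by simp
  qed
  have cint: "(\<lambda>z. 1::real) integrable_on C"
    by (rule integrable_on_compact[OF C]) auto
  define V where "V = integral C (\<lambda>z. 1::real)"
  have V0: "V \<ge> 0" unfolding V_def by (rule integral_nonneg[OF cint]) auto
  show ?thesis
    unfolding has_vector_derivative_def has_derivative_within_alt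
  proof (intro conjI allI impI)
    show "bounded_linear (\<lambda>h. h *\<^sub>R integral C (f' x0))"
      by (rule bounded_linear_scaleR_left)
    fix e :: real assume e: "0 < e"
    define e' where "e' = e / (V + 1)"
    have e': "e' > 0" using e V0 by (auto simp: e'_def)
    obtain X0 where X0: "x0 \<in> X0" "open X0"
      "\<forall>x\<in>X0 \<inter> U. \<forall>t\<in>C. dist (f' x t) (f' x0 t) \<le> e'"
      using continuous_on_prod_compactE[OF cont' C U(2) e'] by auto
    obtain d where d: "d > 0" "ball x0 d \<subseteq> X0" using X0(1,2) open_contains_ball by blast
    have "norm (integral C (f y) - integral C (f x0) - (y - x0) *\<^sub>R integral C (f' x0)) \<le> e * norm (y - x0)"
      if y: "y \<in> U" "norm (y - x0) < d" for y
    proof -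
      let ?S = "U \<inter> ball x0 d"
      have cS: "convex ?S" using U(1) by (intro convex_Int) auto
      have b: "norm (f y t - f x0 t - (y - x0) *\<^sub>R f' x0 t) \<le> e' * norm (y - x0) * 1" if t: "t \<in> C" for t
      proof -
        have "norm (f y t - f x0 t - (y - x0) *\<^sub>R f' x0 t) \<le> norm (y - x0) * e'"
        proof (rule vector_differentiable_bound_linearization[where S = ?S and f' = "\<lambda>x. f' x t"])
          show "closed_segment x0 y \<subseteq> ?S"
            by (rule closed_segment_subset[OF _ _ cS]) (use y U(2) d in \<open>auto simp: dist_norm norm_minus_commute\<close>)
        next
          fix x assume "x \<in> ?S"
          then show "((\<lambda>a. f a t) has_vector_derivative f' x t) (at x within ?S)"
            using der[of x t] t by (auto intro: has_vector_derivative_within_subset)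
        next
          fix x assume x: "x \<in> ?S"
          then show "norm (f' x t - f' x0 t) \<le> e'" using X0(3) d(2) t by (auto simp: dist_norm)
        qed (use U(2) d in auto)
        then show ?thesis by (simp add: mult.commute)
      qed
      have i1: "(\<lambda>t. f y t - f x0 t - (y - x0) *\<^sub>R f' x0 t) integrable_on C"
        by (intro integrable_diff integrable_cmul fint f'int y U)
      have "integral C (\<lambda>t. f y t - f x0 t - (y - x0) *\<^sub>R f' x0 t) =
            integral C (f y) - integral C (f x0) - (y - x0) *\<^sub>R integral C (f' x0)"
        using y U(2) by (simp add: integral_diff fint f'int integrable_diff integrable_cmul)
      moreover have "norm (integral C (\<lambda>t. f y t - f x0 t - (y - x0) *\<^sub>R f' x0 t)) \<le>
          integral C (\<lambda>t. e' * norm (y - x0) * 1)"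
        by (rule integral_norm_bound_integral[OF i1 _ b])
           (intro integrable_on_compact[OF C] continuous_intros)
      moreover have "integral C (\<lambda>t. e' * norm (y - x0) * 1) = e' * norm (y - x0) * V"
        unfolding V_def by (rule integral_mult_right)
      moreover have "e' * norm (y - x0) * V \<le> e * norm (y - x0)"
      proof -
        have "e' * V \<le> e" using V0 e by (auto simp: e'_def field_simps)
        then show ?thesis
          using mult_right_mono[of "e' * V" e "norm (y - x0)"] by (simp add: mult_ac)
      qed
      ultimately show ?thesis by (metis order.trans)
    qed
    then show "\<exists>d>0. \<forall>y\<in>U. norm (y - x0) < d \<longrightarrow>
       norm (integral C (f y) - integral C (f x0) - (y - x0) *\<^sub>R integral C (f' x0)) \<le> e * norm (y - x0)"
      using d by blast
  qed
qed

section \<open>The kernel and integration by parts\<close>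

text \<open>
  The truncation at \<open>0\<close> makes powers of the kernel extend by zero beyond the unit ball, with
  \<open>bump ^ 2\<close> once and \<open>bump ^ 3\<close> twice continuously differentiable.
\<close>

definition bump :: "'a::euclidean_space \<Rightarrow> real" where
  "bump z = max 0 (1 - z \<bullet> z)"

lemma bump_nonneg [simp]: "0 \<le> bump z" by (simp add: bump_def)

lemma bump_le_1 [simp]: "bump z \<le> 1" by (simp add: bump_def)

lemma bump_outside: "1 \<le> norm z \<Longrightarrow> bump z = 0"
  using one_le_power[of "norm z" 2] by (simp add: bump_def dot_square_norm)

lemma continuous_on_bump [continuous_intros]: "continuous_on S bump"
  unfolding bump_def [abs_def] by (intro continuous_intros)

lemma DERIV_pos_part_cube: "((\<lambda>r. max 0 r ^ 3) has_field_derivative 3 * (max 0 r)\<^sup>2) (at (r::real))"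
proof -
  consider "r < 0" | "r > 0" | "r = 0" by linarith
  then show ?thesis
  proof cases
    case 1
    have "((\<lambda>r. 0) has_field_derivative 3 * (max 0 r)\<^sup>2) (at r)" using 1 by simp
    then show ?thesis
      by (rule has_field_derivative_transform_within_open[where S="{..<0}"]) (use 1 in auto)
  next
    case 2
    have "((\<lambda>r. r ^ 3) has_field_derivative 3 * (max 0 r)\<^sup>2) (at r)"
      using 2 by (auto intro!: derivative_eq_intros)
    then show ?thesis
      by (rule has_field_derivative_transform_within_open[where S="{0<..}"]) (use 2 in auto)
  next
    case 3
    have "((\<lambda>h. (max 0 h)^3 / h) \<longlongrightarrow> 0) (at (0::real))"
    proof (rule tendsto_0_le[where K=1 and f="\<lambda>h. h^2"])
      show "((\<lambda>h::real. h\<^sup>2) \<longlongrightarrow> 0) (at 0)" by (intro tendsto_eq_intros) auto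
      show "\<forall>\<^sub>F x in at (0::real). norm ((max 0 x)^3 / x) \<le> norm (x\<^sup>2) * 1"
        by (rule always_eventually) (auto simp: max_def power3_eq_cube power2_eq_square abs_mult)
    qed
    then show ?thesis using 3 by (simp add: DERIV_def)
  qed
qed

lemma has_derivative_bump_cube:
  "((\<lambda>z::'a::euclidean_space. bump z ^ 3) has_derivative (\<lambda>v. - 6 * (bump z)\<^sup>2 * (z \<bullet> v))) (at z)"
proof -
  have "((\<lambda>z::'a. 1 - z \<bullet> z) has_derivative (\<lambda>v. - (z \<bullet> v + v \<bullet> z))) (at z)"
    by (auto intro!: derivative_eq_intros)
  from has_derivative_compose[OF this DERIV_pos_part_cube[of "1 - z \<bullet> z", unfolded has_field_derivative_def]]
  show ?thesis unfolding bump_def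
    by (rule has_derivative_eq_rhs) (auto simp: fun_eq_iff inner_commute algebra_simps)
qed

lemma integral_eq_on_subset:
  fixes f :: "'a::euclidean_space \<Rightarrow> 'b::euclidean_space"
  assumes "S \<subseteq> T" "\<And>x. x \<in> T \<Longrightarrow> x \<notin> S \<Longrightarrow> f x = 0"
  shows "integral T f = integral S f"
proof -
  have "integral T f = integral T (\<lambda>x. if x \<in> S then f x else 0)"
    by (rule integral_cong) (use assms in auto)
  also have "\<dots> = integral S f" using assms(1) by (simp add: integral_restrict_Int Int_absorb2)
  finally show ?thesis .
qed

lemma integral_cball_shift:
  fixes h :: "'a::euclidean_space \<Rightarrow> 'b::euclidean_space"
  shows "integral (cball \<xi> r) h = integral (cball 0 r) (\<lambda>z. h (z + \<xi>))"
proof -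
  obtain a where a: "cball (0::'a) r \<subseteq> cbox (-a) a"
    using bounded_subset_cbox_symmetric[OF bounded_cball] by blast
  have sub: "cball \<xi> r \<subseteq> cbox (-a + \<xi>) (a + \<xi>)"
  proof
    fix y assume "y \<in> cball \<xi> r"
    then have "y - \<xi> \<in> cbox (-a) a" using a by (auto simp: dist_norm norm_minus_commute subset_iff)
    then show "y \<in> cbox (-a + \<xi>) (a + \<xi>)" by (auto simp: mem_box inner_simps algebra_simps)
  qed
  define H where "H = (\<lambda>y. if y \<in> cball \<xi> r then h y else 0)"
  have "integral (cball \<xi> r) h = integral (cbox (-a + \<xi>) (a + \<xi>)) H"
    unfolding H_def integral_restrict_Int using sub by (simp add: Int_absorb2)
  also have "\<dots> = integral (cbox (-a) a) (\<lambda>z. H (z + \<xi>))"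
    by (subst integral_shift_cbox_plus[symmetric]) (simp add: o_def add.commute)
  also have "\<dots> = integral (cbox (-a) a) (\<lambda>z. if z \<in> cball 0 r then h (z + \<xi>) else 0)"
    by (rule integral_cong) (auto simp: H_def dist_norm)
  also have "\<dots> = integral (cball 0 r) (\<lambda>z. h (z + \<xi>))"
    unfolding integral_restrict_Int using a by (simp add: Int_absorb2)
  finally show ?thesis .
qed

text \<open>
  The integral of a compactly supported function does not change under translation; differentiate
  in the direction of the translation.
\<close>

lemma integral_directional_derivative_zero:
  fixes f :: "'a::euclidean_space \<Rightarrow> real"
  assumes der: "\<And>z. (f has_derivative f' z) (at z)"
    and cont: "continuous_on UNIV (\<lambda>z. f' z v)"
    and supp: "\<And>z. z \<notin> cball 0 1 \<Longrightarrow> f z = 0" "\<And>z. z \<notin> cball 0 1 \<Longrightarrow> f' z v = 0"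
  shows "integral (cball 0 1) (\<lambda>z. f' z v) = 0"
proof -
  obtain a where a: "cball (0::'a) (1 + norm v) \<subseteq> cbox (-a) a"
    using bounded_subset_cbox_symmetric[OF bounded_cball] by blast
  have contf: "continuous_on S f" for S
    using der has_derivative_continuous_on[of S f f'] by (blast intro: has_derivative_at_withinI)
  let ?\<phi> = "\<lambda>\<tau>. integral (cbox (-a) a) (\<lambda>z. f (z + \<tau> *\<^sub>R v))"
  have "(?\<phi> has_vector_derivative integral (cbox (-a) a) (\<lambda>z. f' (z + 0 *\<^sub>R v) v)) (at 0 within UNIV)"
  proof (rule has_vector_derivative_integral_compact[where f' = "\<lambda>\<tau> z. f' (z + \<tau> *\<^sub>R v) v"])
    fix \<tau> :: real and z :: 'a
    have "((\<lambda>\<tau>. z + \<tau> *\<^sub>R v) has_derivative (\<lambda>h. h *\<^sub>R v)) (at \<tau>)"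
      by (auto intro!: derivative_eq_intros)
    from has_derivative_compose[OF this der]
    have "((\<lambda>\<tau>. f (z + \<tau> *\<^sub>R v)) has_derivative (\<lambda>h. f' (z + \<tau> *\<^sub>R v) (h *\<^sub>R v))) (at \<tau>)" .
    moreover have "(\<lambda>h. f' (z + \<tau> *\<^sub>R v) (h *\<^sub>R v)) = (\<lambda>h. h *\<^sub>R f' (z + \<tau> *\<^sub>R v) v)"
      using der[THEN has_derivative_linear] by (auto simp: linear_cmul)
    ultimately show "((\<lambda>\<tau>. f (z + \<tau> *\<^sub>R v)) has_vector_derivative f' (z + \<tau> *\<^sub>R v) v) (at \<tau>)"
      unfolding has_vector_derivative_def by simp
  next
    show "continuous_on (UNIV \<times> cbox (- a) a) (\<lambda>(\<tau>, z). f' (z + \<tau> *\<^sub>R v) v)"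
      unfolding split_beta
      by (rule continuous_on_compose2[OF cont]) (auto intro!: continuous_intros)
  next
    fix \<tau> :: real show "continuous_on (cbox (- a) a) (\<lambda>z. f (z + \<tau> *\<^sub>R v))"
      by (rule continuous_on_compose2[OF contf[of UNIV]]) (auto intro!: continuous_intros)
  qed auto
  moreover have "integral (cbox (-a) a) (\<lambda>z. f' (z + 0 *\<^sub>R v) v) = integral (cball 0 1) (\<lambda>z. f' z v)"
    using a by (subst integral_eq_on_subset[of "cball 0 1"]) (use subset_trans[OF _ a, of "cball 0 1"] in \<open>auto simp: supp subset_iff add_increasing2\<close>)
  moreover have "(?\<phi> has_vector_derivative 0) (at 0)"
  proof (rule has_vector_derivative_transform_within_open[where S = "ball 0 1"])
    show "((\<lambda>\<tau>. integral (cball 0 1) f) has_vector_derivative 0) (at 0)" by simp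
    fix \<tau> :: real assume "\<tau> \<in> ball 0 1"
    then have \<tau>: "\<bar>\<tau>\<bar> \<le> 1" by simp
    have sub: "cball 0 1 \<subseteq> cbox (-a + \<tau> *\<^sub>R v) (a + \<tau> *\<^sub>R v)"
    proof
      fix y :: 'a assume "y \<in> cball 0 1"
      moreover have "norm (\<tau> *\<^sub>R v) \<le> norm v" using \<tau> by (simp add: mult_left_le_one_le)
      ultimately have "y - \<tau> *\<^sub>R v \<in> cbox (-a) a"
        using a norm_triangle_ineq4[of y "\<tau> *\<^sub>R v"] by (auto simp: subset_iff)
      then show "y \<in> cbox (-a + \<tau> *\<^sub>R v) (a + \<tau> *\<^sub>R v)" by (auto simp: mem_box inner_simps algebra_simps)
    qed
    show "integral (cball 0 1) f = integral (cbox (- a) a) (\<lambda>z. f (z + \<tau> *\<^sub>R v))"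
      using integral_shift_cbox_plus[of "-a" a f "\<tau> *\<^sub>R v"] integral_eq_on_subset[OF sub, of f] supp
      by (auto simp: o_def add.commute)
  qed auto
  ultimately show ?thesis
    using vector_derivative_unique_at by fastforce
qed

text \<open>
  The gradient of \<open>bump z ^ 3\<close> is \<open>- 6 * (bump z)\<^sup>2 *\<^sub>R z\<close>. This relation between the
  two weights \<open>bump ^ 3\<close> and \<open>bump ^ 2\<close> is the reason for using them throughout.
\<close>

lemma bump_integration_by_parts:
  fixes F :: "'a::euclidean_space \<Rightarrow> real"
  assumes W: "open W" "cball 0 1 \<subseteq> W"
    and der: "\<And>z. z \<in> W \<Longrightarrow> (F has_derivative F' z) (at z)"
    and cont: "continuous_on (cball 0 1) (\<lambda>z. F' z v)"
  shows "integral (cball 0 1) (\<lambda>z. bump z ^ 3 * F' z v)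
       = 6 * integral (cball 0 1) (\<lambda>z. (bump z)\<^sup>2 * (z \<bullet> v) * F z)"
proof -
  let ?B = "cball (0::'a) 1"
  have contF: "continuous_on ?B F"
    using der W has_derivative_continuous_on[of ?B F F'] by (blast intro: has_derivative_at_withinI)
  let ?g = "\<lambda>z w. bump z ^ 3 * F' z w - 6 * (bump z)\<^sup>2 * (z \<bullet> w) * F z"
  define f where "f z = (if z \<in> ?B then bump z ^ 3 * F z else 0)" for z
  define f' where "f' z w = (if z \<in> ?B then ?g z w else 0)" for z w
  have "integral ?B (\<lambda>z. f' z v) = 0"
  proof (rule integral_directional_derivative_zero)
    show "(f has_derivative f' z) (at z)" for z
    proof (cases "z \<in> ?B")
      case True
      then have z: "z \<in> W" using W by blast
      have "((\<lambda>z. bump z ^ 3 * F z) has_derivative f' z) (at z)"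
        by (rule has_derivative_eq_rhs[OF has_derivative_mult[OF has_derivative_bump_cube der[OF z]]])
           (use True in \<open>auto simp: f'_def fun_eq_iff algebra_simps\<close>)
      then show ?thesis
        by (rule has_derivative_transform_within_open[OF _ W(1) z]) (auto simp: f_def bump_outside)
    next
      case False
      have "((\<lambda>z. 0) has_derivative f' z) (at z)" using False by (simp add: f'_def [abs_def])
      then show ?thesis
        by (rule has_derivative_transform_within_open[OF _ open_Compl[OF closed_cball[of 0 1]]]) (use False in \<open>auto simp: f_def\<close>)
    qed
    have "continuous_on ({z. 1 \<le> norm z} \<union> ?B) (\<lambda>z. f' z v)"
    proof (rule continuous_on_closed_Un)
      show "closed {z::'a. 1 \<le> norm z}" by (intro closed_Collect_le continuous_intros)
      have "continuous_on {z. 1 \<le> norm z} (\<lambda>z::'a. 0::real)" by simp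
      then show "continuous_on {z. 1 \<le> norm z} (\<lambda>z. f' z v)"
        by (rule continuous_on_eq) (auto simp: f'_def bump_outside)
      have "continuous_on ?B (\<lambda>z. ?g z v)"
        by (intro continuous_intros cont contF)
      then show "continuous_on ?B (\<lambda>z. f' z v)"
        by (rule continuous_on_eq) (auto simp: f'_def)
    qed auto
    moreover have "{z. 1 \<le> norm z} \<union> ?B = UNIV" by auto
    ultimately show "continuous_on UNIV (\<lambda>z. f' z v)" by metis
  qed (auto simp: f_def f'_def)
  moreover have "integral ?B (\<lambda>z. f' z v) = integral ?B (\<lambda>z. bump z ^ 3 * F' z v - 6 * ((bump z)\<^sup>2 * (z \<bullet> v) * F z))"
    by (rule integral_cong) (auto simp: f'_def)
  moreover have "\<dots> = integral ?B (\<lambda>z. bump z ^ 3 * F' z v) - integral ?B (\<lambda>z. 6 * ((bump z)\<^sup>2 * (z \<bullet> v) * F z))"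
    by (intro integral_diff integrable_on_compact continuous_intros cont contF) auto
  ultimately show ?thesis by simp
qed

lemma integral_cball_eq_0_imp_0:
  fixes f :: "'a::euclidean_space \<Rightarrow> real"
  assumes cont: "continuous_on (cball x r) f" and r: "r > 0"
    and nonneg: "\<And>z. z \<in> cball x r \<Longrightarrow> 0 \<le> f z" and int: "integral (cball x r) f = 0"
    and z: "z \<in> cball x r"
  shows "f z = 0"
proof -
  have i: "f integrable_on cball x r" by (intro integrable_on_compact cont) auto
  then have 0: "(f has_integral 0) (closure (ball x r))"
    using int r by (simp add: has_integral_iff)
  show ?thesis
  proof (rule has_integral_0_closure_imp_0[OF _ _ _ _ _ _ 0])
    show "0 < emeasure lborel (ball x r)" "emeasure lborel (closure (ball x r)) = emeasure lborel (ball x r)"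
      using r by (simp_all add: emeasure_ball emeasure_cball)
    show "emeasure lborel (ball x r) < \<infinity>" using r by (simp add: emeasure_ball ennreal_mult_less_top)
  qed (use assms in auto)
qed

section \<open>The weighted mean value property\<close>

definition bump_mass :: "'a::euclidean_space itself \<Rightarrow> real" where
  "bump_mass _ = integral (cball (0::'a) 1) (\<lambda>z. (bump z)\<^sup>2)"

lemma bump_mass_pos: "bump_mass TYPE('a::euclidean_space) > 0"
proof -
  have i: "(\<lambda>z::'a. (bump z)\<^sup>2) integrable_on cball 0 1"
    by (intro integrable_on_compact continuous_intros) auto
  have "integral (cball (0::'a) 1) (\<lambda>z. (bump z)\<^sup>2) \<noteq> 0"
    using integral_cball_eq_0_imp_0[of 0 1 "\<lambda>z::'a. (bump z)\<^sup>2" 0]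
    by (force intro!: continuous_intros simp: bump_def)
  moreover have "integral (cball (0::'a) 1) (\<lambda>z. (bump z)\<^sup>2) \<ge> 0"
    by (rule integral_nonneg[OF i]) auto
  ultimately show ?thesis unfolding bump_mass_def by simp
qed

text \<open>
  Harmonicity in a form that is visibly stable under uniform limits.
\<close>

definition mean_value_on :: "'a::euclidean_space set \<Rightarrow> ('a \<Rightarrow> 'b::euclidean_space) \<Rightarrow> bool" where
  "mean_value_on U f \<longleftrightarrow> continuous_on U f \<and>
     (\<forall>x t. 0 < t \<and> cball x t \<subseteq> U \<longrightarrow>
        integral (cball 0 1) (\<lambda>z. (bump z)\<^sup>2 *\<^sub>R f (x + t *\<^sub>R z)) = bump_mass TYPE('a) *\<^sub>R f x)"

lemma mean_value_onD:
  fixes f :: "'a::euclidean_space \<Rightarrow> 'b::euclidean_space"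
  assumes "mean_value_on U f" "0 < t" "cball x t \<subseteq> U"
  shows "integral (cball 0 1) (\<lambda>z. (bump z)\<^sup>2 *\<^sub>R f (x + t *\<^sub>R z)) = bump_mass TYPE('a) *\<^sub>R f x"
  using assms unfolding mean_value_on_def by blast

lemma mean_value_on_continuous: "mean_value_on U f \<Longrightarrow> continuous_on U f"
  unfolding mean_value_on_def by blast

lemma mean_value_on_subset: "mean_value_on U f \<Longrightarrow> V \<subseteq> U \<Longrightarrow> mean_value_on V f"
  unfolding mean_value_on_def using continuous_on_subset by blast

lemma affine_cball_mem: "0 \<le> t \<Longrightarrow> z \<in> cball 0 1 \<Longrightarrow> x + t *\<^sub>R z \<in> cball x t" for z :: "'a::real_normed_vector"
  by (auto simp: dist_norm mult_left_le)

lemma affine_cball_mem': "0 \<le> \<tau> \<Longrightarrow> \<tau> \<le> t \<Longrightarrow> z \<in> cball 0 1 \<Longrightarrow> x + \<tau> *\<^sub>R z \<in> cball x t" for z :: "'a::real_normed_vector"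
  using affine_cball_mem[of \<tau> z x] by auto

lemma continuous_on_affine_cball:
  fixes f :: "'a::real_normed_vector \<Rightarrow> 'b::topological_space"
  assumes "continuous_on U f" "cball x t \<subseteq> U" "0 \<le> t"
  shows "continuous_on (cball 0 1) (\<lambda>z. f (x + t *\<^sub>R z))"
proof (rule continuous_on_compose2[OF assms(1)])
  show "(\<lambda>z. x + t *\<^sub>R z) ` cball 0 1 \<subseteq> U"
    using affine_cball_mem[OF assms(3)] assms(2) by blast
qed (intro continuous_intros)

text \<open>
  Differentiating the mean in the radius produces the radial derivative with weight \<open>bump ^ 2\<close>;
  one integration by parts turns it into the Laplacian with weight \<open>bump ^ 3\<close>.
\<close>

lemma weighted_mean_derivative:
  fixes u :: "'a::euclidean_space \<Rightarrow> real"
  assumes U: "open U" "cball x t \<subseteq> U"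
    and der: "\<And>y. y \<in> U \<Longrightarrow> (u has_derivative u' y) (at y)"
    and der2: "\<And>y b. y \<in> U \<Longrightarrow> b \<in> Basis \<Longrightarrow> ((\<lambda>y. u' y b) has_derivative u'' b y) (at y)"
    and cont2: "\<And>b. b \<in> Basis \<Longrightarrow> continuous_on U (\<lambda>y. u'' b y b)"
    and \<tau>: "\<tau> \<in> {0..t}"
  shows "((\<lambda>\<tau>. integral (cball 0 1) (\<lambda>z. (bump z)\<^sup>2 * u (x + \<tau> *\<^sub>R z))) has_vector_derivative
     (\<tau> / 6) * integral (cball 0 1) (\<lambda>z. bump z ^ 3 * (\<Sum>b\<in>Basis. u'' b (x + \<tau> *\<^sub>R z) b))) (at \<tau> within {0..t})"
proof -
  let ?B = "cball (0::'a) 1"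
  have mem: "x + \<tau> *\<^sub>R z \<in> U" if "\<tau> \<in> {0..t}" "z \<in> ?B" for \<tau> z
    using U(2) affine_cball_mem'[of \<tau> t z x] that by auto
  have contu: "continuous_on U u"
    using der has_derivative_continuous_on[of U u u'] by (blast intro: has_derivative_at_withinI)
  have cont1: "continuous_on U (\<lambda>y. u' y b)" if "b \<in> Basis" for b
    using der2[OF _ that] has_derivative_continuous_on[of U "\<lambda>y. u' y b"] by (blast intro: has_derivative_at_withinI)
  have lin: "u' y z = (\<Sum>b\<in>Basis. (z \<bullet> b) * u' y b)" if "y \<in> U" for y z
  proof -
    have "linear (u' y)" using der[OF that] by (rule has_derivative_linear)
    then have "u' y (\<Sum>b\<in>Basis. (z \<bullet> b) *\<^sub>R b) = (\<Sum>b\<in>Basis. (z \<bullet> b) * u' y b)"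
      by (simp add: linear_sum linear_cmul)
    then show ?thesis by (simp add: euclidean_representation)
  qed
  have c\<tau>: "continuous_on ?B (\<lambda>z. g (x + \<tau> *\<^sub>R z))" if "continuous_on U g" "\<tau> \<in> {0..t}" for g :: "'a \<Rightarrow> real" and \<tau>
  proof (rule continuous_on_compose2[OF that(1)])
    show "(\<lambda>z. x + \<tau> *\<^sub>R z) ` ?B \<subseteq> U" using mem that(2) by blast
  qed (intro continuous_intros)
  have 1: "((\<lambda>\<tau>. integral ?B (\<lambda>z. (bump z)\<^sup>2 * u (x + \<tau> *\<^sub>R z))) has_vector_derivative
     integral ?B (\<lambda>z. (bump z)\<^sup>2 * u' (x + \<tau> *\<^sub>R z) z)) (at \<tau> within {0..t})"
  proof (rule has_vector_derivative_integral_compact[where f' = "\<lambda>\<tau> z. (bump z)\<^sup>2 * u' (x + \<tau> *\<^sub>R z) z"])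
    fix \<sigma> z assume *: "\<sigma> \<in> {0..t}" "z \<in> ?B"
    have "((\<lambda>\<tau>. x + \<tau> *\<^sub>R z) has_derivative (\<lambda>h. h *\<^sub>R z)) (at \<sigma>)"
      by (auto intro!: derivative_eq_intros)
    from has_derivative_compose[OF this der[OF mem[OF *]]]
    have "((\<lambda>\<tau>. u (x + \<tau> *\<^sub>R z)) has_derivative (\<lambda>h. u' (x + \<sigma> *\<^sub>R z) (h *\<^sub>R z))) (at \<sigma>)" .
    moreover have "(\<lambda>h. u' (x + \<sigma> *\<^sub>R z) (h *\<^sub>R z)) = (*) (u' (x + \<sigma> *\<^sub>R z) z)"
      using linear_cmul[OF has_derivative_linear[OF der[OF mem[OF *]]]] by (simp add: fun_eq_iff mult.commute)
    ultimately have "((\<lambda>\<tau>. u (x + \<tau> *\<^sub>R z)) has_field_derivative u' (x + \<sigma> *\<^sub>R z) z) (at \<sigma>)"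
      unfolding has_field_derivative_def by metis
    then have "((\<lambda>\<tau>. (bump z)\<^sup>2 * u (x + \<tau> *\<^sub>R z)) has_field_derivative (bump z)\<^sup>2 * u' (x + \<sigma> *\<^sub>R z) z) (at \<sigma>)"
      by (rule DERIV_cmult)
    then show "((\<lambda>x'. (bump z)\<^sup>2 * u (x + x' *\<^sub>R z)) has_vector_derivative
             (bump z)\<^sup>2 * u' (x + \<sigma> *\<^sub>R z) z) (at \<sigma> within {0..t})"
      using has_real_derivative_iff_has_vector_derivative has_vector_derivative_at_within by blast
  next
    fix \<sigma> assume "\<sigma> \<in> {0..t}"
    then show "continuous_on ?B (\<lambda>z. (bump z)\<^sup>2 * u (x + \<sigma> *\<^sub>R z))"
      by (intro continuous_intros c\<tau> contu) auto
  next
    have "continuous_on ({0..t} \<times> ?B) (\<lambda>(\<tau>, z). (bump z)\<^sup>2 * (\<Sum>b\<in>Basis. (z \<bullet> b) * u' (x + \<tau> *\<^sub>R z) b))"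
      unfolding split_beta
    proof (intro continuous_intros continuous_on_compose2[OF continuous_on_bump[of UNIV]])
      fix b :: 'a assume b: "b \<in> Basis"
      show "continuous_on ({0..t} \<times> ?B) (\<lambda>p. u' (x + fst p *\<^sub>R snd p) b)"
      proof (rule continuous_on_compose2[OF cont1[OF b]])
        show "(\<lambda>p. x + fst p *\<^sub>R snd p) ` ({0..t} \<times> ?B) \<subseteq> U" using mem by auto
      qed (intro continuous_intros)
    qed auto
    then show "continuous_on ({0..t} \<times> ?B) (\<lambda>(\<tau>, z). (bump z)\<^sup>2 * u' (x + \<tau> *\<^sub>R z) z)"
    proof (rule continuous_on_eq)
      fix p assume "p \<in> {0..t} \<times> ?B"
      then show "(\<lambda>(\<tau>, z). (bump z)\<^sup>2 * (\<Sum>b\<in>Basis. (z \<bullet> b) * u' (x + \<tau> *\<^sub>R z) b)) p = (\<lambda>(\<tau>, z). (bump z)\<^sup>2 * u' (x + \<tau> *\<^sub>R z) z) p"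
        using lin[OF mem, of "fst p" "snd p" "snd p"] by (auto simp: split_beta)
    qed
  qed (use \<tau> in auto)
  have 2: "integral ?B (\<lambda>z. (bump z)\<^sup>2 * (z \<bullet> b) * u' (x + \<tau> *\<^sub>R z) b)
     = (\<tau>/6) * integral ?B (\<lambda>z. bump z ^ 3 * u'' b (x + \<tau> *\<^sub>R z) b)" if b: "b \<in> Basis" for b
  proof -
    have eq: "u'' b (x + \<tau> *\<^sub>R z) (\<tau> *\<^sub>R b) = \<tau> * u'' b (x + \<tau> *\<^sub>R z) b" if "z \<in> ?B" for z
      using linear_cmul[OF has_derivative_linear[OF der2[OF mem[OF \<tau> that] b]]] by simp
    have "integral ?B (\<lambda>z. bump z ^ 3 * u'' b (x + \<tau> *\<^sub>R z) (\<tau> *\<^sub>R b)) =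
        6 * integral ?B (\<lambda>z. (bump z)\<^sup>2 * (z \<bullet> b) * u' (x + \<tau> *\<^sub>R z) b)"
    proof (rule bump_integration_by_parts[where F' = "\<lambda>z v. u'' b (x + \<tau> *\<^sub>R z) (\<tau> *\<^sub>R v)"])
      show "open ((\<lambda>z. x + \<tau> *\<^sub>R z) -` U)"
        by (rule open_vimage[OF U(1)]) (intro continuous_intros)
      show "?B \<subseteq> (\<lambda>z. x + \<tau> *\<^sub>R z) -` U" using mem[OF \<tau>] by blast
      fix z assume z: "z \<in> (\<lambda>z. x + \<tau> *\<^sub>R z) -` U"
      have "((\<lambda>z. x + \<tau> *\<^sub>R z) has_derivative (\<lambda>v. \<tau> *\<^sub>R v)) (at z)"
        by (auto intro!: derivative_eq_intros)
      from has_derivative_compose[OF this der2[OF _ b]] z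
      show "((\<lambda>z. u' (x + \<tau> *\<^sub>R z) b) has_derivative (\<lambda>v. u'' b (x + \<tau> *\<^sub>R z) (\<tau> *\<^sub>R v))) (at z)" by simp
    next
      have "continuous_on ?B (\<lambda>z. \<tau> * u'' b (x + \<tau> *\<^sub>R z) b)"
        by (intro continuous_intros c\<tau> cont2 b \<tau>)
      then show "continuous_on ?B (\<lambda>z. u'' b (x + \<tau> *\<^sub>R z) (\<tau> *\<^sub>R b))"
        by (rule continuous_on_eq) (simp add: eq)
    qed
    moreover have "integral ?B (\<lambda>z. bump z ^ 3 * u'' b (x + \<tau> *\<^sub>R z) (\<tau> *\<^sub>R b)) =
        integral ?B (\<lambda>z. \<tau> * (bump z ^ 3 * u'' b (x + \<tau> *\<^sub>R z) b))"
      by (rule integral_cong) (simp add: eq)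
    ultimately show ?thesis by simp
  qed
  have "integral ?B (\<lambda>z. (bump z)\<^sup>2 * u' (x + \<tau> *\<^sub>R z) z) =
        integral ?B (\<lambda>z. \<Sum>b\<in>Basis. (bump z)\<^sup>2 * (z \<bullet> b) * u' (x + \<tau> *\<^sub>R z) b)"
  proof (rule integral_cong)
    fix z assume z: "z \<in> ?B"
    show "(bump z)\<^sup>2 * u' (x + \<tau> *\<^sub>R z) z = (\<Sum>b\<in>Basis. (bump z)\<^sup>2 * (z \<bullet> b) * u' (x + \<tau> *\<^sub>R z) b)"
      unfolding sum_distrib_left mult.assoc
      unfolding sum_distrib_left[symmetric] by (subst lin[OF mem[OF \<tau> z], of z]) simp
  qed
  also have "\<dots> = (\<Sum>b\<in>Basis. integral ?B (\<lambda>z. (bump z)\<^sup>2 * (z \<bullet> b) * u' (x + \<tau> *\<^sub>R z) b))"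
    by (intro integral_sum integrable_on_compact continuous_intros c\<tau> cont1 \<tau>) auto
  also have "\<dots> = (\<Sum>b\<in>Basis. (\<tau>/6) * integral ?B (\<lambda>z. bump z ^ 3 * u'' b (x + \<tau> *\<^sub>R z) b))"
    by (rule sum.cong[OF refl 2])
  also have "\<dots> = (\<tau>/6) * (\<Sum>b\<in>Basis. integral ?B (\<lambda>z. bump z ^ 3 * u'' b (x + \<tau> *\<^sub>R z) b))"
    by (rule sum_distrib_left[symmetric])
  also have "(\<Sum>b\<in>Basis. integral ?B (\<lambda>z. bump z ^ 3 * u'' b (x + \<tau> *\<^sub>R z) b)) =
     integral ?B (\<lambda>z. \<Sum>b\<in>Basis. bump z ^ 3 * u'' b (x + \<tau> *\<^sub>R z) b)"
    by (intro integral_sum[symmetric] integrable_on_compact continuous_intros c\<tau> cont2 \<tau>) auto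
  finally show ?thesis using 1 by (simp only: sum_distrib_left)
qed

text \<open>
  The weighted mean is constant in the radius and tends to the value at the centre.
\<close>

lemma mean_value_on_laplace:
  fixes u :: "'a::euclidean_space \<Rightarrow> real"
  assumes U: "open U"
    and der: "\<And>y. y \<in> U \<Longrightarrow> (u has_derivative u' y) (at y)"
    and der2: "\<And>y b. y \<in> U \<Longrightarrow> b \<in> Basis \<Longrightarrow> ((\<lambda>y. u' y b) has_derivative u'' b y) (at y)"
    and cont2: "\<And>b. b \<in> Basis \<Longrightarrow> continuous_on U (\<lambda>y. u'' b y b)"
    and laplace: "\<And>y. y \<in> U \<Longrightarrow> (\<Sum>b\<in>Basis. u'' b y b) = 0"
  shows "mean_value_on U u"
  unfolding mean_value_on_def
proof (intro conjI allI impI)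
  show "continuous_on U u"
    using der has_derivative_continuous_on[of U u u'] by (blast intro: has_derivative_at_withinI)
  fix x t assume xt: "0 < t \<and> cball x t \<subseteq> U"
  let ?M = "\<lambda>\<tau>. integral (cball 0 1) (\<lambda>z. (bump z)\<^sup>2 * u (x + \<tau> *\<^sub>R z))"
  have "(?M has_vector_derivative 0) (at \<tau> within {0..t})" if \<tau>: "\<tau> \<in> {0..t}" for \<tau>
  proof -
    have "integral (cball 0 1) (\<lambda>z. bump z ^ 3 * (\<Sum>b\<in>Basis. u'' b (x + \<tau> *\<^sub>R z) b)) = integral (cball 0 1) (\<lambda>z::'a. 0::real)"
    proof (rule integral_cong)
      fix z :: 'a assume "z \<in> cball 0 1"
      then have "x + \<tau> *\<^sub>R z \<in> U" using xt affine_cball_mem'[of \<tau> t z x] \<tau> by auto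
      then show "bump z ^ 3 * (\<Sum>b\<in>Basis. u'' b (x + \<tau> *\<^sub>R z) b) = 0" using laplace by simp
    qed
    then show ?thesis
      using weighted_mean_derivative[OF U _ der der2 cont2 \<tau>, of x] xt by simp
  qed
  then obtain c where c: "\<And>\<tau>. \<tau> \<in> {0..t} \<Longrightarrow> ?M \<tau> = c"
    by (rule has_vector_derivative_zero_constant[rotated]) auto
  have t: "t \<in> {0..t}" "0 \<in> {0..t}" using xt by auto
  have "?M t = ?M 0" by (rule trans[OF c[OF t(1)] c[OF t(2), symmetric]])
  moreover have "?M 0 = integral (cball (0::'a) 1) (\<lambda>z. (bump z)\<^sup>2 * u x)" by simp
  moreover have "\<dots> = bump_mass TYPE('a) * u x"
    unfolding bump_mass_def by (rule integral_mult_left)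
  ultimately show "integral (cball 0 1) (\<lambda>z. (bump z)\<^sup>2 *\<^sub>R u (x + t *\<^sub>R z)) = bump_mass TYPE('a) *\<^sub>R u x"
    unfolding real_scaleR_def by metis
qed

section \<open>Smoothness from the mean value property\<close>

lemma has_derivative_quadratic_bound:
  fixes g :: "'a::real_normed_vector \<Rightarrow> 'b::real_normed_vector"
  assumes L: "bounded_linear L" and r: "r > 0"
    and bound: "\<And>\<xi>. norm \<xi> < r \<Longrightarrow> norm (g (a + \<xi>) - g a - L \<xi>) \<le> C * (norm \<xi>)\<^sup>2"
  shows "(g has_derivative L) (at a)"
  unfolding has_derivative_at_alt
proof (intro conjI L allI impI)
  fix e :: real assume e: "e > 0"
  define d where "d = min r (e / (\<bar>C\<bar> + 1))"
  have "norm (g y - g a - L (y - a)) \<le> e * norm (y - a)" if "norm (y - a) < d" for y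
  proof -
    have "norm (g y - g a - L (y - a)) \<le> C * (norm (y - a))\<^sup>2"
      using bound[of "y - a"] that by (simp add: d_def)
    also have "\<dots> \<le> (\<bar>C\<bar> + 1) * norm (y - a) * norm (y - a)"
      by (simp add: power2_eq_square mult_right_mono mult.assoc)
    also have "\<dots> \<le> e * norm (y - a)"
      using that by (intro mult_right_mono) (auto simp: d_def field_simps)
    finally show ?thesis .
  qed
  moreover have "d > 0" using e r by (auto simp: d_def)
  ultimately show "\<exists>d>0. \<forall>y. norm (y - a) < d \<longrightarrow> norm (g y - g a - L (y - a)) \<le> e * norm (y - a)"
    by blast
qed

lemma pos_part_square_expand:
  fixes r r' :: real
  shows "\<bar>(max 0 r')\<^sup>2 - (max 0 r)\<^sup>2 - 2 * max 0 r * (r' - r)\<bar> \<le> (r' - r)\<^sup>2"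
proof -
  consider "r \<le> 0" "r' \<le> 0" | "r > 0" "r' > 0" | "r \<le> 0" "r' > 0" | "r > 0" "r' \<le> 0" by linarith
  then show ?thesis
  proof cases
    case 3 then have "r'\<^sup>2 \<le> (r' - r)\<^sup>2" by (intro power_mono) auto
    then show ?thesis using 3 by simp
  next
    case 4
    have "(r' - r)\<^sup>2 = r\<^sup>2 + (r'\<^sup>2 - 2 * r * r')" by (simp add: power2_eq_square algebra_simps)
    moreover have "r * r' \<le> 0" using 4 by (simp add: mult_nonneg_nonpos)
    then have "r\<^sup>2 - 2 * r * r' \<ge> 0" using zero_le_power2[of r] by linarith
    moreover have "- r\<^sup>2 - 2 * r * (r' - r) = r\<^sup>2 - 2 * r * r'" by (simp add: power2_eq_square algebra_simps)
    ultimately show ?thesis using 4 by simp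
  next
    case 2
    have "r'\<^sup>2 - r\<^sup>2 - 2 * r * (r' - r) = (r' - r)\<^sup>2" by (simp add: power2_eq_square algebra_simps)
    then show ?thesis using 2 by simp
  qed simp
qed

text \<open>
  The squared kernel is differentiable with a quadratic error that is uniform up to and across the
  unit sphere.
\<close>

lemma bump_square_expand:
  fixes y \<xi> :: "'a::euclidean_space"
  assumes "norm \<xi> \<le> 1" "norm y \<le> 2"
  shows "\<bar>(bump (y - \<xi>))\<^sup>2 - (bump y)\<^sup>2 - 4 * bump y * (y \<bullet> \<xi>)\<bar> \<le> 27 * (norm \<xi>)\<^sup>2"
proof -
  let ?r = "1 - y \<bullet> y" and ?r' = "1 - (y - \<xi>) \<bullet> (y - \<xi>)"
  have d: "?r' - ?r = 2 * (y \<bullet> \<xi>) - (norm \<xi>)\<^sup>2"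
    by (simp add: power2_norm_eq_inner inner_simps inner_commute)
  have "\<bar>y \<bullet> \<xi>\<bar> \<le> 2 * norm \<xi>"
    using Cauchy_Schwarz_ineq2[of y \<xi>] mult_right_mono[OF assms(2), of "norm \<xi>"] by simp
  moreover have "(norm \<xi>)\<^sup>2 \<le> norm \<xi>" using assms(1) by (simp add: power2_eq_square mult_left_le)
  ultimately have "\<bar>?r' - ?r\<bar> \<le> 5 * norm \<xi>" unfolding d using norm_ge_zero[of \<xi>] zero_le_power2[of "norm \<xi>"] by arith
  then have "(?r' - ?r)\<^sup>2 \<le> (5 * norm \<xi>)\<^sup>2"
    using abs_le_square_iff by fastforce
  also have "\<dots> = 25 * (norm \<xi>)\<^sup>2" by (simp add: power_mult_distrib)
  finally have "(?r' - ?r)\<^sup>2 \<le> 25 * (norm \<xi>)\<^sup>2" .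
  then have 1: "\<bar>(bump (y - \<xi>))\<^sup>2 - (bump y)\<^sup>2 - 2 * bump y * (?r' - ?r)\<bar> \<le> 25 * (norm \<xi>)\<^sup>2"
    using pos_part_square_expand[of ?r' ?r, folded bump_def] by (meson order_trans)
  have 2: "\<bar>2 * bump y * (norm \<xi>)\<^sup>2\<bar> \<le> 2 * (norm \<xi>)\<^sup>2"
    by (simp add: abs_mult mult_left_le_one_le)
  have "(bump (y - \<xi>))\<^sup>2 - (bump y)\<^sup>2 - 4 * bump y * (y \<bullet> \<xi>) =
     ((bump (y - \<xi>))\<^sup>2 - (bump y)\<^sup>2 - 2 * bump y * (?r' - ?r)) - 2 * bump y * (norm \<xi>)\<^sup>2"
    unfolding d by (simp add: algebra_simps)
  then show ?thesis using 1 2 by linarith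
qed

text \<open>
  The derivative of the weighted mean in its centre, with the differentiation moved to the kernel. This
  is why the mean value property makes continuous maps smooth.
\<close>

definition kernel_derivative :: "('a::euclidean_space \<Rightarrow> 'b::euclidean_space) \<Rightarrow> 'a \<Rightarrow> real \<Rightarrow> 'a \<Rightarrow> 'b" where
  "kernel_derivative f x t v = (1 / (bump_mass TYPE('a) * t)) *\<^sub>R integral (cball 0 1) (\<lambda>z. (4 * bump z * (z \<bullet> v)) *\<^sub>R f (x + t *\<^sub>R z))"

text \<open>
  Represent the values of \<open>f\<close> near \<open>x\<close> as integrals over one fixed ball with a moving kernel, and
  expand the kernel by \<open>bump_square_expand\<close>.
\<close>

lemma mean_value_has_derivative:
  fixes f :: "'a::euclidean_space \<Rightarrow> 'b::euclidean_space"
  assumes mv: "mean_value_on U f" and t: "0 < t" and sub: "cball x (2 * t) \<subseteq> U"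
  shows "(f has_derivative kernel_derivative f x t) (at x)"
proof -
  let ?B = "cball (0::'a) 1" and ?B2 = "cball (0::'a) 2" and ?c = "bump_mass TYPE('a)"
  have c: "?c > 0" by (rule bump_mass_pos)
  define g where "g w = f (x + t *\<^sub>R w)" for w
  have contg: "continuous_on ?B2 g" unfolding g_def
  proof (rule continuous_on_compose2[OF mean_value_on_continuous[OF mv]])
    have "x + t *\<^sub>R w \<in> cball x (2 * t)" if "w \<in> ?B2" for w
      using that t by (simp add: dist_norm mult.commute)
    then show "(\<lambda>w. x + t *\<^sub>R w) ` ?B2 \<subseteq> U" using sub by blast
  qed (intro continuous_intros)
  have contgB: "continuous_on ?B g" by (rule continuous_on_subset[OF contg]) auto
  have "bounded (g ` ?B2)" by (intro compact_imp_bounded compact_continuous_image contg compact_cball)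
  then obtain M where M: "M > 0" "\<And>w. w \<in> ?B2 \<Longrightarrow> norm (g w) \<le> M"
    by (auto simp: bounded_pos)
  define V where "V = integral ?B2 (\<lambda>_::'a. 1::real)"
  define L where "L v = integral ?B (\<lambda>z. (4 * bump z * (z \<bullet> v)) *\<^sub>R g z)" for v
  have intL: "(\<lambda>z. (4 * bump z * (z \<bullet> v)) *\<^sub>R g z) integrable_on ?B" for v
    by (intro integrable_on_compact continuous_intros contgB) auto
  have linL: "bounded_linear L"
    unfolding linear_conv_bounded_linear[symmetric]
  proof
    show "L (v + w) = L v + L w" for v w
      unfolding L_def by (subst integral_add[symmetric, OF intL intL]) (simp add: inner_simps algebra_simps)
    show "L (r *\<^sub>R v) = r *\<^sub>R L v" for r v
      unfolding L_def by (subst integral_cmul[symmetric]) (simp add: algebra_simps)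
  qed
  have rep: "?c *\<^sub>R g \<xi> = integral ?B2 (\<lambda>y. (bump (y - \<xi>))\<^sup>2 *\<^sub>R g y)" if \<xi>: "norm \<xi> < 1" for \<xi>
  proof -
    have "cball (x + t *\<^sub>R \<xi>) t \<subseteq> cball x (2 * t)"
      using \<xi> t by (auto simp: cball_subset_cball_iff dist_norm)
    then have "cball (x + t *\<^sub>R \<xi>) t \<subseteq> U" using sub by blast
    from mean_value_onD[OF mv t this]
    have "?c *\<^sub>R g \<xi> = integral ?B (\<lambda>z. (bump z)\<^sup>2 *\<^sub>R g (z + \<xi>))"
      unfolding g_def by (simp add: algebra_simps)
    also have "\<dots> = integral ?B (\<lambda>z. (\<lambda>y. (bump (y - \<xi>))\<^sup>2 *\<^sub>R g y) (z + \<xi>))" by simp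
    also have "\<dots> = integral (cball \<xi> 1) (\<lambda>y. (bump (y - \<xi>))\<^sup>2 *\<^sub>R g y)"
      by (rule integral_cball_shift[symmetric])
    also have "\<dots> = integral ?B2 (\<lambda>y. (bump (y - \<xi>))\<^sup>2 *\<^sub>R g y)"
      using \<xi> by (intro integral_eq_on_subset[symmetric])
                 (auto simp: cball_subset_cball_iff bump_outside dist_norm norm_minus_commute)
    finally show ?thesis .
  qed
  have "(g has_derivative (\<lambda>v. (1 / ?c) *\<^sub>R L v)) (at 0)"
  proof (rule has_derivative_quadratic_bound[where r = 1])
    show "bounded_linear (\<lambda>v. (1 / ?c) *\<^sub>R L v)"
      using linL by (rule bounded_linear_const_scaleR)
    fix \<xi> :: 'a assume \<xi>: "norm \<xi> < 1"
    have L2: "L \<xi> = integral ?B2 (\<lambda>z. (4 * bump z * (z \<bullet> \<xi>)) *\<^sub>R g z)"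
      unfolding L_def by (intro integral_eq_on_subset[symmetric]) (auto simp: bump_outside)
    have i: "(\<lambda>y. (bump (y - \<xi>))\<^sup>2 *\<^sub>R g y) integrable_on ?B2" for \<xi>
      by (intro integrable_on_compact continuous_intros contg
            continuous_on_compose2[OF continuous_on_bump[of UNIV]]) auto
    have i': "(\<lambda>y. (4 * bump y * (y \<bullet> \<xi>)) *\<^sub>R g y) integrable_on ?B2"
      by (intro integrable_on_compact continuous_intros contg) auto
    have "?c *\<^sub>R g \<xi> - ?c *\<^sub>R g 0 - L \<xi> =
        integral ?B2 (\<lambda>y. ((bump (y - \<xi>))\<^sup>2 - (bump y)\<^sup>2 - 4 * bump y * (y \<bullet> \<xi>)) *\<^sub>R g y)"
      using rep[OF \<xi>] rep[of 0] L2 i[of \<xi>] i[of 0] i'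
      by (simp add: scaleR_left_diff_distrib integral_diff integrable_diff)
    also have "norm \<dots> \<le> integral ?B2 (\<lambda>y. 27 * (norm \<xi>)\<^sup>2 * M)"
    proof (rule integral_norm_bound_integral)
      show "(\<lambda>y. ((bump (y - \<xi>))\<^sup>2 - (bump y)\<^sup>2 - 4 * bump y * (y \<bullet> \<xi>)) *\<^sub>R g y) integrable_on ?B2"
        by (intro integrable_on_compact continuous_intros contg
            continuous_on_compose2[OF continuous_on_bump[of UNIV]]) auto
      show "(\<lambda>y::'a. 27 * (norm \<xi>)\<^sup>2 * M) integrable_on ?B2"
        by (intro integrable_on_compact continuous_intros) auto
      fix y assume y: "y \<in> ?B2"
      show "norm (((bump (y - \<xi>))\<^sup>2 - (bump y)\<^sup>2 - 4 * bump y * (y \<bullet> \<xi>)) *\<^sub>R g y) \<le> 27 * (norm \<xi>)\<^sup>2 * M"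
        unfolding norm_scaleR real_norm_def using \<xi> y M(2)[OF y]
        by (intro mult_mono bump_square_expand) auto
    qed
    also have "\<dots> = 27 * (norm \<xi>)\<^sup>2 * M * V"
      unfolding V_def using integral_mult_right[of ?B2 "27 * (norm \<xi>)\<^sup>2 * M" "\<lambda>_::'a. 1::real"] by simp
    finally have "norm (?c *\<^sub>R g \<xi> - ?c *\<^sub>R g 0 - L \<xi>) \<le> 27 * (norm \<xi>)\<^sup>2 * M * V" .
    moreover have "g (0 + \<xi>) - g 0 - (1 / ?c) *\<^sub>R L \<xi> = (1 / ?c) *\<^sub>R (?c *\<^sub>R g \<xi> - ?c *\<^sub>R g 0 - L \<xi>)"
      using c by (simp add: algebra_simps)
    ultimately show "norm (g (0 + \<xi>) - g 0 - (1 / ?c) *\<^sub>R L \<xi>) \<le> (27 * M * V / ?c) * (norm \<xi>)\<^sup>2"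
      using c by (simp add: divide_simps mult_ac)
  qed simp
  then have g': "(g has_derivative (\<lambda>v. (1 / ?c) *\<^sub>R L v)) (at ((1/t) *\<^sub>R (x - x)))" by simp
  have "((\<lambda>y. (1/t) *\<^sub>R (y - x)) has_derivative (\<lambda>v. (1/t) *\<^sub>R v)) (at x)"
    by (auto intro!: derivative_eq_intros)
  from has_derivative_compose[OF this g']
  have "((\<lambda>y. g ((1/t) *\<^sub>R (y - x))) has_derivative (\<lambda>v. (1 / ?c) *\<^sub>R L ((1/t) *\<^sub>R v))) (at x)" .
  moreover have "(\<lambda>y. g ((1/t) *\<^sub>R (y - x))) = f" using t by (auto simp: g_def)
  moreover have "(\<lambda>v. (1 / ?c) *\<^sub>R L ((1/t) *\<^sub>R v)) = kernel_derivative f x t"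
  proof
    fix v
    have "L ((1/t) *\<^sub>R v) = (1/t) *\<^sub>R L v"
      by (rule linear_cmul[OF bounded_linear.linear[OF linL]])
    then show "(1 / ?c) *\<^sub>R L ((1/t) *\<^sub>R v) = kernel_derivative f x t v"
      by (simp add: kernel_derivative_def L_def g_def)
  qed
  ultimately show ?thesis by simp
qed

abbreviation fd :: "('a::euclidean_space \<Rightarrow> 'b::euclidean_space) \<Rightarrow> 'a \<Rightarrow> 'a \<Rightarrow> 'b" where
  "fd f x \<equiv> frechet_derivative f (at x)"

lemma has_derivative_imp_fd: "(f has_derivative f') (at x) \<Longrightarrow> fd f x = f'"
  using frechet_derivative_at by metis

lemma mean_value_has_fd:
  fixes f :: "'a::euclidean_space \<Rightarrow> 'b::euclidean_space"
  assumes "open U" "mean_value_on U f" "x \<in> U"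
  shows "(f has_derivative fd f x) (at x)"
proof -
  obtain e where e: "e > 0" "cball x e \<subseteq> U"
    using assms(1,3) open_contains_cball by blast
  then have "(f has_derivative kernel_derivative f x (e/2)) (at x)"
    by (intro mean_value_has_derivative[OF assms(2)]) auto
  then show ?thesis using has_derivative_imp_fd by metis
qed

lemma fd_eq_kernel_derivative:
  assumes "mean_value_on U f" "0 < t" "cball x (2 * t) \<subseteq> U"
  shows "fd f x = kernel_derivative f x t"
  using has_derivative_imp_fd[OF mean_value_has_derivative[OF assms]] .

lemma fd_expand:
  fixes f :: "'a::euclidean_space \<Rightarrow> 'b::euclidean_space"
  assumes "(f has_derivative fd f x) (at x)"
  shows "fd f x v = (\<Sum>b\<in>Basis. (v \<bullet> b) *\<^sub>R fd f x b)"
proof -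
  have "linear (fd f x)" using assms by (rule has_derivative_linear)
  then have "fd f x (\<Sum>b\<in>Basis. (v \<bullet> b) *\<^sub>R b) = (\<Sum>b\<in>Basis. (v \<bullet> b) *\<^sub>R fd f x b)"
    by (simp add: linear_sum linear_cmul)
  then show ?thesis by (simp add: euclidean_representation)
qed

lemma continuous_on_convolution:
  fixes f :: "'a::euclidean_space \<Rightarrow> 'b::euclidean_space"
  assumes cont: "continuous_on U f" and sub: "\<And>x. x \<in> X \<Longrightarrow> cball x t \<subseteq> U" and t: "0 \<le> t"
    and k: "continuous_on UNIV k"
  shows "continuous_on X (\<lambda>x. integral (cball 0 1) (\<lambda>z. k z *\<^sub>R f (x + t *\<^sub>R z)))"
proof (rule continuous_on_integral_param)
  have "continuous_on (X \<times> cball 0 1) (\<lambda>p. f (fst p + t *\<^sub>R snd p))"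
  proof (rule continuous_on_compose2[OF cont])
    show "(\<lambda>p. fst p + t *\<^sub>R snd p) ` (X \<times> cball 0 1) \<subseteq> U"
      using sub affine_cball_mem[OF t] by fastforce
  qed (intro continuous_intros)
  moreover have "continuous_on (X \<times> cball 0 1) (\<lambda>p::'a\<times>'a. k (snd p))"
    by (rule continuous_on_compose2[OF k]) (auto intro: continuous_on_snd continuous_on_id)
  ultimately show "continuous_on (X \<times> cball 0 1) (\<lambda>(x, z). k z *\<^sub>R f (x + t *\<^sub>R z))"
    unfolding split_beta by (rule continuous_on_scaleR[rotated])
qed auto

lemma mean_value_continuous_fd:
  fixes f :: "'a::euclidean_space \<Rightarrow> 'b::euclidean_space"
  assumes U: "open U" and mv: "mean_value_on U f"
  shows "continuous_on U (\<lambda>x. fd f x v)"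
proof -
  have "isCont (\<lambda>x. fd f x v) x0" if x0: "x0 \<in> U" for x0
  proof -
    obtain e where e: "e > 0" "cball x0 e \<subseteq> U"
      using U x0 open_contains_cball by blast
    define t where "t = e / 4"
    have t: "t > 0" using e by (simp add: t_def)
    have sub: "cball x (2 * t) \<subseteq> U" if "x \<in> ball x0 t" for x
    proof -
      have "dist x0 x < t" using that by simp
      then have "cball x (2 * t) \<subseteq> cball x0 e"
        using t by (auto simp: cball_subset_cball_iff t_def dist_commute)
      then show ?thesis using e by blast
    qed
    have "continuous_on (ball x0 t) (\<lambda>x. integral (cball 0 1) (\<lambda>z. (4 * bump z * (z \<bullet> v)) *\<^sub>R f (x + t *\<^sub>R z)))"
    proof (rule continuous_on_convolution[OF mean_value_on_continuous[OF mv]])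
      show "cball x t \<subseteq> U" if "x \<in> ball x0 t" for x
        using sub[OF that] t by (auto simp: subset_iff)
    qed (use t in \<open>auto intro!: continuous_intros\<close>)
    then have "continuous_on (ball x0 t) (\<lambda>x. kernel_derivative f x t v)"
      unfolding kernel_derivative_def by (intro continuous_on_scaleR continuous_on_const)
    then have "continuous_on (ball x0 t) (\<lambda>x. fd f x v)"
      by (rule continuous_on_eq) (use fd_eq_kernel_derivative[OF mv t sub] in auto)
    then show ?thesis using t by (simp add: continuous_on_eq_continuous_at)
  qed
  then show ?thesis using continuous_at_imp_continuous_on by blast
qed

text \<open>
  The affine field \<open>y \<mapsto> a + \<kappa> *\<^sub>R y\<close> generates translations (\<open>\<kappa> = 0\<close>) or dilations
  (\<open>a = 0\<close>, \<open>\<kappa> = 1\<close>), both of which map balls to balls. Differentiating the mean value identity along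
  this flow shows that the derivative of \<open>f\<close> along the field inherits the mean value property. The
  flow parameter is taken in \<open>{-\<delta>..0}\<close> because dilations with negative parameter do not leave a
  ball around the origin.
\<close>

lemma mean_value_flow_derivative:
  fixes f :: "'a::euclidean_space \<Rightarrow> 'b::euclidean_space"
  assumes U: "open U" and mv: "mean_value_on U f" and t: "0 < t" and \<delta>: "0 < \<delta>" "\<kappa> * \<delta> < 1" "0 \<le> \<kappa>"
    and sub: "\<And>\<tau>. \<tau> \<in> {-\<delta>..0} \<Longrightarrow> cball (x + \<tau> *\<^sub>R (a + \<kappa> *\<^sub>R x)) ((1 + \<kappa> * \<tau>) * t) \<subseteq> U"
  shows "integral (cball 0 1) (\<lambda>z. (bump z)\<^sup>2 *\<^sub>R fd f (x + t *\<^sub>R z) (a + \<kappa> *\<^sub>R (x + t *\<^sub>R z)))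
       = bump_mass TYPE('a) *\<^sub>R fd f x (a + \<kappa> *\<^sub>R x)"
proof -
  let ?B = "cball (0::'a) 1" and ?I = "{-\<delta>..0::real}"
  define P where "P \<tau> y = y + \<tau> *\<^sub>R (a + \<kappa> *\<^sub>R y)" for \<tau> and y :: 'a
  have pos: "0 < 1 + \<kappa> * \<tau>" if "\<tau> \<in> ?I" for \<tau>
  proof -
    have "\<kappa> * (- \<tau>) \<le> \<kappa> * \<delta>" using that \<delta> by (intro mult_left_mono) auto
    then show ?thesis using \<delta> by simp
  qed
  have Peq: "P \<tau> (x + t *\<^sub>R z) = P \<tau> x + ((1 + \<kappa> * \<tau>) * t) *\<^sub>R z" for \<tau> z
    by (simp add: P_def algebra_simps)
  have memP: "P \<tau> (x + t *\<^sub>R z) \<in> U" if "\<tau> \<in> ?I" "z \<in> ?B" for \<tau> z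
  proof -
    have "P \<tau> x + ((1 + \<kappa> * \<tau>) * t) *\<^sub>R z \<in> cball (P \<tau> x) ((1 + \<kappa> * \<tau>) * t)"
      using pos[OF that(1)] t that(2) by (intro affine_cball_mem) auto
    then show ?thesis using sub[OF that(1)] unfolding Peq by (auto simp: P_def)
  qed
  have Px: "P \<tau> x \<in> U" if "\<tau> \<in> ?I" for \<tau> using memP[OF that, of 0] by simp
  have derP: "((\<lambda>\<tau>. f (P \<tau> y)) has_vector_derivative fd f (P \<tau> y) (a + \<kappa> *\<^sub>R y)) (at \<tau> within ?I)"
    if "P \<tau> y \<in> U" for \<tau> y
  proof -
    have "((\<lambda>\<tau>. P \<tau> y) has_derivative (\<lambda>h. h *\<^sub>R (a + \<kappa> *\<^sub>R y))) (at \<tau>)"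
      unfolding P_def by (auto intro!: derivative_eq_intros)
    from has_derivative_compose[OF this mean_value_has_fd[OF U mv that]]
    have "((\<lambda>\<tau>. f (P \<tau> y)) has_derivative (\<lambda>h. fd f (P \<tau> y) (h *\<^sub>R (a + \<kappa> *\<^sub>R y)))) (at \<tau>)" .
    moreover have "(\<lambda>h. fd f (P \<tau> y) (h *\<^sub>R (a + \<kappa> *\<^sub>R y))) = (\<lambda>h. h *\<^sub>R fd f (P \<tau> y) (a + \<kappa> *\<^sub>R y))"
      using linear_cmul[OF has_derivative_linear[OF mean_value_has_fd[OF U mv that]]] by (simp add: fun_eq_iff)
    ultimately show ?thesis
      unfolding has_vector_derivative_def by (metis has_derivative_at_withinI)
  qed
  have contf: "continuous_on U f" by (rule mean_value_on_continuous[OF mv])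
  have "((\<lambda>\<tau>. integral ?B (\<lambda>z. (bump z)\<^sup>2 *\<^sub>R f (P \<tau> (x + t *\<^sub>R z)))) has_vector_derivative
     integral ?B (\<lambda>z. (bump z)\<^sup>2 *\<^sub>R fd f (P 0 (x + t *\<^sub>R z)) (a + \<kappa> *\<^sub>R (x + t *\<^sub>R z)))) (at 0 within ?I)"
  proof (rule has_vector_derivative_integral_compact[where
        f' = "\<lambda>\<tau> z. (bump z)\<^sup>2 *\<^sub>R fd f (P \<tau> (x + t *\<^sub>R z)) (a + \<kappa> *\<^sub>R (x + t *\<^sub>R z))"])
    fix \<tau> z assume *: "\<tau> \<in> ?I" "z \<in> ?B"
    show "((\<lambda>\<tau>. (bump z)\<^sup>2 *\<^sub>R f (P \<tau> (x + t *\<^sub>R z))) has_vector_derivative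
        (bump z)\<^sup>2 *\<^sub>R fd f (P \<tau> (x + t *\<^sub>R z)) (a + \<kappa> *\<^sub>R (x + t *\<^sub>R z))) (at \<tau> within ?I)"
      using has_vector_derivative_scaleR[OF DERIV_const derP[OF memP[OF *]], of "(bump z)\<^sup>2"] by simp
  next
    fix \<tau> assume *: "\<tau> \<in> ?I"
    have "continuous_on ?B (\<lambda>z. f (P \<tau> (x + t *\<^sub>R z)))"
    proof (rule continuous_on_compose2[OF contf])
      show "(\<lambda>z. P \<tau> (x + t *\<^sub>R z)) ` ?B \<subseteq> U" using memP[OF *] by blast
    qed (auto simp: P_def intro!: continuous_intros)
    then show "continuous_on ?B (\<lambda>z. (bump z)\<^sup>2 *\<^sub>R f (P \<tau> (x + t *\<^sub>R z)))"
      by (intro continuous_intros)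
  next
    have cb: "continuous_on (?I \<times> ?B) (\<lambda>p. fd f (P (fst p) (x + t *\<^sub>R snd p)) b)" for b
    proof (rule continuous_on_compose2[OF mean_value_continuous_fd[OF U mv]])
      show "(\<lambda>p. P (fst p) (x + t *\<^sub>R snd p)) ` (?I \<times> ?B) \<subseteq> U" using memP by auto
    qed (auto simp: P_def intro!: continuous_intros)
    have "continuous_on (?I \<times> ?B) (\<lambda>p. (bump (snd p))\<^sup>2 *\<^sub>R
        (\<Sum>b\<in>Basis. ((a + \<kappa> *\<^sub>R (x + t *\<^sub>R snd p)) \<bullet> b) *\<^sub>R fd f (P (fst p) (x + t *\<^sub>R snd p)) b))"
      by (intro continuous_intros cb continuous_on_compose2[OF continuous_on_bump[of UNIV]]) auto
    then show "continuous_on (?I \<times> ?B) (\<lambda>(\<tau>, z). (bump z)\<^sup>2 *\<^sub>R fd f (P \<tau> (x + t *\<^sub>R z)) (a + \<kappa> *\<^sub>R (x + t *\<^sub>R z)))"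
    proof (rule continuous_on_eq)
      fix p assume p: "p \<in> ?I \<times> ?B"
      then have "P (fst p) (x + t *\<^sub>R snd p) \<in> U" using memP by auto
      from fd_expand[OF mean_value_has_fd[OF U mv this], of "a + \<kappa> *\<^sub>R (x + t *\<^sub>R snd p)"]
      show "(bump (snd p))\<^sup>2 *\<^sub>R (\<Sum>b\<in>Basis. ((a + \<kappa> *\<^sub>R (x + t *\<^sub>R snd p)) \<bullet> b) *\<^sub>R fd f (P (fst p) (x + t *\<^sub>R snd p)) b)
        = (case p of (\<tau>, z) \<Rightarrow> (bump z)\<^sup>2 *\<^sub>R fd f (P \<tau> (x + t *\<^sub>R z)) (a + \<kappa> *\<^sub>R (x + t *\<^sub>R z)))"
        by (simp add: split_beta)
    qed
  qed (use \<delta> in auto)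
  moreover have "((\<lambda>\<tau>. integral ?B (\<lambda>z. (bump z)\<^sup>2 *\<^sub>R f (P \<tau> (x + t *\<^sub>R z)))) has_vector_derivative
      bump_mass TYPE('a) *\<^sub>R fd f (P 0 x) (a + \<kappa> *\<^sub>R x)) (at 0 within ?I)"
  proof (rule has_vector_derivative_transform[where f = "\<lambda>\<tau>. bump_mass TYPE('a) *\<^sub>R f (P \<tau> x)"])
    show "((\<lambda>\<tau>. bump_mass TYPE('a) *\<^sub>R f (P \<tau> x)) has_vector_derivative
      bump_mass TYPE('a) *\<^sub>R fd f (P 0 x) (a + \<kappa> *\<^sub>R x)) (at 0 within ?I)"
      using has_vector_derivative_scaleR[OF DERIV_const derP[OF Px[of 0]], of "bump_mass TYPE('a)"] \<delta> by simp
    fix \<tau> assume *: "\<tau> \<in> ?I"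
    have "(1 + \<kappa> * \<tau>) * t > 0" using pos[OF *] t by simp
    from mean_value_onD[OF mv this, of "P \<tau> x"] sub[OF *]
    show "integral ?B (\<lambda>z. (bump z)\<^sup>2 *\<^sub>R f (P \<tau> (x + t *\<^sub>R z))) = bump_mass TYPE('a) *\<^sub>R f (P \<tau> x)"
      unfolding Peq by (simp add: P_def)
  qed (use \<delta> in auto)
  moreover have "at 0 within ?I \<noteq> bot" using \<delta> by (simp add: trivial_limit_within islimpt_Icc)
  ultimately have "integral ?B (\<lambda>z. (bump z)\<^sup>2 *\<^sub>R fd f (P 0 (x + t *\<^sub>R z)) (a + \<kappa> *\<^sub>R (x + t *\<^sub>R z)))
     = bump_mass TYPE('a) *\<^sub>R fd f (P 0 x) (a + \<kappa> *\<^sub>R x)"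
    using vector_derivative_unique_within by blast
  then show ?thesis by (simp add: P_def)
qed

lemma mean_value_on_fd:
  fixes f :: "'a::euclidean_space \<Rightarrow> 'b::euclidean_space"
  assumes U: "open U" and mv: "mean_value_on U f"
  shows "mean_value_on U (\<lambda>x. fd f x v)"
  unfolding mean_value_on_def
proof (intro conjI allI impI mean_value_continuous_fd[OF assms])
  fix x t assume xt: "0 < t \<and> cball x t \<subseteq> U"
  obtain e where e: "e > 0" "(\<Union>y\<in>cball x t. ball y e) \<subseteq> U"
    using compact_subset_open_imp_ball_epsilon_subset[OF compact_cball U] xt by blast
  define \<delta> where "\<delta> = e / (norm v + 1)"
  have \<delta>: "\<delta> > 0" using e by (simp add: \<delta>_def add_nonneg_pos)
  have "integral (cball 0 1) (\<lambda>z. (bump z)\<^sup>2 *\<^sub>R fd f (x + t *\<^sub>R z) (v + 0 *\<^sub>R (x + t *\<^sub>R z)))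
       = bump_mass TYPE('a) *\<^sub>R fd f x (v + 0 *\<^sub>R x)"
  proof (rule mean_value_flow_derivative[OF U mv _ \<delta>])
    fix \<tau> assume \<tau>: "\<tau> \<in> {-\<delta>..0}"
    have "\<bar>\<tau>\<bar> \<le> \<delta>" using \<tau> by auto
    then have "norm (\<tau> *\<^sub>R v) \<le> \<delta> * norm v" by (simp add: mult_right_mono)
    also have "\<dots> < e" using e by (simp add: \<delta>_def divide_simps add_nonneg_pos)
    finally have n: "norm (\<tau> *\<^sub>R v) < e" .
    show "cball (x + \<tau> *\<^sub>R (v + 0 *\<^sub>R x)) ((1 + 0 * \<tau>) * t) \<subseteq> U"
    proof
      fix y assume "y \<in> cball (x + \<tau> *\<^sub>R (v + 0 *\<^sub>R x)) ((1 + 0 * \<tau>) * t)"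
      then have "y - \<tau> *\<^sub>R v \<in> cball x t" by (simp add: dist_norm algebra_simps)
      moreover have "y \<in> ball (y - \<tau> *\<^sub>R v) e" using n by (simp add: dist_norm)
      ultimately show "y \<in> U" using e(2) by blast
    qed
  qed (use xt in auto)
  then show "integral (cball 0 1) (\<lambda>z. (bump z)\<^sup>2 *\<^sub>R fd f (x + t *\<^sub>R z) v) = bump_mass TYPE('a) *\<^sub>R fd f x v"
    by simp
qed

text \<open>
  The radial derivative, scaled so that its eigenfunctions are the homogeneous maps and its
  eigenvalues their degrees.
\<close>

definition euler :: "('a::euclidean_space \<Rightarrow> 'b::euclidean_space) \<Rightarrow> 'a \<Rightarrow> 'b" where
  "euler f x = fd f x x"

lemma mean_value_on_euler:
  fixes f :: "'a::euclidean_space \<Rightarrow> 'b::euclidean_space"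
  assumes mv: "mean_value_on (ball 0 R) f"
  shows "mean_value_on (ball 0 R) (euler f)"
  unfolding mean_value_on_def
proof (intro conjI allI impI)
  have "continuous_on (ball 0 R) (\<lambda>x. \<Sum>b\<in>Basis. (x \<bullet> b) *\<^sub>R fd f x b)"
    by (intro continuous_intros mean_value_continuous_fd[OF _ mv]) auto
  then show "continuous_on (ball 0 R) (euler f)"
    by (rule continuous_on_eq) (use fd_expand[OF mean_value_has_fd[OF _ mv]] in \<open>auto simp: euler_def\<close>)
  fix x :: 'a and t assume xt: "0 < t \<and> cball x t \<subseteq> ball 0 R"
  have "integral (cball 0 1) (\<lambda>z. (bump z)\<^sup>2 *\<^sub>R fd f (x + t *\<^sub>R z) (0 + 1 *\<^sub>R (x + t *\<^sub>R z)))
       = bump_mass TYPE('a) *\<^sub>R fd f x (0 + 1 *\<^sub>R x)"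
  proof (rule mean_value_flow_derivative[OF _ mv, where \<delta> = "1/2"])
    fix \<tau> :: real assume \<tau>: "\<tau> \<in> {-(1/2)..0}"
    have nx: "norm x + t < R"
      using xt by (auto simp: cball_subset_ball_iff dist_norm)
    show "cball (x + \<tau> *\<^sub>R (0 + 1 *\<^sub>R x)) ((1 + 1 * \<tau>) * t) \<subseteq> ball 0 R"
    proof -
      have "norm ((1 + \<tau>) *\<^sub>R x) + (1 + \<tau>) * t = (1 + \<tau>) * (norm x + t)"
        unfolding norm_scaleR using \<tau> by (simp add: algebra_simps)
      also have "\<dots> \<le> norm x + t" using \<tau> xt by (intro mult_left_le_one_le) auto
      finally have "norm ((1 + \<tau>) *\<^sub>R x) + (1 + \<tau>) * t < R" using nx by simp
      moreover have "x + \<tau> *\<^sub>R (0 + 1 *\<^sub>R x) = (1 + \<tau>) *\<^sub>R x" by (simp add: algebra_simps)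
      ultimately show ?thesis by (simp add: cball_subset_ball_iff dist_norm)
    qed
  qed (use xt in auto)
  then show "integral (cball 0 1) (\<lambda>z. (bump z)\<^sup>2 *\<^sub>R euler f (x + t *\<^sub>R z)) = bump_mass TYPE('a) *\<^sub>R euler f x"
    by (simp add: euler_def)
qed

lemma mean_value_on_inner:
  fixes f :: "'a::euclidean_space \<Rightarrow> 'b::euclidean_space"
  assumes mv: "mean_value_on U f"
  shows "mean_value_on U (\<lambda>x. f x \<bullet> e)"
  unfolding mean_value_on_def
proof (intro conjI allI impI continuous_intros mean_value_on_continuous[OF mv])
  fix x t assume xt: "0 < t \<and> cball x t \<subseteq> U"
  have i: "(\<lambda>z. (bump z)\<^sup>2 *\<^sub>R f (x + t *\<^sub>R z)) integrable_on cball 0 1"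
    by (intro integrable_on_compact continuous_intros
          continuous_on_affine_cball[OF mean_value_on_continuous[OF mv]]) (use xt in auto)
  have "integral (cball 0 1) ((\<lambda>w. w \<bullet> e) \<circ> (\<lambda>z. (bump z)\<^sup>2 *\<^sub>R f (x + t *\<^sub>R z))) =
     integral (cball 0 1) (\<lambda>z. (bump z)\<^sup>2 *\<^sub>R f (x + t *\<^sub>R z)) \<bullet> e"
    by (rule integral_linear[OF i bounded_linear_inner_left])
  then show "integral (cball 0 1) (\<lambda>z. (bump z)\<^sup>2 *\<^sub>R (f (x + t *\<^sub>R z) \<bullet> e)) = bump_mass TYPE('a) *\<^sub>R (f x \<bullet> e)"
    using mean_value_onD[OF mv, of t x] xt by (simp add: o_def)
qed

lemma fd_inner:
  assumes "(f has_derivative fd f x) (at x)"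
  shows "fd (\<lambda>x. f x \<bullet> e) x = (\<lambda>v. fd f x v \<bullet> e)"
  by (rule has_derivative_imp_fd) (rule has_derivative_inner_left[OF assms])

text \<open>
  The converse of \<open>mean_value_on_laplace\<close>: the constant weighted mean has derivative zero, and letting
  the radius tend to zero isolates the Laplacian at the centre.
\<close>

lemma mean_value_on_laplacian_zero:
  fixes u :: "'a::euclidean_space \<Rightarrow> real"
  assumes U: "open U" and mv: "mean_value_on U u" and x: "x \<in> U"
  shows "(\<Sum>b\<in>Basis. fd (\<lambda>y. fd u y b) x b) = 0"
proof -
  let ?B = "cball (0::'a) 1"
  obtain t where t: "t > 0" "cball x t \<subseteq> U"
    using U x open_contains_cball by blast
  let ?L = "\<lambda>y. \<Sum>b\<in>Basis. fd (\<lambda>y. fd u y b) y b"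
  let ?M = "\<lambda>\<tau>. integral ?B (\<lambda>z. (bump z)\<^sup>2 * u (x + \<tau> *\<^sub>R z))"
  define I where "I \<tau> = integral ?B (\<lambda>z. bump z ^ 3 * ?L (x + \<tau> *\<^sub>R z))" for \<tau>
  have contL: "continuous_on U ?L"
    by (intro continuous_intros mean_value_continuous_fd[OF U] mean_value_on_fd[OF U mv])
  have der: "(?M has_vector_derivative (\<tau> / 6) * I \<tau>) (at \<tau> within {0..t})" if "\<tau> \<in> {0..t}" for \<tau>
    unfolding I_def
    by (rule weighted_mean_derivative[OF U t(2) _ _ _ that, where u' = "fd u"])
       (use mean_value_has_fd[OF U mv] mean_value_has_fd[OF U mean_value_on_fd[OF U mv]]
            mean_value_continuous_fd[OF U mean_value_on_fd[OF U mv]] in auto)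
  have const: "?M \<tau> = bump_mass TYPE('a) * u x" if "\<tau> \<in> {0..t}" for \<tau>
  proof (cases "\<tau> = 0")
    case False
    then have "cball x \<tau> \<subseteq> U" "\<tau> > 0" using that t by (auto simp: subset_iff)
    then show ?thesis using mean_value_onD[OF mv, of \<tau> x] by simp
  qed (simp add: bump_mass_def)
  have I0: "I \<tau> = 0" if \<tau>: "\<tau> \<in> {0<..t}" for \<tau>
  proof -
    have "(?M has_vector_derivative 0) (at \<tau> within {0..t})"
      by (rule has_vector_derivative_transform[where f = "\<lambda>\<tau>. bump_mass TYPE('a) * u x"])
         (use const \<tau> in auto)
    moreover have "at \<tau> within {0..t} \<noteq> bot" using \<tau> by (simp add: trivial_limit_within islimpt_Icc)
    ultimately have "(\<tau> / 6) * I \<tau> = 0"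
      using vector_derivative_unique_within der[of \<tau>] \<tau> by fastforce
    then show ?thesis using \<tau> by simp
  qed
  have "continuous_on {0..t} I"
    unfolding I_def
  proof (rule continuous_on_integral_param)
    have *: "continuous_on ({0..t} \<times> ?B) (\<lambda>p. ?L (x + fst p *\<^sub>R snd p))"
    proof (rule continuous_on_compose2[OF contL])
      show "(\<lambda>p. x + fst p *\<^sub>R snd p) ` ({0..t} \<times> ?B) \<subseteq> U"
        using affine_cball_mem'[of _ t _ x] t by fastforce
    qed (intro continuous_intros)
    show "continuous_on ({0..t} \<times> ?B) (\<lambda>(\<tau>, z). bump z ^ 3 * ?L (x + \<tau> *\<^sub>R z))"
      unfolding split_beta
      by (rule continuous_on_mult[OF _ *])
         (intro continuous_on_power continuous_on_compose2[OF continuous_on_bump[of UNIV]] continuous_on_snd continuous_on_id subset_UNIV)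
  qed auto
  then have "(I \<longlongrightarrow> I 0) (at 0 within {0..t})" using t by (simp add: continuous_on)
  moreover have "(I \<longlongrightarrow> 0) (at 0 within {0..t})"
    by (rule tendsto_eventually) (auto simp: eventually_at_filter I0)
  moreover have "at 0 within {0..t} \<noteq> bot" using t by (simp add: trivial_limit_within islimpt_Icc)
  ultimately have "I 0 = 0" using tendsto_unique by blast
  then have "integral ?B (\<lambda>z. bump z ^ 3) * ?L x = 0" unfolding I_def by simp
  moreover have "integral ?B (\<lambda>z. bump z ^ 3) \<noteq> 0"
    using integral_cball_eq_0_imp_0[of 0 1 "\<lambda>z::'a. bump z ^ 3" 0]
    by (force intro!: continuous_intros simp: bump_def)
  ultimately show ?thesis by simp
qed

section \<open>Gradient estimates\<close>

definition gradient_const :: "'a::euclidean_space itself \<Rightarrow> real" where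
  "gradient_const _ = 4 * integral (cball (0::'a) 1) (\<lambda>_. 1) / bump_mass TYPE('a)"

lemma integral_ball_one_nonneg: "integral (cball (0::'a::euclidean_space) r) (\<lambda>_. 1::real) \<ge> 0"
  by (intro integral_nonneg integrable_on_compact) auto

lemma gradient_const_nonneg: "gradient_const TYPE('a::euclidean_space) \<ge> 0"
  unfolding gradient_const_def using integral_ball_one_nonneg[where 'a='a] bump_mass_pos[where 'a='a]
  by (simp add: divide_nonneg_pos)

lemma bump_inner_le: "z \<in> cball 0 1 \<Longrightarrow> \<bar>4 * bump z * (z \<bullet> v)\<bar> \<le> 4 * norm v"
proof -
  assume z: "z \<in> cball 0 1"
  have "\<bar>z \<bullet> v\<bar> \<le> norm z * norm v" by (rule Cauchy_Schwarz_ineq2)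
  also have "\<dots> \<le> norm v" using z by (simp add: mult_left_le_one_le)
  finally have 1: "\<bar>z \<bullet> v\<bar> \<le> norm v" .
  have "\<bar>bump z * (z \<bullet> v)\<bar> \<le> 1 * norm v"
    unfolding abs_mult using 1 by (intro mult_mono) auto
  then show ?thesis by (simp add: abs_mult)
qed

text \<open>
  Estimate the integral in \<open>kernel_derivative\<close> by the supremum of \<open>f\<close>.
\<close>

lemma mean_value_gradient_bound:
  fixes f :: "'a::euclidean_space \<Rightarrow> 'b::euclidean_space"
  assumes mv: "mean_value_on U f" and t: "0 < t" and sub: "cball x (2 * t) \<subseteq> U"
    and M: "\<And>y. y \<in> cball x t \<Longrightarrow> norm (f y) \<le> M"
  shows "norm (fd f x v) \<le> gradient_const TYPE('a) / t * M * norm v"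
proof -
  let ?B = "cball (0::'a) 1" and ?c = "bump_mass TYPE('a)"
  have sub': "cball x t \<subseteq> U" using sub t by (auto simp: subset_iff)
  have "norm (integral ?B (\<lambda>z. (4 * bump z * (z \<bullet> v)) *\<^sub>R f (x + t *\<^sub>R z))) \<le> integral ?B (\<lambda>z. (4 * norm v * M) * 1)"
  proof (rule integral_norm_bound_integral)
    show "(\<lambda>z. (4 * bump z * (z \<bullet> v)) *\<^sub>R f (x + t *\<^sub>R z)) integrable_on ?B"
      by (intro integrable_on_compact continuous_intros
            continuous_on_affine_cball[OF mean_value_on_continuous[OF mv] sub']) (use t in auto)
    show "(\<lambda>z::'a. 4 * norm v * M * 1) integrable_on ?B"
      by (intro integrable_on_compact continuous_intros) auto
    fix z assume z: "z \<in> ?B"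
    have "norm (f (x + t *\<^sub>R z)) \<le> M"
      by (rule M) (rule affine_cball_mem[OF less_imp_le[OF t] z])
    then show "norm ((4 * bump z * (z \<bullet> v)) *\<^sub>R f (x + t *\<^sub>R z)) \<le> 4 * norm v * M * 1"
      unfolding norm_scaleR real_norm_def mult_1_right using bump_inner_le[OF z, of v]
      by (intro mult_mono) auto
  qed
  also have "\<dots> = 4 * norm v * M * integral ?B (\<lambda>_. 1)" by (rule integral_mult_right)
  finally show ?thesis
    unfolding fd_eq_kernel_derivative[OF mv t sub] kernel_derivative_def gradient_const_def
    using t bump_mass_pos[where 'a='a] by (simp add: divide_simps mult_ac)
qed

lemma integral_cball_scale:
  fixes h :: "'a::euclidean_space \<Rightarrow> real"
  assumes m: "0 < m" and cont: "continuous_on (cball 0 (m * r)) h"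
  shows "integral (cball 0 (m * r)) h = m ^ DIM('a) * integral (cball 0 r) (\<lambda>z. h (m *\<^sub>R z))"
proof -
  obtain a where a: "cball (0::'a) (m * r) \<subseteq> cbox (-a) a"
    using bounded_subset_cbox_symmetric[OF bounded_cball] by blast
  define H where "H = (\<lambda>y. if y \<in> cball 0 (m * r) then h y else 0)"
  have i: "h integrable_on cball 0 (m * r)" by (rule integrable_on_compact[OF _ cont]) auto
  have "integral (cbox (-a) a) H = integral (cball 0 (m * r)) h"
    unfolding H_def integral_restrict_Int using a by (simp add: Int_absorb2)
  moreover have "H integrable_on cbox (-a) a"
    unfolding H_def integrable_restrict_Int using i a by (simp add: Int_absorb2)
  ultimately have "(H has_integral integral (cball 0 (m * r)) h) (cbox (-a) a)"
    by (simp add: has_integral_iff)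
  from has_integral_affinity[OF this, of m 0] m
  have hi: "((\<lambda>z. H (m *\<^sub>R z)) has_integral (1 / m ^ DIM('a)) * integral (cball 0 (m * r)) h)
     ((\<lambda>x. (1/m) *\<^sub>R x) ` cbox (-a) a)" by simp
  have sub: "cball 0 r \<subseteq> (\<lambda>x. (1/m) *\<^sub>R x) ` cbox (-a) a"
  proof
    fix z :: 'a assume "z \<in> cball 0 r"
    then have "m *\<^sub>R z \<in> cball 0 (m * r)" using m by simp
    then have "m *\<^sub>R z \<in> cbox (-a) a" using a by blast
    moreover have "z = (1/m) *\<^sub>R (m *\<^sub>R z)" using m by simp
    ultimately show "z \<in> (\<lambda>x. (1/m) *\<^sub>R x) ` cbox (-a) a" by blast
  qed
  have "integral ((\<lambda>x. (1/m) *\<^sub>R x) ` cbox (-a) a) (\<lambda>z. H (m *\<^sub>R z)) =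
      integral ((\<lambda>x. (1/m) *\<^sub>R x) ` cbox (-a) a) (\<lambda>z. if z \<in> cball 0 r then h (m *\<^sub>R z) else 0)"
    by (rule integral_cong) (use m in \<open>auto simp: H_def\<close>)
  also have "\<dots> = integral (cball 0 r) (\<lambda>z. h (m *\<^sub>R z))"
    unfolding integral_restrict_Int using sub by (simp add: Int_absorb2)
  finally show ?thesis using integral_unique[OF hi] m by (simp add: divide_simps)
qed

definition harnack_const :: "'a::euclidean_space itself \<Rightarrow> real" where
  "harnack_const _ = 8 * 2 ^ DIM('a)"

text \<open>
  A differential Harnack inequality. For nonnegative \<open>u\<close> the kernel integral is bounded by the
  unweighted integral of \<open>u\<close>, which the mean value property on the ball of twice the radius
  bounds by a multiple of \<open>u x\<close>, because the kernel is bounded below on the inner half.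
\<close>

lemma nonneg_gradient_bound:
  fixes u :: "'a::euclidean_space \<Rightarrow> real"
  assumes mv: "mean_value_on U u" and t: "0 < t" and sub: "cball x (2 * t) \<subseteq> U"
    and nonneg: "\<And>y. y \<in> cball x (2 * t) \<Longrightarrow> 0 \<le> u y"
  shows "\<bar>fd u x v\<bar> \<le> harnack_const TYPE('a) / t * u x * norm v"
proof -
  let ?B = "cball (0::'a) 1" and ?c = "bump_mass TYPE('a)"
  have sub': "cball x t \<subseteq> U" "cball x t \<subseteq> cball x (2 * t)" using sub t by (auto simp: subset_iff)
  have contu: "continuous_on U u" by (rule mean_value_on_continuous[OF mv])
  have cB: "continuous_on ?B (\<lambda>z. u (x + t *\<^sub>R z))"
    by (rule continuous_on_affine_cball[OF contu sub'(1)]) (use t in auto)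
  have cB2: "continuous_on ?B (\<lambda>z. u (x + (2 * t) *\<^sub>R z))"
    by (rule continuous_on_affine_cball[OF contu sub]) (use t in auto)
  have nn: "0 \<le> u (x + t *\<^sub>R z)" if "z \<in> ?B" for z
    by (rule nonneg, rule subsetD[OF sub'(2)], rule affine_cball_mem) (use t that in auto)
  have nn2: "0 \<le> u (x + (2 * t) *\<^sub>R z)" if "z \<in> ?B" for z
    by (rule nonneg, rule affine_cball_mem) (use t that in auto)
  have half: "cball (0::'a) (1/2) \<subseteq> ?B" by auto
  have "integral ?B (\<lambda>z. u (x + t *\<^sub>R z)) = 2 ^ DIM('a) * integral (cball 0 (1/2)) (\<lambda>z. u (x + (2 * t) *\<^sub>R z))"
    using integral_cball_scale[of 2 "1/2" "\<lambda>z. u (x + t *\<^sub>R z)"] cB by (simp add: mult.commute)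
  also have "integral (cball 0 (1/2)) (\<lambda>z. u (x + (2 * t) *\<^sub>R z)) \<le>
      integral (cball 0 (1/2)) (\<lambda>z. 2 * ((bump z)\<^sup>2 * u (x + (2 * t) *\<^sub>R z)))"
  proof (rule integral_le)
    fix z :: 'a assume z: "z \<in> cball 0 (1/2)"
    then have "(norm z)\<^sup>2 \<le> (1/2)\<^sup>2" by (intro power_mono) auto
    then have "z \<bullet> z \<le> 1/4" by (simp add: power2_norm_eq_inner power_divide)
    then have "(3/4)\<^sup>2 \<le> (bump z)\<^sup>2"
      by (intro power_mono) (auto simp: bump_def)
    then have "1 \<le> 2 * (bump z)\<^sup>2" by (simp add: power2_eq_square)
    then show "u (x + (2 * t) *\<^sub>R z) \<le> 2 * ((bump z)\<^sup>2 * u (x + (2 * t) *\<^sub>R z))"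
      using nn2[of z] z mult_right_mono[of 1 "2 * (bump z)\<^sup>2" "u (x + (2 * t) *\<^sub>R z)"] by simp
  qed (intro integrable_on_compact continuous_intros continuous_on_subset[OF cB2 half]; simp)+
  also have "\<dots> \<le> integral ?B (\<lambda>z. 2 * ((bump z)\<^sup>2 * u (x + (2 * t) *\<^sub>R z)))"
    by (rule integral_subset_le[OF half])
       (use nn2 half in \<open>auto intro!: integrable_on_compact continuous_intros continuous_on_subset[OF cB2 half] cB2\<close>)
  also have "\<dots> = 2 * (?c * u x)"
    using mean_value_onD[OF mv _ sub] t by simp
  finally have i: "integral ?B (\<lambda>z. u (x + t *\<^sub>R z)) \<le> 2 ^ DIM('a) * (2 * (?c * u x))" by simp
  have "norm (integral ?B (\<lambda>z. (4 * bump z * (z \<bullet> v)) *\<^sub>R u (x + t *\<^sub>R z))) \<le> integral ?B (\<lambda>z. 4 * norm v * u (x + t *\<^sub>R z))"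
  proof (rule integral_norm_bound_integral)
    show "(\<lambda>z. (4 * bump z * (z \<bullet> v)) *\<^sub>R u (x + t *\<^sub>R z)) integrable_on ?B"
      by (intro integrable_on_compact continuous_intros cB) auto
    show "(\<lambda>z::'a. 4 * norm v * u (x + t *\<^sub>R z)) integrable_on ?B"
      by (intro integrable_on_compact continuous_intros cB) auto
    fix z assume z: "z \<in> ?B"
    show "norm ((4 * bump z * (z \<bullet> v)) *\<^sub>R u (x + t *\<^sub>R z)) \<le> 4 * norm v * u (x + t *\<^sub>R z)"
      using mult_right_mono[OF bump_inner_le[OF z, of v] nn[OF z]] nn[OF z] by (simp add: abs_mult)
  qed
  also have "\<dots> = 4 * norm v * integral ?B (\<lambda>z. u (x + t *\<^sub>R z))" by (rule integral_mult_right)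
  also have "\<dots> \<le> 4 * norm v * (2 ^ DIM('a) * (2 * (?c * u x)))"
    by (rule mult_left_mono[OF i]) auto
  finally show ?thesis
    unfolding fd_eq_kernel_derivative[OF mv t sub] kernel_derivative_def harnack_const_def
    using t bump_mass_pos[where 'a='a] by (simp add: divide_simps abs_mult mult_ac)
qed

section \<open>Closure properties and compactness\<close>

lemma mean_value_on_affine:
  fixes f :: "'a::euclidean_space \<Rightarrow> 'b::euclidean_space"
  assumes mv: "mean_value_on U f" and s: "0 < s" and sub: "\<And>z. z \<in> V \<Longrightarrow> x0 + s *\<^sub>R z \<in> U"
  shows "mean_value_on V (\<lambda>z. f (x0 + s *\<^sub>R z))"
  unfolding mean_value_on_def
proof (intro conjI allI impI)
  show "continuous_on V (\<lambda>z. f (x0 + s *\<^sub>R z))"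
  proof (rule continuous_on_compose2[OF mean_value_on_continuous[OF mv]])
    show "(\<lambda>z. x0 + s *\<^sub>R z) ` V \<subseteq> U" using sub by blast
  qed (intro continuous_intros)
  fix x t assume xt: "0 < t \<and> cball x t \<subseteq> V"
  have "cball (x0 + s *\<^sub>R x) (s * t) \<subseteq> U"
  proof
    fix y assume y: "y \<in> cball (x0 + s *\<^sub>R x) (s * t)"
    define w where "w = (1/s) *\<^sub>R (y - x0)"
    have yw: "y = x0 + s *\<^sub>R w" using s by (simp add: w_def)
    have "norm (s *\<^sub>R (x - w)) \<le> s * t" using y by (simp add: yw dist_norm scaleR_diff_right)
    then have "w \<in> cball x t" using s by (simp add: dist_norm)
    then show "y \<in> U" unfolding yw using sub xt by blast
  qed
  from mean_value_onD[OF mv _ this] s xt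
  show "integral (cball 0 1) (\<lambda>z. (bump z)\<^sup>2 *\<^sub>R f (x0 + s *\<^sub>R (x + t *\<^sub>R z))) = bump_mass TYPE('a) *\<^sub>R f (x0 + s *\<^sub>R x)"
    by (simp add: algebra_simps)
qed

lemma mean_value_on_scaleR:
  fixes f :: "'a::euclidean_space \<Rightarrow> 'b::euclidean_space"
  assumes "mean_value_on U f"
  shows "mean_value_on U (\<lambda>x. a *\<^sub>R f x)"
  unfolding mean_value_on_def
proof (intro conjI allI impI continuous_intros mean_value_on_continuous[OF assms])
  fix x t assume "0 < t \<and> cball x t \<subseteq> U"
  then show "integral (cball 0 1) (\<lambda>z. (bump z)\<^sup>2 *\<^sub>R (a *\<^sub>R f (x + t *\<^sub>R z))) = bump_mass TYPE('a) *\<^sub>R (a *\<^sub>R f x)"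
    using mean_value_onD[OF assms, of t x]
    unfolding scaleR_left_commute[of _ a] integral_cmul by simp
qed

lemma mean_value_on_const:
  fixes c :: "'b::euclidean_space"
  shows "mean_value_on U (\<lambda>x::'a::euclidean_space. c)"
  unfolding mean_value_on_def
proof (intro conjI allI impI)
  have "(\<lambda>z::'a. (bump z)\<^sup>2) integrable_on cball 0 1"
    by (intro integrable_on_compact continuous_intros) auto
  from integral_linear[OF this bounded_linear_scaleR_left[of c]]
  show "integral (cball 0 1) (\<lambda>z::'a. (bump z)\<^sup>2 *\<^sub>R c) = bump_mass TYPE('a) *\<^sub>R c"
    by (simp add: o_def bump_mass_def)
qed auto

lemma mean_value_on_diff:
  fixes f g :: "'a::euclidean_space \<Rightarrow> 'b::euclidean_space"
  assumes f: "mean_value_on U f" and g: "mean_value_on U g"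
  shows "mean_value_on U (\<lambda>x. f x - g x)"
  unfolding mean_value_on_def
proof (intro conjI allI impI continuous_intros mean_value_on_continuous[OF f] mean_value_on_continuous[OF g])
  fix x t assume xt: "0 < t \<and> cball x t \<subseteq> U"
  have i: "(\<lambda>z. (bump z)\<^sup>2 *\<^sub>R h (x + t *\<^sub>R z)) integrable_on cball 0 1" if "mean_value_on U h" for h :: "'a \<Rightarrow> 'b"
    by (intro integrable_on_compact continuous_intros
          continuous_on_affine_cball[OF mean_value_on_continuous[OF that]]) (use xt in auto)
  show "integral (cball 0 1) (\<lambda>z. (bump z)\<^sup>2 *\<^sub>R (f (x + t *\<^sub>R z) - g (x + t *\<^sub>R z))) = bump_mass TYPE('a) *\<^sub>R (f x - g x)"
    unfolding scaleR_diff_right using mean_value_onD[OF f, of t x] mean_value_onD[OF g, of t x] xt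
    by (subst integral_diff[OF i[OF f] i[OF g]]) auto
qed

lemma integral_compact_uniform_limit:
  fixes f :: "nat \<Rightarrow> 'a::euclidean_space \<Rightarrow> 'b::euclidean_space"
  assumes C: "compact C" and cont: "\<And>n. continuous_on C (f n)" and lim: "uniform_limit C f g sequentially"
  shows "(\<lambda>n. integral C (f n)) \<longlonglongrightarrow> integral C g"
proof -
  have contg: "continuous_on C g"
    by (rule uniform_limit_theorem[OF _ lim]) (auto simp: cont)
  define V where "V = integral C (\<lambda>_. 1::real)"
  have V0: "V \<ge> 0" unfolding V_def by (intro integral_nonneg integrable_on_compact C) auto
  show ?thesis
  proof (rule LIMSEQ_I)
    fix e :: real assume e: "e > 0"
    have e': "e / (2 * (V + 1)) > 0" using e V0 by (simp add: add_nonneg_pos)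
    then have "\<forall>\<^sub>F n in sequentially. \<forall>x\<in>C. dist (f n x) (g x) < e / (2 * (V + 1))"
      using lim unfolding uniform_limit_iff by blast
    then obtain N where N: "\<And>n x. n \<ge> N \<Longrightarrow> x \<in> C \<Longrightarrow> dist (f n x) (g x) < e / (2 * (V + 1))"
      unfolding eventually_sequentially by blast
    have "norm (integral C (f n) - integral C g) < e" if n: "n \<ge> N" for n
    proof -
      have "integral C (f n) - integral C g = integral C (\<lambda>x. f n x - g x)"
        by (intro integral_diff[symmetric] integrable_on_compact C cont contg)
      also have "norm \<dots> \<le> integral C (\<lambda>x. e / (2 * (V + 1)) * 1)"
        by (rule integral_norm_bound_integral)
           (use N[OF n] in \<open>force intro!: integrable_on_compact C continuous_intros cont contg simp: dist_norm less_imp_le\<close>)+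
      also have "\<dots> = e / (2 * (V + 1)) * V" unfolding V_def by (rule integral_mult_right)
      also have "\<dots> < e" using e V0 by (simp add: divide_simps add_nonneg_pos)
      finally show ?thesis .
    qed
    then show "\<exists>no. \<forall>n\<ge>no. norm (integral C (f n) - integral C g) < e" by blast
  qed
qed

lemma uniform_limit_compose_image:
  assumes "uniform_limit U f g F" "h ` V \<subseteq> U"
  shows "uniform_limit V (\<lambda>n x. f n (h x)) (\<lambda>x. g (h x)) F"
  using assms unfolding uniform_limit_iff by (fastforce elim: eventually_mono)

lemma mean_value_on_uniform_limit:
  fixes f :: "nat \<Rightarrow> 'a::euclidean_space \<Rightarrow> 'b::euclidean_space"
  assumes mv: "\<And>n. mean_value_on U (f n)" and lim: "uniform_limit U f g sequentially"
  shows "mean_value_on U g"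
  unfolding mean_value_on_def
proof (intro conjI allI impI)
  show "continuous_on U g"
    by (rule uniform_limit_theorem[OF _ lim]) (auto simp: mean_value_on_continuous[OF mv])
  fix x t assume xt: "0 < t \<and> cball x t \<subseteq> U"
  let ?B = "cball (0::'a) 1"
  have im: "(\<lambda>z. x + t *\<^sub>R z) ` ?B \<subseteq> U" using affine_cball_mem[of t] xt by fastforce
  have "uniform_limit ?B (\<lambda>n z. f n (x + t *\<^sub>R z)) (\<lambda>z. g (x + t *\<^sub>R z)) sequentially"
    by (rule uniform_limit_compose_image[OF lim im])
  moreover have b: "norm ((bump z)\<^sup>2) \<le> 1" for z :: 'a by (simp add: power_le_one)
  ultimately have "uniform_limit ?B (\<lambda>n z. (bump z)\<^sup>2 *\<^sub>R f n (x + t *\<^sub>R z)) (\<lambda>z. (bump z)\<^sup>2 *\<^sub>R g (x + t *\<^sub>R z)) sequentially"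
    unfolding uniform_limit_iff
  proof (intro allI impI)
    fix e :: real assume "\<forall>e>0. \<forall>\<^sub>F n in sequentially. \<forall>z\<in>?B. dist (f n (x + t *\<^sub>R z)) (g (x + t *\<^sub>R z)) < e" "0 < e"
    then have "\<forall>\<^sub>F n in sequentially. \<forall>z\<in>?B. dist (f n (x + t *\<^sub>R z)) (g (x + t *\<^sub>R z)) < e" by blast
    then show "\<forall>\<^sub>F n in sequentially. \<forall>z\<in>?B. dist ((bump z)\<^sup>2 *\<^sub>R f n (x + t *\<^sub>R z)) ((bump z)\<^sup>2 *\<^sub>R g (x + t *\<^sub>R z)) < e"
    proof (rule eventually_mono, intro ballI)
      fix n z assume *: "\<forall>z\<in>?B. dist (f n (x + t *\<^sub>R z)) (g (x + t *\<^sub>R z)) < e" "z \<in> ?B"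
      have "dist ((bump z)\<^sup>2 *\<^sub>R f n (x + t *\<^sub>R z)) ((bump z)\<^sup>2 *\<^sub>R g (x + t *\<^sub>R z)) =
         norm ((bump z)\<^sup>2) * norm (f n (x + t *\<^sub>R z) - g (x + t *\<^sub>R z))"
        unfolding dist_norm scaleR_diff_right[symmetric] norm_scaleR real_norm_def ..
      also have "\<dots> \<le> 1 * norm (f n (x + t *\<^sub>R z) - g (x + t *\<^sub>R z))"
        using b[of z] by (intro mult_right_mono) auto
      also have "\<dots> < e" using * by (simp add: dist_norm)
      finally show "dist ((bump z)\<^sup>2 *\<^sub>R f n (x + t *\<^sub>R z)) ((bump z)\<^sup>2 *\<^sub>R g (x + t *\<^sub>R z)) < e" .
    qed
  qed
  then have "(\<lambda>n. integral ?B (\<lambda>z. (bump z)\<^sup>2 *\<^sub>R f n (x + t *\<^sub>R z))) \<longlonglongrightarrow> integral ?B (\<lambda>z. (bump z)\<^sup>2 *\<^sub>R g (x + t *\<^sub>R z))"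
    by (intro integral_compact_uniform_limit continuous_intros
          continuous_on_affine_cball[OF mean_value_on_continuous[OF mv]]) (use xt in auto)
  moreover have "(\<lambda>n. integral ?B (\<lambda>z. (bump z)\<^sup>2 *\<^sub>R f n (x + t *\<^sub>R z))) = (\<lambda>n. bump_mass TYPE('a) *\<^sub>R f n x)"
    using mean_value_onD[OF mv] xt by auto
  moreover have "(\<lambda>n. bump_mass TYPE('a) *\<^sub>R f n x) \<longlonglongrightarrow> bump_mass TYPE('a) *\<^sub>R g x"
  proof (intro tendsto_intros tendsto_uniform_limitI[OF lim])
    show "x \<in> U" using xt by (auto simp: subset_iff)
  qed
  ultimately show "integral ?B (\<lambda>z. (bump z)\<^sup>2 *\<^sub>R g (x + t *\<^sub>R z)) = bump_mass TYPE('a) *\<^sub>R g x"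
    using LIMSEQ_unique by metis
qed

lemma fd_diff:
  fixes f g :: "'a::euclidean_space \<Rightarrow> 'b::euclidean_space"
  assumes "open U" "mean_value_on U f" "mean_value_on U g" "x \<in> U"
  shows "fd (\<lambda>x. f x - g x) x v = fd f x v - fd g x v"
  using has_derivative_imp_fd[OF has_derivative_diff[OF mean_value_has_fd[OF assms(1,2,4)] mean_value_has_fd[OF assms(1,3,4)]]]
  by simp

text \<open>
  Apply the gradient bound to the differences.
\<close>

lemma mean_value_fd_uniform_limit:
  fixes f :: "nat \<Rightarrow> 'a::euclidean_space \<Rightarrow> 'b::euclidean_space"
  assumes mv: "\<And>n. mean_value_on (ball 0 r) (f n)" and lim: "uniform_limit (ball 0 r) f g sequentially"
    and \<rho>: "\<rho> < r" and e: "e > 0"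
  shows "\<forall>\<^sub>F n in sequentially. \<forall>x\<in>cball 0 \<rho>. \<forall>v. norm (fd (f n) x v - fd g x v) \<le> e * norm v"
proof -
  have mvg: "mean_value_on (ball 0 r) g" by (rule mean_value_on_uniform_limit[OF mv lim])
  define t where "t = (r - \<rho>) / 3"
  have t: "t > 0" using \<rho> by (simp add: t_def)
  let ?G = "gradient_const TYPE('a)"
  define d where "d = e * t / (?G + 1)"
  have G: "?G \<ge> 0" by (rule gradient_const_nonneg)
  have d: "d > 0" using e t G by (simp add: d_def add_nonneg_pos)
  have dle: "?G / t * d \<le> e" using e t G by (simp add: d_def divide_simps add_nonneg_pos)
  have "\<forall>\<^sub>F n in sequentially. \<forall>x\<in>ball 0 r. dist (f n x) (g x) < d"
    using lim d unfolding uniform_limit_iff by blast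
  then show ?thesis
  proof (rule eventually_mono, intro ballI allI)
    fix n and x v :: 'a assume n: "\<forall>x\<in>ball 0 r. dist (f n x) (g x) < d" and x: "x \<in> cball 0 \<rho>"
    have sub: "cball x (2 * t) \<subseteq> ball 0 r"
    proof
      fix y assume "y \<in> cball x (2 * t)"
      then have "norm (y - x) \<le> 2 * t" by (simp add: dist_norm norm_minus_commute)
      then have "norm y < r"
        using norm_triangle_sub[of y x] x \<rho> by (simp add: t_def field_simps)
      then show "y \<in> ball 0 r" by simp
    qed
    have sub1: "cball x t \<subseteq> ball 0 r" by (rule subset_trans[OF subset_cball sub]) (use t in auto)
    have xr: "x \<in> ball 0 r" using x \<rho> by auto
    have "norm (fd (\<lambda>x. f n x - g x) x v) \<le> ?G / t * d * norm v"
    proof (rule mean_value_gradient_bound[OF mean_value_on_diff[OF mv mvg] t sub])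
      fix y assume "y \<in> cball x t"
      then have "y \<in> ball 0 r" using sub1 by blast
      then show "norm (f n y - g y) \<le> d" using n by (auto simp: dist_norm less_imp_le)
    qed
    also have "\<dots> \<le> e * norm v" using dle by (rule mult_right_mono) auto
    finally show "norm (fd (f n) x v - fd g x v) \<le> e * norm v"
      using fd_diff[OF _ mv mvg xr] by auto
  qed
qed

lemma mean_value_lipschitz:
  fixes f :: "'a::euclidean_space \<Rightarrow> 'b::euclidean_space"
  assumes mv: "mean_value_on (ball 0 R) f" and M: "\<And>x. x \<in> ball 0 R \<Longrightarrow> norm (f x) \<le> M"
    and r: "r < R" and xy: "x \<in> cball 0 r" "y \<in> cball 0 r"
  shows "norm (f x - f y) \<le> 3 * gradient_const TYPE('a) * M / (R - r) * norm (x - y)"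
proof -
  define t where "t = (R - r) / 3"
  have t: "t > 0" using r by (simp add: t_def)
  let ?G = "gradient_const TYPE('a)"
  have "norm (f x - f y) \<le> (?G / t * M) * norm (x - y)"
  proof (rule differentiable_bound[where S = "cball 0 r" and f' = "fd f"])
    fix z :: 'a assume z: "z \<in> cball 0 r"
    then have zR: "z \<in> ball 0 R" using r by auto
    show "(f has_derivative fd f z) (at z within cball 0 r)"
      using mean_value_has_fd[OF _ mv zR] has_derivative_at_withinI by blast
    have sub: "cball z (2 * t) \<subseteq> ball 0 R"
      using z r t by (auto simp: cball_subset_ball_iff t_def field_simps)
    show "onorm (fd f z) \<le> ?G / t * M"
    proof (rule onorm_le)
      fix v show "norm (fd f z v) \<le> ?G / t * M * norm v"
        using sub t by (intro mean_value_gradient_bound[OF mv t sub] M) (auto simp: subset_iff)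
    qed
  qed (use xy in auto)
  then show ?thesis by (simp add: t_def mult_ac)
qed

text \<open>
  Montel's theorem: the gradient bound gives equicontinuity, and Arzela-Ascoli a convergent
  subsequence.
\<close>

lemma mean_value_compactness:
  fixes f :: "nat \<Rightarrow> 'a::euclidean_space \<Rightarrow> 'b::euclidean_space"
  assumes mv: "\<And>n. mean_value_on (ball 0 R) (f n)" and M: "\<And>n x. x \<in> ball 0 R \<Longrightarrow> norm (f n x) \<le> M"
    and r: "r < R"
  obtains g k where "strict_mono (k :: nat \<Rightarrow> nat)" "mean_value_on (ball 0 r) g"
    "uniform_limit (ball 0 r) (\<lambda>n. f (k n)) g sequentially"
proof -
  let ?G = "gradient_const TYPE('a)"
  have "\<exists>g k. continuous_on (cball 0 r) g \<and> strict_mono (k :: nat \<Rightarrow> nat) \<and>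
     (\<forall>e>0. \<exists>N. \<forall>n x. n \<ge> N \<and> x \<in> cball 0 r \<longrightarrow> norm (f (k n) x - g x) < e)"
  proof (rule Arzela_Ascoli[of "cball 0 r" f M])
    show "norm (f n x) \<le> M" if "x \<in> cball 0 r" for n x using M that r by auto
    fix x :: 'a and e :: real assume x: "x \<in> cball 0 r" and e: "0 < e"
    define L where "L = 3 * ?G * M / (R - r)"
    have "norm (f n x - f n y) < e" if y: "y \<in> cball 0 r" "norm (x - y) < e / (\<bar>L\<bar> + 1)" for n y
    proof -
      have "norm (f n x - f n y) \<le> L * norm (x - y)"
        unfolding L_def by (rule mean_value_lipschitz[OF mv M r x y(1)])
      also have "\<dots> \<le> (\<bar>L\<bar> + 1) * norm (x - y)" by (intro mult_right_mono) auto
      also have "\<dots> < e" using y(2) by (simp add: field_simps)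
      finally show ?thesis .
    qed
    then show "\<exists>d>0. \<forall>n y. y \<in> cball 0 r \<and> norm (x - y) < d \<longrightarrow> norm (f n x - f n y) < e"
      using e by (intro exI[of _ "e / (\<bar>L\<bar> + 1)"]) auto
  qed (simp, blast)
  then obtain g k where gk: "strict_mono (k :: nat \<Rightarrow> nat)"
     "\<forall>e>0. \<exists>N. \<forall>n x. n \<ge> N \<and> x \<in> cball 0 r \<longrightarrow> norm (f (k n) x - g x) < e" by blast
  have ul: "uniform_limit (ball 0 r) (\<lambda>n. f (k n)) g sequentially"
    unfolding uniform_limit_iff eventually_sequentially dist_norm using gk(2)
    by (meson ball_subset_cball subsetD)
  moreover have "mean_value_on (ball 0 r) g"
  proof (rule mean_value_on_uniform_limit[OF _ ul])
    show "mean_value_on (ball 0 r) (f (k n))" for n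
      by (rule mean_value_on_subset[OF mv]) (use r in auto)
  qed
  ultimately show ?thesis using that gk(1) by blast
qed

section \<open>Monotonicity of the frequency\<close>

text \<open>
  The weighted inner product of \<open>f\<close> and \<open>g\<close> on the ball of radius \<open>t\<close>, rescaled to the unit ball. The
  Almgren frequency of \<open>f\<close> is \<open>pairing t (euler f) f / pairing t f f\<close>.
\<close>

definition pairing :: "real \<Rightarrow> ('a::euclidean_space \<Rightarrow> 'b::euclidean_space) \<Rightarrow> ('a \<Rightarrow> 'b) \<Rightarrow> real" where
  "pairing t f g = integral (cball 0 1) (\<lambda>z. (bump z)\<^sup>2 * (f (t *\<^sub>R z) \<bullet> g (t *\<^sub>R z)))"

lemma scaled_mem: "0 \<le> t \<Longrightarrow> t < R \<Longrightarrow> z \<in> cball 0 1 \<Longrightarrow> t *\<^sub>R z \<in> ball 0 R" for z :: "'a::real_normed_vector"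
proof -
  assume "0 \<le> t" "t < R" "z \<in> cball 0 1"
  then have "t * norm z \<le> t * 1" by (intro mult_left_mono) auto
  then show ?thesis using \<open>0 \<le> t\<close> \<open>t < R\<close> by simp
qed

lemma continuous_on_scaled:
  fixes f :: "'a::real_normed_vector \<Rightarrow> 'b::topological_space"
  assumes "continuous_on (ball 0 R) f" "0 \<le> t" "t < R"
  shows "continuous_on (cball 0 1) (\<lambda>z. f (t *\<^sub>R z))"
proof (rule continuous_on_compose2[OF assms(1)])
  show "(\<lambda>z::'a. t *\<^sub>R z) ` cball 0 1 \<subseteq> ball 0 R" by (rule image_subsetI) (rule scaled_mem[OF assms(2,3)])
qed (intro continuous_intros)

lemma pairing_integrable:
  fixes f g :: "'a::euclidean_space \<Rightarrow> 'b::euclidean_space"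
  assumes "continuous_on (ball 0 R) f" "continuous_on (ball 0 R) g" "0 \<le> t" "t < R"
  shows "(\<lambda>z. (bump z)\<^sup>2 * (f (t *\<^sub>R z) \<bullet> g (t *\<^sub>R z))) integrable_on cball 0 1"
  by (intro integrable_on_compact compact_cball continuous_on_mult continuous_on_power continuous_on_bump continuous_on_inner
        continuous_on_scaled[OF assms(1,3,4)] continuous_on_scaled[OF assms(2,3,4)])

lemma pairing_commute: "pairing t f g = pairing t g f"
proof -
  have "(\<lambda>z. (bump z)\<^sup>2 * (f (t *\<^sub>R z) \<bullet> g (t *\<^sub>R z))) = (\<lambda>z. (bump z)\<^sup>2 * (g (t *\<^sub>R z) \<bullet> f (t *\<^sub>R z)))"
    by (rule ext, subst inner_commute) (rule refl)
  then show ?thesis unfolding pairing_def by (rule arg_cong)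
qed

lemma pairing_self_nonneg:
  "pairing t f f \<ge> 0"
proof (cases "(\<lambda>z. (bump z)\<^sup>2 * (f (t *\<^sub>R z) \<bullet> f (t *\<^sub>R z))) integrable_on cball 0 1")
  case True
  then show ?thesis unfolding pairing_def by (rule integral_nonneg) simp
next
  case False
  then show ?thesis unfolding pairing_def using not_integrable_integral by (metis order_refl)
qed

lemma pairing_combine:
  fixes f g :: "'a::euclidean_space \<Rightarrow> 'b::euclidean_space"
  assumes "continuous_on (ball 0 R) f" "continuous_on (ball 0 R) g" "0 \<le> t" "t < R"
  shows "pairing t (\<lambda>x. a *\<^sub>R f x - b *\<^sub>R g x) (\<lambda>x. a *\<^sub>R f x - b *\<^sub>R g x) =
     a\<^sup>2 * pairing t f f - 2 * a * b * pairing t f g + b\<^sup>2 * pairing t g g"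
proof -
  note i = pairing_integrable[OF assms(1,1,3,4)] pairing_integrable[OF assms(1,2,3,4)] pairing_integrable[OF assms(2,2,3,4)]
  have "pairing t (\<lambda>x. a *\<^sub>R f x - b *\<^sub>R g x) (\<lambda>x. a *\<^sub>R f x - b *\<^sub>R g x) =
     integral (cball 0 1) (\<lambda>z. a\<^sup>2 * ((bump z)\<^sup>2 * (f (t *\<^sub>R z) \<bullet> f (t *\<^sub>R z))) - (2 * a * b) * ((bump z)\<^sup>2 * (f (t *\<^sub>R z) \<bullet> g (t *\<^sub>R z)))
       + b\<^sup>2 * ((bump z)\<^sup>2 * (g (t *\<^sub>R z) \<bullet> g (t *\<^sub>R z))))"
    unfolding pairing_def
  proof (rule integral_cong)
    fix z
    have c: "g (t *\<^sub>R z) \<bullet> f (t *\<^sub>R z) = f (t *\<^sub>R z) \<bullet> g (t *\<^sub>R z)" by (rule inner_commute)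
    show "(bump z)\<^sup>2 * ((a *\<^sub>R f (t *\<^sub>R z) - b *\<^sub>R g (t *\<^sub>R z)) \<bullet> (a *\<^sub>R f (t *\<^sub>R z) - b *\<^sub>R g (t *\<^sub>R z))) =
      a\<^sup>2 * ((bump z)\<^sup>2 * (f (t *\<^sub>R z) \<bullet> f (t *\<^sub>R z))) - (2 * a * b) * ((bump z)\<^sup>2 * (f (t *\<^sub>R z) \<bullet> g (t *\<^sub>R z)))
       + b\<^sup>2 * ((bump z)\<^sup>2 * (g (t *\<^sub>R z) \<bullet> g (t *\<^sub>R z)))"
      by (simp add: inner_diff_left inner_diff_right c power2_eq_square algebra_simps)
  qed
  also have "\<dots> = integral (cball 0 1) (\<lambda>z. a\<^sup>2 * ((bump z)\<^sup>2 * (f (t *\<^sub>R z) \<bullet> f (t *\<^sub>R z))))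
     - integral (cball 0 1) (\<lambda>z. (2 * a * b) * ((bump z)\<^sup>2 * (f (t *\<^sub>R z) \<bullet> g (t *\<^sub>R z))))
     + integral (cball 0 1) (\<lambda>z. b\<^sup>2 * ((bump z)\<^sup>2 * (g (t *\<^sub>R z) \<bullet> g (t *\<^sub>R z))))"
    by (intro integral_unique has_integral_add has_integral_diff integrable_integral integrable_on_mult_right i)
  finally show ?thesis unfolding pairing_def integral_mult_right .
qed

lemma pairing_Cauchy_Schwarz:
  fixes f g :: "'a::euclidean_space \<Rightarrow> 'b::euclidean_space"
  assumes "continuous_on (ball 0 R) f" "continuous_on (ball 0 R) g" "0 \<le> t" "t < R" "pairing t g g > 0"
  shows "(pairing t f g)\<^sup>2 \<le> pairing t f f * pairing t g g"
proof -
  let ?a = "pairing t g g" and ?b = "pairing t f g"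
  have "0 \<le> ?a\<^sup>2 * pairing t f f - 2 * ?a * ?b * ?b + ?b\<^sup>2 * ?a"
    using pairing_combine[OF assms(1-4), of ?a ?b] pairing_self_nonneg by metis
  also have "\<dots> = ?a * (pairing t f f * ?a - ?b\<^sup>2)" by (simp add: power2_eq_square algebra_simps)
  finally show ?thesis using assms(5) by (simp add: zero_le_mult_iff)
qed

lemma pairing_pos:
  fixes f :: "'a::euclidean_space \<Rightarrow> 'b::euclidean_space"
  assumes cont: "continuous_on (ball 0 R) f" and t: "0 < t" "t < R" and x: "norm x < t" "f x \<noteq> 0"
  shows "pairing t f f > 0"
proof -
  let ?q = "\<lambda>z. (bump z)\<^sup>2 * (f (t *\<^sub>R z) \<bullet> f (t *\<^sub>R z))"
  have "pairing t f f \<noteq> 0"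
  proof
    assume "pairing t f f = 0"
    then have "?q ((1/t) *\<^sub>R x) = 0"
      using t x by (intro integral_cball_eq_0_imp_0[of 0 1 ?q])
        (auto simp: pairing_def intro!: continuous_intros continuous_on_scaled[OF cont])
    moreover have "bump ((1/t) *\<^sub>R x) > 0"
    proof -
      have "norm x / t < 1" using x t by simp
      then have "(norm x / t)\<^sup>2 < 1" using t by (simp add: power_less_one_iff abs_square_less_1)
      then show ?thesis using t
        by (simp add: bump_def power2_norm_eq_inner[symmetric] power_divide flip: power2_eq_square)
    qed
    ultimately show False using x t by simp
  qed
  then show ?thesis using pairing_self_nonneg[of t f] by simp
qed

text \<open>
  The kernel is positive inside the ball, so the pairing is definite there.
\<close>

lemma pairing_zero_imp:
  fixes f :: "'a::euclidean_space \<Rightarrow> 'b::euclidean_space"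
  assumes "continuous_on (ball 0 R) f" "0 < t" "t < R" "pairing t f f = 0" "norm x < t"
  shows "f x = 0"
  using pairing_pos[OF assms(1,2,3,5)] assms(4) by force

lemma laplacian_zero_vector:
  fixes f :: "'a::euclidean_space \<Rightarrow> 'b::euclidean_space"
  assumes U: "open U" and mv: "mean_value_on U f" and x: "x \<in> U"
  shows "(\<Sum>b\<in>Basis. fd (\<lambda>y. fd f y b) x b) = 0"
proof (rule euclidean_eqI)
  fix e :: 'b
  let ?u = "\<lambda>x. f x \<bullet> e"
  have mvu: "mean_value_on U ?u" by (rule mean_value_on_inner[OF mv])
  have 1: "fd ?u y b = fd f y b \<bullet> e" if "y \<in> U" for y b
    using fd_inner[OF mean_value_has_fd[OF U mv that], of e] by simp
  have 2: "fd (\<lambda>y. fd ?u y b) x b = fd (\<lambda>y. fd f y b) x b \<bullet> e" for b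
  proof -
    have "((\<lambda>y. fd f y b \<bullet> e) has_derivative (\<lambda>v. fd (\<lambda>y. fd f y b) x v \<bullet> e)) (at x)"
      by (rule has_derivative_inner_left[OF mean_value_has_fd[OF U mean_value_on_fd[OF U mv] x]])
    then have "((\<lambda>y. fd ?u y b) has_derivative (\<lambda>v. fd (\<lambda>y. fd f y b) x v \<bullet> e)) (at x)"
      by (rule has_derivative_transform_within_open[OF _ U x]) (simp add: 1)
    then show ?thesis using has_derivative_imp_fd by metis
  qed
  show "(\<Sum>b\<in>Basis. fd (\<lambda>y. fd f y b) x b) \<bullet> e = 0 \<bullet> e"
    using mean_value_on_laplacian_zero[OF U mvu x] by (simp add: 2 inner_sum_left)
qed

text \<open>
  Green's second identity. Integrate the components \<open>F b\<close> of the field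
  \<open>g \<bullet> \<nabla>f - f \<bullet> \<nabla>g\<close> by parts: its divergence is zero because both Laplacians are, while the
  gradient of \<open>bump ^ 3\<close> yields its radial component with weight \<open>bump ^ 2\<close>.
\<close>

lemma euler_symmetric:
  fixes f g :: "'a::euclidean_space \<Rightarrow> 'b::euclidean_space"
  assumes f: "mean_value_on (ball 0 R) f" and g: "mean_value_on (ball 0 R) g" and t: "0 < t" "t < R"
  shows "pairing t (euler f) g = pairing t f (euler g)"
proof -
  let ?U = "ball (0::'a) R" and ?B = "cball (0::'a) 1"
  have U: "open ?U" by simp
  define F where "F b z = g (t *\<^sub>R z) \<bullet> fd f (t *\<^sub>R z) b - f (t *\<^sub>R z) \<bullet> fd g (t *\<^sub>R z) b" for b z
  define F' where "F' b z w = (g (t *\<^sub>R z) \<bullet> fd (\<lambda>y. fd f y b) (t *\<^sub>R z) (t *\<^sub>R w) + fd g (t *\<^sub>R z) (t *\<^sub>R w) \<bullet> fd f (t *\<^sub>R z) b)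
     - (f (t *\<^sub>R z) \<bullet> fd (\<lambda>y. fd g y b) (t *\<^sub>R z) (t *\<^sub>R w) + fd f (t *\<^sub>R z) (t *\<^sub>R w) \<bullet> fd g (t *\<^sub>R z) b)" for b z w
  let ?W = "(\<lambda>z. t *\<^sub>R z) -` ?U"
  have mem: "t *\<^sub>R z \<in> ?U" if "z \<in> ?B" for z by (rule scaled_mem[OF less_imp_le[OF t(1)] t(2) that])
  have der: "(F b has_derivative F' b z) (at z)" if "z \<in> ?W" for b z
  proof -
    have z: "t *\<^sub>R z \<in> ?U" using that by simp
    have s: "((\<lambda>z. t *\<^sub>R z) has_derivative (\<lambda>w. t *\<^sub>R w)) (at z)" by (auto intro!: derivative_eq_intros)
    have c: "((\<lambda>z. h (t *\<^sub>R z)) has_derivative (\<lambda>w. fd h (t *\<^sub>R z) (t *\<^sub>R w))) (at z)"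
      if "mean_value_on ?U h" for h :: "'a \<Rightarrow> 'b"
      using has_derivative_compose[OF s mean_value_has_fd[OF U that z]] .
    show ?thesis unfolding F_def [abs_def] F'_def [abs_def]
      by (intro has_derivative_diff has_derivative_inner c f g
            c[OF mean_value_on_fd[OF U f]] c[OF mean_value_on_fd[OF U g]])
  qed
  have lin: "fd h (t *\<^sub>R z) (t *\<^sub>R b) = t *\<^sub>R fd h (t *\<^sub>R z) b" if "mean_value_on ?U h" "z \<in> ?B" for h :: "'a \<Rightarrow> 'b" and z b
    using linear_cmul[OF has_derivative_linear[OF mean_value_has_fd[OF U that(1) mem[OF that(2)]]]] .
  \<comment> \<open>the products of first derivatives cancel, by symmetry of the inner product\<close>
  have F'b: "F' b z b = t * (g (t *\<^sub>R z) \<bullet> fd (\<lambda>y. fd f y b) (t *\<^sub>R z) b - f (t *\<^sub>R z) \<bullet> fd (\<lambda>y. fd g y b) (t *\<^sub>R z) b)"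
    if "z \<in> ?B" for b z
    unfolding F'_def lin[OF f that] lin[OF g that] lin[OF mean_value_on_fd[OF U f] that] lin[OF mean_value_on_fd[OF U g] that]
    using inner_commute[of "fd f (t *\<^sub>R z) b" "fd g (t *\<^sub>R z) b"] by (simp add: right_diff_distrib)
  have cf: "continuous_on ?B (\<lambda>z. h (t *\<^sub>R z))" if "mean_value_on ?U h" for h :: "'a \<Rightarrow> 'b"
    by (rule continuous_on_scaled[OF mean_value_on_continuous[OF that]]) (use t in auto)
  have contF: "continuous_on ?B (F b)" for b
    unfolding F_def [abs_def]
    by (intro continuous_intros cf f g cf[OF mean_value_on_fd[OF U f]] cf[OF mean_value_on_fd[OF U g]])
  have contF': "continuous_on ?B (\<lambda>z. F' b z b)" for b
  proof (rule continuous_on_eq)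
    show "continuous_on ?B (\<lambda>z. t * (g (t *\<^sub>R z) \<bullet> fd (\<lambda>y. fd f y b) (t *\<^sub>R z) b - f (t *\<^sub>R z) \<bullet> fd (\<lambda>y. fd g y b) (t *\<^sub>R z) b))"
      by (intro continuous_intros cf f g cf[OF mean_value_on_fd[OF U mean_value_on_fd[OF U f]]]
            cf[OF mean_value_on_fd[OF U mean_value_on_fd[OF U g]]])
  qed (simp add: F'b)
  have ibp: "6 * integral ?B (\<lambda>z. (bump z)\<^sup>2 * (z \<bullet> b) * F b z) = integral ?B (\<lambda>z. bump z ^ 3 * F' b z b)" for b
  proof (rule bump_integration_by_parts[symmetric, where F' = "F' b"])
    show "open ?W" by (rule open_vimage[OF U]) (intro continuous_intros)
    show "?B \<subseteq> ?W" using mem by auto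
  qed (use der contF' in auto)
  have sum0: "(\<Sum>b\<in>Basis. F' b z b) = 0" if "z \<in> ?B" for z
  proof -
    have "(\<Sum>b\<in>Basis. F' b z b) = t * (g (t *\<^sub>R z) \<bullet> (\<Sum>b\<in>Basis. fd (\<lambda>y. fd f y b) (t *\<^sub>R z) b) - f (t *\<^sub>R z) \<bullet> (\<Sum>b\<in>Basis. fd (\<lambda>y. fd g y b) (t *\<^sub>R z) b))"
      by (simp add: F'b[OF that] sum_subtractf sum_distrib_left inner_sum_right right_diff_distrib)
    then show ?thesis using laplacian_zero_vector[OF U f mem[OF that]] laplacian_zero_vector[OF U g mem[OF that]] by simp
  qed
  have "(\<Sum>b\<in>Basis. 6 * integral ?B (\<lambda>z. (bump z)\<^sup>2 * (z \<bullet> b) * F b z)) = (\<Sum>b\<in>Basis. integral ?B (\<lambda>z. bump z ^ 3 * F' b z b))"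
    by (rule sum.cong[OF refl ibp])
  also have "\<dots> = integral ?B (\<lambda>z. \<Sum>b\<in>Basis. bump z ^ 3 * F' b z b)"
    by (intro integral_sum[symmetric] integrable_on_compact continuous_intros contF') auto
  also have "\<dots> = integral ?B (\<lambda>z::'a. 0::real)"
    by (rule integral_cong) (simp add: sum_distrib_left[symmetric] sum0)
  finally have "0 = (\<Sum>b\<in>Basis. integral ?B (\<lambda>z. (bump z)\<^sup>2 * (z \<bullet> b) * F b z))"
    by (simp add: sum_distrib_left[symmetric])
  also have "\<dots> = integral ?B (\<lambda>z. \<Sum>b\<in>Basis. (bump z)\<^sup>2 * (z \<bullet> b) * F b z)"
    by (intro integral_sum[symmetric] integrable_on_compact continuous_intros contF) auto
  also have "\<dots> = integral ?B (\<lambda>z. (1/t) * ((bump z)\<^sup>2 * (euler f (t *\<^sub>R z) \<bullet> g (t *\<^sub>R z)) - (bump z)\<^sup>2 * (f (t *\<^sub>R z) \<bullet> euler g (t *\<^sub>R z))))"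
  proof (rule integral_cong)
    fix z assume z: "z \<in> ?B"
    have e: "(\<Sum>b\<in>Basis. (z \<bullet> b) *\<^sub>R fd h (t *\<^sub>R z) b) = (1/t) *\<^sub>R euler h (t *\<^sub>R z)" if "mean_value_on ?U h" for h :: "'a \<Rightarrow> 'b"
    proof -
      have "(\<Sum>b\<in>Basis. (z \<bullet> b) *\<^sub>R fd h (t *\<^sub>R z) b) = fd h (t *\<^sub>R z) z"
        using fd_expand[OF mean_value_has_fd[OF U that mem[OF z]], of z] by simp
      moreover have "euler h (t *\<^sub>R z) = t *\<^sub>R fd h (t *\<^sub>R z) z"
        unfolding euler_def by (rule lin[OF that z])
      ultimately show ?thesis using t by simp
    qed
    have "(\<Sum>b\<in>Basis. (bump z)\<^sup>2 * (z \<bullet> b) * F b z) =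
       (bump z)\<^sup>2 * (g (t *\<^sub>R z) \<bullet> (\<Sum>b\<in>Basis. (z \<bullet> b) *\<^sub>R fd f (t *\<^sub>R z) b) - f (t *\<^sub>R z) \<bullet> (\<Sum>b\<in>Basis. (z \<bullet> b) *\<^sub>R fd g (t *\<^sub>R z) b))"
      by (simp add: F_def sum_distrib_left sum_subtractf inner_sum_right algebra_simps)
    then show "(\<Sum>b\<in>Basis. (bump z)\<^sup>2 * (z \<bullet> b) * F b z) = (1/t) * ((bump z)\<^sup>2 * (euler f (t *\<^sub>R z) \<bullet> g (t *\<^sub>R z)) - (bump z)\<^sup>2 * (f (t *\<^sub>R z) \<bullet> euler g (t *\<^sub>R z)))"
      unfolding e[OF f] e[OF g] using inner_commute[of "g (t *\<^sub>R z)" "euler f (t *\<^sub>R z)"] by (simp add: right_diff_distrib diff_divide_distrib)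
  qed
  also have "\<dots> = (1/t) * (pairing t (euler f) g - pairing t f (euler g))"
    unfolding pairing_def integral_mult_right
    by (subst integral_diff)
       (use t mean_value_on_continuous[OF mean_value_on_euler[OF f]] mean_value_on_continuous[OF mean_value_on_euler[OF g]]
          mean_value_on_continuous[OF f] mean_value_on_continuous[OF g] in \<open>auto intro!: pairing_integrable\<close>)
  finally show ?thesis using t by simp
qed

lemma pairing_has_derivative:
  fixes f g :: "'a::euclidean_space \<Rightarrow> 'b::euclidean_space"
  assumes f: "mean_value_on (ball 0 R) f" and g: "mean_value_on (ball 0 R) g" and t: "0 < t" "t < R"
  shows "((\<lambda>t. pairing t f g) has_real_derivative (pairing t (euler f) g + pairing t f (euler g)) / t) (at t)"
proof -
  let ?U = "ball (0::'a) R" and ?B = "cball (0::'a) 1" and ?I = "{0<..<R}"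
  have U: "open ?U" by simp
  have mem: "\<tau> *\<^sub>R z \<in> ?U" if "\<tau> \<in> ?I" "z \<in> ?B" for z \<tau> using scaled_mem[of \<tau> R z] that by auto
  have der: "((\<lambda>\<tau>. h (\<tau> *\<^sub>R z)) has_vector_derivative (1/\<tau>) *\<^sub>R euler h (\<tau> *\<^sub>R z)) (at \<tau> within ?I)"
    if h: "mean_value_on ?U h" and *: "\<tau> \<in> ?I" "z \<in> ?B" for h :: "'a \<Rightarrow> 'b" and \<tau> z
  proof -
    note hd = mean_value_has_fd[OF U h mem[OF *]]
    have "((\<lambda>\<tau>. \<tau> *\<^sub>R z) has_derivative (\<lambda>k. k *\<^sub>R z)) (at \<tau>)" by (auto intro!: derivative_eq_intros)
    from has_derivative_compose[OF this hd]
    have 1: "((\<lambda>\<tau>. h (\<tau> *\<^sub>R z)) has_derivative (\<lambda>k. fd h (\<tau> *\<^sub>R z) (k *\<^sub>R z))) (at \<tau>)" .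
    have 2: "fd h (\<tau> *\<^sub>R z) (k *\<^sub>R z) = k *\<^sub>R (1/\<tau>) *\<^sub>R euler h (\<tau> *\<^sub>R z)" for k
      using * linear_cmul[OF has_derivative_linear[OF hd]] by (simp add: euler_def)
    show ?thesis using 1 unfolding has_vector_derivative_def 2 by (rule has_derivative_at_withinI)
  qed
  have ce: "continuous_on ?U (euler h)" if "mean_value_on ?U h" for h :: "'a \<Rightarrow> 'b"
    by (rule mean_value_on_continuous[OF mean_value_on_euler[OF that]])
  have cp: "continuous_on (?I \<times> ?B) (\<lambda>p. h (fst p *\<^sub>R snd p))" if "continuous_on ?U h" for h :: "'a \<Rightarrow> 'b"
  proof (rule continuous_on_compose2[OF that])
    show "(\<lambda>p. fst p *\<^sub>R snd p) ` (?I \<times> ?B) \<subseteq> ?U" using mem by auto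
  qed (intro continuous_intros)
  have cb: "continuous_on (?I \<times> ?B) (\<lambda>p::real\<times>'a. bump (snd p))"
    by (rule continuous_on_compose2[OF continuous_on_bump[of UNIV]]) (auto intro: continuous_intros)
  have D: "((\<lambda>\<tau>. integral ?B (\<lambda>z. (bump z)\<^sup>2 * (f (\<tau> *\<^sub>R z) \<bullet> g (\<tau> *\<^sub>R z)))) has_vector_derivative
     integral ?B (\<lambda>z. (bump z)\<^sup>2 * (f (t *\<^sub>R z) \<bullet> ((1/t) *\<^sub>R euler g (t *\<^sub>R z)) + ((1/t) *\<^sub>R euler f (t *\<^sub>R z)) \<bullet> g (t *\<^sub>R z))))
      (at t within ?I)"
  proof (rule has_vector_derivative_integral_compact[where
        f' = "\<lambda>\<tau> z. (bump z)\<^sup>2 * (f (\<tau> *\<^sub>R z) \<bullet> ((1/\<tau>) *\<^sub>R euler g (\<tau> *\<^sub>R z)) + ((1/\<tau>) *\<^sub>R euler f (\<tau> *\<^sub>R z)) \<bullet> g (\<tau> *\<^sub>R z))"])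
    fix \<tau> z assume *: "\<tau> \<in> ?I" "z \<in> ?B"
    have "((\<lambda>\<tau>. f (\<tau> *\<^sub>R z) \<bullet> g (\<tau> *\<^sub>R z)) has_vector_derivative
       (f (\<tau> *\<^sub>R z) \<bullet> ((1/\<tau>) *\<^sub>R euler g (\<tau> *\<^sub>R z)) + ((1/\<tau>) *\<^sub>R euler f (\<tau> *\<^sub>R z)) \<bullet> g (\<tau> *\<^sub>R z))) (at \<tau> within ?I)"
      using bounded_bilinear.has_vector_derivative[OF bounded_bilinear_inner der[OF f *] der[OF g *]] .
    from has_vector_derivative_mult[OF has_vector_derivative_const[of "(bump z)\<^sup>2"] this]
    show "((\<lambda>\<tau>. (bump z)\<^sup>2 * (f (\<tau> *\<^sub>R z) \<bullet> g (\<tau> *\<^sub>R z))) has_vector_derivative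
       (bump z)\<^sup>2 * (f (\<tau> *\<^sub>R z) \<bullet> ((1/\<tau>) *\<^sub>R euler g (\<tau> *\<^sub>R z)) + ((1/\<tau>) *\<^sub>R euler f (\<tau> *\<^sub>R z)) \<bullet> g (\<tau> *\<^sub>R z))) (at \<tau> within ?I)"
      by simp
  next
    fix \<tau> assume "\<tau> \<in> ?I"
    then show "continuous_on ?B (\<lambda>z. (bump z)\<^sup>2 * (f (\<tau> *\<^sub>R z) \<bullet> g (\<tau> *\<^sub>R z)))"
      by (intro continuous_intros continuous_on_scaled[OF mean_value_on_continuous[OF f]]
            continuous_on_scaled[OF mean_value_on_continuous[OF g]]) auto
  next
    show "continuous_on (?I \<times> ?B) (\<lambda>(\<tau>, z). (bump z)\<^sup>2 * (f (\<tau> *\<^sub>R z) \<bullet> ((1/\<tau>) *\<^sub>R euler g (\<tau> *\<^sub>R z)) + ((1/\<tau>) *\<^sub>R euler f (\<tau> *\<^sub>R z)) \<bullet> g (\<tau> *\<^sub>R z)))"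
      unfolding split_beta
      by (intro continuous_on_mult continuous_on_power continuous_on_add continuous_on_inner continuous_on_scaleR
            continuous_on_divide continuous_on_const continuous_on_fst continuous_on_id cb
            cp[OF ce[OF f]] cp[OF ce[OF g]] cp[OF mean_value_on_continuous[OF f]] cp[OF mean_value_on_continuous[OF g]]) auto
  qed (use t in auto)
  have "integral ?B (\<lambda>z. (bump z)\<^sup>2 * (f (t *\<^sub>R z) \<bullet> ((1/t) *\<^sub>R euler g (t *\<^sub>R z)) + ((1/t) *\<^sub>R euler f (t *\<^sub>R z)) \<bullet> g (t *\<^sub>R z)))
     = integral ?B (\<lambda>z. (1/t) * ((bump z)\<^sup>2 * (euler f (t *\<^sub>R z) \<bullet> g (t *\<^sub>R z)) + (bump z)\<^sup>2 * (f (t *\<^sub>R z) \<bullet> euler g (t *\<^sub>R z))))"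
    by (rule integral_cong) (simp add: algebra_simps add_divide_distrib)
  also have "\<dots> = (pairing t (euler f) g + pairing t f (euler g)) / t"
    unfolding integral_mult_right pairing_def
    by (subst integral_add)
       (use t ce[OF f] ce[OF g] mean_value_on_continuous[OF f] mean_value_on_continuous[OF g] in \<open>auto intro!: pairing_integrable\<close>)
  finally have E: "integral ?B (\<lambda>z. (bump z)\<^sup>2 * (f (t *\<^sub>R z) \<bullet> ((1/t) *\<^sub>R euler g (t *\<^sub>R z)) + ((1/t) *\<^sub>R euler f (t *\<^sub>R z)) \<bullet> g (t *\<^sub>R z)))
     = (pairing t (euler f) g + pairing t f (euler g)) / t" .
  have at: "at t within ?I = at t" using t by (intro at_within_open) auto
  show ?thesis
    using D unfolding E at has_real_derivative_iff_has_vector_derivative pairing_def .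
qed

lemma pairing_continuous:
  fixes f g :: "'a::euclidean_space \<Rightarrow> 'b::euclidean_space"
  assumes "continuous_on (ball 0 R) f" "continuous_on (ball 0 R) g"
  shows "continuous_on {0..<R} (\<lambda>t. pairing t f g)"
  unfolding pairing_def
proof (rule continuous_on_integral_param)
  let ?U = "ball (0::'a) R" and ?B = "cball (0::'a) 1" and ?I = "{0..<R}"
  have cp: "continuous_on (?I \<times> ?B) (\<lambda>p. h (fst p *\<^sub>R snd p))" if "continuous_on ?U h" for h :: "'a \<Rightarrow> 'b"
  proof (rule continuous_on_compose2[OF that])
    show "(\<lambda>p. fst p *\<^sub>R snd p) ` (?I \<times> ?B) \<subseteq> ?U" using scaled_mem by fastforce
  qed (intro continuous_intros)
  have cb: "continuous_on (?I \<times> ?B) (\<lambda>p::real\<times>'a. bump (snd p))"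
    by (rule continuous_on_compose2[OF continuous_on_bump[of UNIV]]) (auto intro: continuous_intros)
  show "continuous_on (?I \<times> ?B) (\<lambda>(t, z). (bump z)\<^sup>2 * (f (t *\<^sub>R z) \<bullet> g (t *\<^sub>R z)))"
    unfolding split_beta
    by (intro continuous_on_mult continuous_on_power continuous_on_inner cb cp assms)
qed auto

lemma nonneg_derivative_imp_le:
  fixes f :: "real \<Rightarrow> real"
  assumes "a \<le> b" and "continuous_on {a..b} f"
    and "\<And>x. a < x \<Longrightarrow> x < b \<Longrightarrow> (f has_real_derivative f' x) (at x)"
    and "\<And>x. a < x \<Longrightarrow> x < b \<Longrightarrow> 0 \<le> f' x"
  shows "f a \<le> f b"
  using DERIV_nonneg_imp_increasing_open[OF assms(1) _ assms(2)] assms(3,4) by blast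

lemma nonpos_derivative_imp_ge:
  fixes f :: "real \<Rightarrow> real"
  assumes "a \<le> b" and "continuous_on {a..b} f"
    and "\<And>x. a < x \<Longrightarrow> x < b \<Longrightarrow> (f has_real_derivative f' x) (at x)"
    and "\<And>x. a < x \<Longrightarrow> x < b \<Longrightarrow> f' x \<le> 0"
  shows "f b \<le> f a"
proof -
  have "- f a \<le> - f b"
    by (rule nonneg_derivative_imp_le[where f' = "\<lambda>x. - f' x"])
       (use assms in \<open>auto intro: continuous_on_minus DERIV_minus\<close>)
  then show ?thesis by simp
qed

text \<open>
  The two summands of \<open>pairing_has_derivative\<close> coincide because the Euler operator is symmetric.
\<close>

lemma pairing_self_derivative:
  fixes f :: "'a::euclidean_space \<Rightarrow> 'b::euclidean_space"
  assumes "mean_value_on (ball 0 R) f" "0 < t" "t < R"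
  shows "((\<lambda>t. pairing t f f) has_real_derivative 2 * pairing t (euler f) f / t) (at t)"
  using pairing_has_derivative[OF assms(1,1,2,3)] pairing_commute[of t f "euler f"] by simp

lemma pairing_euler_derivative:
  fixes f :: "'a::euclidean_space \<Rightarrow> 'b::euclidean_space"
  assumes f: "mean_value_on (ball 0 R) f" and t: "0 < t" "t < R"
  shows "((\<lambda>t. pairing t (euler f) f) has_real_derivative 2 * pairing t (euler f) (euler f) / t) (at t)"
  using pairing_has_derivative[OF mean_value_on_euler[OF f] f t] euler_symmetric[OF mean_value_on_euler[OF f] f t]
  by simp

lemma pairing_continuous_sub:
  fixes f g :: "'a::euclidean_space \<Rightarrow> 'b::euclidean_space"
  assumes "mean_value_on (ball 0 R) f" "mean_value_on (ball 0 R) g" "0 \<le> a" "b < R"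
  shows "continuous_on {a..b} (\<lambda>t. pairing t f g)"
  by (rule continuous_on_subset[OF pairing_continuous[OF assms(1,2)[THEN mean_value_on_continuous]]])
     (use assms in auto)

text \<open>
  It vanishes at \<open>t = 0\<close> and its derivative is a square.
\<close>

lemma pairing_euler_nonneg:
  fixes f :: "'a::euclidean_space \<Rightarrow> 'b::euclidean_space"
  assumes f: "mean_value_on (ball 0 R) f" and t: "0 \<le> t" "t < R"
  shows "0 \<le> pairing t (euler f) f"
proof -
  have R: "R > 0" using t by simp
  have "euler f 0 = 0"
    unfolding euler_def using linear_0[OF has_derivative_linear[OF mean_value_has_fd[OF _ f]]] R by simp
  then have "pairing 0 (euler f) f = 0" by (simp add: pairing_def)
  moreover have "pairing 0 (euler f) f \<le> pairing t (euler f) f"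
  proof (rule nonneg_derivative_imp_le[OF t(1) pairing_continuous_sub[OF mean_value_on_euler[OF f] f _ t(2)]])
    fix x assume x: "0 < x" "x < t"
    show "((\<lambda>t. pairing t (euler f) f) has_real_derivative 2 * pairing x (euler f) (euler f) / x) (at x)"
      by (rule pairing_euler_derivative[OF f]) (use x t in auto)
    show "0 \<le> 2 * pairing x (euler f) (euler f) / x"
      using x pairing_self_nonneg[of x "euler f"] by simp
  qed simp
  ultimately show ?thesis by simp
qed

text \<open>
  By the quotient rule the derivative of the frequency is a positive multiple of
  \<open>pairing x (euler f) (euler f) * pairing x f f - (pairing x (euler f) f)\<^sup>2\<close>, which is nonnegative by
  the Cauchy-Schwarz inequality.
\<close>

lemma frequency_mono:
  fixes f :: "'a::euclidean_space \<Rightarrow> 'b::euclidean_space"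
  assumes f: "mean_value_on (ball 0 R) f" and st: "0 < s" "s \<le> t" "t < R"
    and pos: "\<And>x. s \<le> x \<Longrightarrow> x \<le> t \<Longrightarrow> 0 < pairing x f f"
  shows "pairing s (euler f) f / pairing s f f \<le> pairing t (euler f) f / pairing t f f"
proof (rule nonneg_derivative_imp_le[OF st(2)])
  have p: "pairing x f f \<noteq> 0" if "s \<le> x" "x \<le> t" for x using pos[OF that] by simp
  show "continuous_on {s..t} (\<lambda>x. pairing x (euler f) f / pairing x f f)"
    by (intro continuous_intros pairing_continuous_sub[OF mean_value_on_euler[OF f] f] pairing_continuous_sub[OF f f])
       (use st p in auto)
  fix x assume x: "s < x" "x < t"
  have xR: "0 < x" "x < R" using x st by auto
  let ?D = "pairing x (euler f) f" and ?H = "pairing x f f" and ?E = "pairing x (euler f) (euler f)"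
  have H: "?H > 0" using pos x by simp
  show "((\<lambda>x. pairing x (euler f) f / pairing x f f) has_real_derivative
     ((2 * ?E / x) * ?H - ?D * (2 * ?D / x)) / (?H * ?H)) (at x)"
    by (rule DERIV_divide[OF pairing_euler_derivative[OF f xR] pairing_self_derivative[OF f xR]]) (use H in simp)
  have "?D\<^sup>2 \<le> ?E * ?H"
    by (rule pairing_Cauchy_Schwarz[OF _ _ _ xR(2) H])
       (use mean_value_on_continuous[OF f] mean_value_on_continuous[OF mean_value_on_euler[OF f]] xR in auto)
  then have "0 \<le> (2 / x) * (?E * ?H - ?D\<^sup>2) / (?H * ?H)"
    using xR H by (intro divide_nonneg_nonneg mult_nonneg_nonneg) auto
  also have "\<dots> = ((2 * ?E / x) * ?H - ?D * (2 * ?D / x)) / (?H * ?H)"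
    using xR H by (simp add: power2_eq_square algebra_simps diff_divide_distrib)
  finally show "0 \<le> ((2 * ?E / x) * ?H - ?D * (2 * ?D / x)) / (?H * ?H)" .
qed

text \<open>
  A frequency at most \<open>N\<close> means that the logarithmic derivative of \<open>pairing t f f\<close> is at most
  \<open>2 * N / t\<close>.
\<close>

lemma pairing_growth_bound:
  fixes f :: "'a::euclidean_space \<Rightarrow> 'b::euclidean_space"
  assumes f: "mean_value_on (ball 0 R) f" and st: "0 < s" "s \<le> t" "t < R"
    and freq: "\<And>x. s < x \<Longrightarrow> x < t \<Longrightarrow> pairing x (euler f) f \<le> N * pairing x f f"
  shows "pairing t f f * t powr (-2 * N) \<le> pairing s f f * s powr (-2 * N)"
proof (rule nonpos_derivative_imp_ge[OF st(2)])
  show "continuous_on {s..t} (\<lambda>t. pairing t f f * t powr (-2 * N))"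
    by (intro continuous_intros pairing_continuous_sub[OF f f]) (use st in auto)
  fix x assume x: "s < x" "x < t"
  have xR: "0 < x" "x < R" using x st by auto
  show "((\<lambda>t. pairing t f f * t powr (-2 * N)) has_real_derivative
     2 * pairing x (euler f) f / x * x powr (-2 * N) + (-2 * N * x powr (-2 * N - 1)) * pairing x f f) (at x)"
    by (rule DERIV_mult[OF pairing_self_derivative[OF f xR] has_real_derivative_powr[OF xR(1)]])
  have "2 * pairing x (euler f) f / x * x powr (-2 * N) + (-2 * N * x powr (-2 * N - 1)) * pairing x f f
      = 2 * x powr (-2 * N) / x * (pairing x (euler f) f - N * pairing x f f)"
    using xR by (simp add: powr_diff field_simps)
  also have "\<dots> \<le> 0" using freq[OF x] xR by (intro mult_nonneg_nonpos) auto
  finally show "2 * pairing x (euler f) f / x * x powr (-2 * N) + (-2 * N * x powr (-2 * N - 1)) * pairing x f f \<le> 0" .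
qed

text \<open>
  Go down to the largest radius at which the pairing vanishes. Above it the frequency is bounded by
  monotonicity, and the growth bound forbids the pairing to reach zero.
\<close>

lemma pairing_unique_continuation:
  fixes f :: "'a::euclidean_space \<Rightarrow> 'b::euclidean_space"
  assumes f: "mean_value_on (ball 0 R) f" and t: "t1 < R" "pairing t1 f f > 0" and t0: "0 < t0" "t0 \<le> t1"
  shows "pairing t0 f f > 0"
proof (rule ccontr)
  assume "\<not> pairing t0 f f > 0"
  then have z0: "pairing t0 f f = 0" using pairing_self_nonneg[of t0 f] by simp
  define Z where "Z = {s \<in> {t0..t1}. pairing s f f = 0}"
  have "closed Z" unfolding Z_def
    by (rule continuous_closed_preimage_constant[OF pairing_continuous_sub[OF f f]]) (use t t0 in auto)
  moreover have "Z \<noteq> {}" "bdd_above Z" using z0 t0 by (auto simp: Z_def)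
  ultimately have "Sup Z \<in> Z" using closed_contains_Sup by blast
  define a where "a = Sup Z"
  have a: "t0 \<le> a" "a \<le> t1" "pairing a f f = 0" using \<open>Sup Z \<in> Z\<close> by (auto simp: a_def Z_def)
  have pos: "pairing s f f > 0" if "a < s" "s \<le> t1" for s
  proof (rule ccontr)
    assume "\<not> ?thesis"
    then have "s \<in> Z" using pairing_self_nonneg[of s f] that a by (auto simp: Z_def)
    then have "s \<le> a" unfolding a_def using cSup_upper \<open>bdd_above Z\<close> by blast
    then show False using that by simp
  qed
  define N where "N = pairing t1 (euler f) f / pairing t1 f f"
  have "pairing t1 f f * t1 powr (-2 * N) \<le> pairing a f f * a powr (-2 * N)"
  proof (rule pairing_growth_bound[OF f _ a(2) t(1)])
    fix x assume x: "a < x" "x < t1"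
    have "pairing x (euler f) f / pairing x f f \<le> N"
      unfolding N_def by (rule frequency_mono[OF f]) (use x a t t0 pos in auto)
    then show "pairing x (euler f) f \<le> N * pairing x f f"
      using pos[of x] x by (simp add: divide_simps)
  qed (use a t0 in auto)
  moreover have "pairing t1 f f * t1 powr (-2 * N) > 0" using t t0 by simp
  ultimately show False using a by simp
qed

lemma unique_continuation:
  fixes f :: "'a::euclidean_space \<Rightarrow> 'b::euclidean_space"
  assumes f: "mean_value_on (ball 0 R) f" and t: "0 < t" and zero: "\<And>x. x \<in> ball 0 t \<Longrightarrow> f x = 0" and x: "x \<in> ball 0 R"
  shows "f x = 0"
proof (rule ccontr)
  assume "f x \<noteq> 0"
  define t1 where "t1 = (norm x + R) / 2"
  have t1: "norm x < t1" "t1 < R" using x by (auto simp: t1_def)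
  have t1': "0 < t1" using t1 norm_ge_zero[of x] by linarith
  have H1: "pairing t1 f f > 0"
    by (rule pairing_pos[OF mean_value_on_continuous[OF f] t1' t1(2) t1(1) \<open>f x \<noteq> 0\<close>])
  define s where "s = min t1 (t / 2)"
  have s: "0 < s" "s \<le> t1" "s < t" using t t1' by (auto simp: s_def)
  have "pairing s f f > 0" by (rule pairing_unique_continuation[OF f t1(2) H1 s(1,2)])
  moreover have "pairing s f f = integral (cball 0 1) (\<lambda>z::'a. 0::real)"
    unfolding pairing_def
  proof (rule integral_cong)
    fix z :: 'a assume "z \<in> cball 0 1"
    then have "s *\<^sub>R z \<in> ball 0 t" by (rule scaled_mem[OF less_imp_le[OF s(1)] s(3)])
    then show "(bump z)\<^sup>2 * (f (s *\<^sub>R z) \<bullet> f (s *\<^sub>R z)) = 0" using zero by simp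
  qed
  ultimately show False by simp
qed

text \<open>
  Jensen's inequality for the weighted mean.
\<close>

lemma mean_square_bound:
  fixes f :: "'a::euclidean_space \<Rightarrow> 'b::euclidean_space"
  assumes mv: "mean_value_on U f" and t: "0 < t" and sub: "cball x t \<subseteq> U"
  shows "bump_mass TYPE('a) * (norm (f x))\<^sup>2 \<le> integral (cball 0 1) (\<lambda>z. (bump z)\<^sup>2 * (norm (f (x + t *\<^sub>R z)))\<^sup>2)"
proof -
  let ?B = "cball (0::'a) 1" and ?c = "bump_mass TYPE('a)"
  have cf: "continuous_on ?B (\<lambda>z. f (x + t *\<^sub>R z))"
    by (rule continuous_on_affine_cball[OF mean_value_on_continuous[OF mv] sub]) (use t in auto)
  have i1: "(\<lambda>z. (bump z)\<^sup>2 * (norm (f (x + t *\<^sub>R z)))\<^sup>2) integrable_on ?B"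
    by (intro integrable_on_compact compact_cball continuous_on_mult continuous_on_power continuous_on_bump continuous_on_norm cf)
  have i2: "(\<lambda>z. (bump z)\<^sup>2 *\<^sub>R f (x + t *\<^sub>R z)) integrable_on ?B"
    by (intro integrable_on_compact compact_cball continuous_on_scaleR continuous_on_power continuous_on_bump cf)
  have i3: "(\<lambda>z::'a. (bump z)\<^sup>2) integrable_on ?B"
    by (intro integrable_on_compact compact_cball continuous_on_power continuous_on_bump)
  have m: "integral ?B (\<lambda>z. ((bump z)\<^sup>2 *\<^sub>R f (x + t *\<^sub>R z)) \<bullet> f x) = ?c * (norm (f x))\<^sup>2"
    using integral_linear[OF i2 bounded_linear_inner_left[of "f x"]] mean_value_onD[OF mv t sub]
    by (simp add: o_def power2_norm_eq_inner)
  have i4: "(\<lambda>z. ((bump z)\<^sup>2 *\<^sub>R f (x + t *\<^sub>R z)) \<bullet> f x) integrable_on ?B"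
    using integrable_linear[OF i2 bounded_linear_inner_left[of "f x"]] by (simp add: o_def)
  have "0 \<le> integral ?B (\<lambda>z. (bump z)\<^sup>2 * (norm (f (x + t *\<^sub>R z) - f x))\<^sup>2)"
    by (rule integral_nonneg)
       (intro integrable_on_compact compact_cball continuous_on_mult continuous_on_power continuous_on_bump
          continuous_on_norm continuous_on_diff cf continuous_on_const, simp)
  also have "\<dots> = integral ?B (\<lambda>z. ((bump z)\<^sup>2 * (norm (f (x + t *\<^sub>R z)))\<^sup>2 - 2 * (((bump z)\<^sup>2 *\<^sub>R f (x + t *\<^sub>R z)) \<bullet> f x))
       + (bump z)\<^sup>2 * (norm (f x))\<^sup>2)"
  proof (rule integral_cong)
    fix z :: 'a
    have c: "f x \<bullet> f (x + t *\<^sub>R z) = f (x + t *\<^sub>R z) \<bullet> f x" by (rule inner_commute)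
    show "(bump z)\<^sup>2 * (norm (f (x + t *\<^sub>R z) - f x))\<^sup>2 = ((bump z)\<^sup>2 * (norm (f (x + t *\<^sub>R z)))\<^sup>2 - 2 * (((bump z)\<^sup>2 *\<^sub>R f (x + t *\<^sub>R z)) \<bullet> f x))
       + (bump z)\<^sup>2 * (norm (f x))\<^sup>2"
      by (simp add: power2_norm_eq_inner inner_diff_left inner_diff_right c algebra_simps)
  qed
  also have "\<dots> = (integral ?B (\<lambda>z. (bump z)\<^sup>2 * (norm (f (x + t *\<^sub>R z)))\<^sup>2) - 2 * integral ?B (\<lambda>z. ((bump z)\<^sup>2 *\<^sub>R f (x + t *\<^sub>R z)) \<bullet> f x))
     + integral ?B (\<lambda>z. (bump z)\<^sup>2) * (norm (f x))\<^sup>2"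
    by (intro integral_unique has_integral_add has_integral_diff has_integral_mult_right has_integral_mult_left integrable_integral i1 i4 i3)
  finally show ?thesis unfolding m bump_mass_def by (simp add: mult.commute)
qed

text \<open>
  Jensen's inequality on a ball of radius \<open>t\<close>, which lies in the ball of radius \<open>3 * t\<close> about the origin,
  where the kernel of the ball of radius \<open>4 * t\<close> is bounded below: \<open>1 \<le> 6 * (7/16)\<^sup>2\<close>.
\<close>

lemma norm_le_pairing:
  fixes f :: "'a::euclidean_space \<Rightarrow> 'b::euclidean_space"
  assumes f: "mean_value_on (ball 0 R) f" and t: "0 < t" "4 * t < R" and x: "norm x \<le> 2 * t"
  shows "(norm (f x))\<^sup>2 \<le> (6 * 4 ^ DIM('a) / bump_mass TYPE('a)) * pairing (4 * t) f f"
proof -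
  let ?B = "cball (0::'a) 1" and ?c = "bump_mass TYPE('a)" and ?q = "\<lambda>y. (norm (f y))\<^sup>2"
  have contf: "continuous_on (ball 0 R) f" by (rule mean_value_on_continuous[OF f])
  define \<xi> where "\<xi> = (1/t) *\<^sub>R x"
  have x\<xi>: "x = t *\<^sub>R \<xi>" using t by (simp add: \<xi>_def)
  have n\<xi>: "norm \<xi> \<le> 2" using x t by (simp add: \<xi>_def divide_simps)
  have sub: "cball x t \<subseteq> ball 0 R"
  proof
    fix y assume "y \<in> cball x t"
    then have "norm (y - x) \<le> t" by (simp add: dist_norm norm_minus_commute)
    then show "y \<in> ball 0 R" using norm_triangle_sub[of y x] x t by simp
  qed
  have cq: "continuous_on (cball 0 r) (\<lambda>z. ?q (s *\<^sub>R z))" if "0 \<le> s" "s * r < R" for r s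
  proof (intro continuous_on_power continuous_on_norm continuous_on_compose2[OF contf])
    show "(\<lambda>z::'a. s *\<^sub>R z) ` cball 0 r \<subseteq> ball 0 R"
    proof (rule image_subsetI)
      fix z :: 'a assume "z \<in> cball 0 r"
      then have "s * norm z \<le> s * r" using that by (intro mult_left_mono) auto
      then show "s *\<^sub>R z \<in> ball 0 R" using that by simp
    qed
  qed (intro continuous_intros)
  have cx: "continuous_on ?B (\<lambda>z. ?q (x + t *\<^sub>R z))"
    by (intro continuous_on_power continuous_on_norm continuous_on_affine_cball[OF contf sub]) (use t in auto)
  have "?c * ?q x \<le> integral ?B (\<lambda>z. (bump z)\<^sup>2 * ?q (x + t *\<^sub>R z))"
    by (rule mean_square_bound[OF f t(1) sub])
  also have "\<dots> \<le> integral ?B (\<lambda>z. ?q (x + t *\<^sub>R z))"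
  proof (rule integral_le)
    show "(\<lambda>z. (bump z)\<^sup>2 * ?q (x + t *\<^sub>R z)) integrable_on ?B" "(\<lambda>z. ?q (x + t *\<^sub>R z)) integrable_on ?B"
      by (intro integrable_on_compact compact_cball continuous_on_mult continuous_on_power continuous_on_bump cx[THEN continuous_on_subset, OF order_refl] cx)+
    show "(bump z)\<^sup>2 * ?q (x + t *\<^sub>R z) \<le> ?q (x + t *\<^sub>R z)" for z
      by (rule mult_left_le_one_le) (auto simp: power_le_one)
  qed
  also have "\<dots> = integral ?B (\<lambda>z. (\<lambda>y. ?q (t *\<^sub>R y)) (z + \<xi>))"
    by (simp add: x\<xi> algebra_simps)
  also have "\<dots> = integral (cball \<xi> 1) (\<lambda>y. ?q (t *\<^sub>R y))"
    by (rule integral_cball_shift[symmetric])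
  also have "\<dots> \<le> integral (cball 0 3) (\<lambda>y. ?q (t *\<^sub>R y))"
  proof (rule integral_subset_le)
    show s: "cball \<xi> 1 \<subseteq> cball 0 3"
    proof
      fix y assume "y \<in> cball \<xi> 1"
      then have "norm (y - \<xi>) \<le> 1" by (simp add: dist_norm norm_minus_commute)
      then show "y \<in> cball 0 3" using norm_triangle_sub[of y \<xi>] n\<xi> by simp
    qed
    have c3: "continuous_on (cball 0 3) (\<lambda>y. ?q (t *\<^sub>R y))" by (rule cq) (use t in auto)
    show "(\<lambda>y. ?q (t *\<^sub>R y)) integrable_on cball 0 3" by (rule integrable_on_compact[OF _ c3]) auto
    show "(\<lambda>y. ?q (t *\<^sub>R y)) integrable_on cball \<xi> 1"
      by (rule integrable_on_compact[OF _ continuous_on_subset[OF c3 s]]) auto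
  qed auto
  also have "\<dots> = 4 ^ DIM('a) * integral (cball 0 (3/4)) (\<lambda>z. ?q ((4 * t) *\<^sub>R z))"
  proof -
    have "continuous_on (cball 0 (4 * (3/4))) (\<lambda>y. ?q (t *\<^sub>R y))" by (rule cq) (use t in auto)
    from integral_cball_scale[OF _ this] show ?thesis by (simp add: mult.commute)
  qed
  also have "integral (cball 0 (3/4)) (\<lambda>z. ?q ((4 * t) *\<^sub>R z)) \<le> integral (cball 0 (3/4)) (\<lambda>z. 6 * ((bump z)\<^sup>2 * ?q ((4 * t) *\<^sub>R z)))"
  proof (rule integral_le)
    have c: "continuous_on (cball 0 (3/4)) (\<lambda>z. ?q ((4 * t) *\<^sub>R z))" by (rule cq) (use t in auto)
    show "(\<lambda>z. ?q ((4 * t) *\<^sub>R z)) integrable_on cball 0 (3/4)" by (rule integrable_on_compact[OF _ c]) auto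
    show "(\<lambda>z. 6 * ((bump z)\<^sup>2 * ?q ((4 * t) *\<^sub>R z))) integrable_on cball 0 (3/4)"
      by (intro integrable_on_compact compact_cball continuous_on_mult continuous_on_const c) (intro continuous_on_power continuous_on_bump)
    fix z :: 'a assume z: "z \<in> cball 0 (3/4)"
    then have "(norm z)\<^sup>2 \<le> (3/4)\<^sup>2" by (intro power_mono) auto
    then have "z \<bullet> z \<le> 9/16" by (simp add: power2_norm_eq_inner power_divide)
    then have "(7/16)\<^sup>2 \<le> (bump z)\<^sup>2" by (intro power_mono) (auto simp: bump_def)
    then have "1 \<le> 6 * (bump z)\<^sup>2" by (simp add: power_divide)
    then show "?q ((4 * t) *\<^sub>R z) \<le> 6 * ((bump z)\<^sup>2 * ?q ((4 * t) *\<^sub>R z))"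
      using mult_right_mono[of 1 "6 * (bump z)\<^sup>2" "?q ((4 * t) *\<^sub>R z)"] by simp
  qed
  also have "\<dots> \<le> integral ?B (\<lambda>z. 6 * ((bump z)\<^sup>2 * ?q ((4 * t) *\<^sub>R z)))"
  proof (rule integral_subset_le)
    have c: "continuous_on ?B (\<lambda>z. ?q ((4 * t) *\<^sub>R z))" by (rule cq) (use t in auto)
    have c2: "continuous_on ?B (\<lambda>z. 6 * ((bump z)\<^sup>2 * ?q ((4 * t) *\<^sub>R z)))"
      by (intro continuous_on_mult continuous_on_const c) (intro continuous_on_power continuous_on_bump)
    show s: "cball (0::'a) (3/4) \<subseteq> ?B" by auto
    show "(\<lambda>z. 6 * ((bump z)\<^sup>2 * ?q ((4 * t) *\<^sub>R z))) integrable_on ?B" by (rule integrable_on_compact[OF _ c2]) auto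
    show "(\<lambda>z. 6 * ((bump z)\<^sup>2 * ?q ((4 * t) *\<^sub>R z))) integrable_on cball 0 (3/4)"
      by (rule integrable_on_compact[OF _ continuous_on_subset[OF c2 s]]) auto
  qed auto
  also have "\<dots> = 6 * pairing (4 * t) f f"
    unfolding integral_mult_right pairing_def by (simp add: power2_norm_eq_inner)
  finally have "?c * ?q x \<le> 4 ^ DIM('a) * (6 * pairing (4 * t) f f)" by simp
  then show ?thesis using bump_mass_pos[where 'a='a] by (simp add: field_simps)
qed

section \<open>Homogeneous blow-up limits\<close>

lemma pairing_scaled:
  "pairing \<sigma> (\<lambda>z. c *\<^sub>R f (s *\<^sub>R z)) (\<lambda>z. c *\<^sub>R g (s *\<^sub>R z)) = c\<^sup>2 * pairing (s * \<sigma>) f g"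
proof -
  have "(\<lambda>z. (bump z)\<^sup>2 * ((c *\<^sub>R f (s *\<^sub>R \<sigma> *\<^sub>R z)) \<bullet> (c *\<^sub>R g (s *\<^sub>R \<sigma> *\<^sub>R z)))) =
     (\<lambda>z. c\<^sup>2 * ((bump z)\<^sup>2 * (f ((s * \<sigma>) *\<^sub>R z) \<bullet> g ((s * \<sigma>) *\<^sub>R z))))"
    by (simp add: power2_eq_square mult_ac)
  then show ?thesis unfolding pairing_def by simp
qed

lemma fd_scaled:
  fixes f :: "'a::euclidean_space \<Rightarrow> 'b::euclidean_space"
  assumes "(f has_derivative fd f (x0 + s *\<^sub>R z)) (at (x0 + s *\<^sub>R z))"
  shows "fd (\<lambda>z. c *\<^sub>R f (x0 + s *\<^sub>R z)) z = (\<lambda>v. (c * s) *\<^sub>R fd f (x0 + s *\<^sub>R z) v)"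
proof (rule has_derivative_imp_fd)
  have "((\<lambda>z. x0 + s *\<^sub>R z) has_derivative (\<lambda>v. s *\<^sub>R v)) (at z)" by (auto intro!: derivative_eq_intros)
  from has_derivative_scaleR_right[OF has_derivative_compose[OF this assms], of c]
  have "((\<lambda>z. c *\<^sub>R f (x0 + s *\<^sub>R z)) has_derivative (\<lambda>v. c *\<^sub>R fd f (x0 + s *\<^sub>R z) (s *\<^sub>R v))) (at z)" .
  moreover have "(\<lambda>v. c *\<^sub>R fd f (x0 + s *\<^sub>R z) (s *\<^sub>R v)) = (\<lambda>v. (c * s) *\<^sub>R fd f (x0 + s *\<^sub>R z) v)"
    using linear_cmul[OF has_derivative_linear[OF assms]] by simp
  ultimately show "((\<lambda>z. c *\<^sub>R f (x0 + s *\<^sub>R z)) has_derivative (\<lambda>v. (c * s) *\<^sub>R fd f (x0 + s *\<^sub>R z) v)) (at z)" by simp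
qed

lemma euler_scaled:
  fixes f :: "'a::euclidean_space \<Rightarrow> 'b::euclidean_space"
  assumes d: "(f has_derivative fd f (s *\<^sub>R z)) (at (s *\<^sub>R z))"
  shows "euler (\<lambda>z. c *\<^sub>R f (s *\<^sub>R z)) z = c *\<^sub>R euler f (s *\<^sub>R z)"
proof -
  have "(f has_derivative fd f (0 + s *\<^sub>R z)) (at (0 + s *\<^sub>R z))" using d by simp
  from fd_scaled[OF this, of c] have "fd (\<lambda>z. c *\<^sub>R f (s *\<^sub>R z)) z = (\<lambda>v. (c * s) *\<^sub>R fd f (s *\<^sub>R z) v)" by simp
  then show ?thesis
    unfolding euler_def using linear_cmul[OF has_derivative_linear[OF d], of s z] by simp
qed

lemma pairing_limit:
  fixes F G :: "nat \<Rightarrow> 'a::euclidean_space \<Rightarrow> 'b::euclidean_space"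
  assumes cF: "\<And>k. continuous_on (ball 0 R) (F k)" and cG: "\<And>k. continuous_on (ball 0 R) (G k)"
    and cP: "continuous_on (ball 0 R) P" and cQ: "continuous_on (ball 0 R) Q"
    and \<sigma>: "0 \<le> \<sigma>" "\<sigma> < R"
    and F: "uniform_limit (cball 0 \<sigma>) F P sequentially" and G: "uniform_limit (cball 0 \<sigma>) G Q sequentially"
  shows "(\<lambda>k. pairing \<sigma> (F k) (G k)) \<longlonglongrightarrow> pairing \<sigma> P Q"
  unfolding pairing_def
proof (rule integral_compact_uniform_limit)
  let ?B = "cball (0::'a) 1"
  show "continuous_on ?B (\<lambda>z. (bump z)\<^sup>2 * (F k (\<sigma> *\<^sub>R z) \<bullet> G k (\<sigma> *\<^sub>R z)))" for k
    by (intro continuous_on_mult continuous_on_power continuous_on_bump continuous_on_inner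
          continuous_on_scaled[OF cF \<sigma>] continuous_on_scaled[OF cG \<sigma>])
  have im: "(\<lambda>z. \<sigma> *\<^sub>R z) ` ?B \<subseteq> cball 0 \<sigma>"
    using affine_cball_mem[OF \<sigma>(1), of _ 0] by auto
  have bd: "bounded ((\<lambda>z. h (\<sigma> *\<^sub>R z)) ` ?B)" if "continuous_on (ball 0 R) h" for h :: "'a \<Rightarrow> 'b"
    by (intro compact_imp_bounded compact_continuous_image continuous_on_scaled[OF that \<sigma>] compact_cball)
  have u: "uniform_limit ?B (\<lambda>k z. F k (\<sigma> *\<^sub>R z) \<bullet> G k (\<sigma> *\<^sub>R z)) (\<lambda>z. P (\<sigma> *\<^sub>R z) \<bullet> Q (\<sigma> *\<^sub>R z)) sequentially"
    by (rule bounded_bilinear.bounded_uniform_limit[OF bounded_bilinear_inner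
          uniform_limit_compose_image[OF F im] uniform_limit_compose_image[OF G im] bd[OF cQ] bd[OF cP]])
  show "uniform_limit ?B (\<lambda>k z. (bump z)\<^sup>2 * (F k (\<sigma> *\<^sub>R z) \<bullet> G k (\<sigma> *\<^sub>R z))) (\<lambda>z. (bump z)\<^sup>2 * (P (\<sigma> *\<^sub>R z) \<bullet> Q (\<sigma> *\<^sub>R z))) sequentially"
  proof (rule bounded_bilinear.bounded_uniform_limit[OF bounded_bilinear_mult _ u])
    show "uniform_limit ?B (\<lambda>_ z. (bump z)\<^sup>2) (\<lambda>z. (bump z)\<^sup>2) sequentially"
      by (simp add: uniform_limit_iff)
    show "bounded ((\<lambda>z. P (\<sigma> *\<^sub>R z) \<bullet> Q (\<sigma> *\<^sub>R z)) ` ?B)"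
      by (intro compact_imp_bounded compact_continuous_image compact_cball continuous_on_inner
            continuous_on_scaled[OF cP \<sigma>] continuous_on_scaled[OF cQ \<sigma>])
    show "bounded ((\<lambda>z::'a. (bump z)\<^sup>2) ` ?B)"
      by (intro compact_imp_bounded compact_continuous_image compact_cball continuous_on_power continuous_on_bump)
  qed
qed auto

lemma euler_uniform_limit:
  fixes F :: "nat \<Rightarrow> 'a::euclidean_space \<Rightarrow> 'b::euclidean_space"
  assumes mv: "\<And>k. mean_value_on (ball 0 R) (F k)" and lim: "uniform_limit (ball 0 R) F P sequentially"
    and \<sigma>: "0 \<le> \<sigma>" "\<sigma> < R"
  shows "uniform_limit (cball 0 \<sigma>) (\<lambda>k. euler (F k)) (euler P) sequentially"
  unfolding uniform_limit_iff
proof (intro allI impI)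
  fix e :: real assume e: "e > 0"
  define d where "d = e / (\<sigma> + 1)"
  have d: "d > 0" "d * \<sigma> < e" using e \<sigma> by (auto simp: d_def field_simps)
  from mean_value_fd_uniform_limit[OF mv lim \<sigma>(2) d(1)]
  show "\<forall>\<^sub>F k in sequentially. \<forall>z\<in>cball 0 \<sigma>. dist (euler (F k) z) (euler P z) < e"
  proof (rule eventually_mono, intro ballI)
    fix k and z :: 'a assume *: "\<forall>x\<in>cball 0 \<sigma>. \<forall>v. norm (fd (F k) x v - fd P x v) \<le> d * norm v" "z \<in> cball 0 \<sigma>"
    then have "norm (fd (F k) z z - fd P z z) \<le> d * norm z" by blast
    also have "\<dots> \<le> d * \<sigma>" using *(2) d by (intro mult_left_mono) auto
    finally show "dist (euler (F k) z) (euler P z) < e" using d by (simp add: euler_def dist_norm)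
  qed
qed

text \<open>
  Along a ray, \<open>s powr (- m) *\<^sub>R P (s *\<^sub>R z)\<close> has derivative zero.
\<close>

lemma euler_eigen_homogeneous:
  fixes P :: "'a::euclidean_space \<Rightarrow> 'b::euclidean_space"
  assumes mv: "mean_value_on (ball 0 R) P" and eig: "\<And>z. z \<in> ball 0 R \<Longrightarrow> euler P z = m *\<^sub>R P z"
    and z: "z \<in> ball 0 R" and l: "0 < l" "l \<le> 1"
  shows "P (l *\<^sub>R z) = l powr m *\<^sub>R P z"
proof -
  let ?\<phi> = "\<lambda>s. s powr (- m) *\<^sub>R P (s *\<^sub>R z)"
  have "(?\<phi> has_vector_derivative 0) (at s within {0<..1})" if s: "s \<in> {0<..1}" for s
  proof -
    have sz: "s *\<^sub>R z \<in> ball 0 R"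
    proof -
      have "s * norm z \<le> norm z" using s by (simp add: mult_left_le_one_le)
      then show ?thesis using z s by simp
    qed
    note d = mean_value_has_fd[OF open_ball mv sz]
    have "((\<lambda>s. s *\<^sub>R z) has_derivative (\<lambda>h. h *\<^sub>R z)) (at s)" by (auto intro!: derivative_eq_intros)
    from has_derivative_compose[OF this d]
    have 1: "((\<lambda>s. P (s *\<^sub>R z)) has_derivative (\<lambda>h. fd P (s *\<^sub>R z) (h *\<^sub>R z))) (at s)" .
    have e: "s *\<^sub>R fd P (s *\<^sub>R z) z = m *\<^sub>R P (s *\<^sub>R z)"
      using eig[OF sz] linear_cmul[OF has_derivative_linear[OF d], of s z] by (simp add: euler_def)
    have "fd P (s *\<^sub>R z) z = (1 / s) *\<^sub>R (s *\<^sub>R fd P (s *\<^sub>R z) z)" using s by simp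
    then have e': "fd P (s *\<^sub>R z) z = (m / s) *\<^sub>R P (s *\<^sub>R z)" unfolding e by simp
    have "((\<lambda>s. P (s *\<^sub>R z)) has_vector_derivative (m / s) *\<^sub>R P (s *\<^sub>R z)) (at s)"
      using 1 unfolding has_vector_derivative_def e'[symmetric]
      using linear_cmul[OF has_derivative_linear[OF d]] by simp
    moreover have "((\<lambda>s. s powr (- m)) has_real_derivative (- m) * s powr (- m - 1)) (at s)"
      by (rule has_real_derivative_powr) (use s in auto)
    ultimately have "(?\<phi> has_vector_derivative s powr (- m) *\<^sub>R ((m / s) *\<^sub>R P (s *\<^sub>R z)) + ((- m) * s powr (- m - 1)) *\<^sub>R P (s *\<^sub>R z)) (at s)"
      by (rule has_vector_derivative_scaleR[rotated])
    moreover have "s powr (- m) * (m / s) + (- m) * s powr (- m - 1) = 0"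
      using s by (simp add: powr_diff field_simps)
    then have "s powr (- m) *\<^sub>R ((m / s) *\<^sub>R P (s *\<^sub>R z)) + ((- m) * s powr (- m - 1)) *\<^sub>R P (s *\<^sub>R z) = 0"
      unfolding scaleR_scaleR scaleR_left_distrib[symmetric] by simp
    ultimately show ?thesis by (metis has_vector_derivative_at_within)
  qed
  then obtain c where c: "\<And>s. s \<in> {0<..1} \<Longrightarrow> ?\<phi> s = c"
    by (rule has_vector_derivative_zero_constant[rotated]) auto
  have "?\<phi> l = ?\<phi> 1" using c[of l] c[of 1] l by simp
  then have "l powr m *\<^sub>R (l powr (- m) *\<^sub>R P (l *\<^sub>R z)) = l powr m *\<^sub>R P z" by simp
  moreover have "l powr m * l powr (- m) = 1" using l by (simp flip: powr_add)
  ultimately show ?thesis unfolding scaleR_scaleR by simp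
qed

text \<open>
  Rescale by the square root of \<open>H t = pairing t f f\<close>. The frequency \<open>N\<close> is monotone and
  nonnegative, hence has a limit \<open>m\<close> at radius \<open>0\<close>; the bound on \<open>N\<close> bounds the quotients of \<open>H\<close> at
  comparable radii, which makes the rescalings bounded and keeps their limit \<open>P\<close> from vanishing. The
  frequency of \<open>P\<close> is constantly \<open>m\<close>, so equality holds in the Cauchy-Schwarz inequality behind
  monotonicity, and \<open>P\<close> is an eigenfunction of the Euler operator.
\<close>

lemma blow_up:
  fixes f :: "'a::euclidean_space \<Rightarrow> 'b::euclidean_space"
  assumes f: "mean_value_on (ball 0 R) f" and x: "x \<in> ball 0 R" "f x \<noteq> 0"
  obtains \<tau> a P m where "\<And>k::nat. 0 < \<tau> k" "\<And>k. \<tau> k < R" "\<tau> \<longlonglongrightarrow> 0" "\<And>k. 0 < a k"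
    "mean_value_on (ball 0 1) P"
    "uniform_limit (ball 0 1) (\<lambda>k z. a k *\<^sub>R f (\<tau> k *\<^sub>R z)) P sequentially"
    "\<exists>z\<in>ball 0 1. P z \<noteq> 0" "0 \<le> m" "\<And>z. z \<in> ball 0 1 \<Longrightarrow> euler P z = m *\<^sub>R P z"
proof -
  have contf: "continuous_on (ball 0 R) f" by (rule mean_value_on_continuous[OF f])
  define H where "H t = pairing t f f" for t
  define D where "D t = pairing t (euler f) f" for t
  \<comment> \<open>a radius beyond \<open>x\<close>, so that the pairing sees that \<open>f x \<noteq> 0\<close>\<close>
  define t1 where "t1 = (norm x + R) / 2"
  have t1: "norm x < t1" "t1 < R" using x by (auto simp: t1_def)
  have t1': "0 < t1" using t1 norm_ge_zero[of x] by linarith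
  have H1: "H t1 > 0"
    unfolding H_def by (rule pairing_pos[OF contf t1' t1(2) t1(1) x(2)])
  have Hpos: "H t > 0" if "0 < t" "t \<le> t1" for t
    unfolding H_def by (rule pairing_unique_continuation[OF f t1(2) H1[unfolded H_def] that])
  define N where "N t = D t / H t" for t
  have Nmono: "N s \<le> N t" if "0 < s" "s \<le> t" "t \<le> t1" for s t
    unfolding N_def D_def H_def
    by (rule frequency_mono[OF f that(1,2)]) (use that t1 Hpos in \<open>auto simp: H_def\<close>)
  have Nnn: "0 \<le> N t" if "0 < t" "t \<le> t1" for t
    unfolding N_def D_def using pairing_euler_nonneg[OF f, of t] Hpos[OF that] that t1 by simp
  define m where "m = Inf (N ` {0<..t1})"
  have ne: "N ` {0<..t1} \<noteq> {}" using t1' by auto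
  have bdd: "bdd_below (N ` {0<..t1})" using Nnn by (auto intro: bdd_belowI[of _ 0])
  have m0: "0 \<le> m" unfolding m_def by (rule cInf_greatest[OF ne]) (use Nnn in auto)
  have mle: "m \<le> N t" if "0 < t" "t \<le> t1" for t
    unfolding m_def by (rule cInf_lower[OF _ bdd]) (use that in auto)
  have Nlim: "(\<lambda>k. N (y k)) \<longlonglongrightarrow> m" if y: "\<And>k. 0 < y k" "\<And>k. y k \<le> t1" "y \<longlonglongrightarrow> 0" for y :: "nat \<Rightarrow> real"
  proof (rule LIMSEQ_I)
    fix e :: real assume e: "e > 0"
    then have "m < m + e" by simp
    then obtain t where t: "t \<in> {0<..t1}" "N t < m + e"
      unfolding m_def using cInf_lessD[OF ne] by (metis (no_types, lifting) imageE)
    have "\<forall>\<^sub>F k in sequentially. y k < t" using order_tendstoD(2)[OF y(3), of t] t by simp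
    then obtain K where K: "\<And>k. k \<ge> K \<Longrightarrow> y k < t" unfolding eventually_sequentially by blast
    have "norm (N (y k) - m) < e" if "k \<ge> K" for k
      using Nmono[of "y k" t] mle[of "y k"] y(1,2)[of k] K[OF that] t by auto
    then show "\<exists>no. \<forall>k\<ge>no. norm (N (y k) - m) < e" by blast
  qed
  define N1 where "N1 = N t1"
  have decay: "H t * t powr (-2 * N1) \<le> H s * s powr (-2 * N1)" if "0 < s" "s \<le> t" "t \<le> t1" for s t
    unfolding H_def
  proof (rule pairing_growth_bound[OF f that(1,2)])
    fix y assume y: "s < y" "y < t"
    have "N y \<le> N1" unfolding N1_def using Nmono[of y t1] y that by auto
    then have "D y \<le> N1 * H y" using Hpos[of y] y that by (simp add: N_def divide_simps)
    then show "pairing y (euler f) f \<le> N1 * pairing y f f" by (simp add: D_def H_def)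
  qed (use that t1 in auto)
  \<comment> \<open>the factor \<open>4\<close> leaves room for \<open>norm_le_pairing\<close> on the ball of radius \<open>2 * s k\<close>\<close>
  define s where "s k = t1 / (4 * (real k + 1))" for k
  have s: "0 < s k" "4 * s k \<le> t1" for k
    using t1' by (auto simp: s_def divide_simps)
  have slim: "s \<longlonglongrightarrow> 0"
  proof -
    have "(\<lambda>k. (t1 / 4) * (1 / real (Suc k))) \<longlonglongrightarrow> (t1 / 4) * 0"
      by (intro tendsto_mult tendsto_const) (use LIMSEQ_inverse_real_of_nat in \<open>simp add: inverse_eq_divide\<close>)
    moreover have "(\<lambda>k. (t1 / 4) * (1 / real (Suc k))) = s" by (auto simp: s_def)
    ultimately show ?thesis by simp
  qed
  define c where "c k = 1 / sqrt (H (s k))" for k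
  have Hs: "H (s k) > 0" for k using Hpos[of "s k"] s[of k] by simp
  have c: "c k > 0" "(c k)\<^sup>2 = 1 / H (s k)" for k
    using Hs[of k] by (auto simp: c_def power_divide)
  define F where "F k z = c k *\<^sub>R f (s k *\<^sub>R z)" for k z
  have mem: "s k *\<^sub>R z \<in> ball 0 R" if "z \<in> ball 0 2" for k and z :: 'a
  proof -
    have "s k * norm z \<le> s k * 2" using s[of k] that by (intro mult_left_mono) auto
    then have "s k * norm z < R" using s[of k] t1 by linarith
    then show ?thesis using s[of k] by simp
  qed
  have mvF2: "mean_value_on (ball 0 2) (F k)" for k
    unfolding F_def [abs_def]
    using mean_value_on_scaleR[OF mean_value_on_affine[OF f s(1)[of k], of "ball 0 2" 0]] mem by simp
  define C where "C = 6 * 4 ^ DIM('a) / bump_mass TYPE('a)"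
  have C: "C \<ge> 0" unfolding C_def using bump_mass_pos[where 'a='a] by simp
  define M where "M = sqrt (C * 4 powr (2 * N1))"
  have bound: "norm (F k z) \<le> M" if "z \<in> ball 0 2" for k z
  proof -
    have "norm (s k *\<^sub>R z) \<le> 2 * s k"
      using that s[of k] mult_left_mono[of "norm z" 2 "s k"] by simp
    then have 1: "(norm (f (s k *\<^sub>R z)))\<^sup>2 \<le> C * H (4 * s k)"
      unfolding C_def H_def using s[of k] t1 by (intro norm_le_pairing[OF f]) auto
    have "H (4 * s k) * (4 * s k) powr (-2 * N1) \<le> H (s k) * s k powr (-2 * N1)"
      using decay[of "s k" "4 * s k"] s[of k] by simp
    then have "H (4 * s k) * 4 powr (-2 * N1) * s k powr (-2 * N1) \<le> H (s k) * s k powr (-2 * N1)"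
      using s[of k] by (simp add: powr_mult mult_ac)
    then have "H (4 * s k) * 4 powr (-2 * N1) \<le> H (s k)" using s(1)[of k] by simp
    then have 2: "H (4 * s k) \<le> H (s k) * 4 powr (2 * N1)" by (simp add: powr_minus divide_simps)
    have "(norm (F k z))\<^sup>2 = (c k)\<^sup>2 * (norm (f (s k *\<^sub>R z)))\<^sup>2" by (simp add: F_def power_mult_distrib)
    also have "\<dots> \<le> (c k)\<^sup>2 * (C * (H (s k) * 4 powr (2 * N1)))"
      using 1 mult_left_mono[OF 2 C] by (intro mult_left_mono) auto
    also have "\<dots> = C * 4 powr (2 * N1)" using Hs[of k] by (simp add: c)
    finally show ?thesis unfolding M_def by (rule real_le_rsqrt)
  qed
  obtain P r where r: "strict_mono (r :: nat \<Rightarrow> nat)" and mvP: "mean_value_on (ball 0 1) P"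
    and lim: "uniform_limit (ball 0 1) (\<lambda>k. F (r k)) P sequentially"
  proof (rule mean_value_compactness[of 2 F M 1, OF mvF2])
    show "norm (F n x) \<le> M" if "x \<in> ball 0 2" for n x using bound that .
  qed (simp, rule that)
  define \<tau> where "\<tau> k = s (r k)" for k
  define a where "a k = c (r k)" for k
  have \<tau>lim: "\<tau> \<longlonglongrightarrow> 0" unfolding \<tau>_def using LIMSEQ_subseq_LIMSEQ[OF slim r] by (simp add: o_def)
  have Feq: "F (r k) = (\<lambda>z. a k *\<^sub>R f (\<tau> k *\<^sub>R z))" for k by (simp add: F_def [abs_def] a_def \<tau>_def)
  have mvF: "mean_value_on (ball 0 1) (F k)" for k
    by (rule mean_value_on_subset[OF mvF2]) auto
  have contP: "continuous_on (ball 0 1) P" by (rule mean_value_on_continuous[OF mvP])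
  have contEP: "continuous_on (ball 0 1) (euler P)" by (rule mean_value_on_continuous[OF mean_value_on_euler[OF mvP]])
  have pFF: "pairing \<sigma> (F k) (F k) = H (s k * \<sigma>) / H (s k)" for \<sigma> k
    unfolding F_def [abs_def] pairing_scaled H_def[symmetric] c(2) by simp
  have pEF: "pairing \<sigma> (euler (F k)) (F k) = D (s k * \<sigma>) / H (s k)" if \<sigma>: "0 \<le> \<sigma>" "\<sigma> < 1" for \<sigma> k
  proof -
    have "pairing \<sigma> (euler (F k)) (F k) = pairing \<sigma> (\<lambda>z. c k *\<^sub>R euler f (s k *\<^sub>R z)) (F k)"
      unfolding pairing_def
    proof (rule integral_cong)
      fix z :: 'a assume "z \<in> cball 0 1"
      then have "\<sigma> *\<^sub>R z \<in> ball 0 2" using scaled_mem[of \<sigma> 1 z] \<sigma> by auto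
      from euler_scaled[OF mean_value_has_fd[OF open_ball f mem[OF this]], of "c k"]
      show "(bump z)\<^sup>2 * (euler (F k) (\<sigma> *\<^sub>R z) \<bullet> F k (\<sigma> *\<^sub>R z)) = (bump z)\<^sup>2 * ((c k *\<^sub>R euler f (s k *\<^sub>R \<sigma> *\<^sub>R z)) \<bullet> F k (\<sigma> *\<^sub>R z))"
        unfolding F_def [abs_def] by simp
    qed
    then show ?thesis unfolding F_def [abs_def] pairing_scaled D_def[symmetric] c(2) by simp
  qed
  have s\<sigma>: "0 < s k * \<sigma>" "s k * \<sigma> \<le> s k" "s k * \<sigma> \<le> t1" if "0 < \<sigma>" "\<sigma> < 1" for \<sigma> k
  proof -
    show "0 < s k * \<sigma>" using s[of k] that by simp
    show *: "s k * \<sigma> \<le> s k" using s[of k] that by (simp add: mult_left_le)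
    show "s k * \<sigma> \<le> t1" using * s[of k] by linarith
  qed
  have limFF: "(\<lambda>k. pairing \<sigma> (F (r k)) (F (r k))) \<longlonglongrightarrow> pairing \<sigma> P P" if \<sigma>: "0 < \<sigma>" "\<sigma> < 1" for \<sigma>
  proof (rule pairing_limit[where R = 1])
    have sub: "cball 0 \<sigma> \<subseteq> ball (0::'a) 1" using \<sigma> by auto
    show "uniform_limit (cball 0 \<sigma>) (\<lambda>k. F (r k)) P sequentially"
      using lim sub by (rule uniform_limit_on_subset)
    then show "uniform_limit (cball 0 \<sigma>) (\<lambda>k. F (r k)) P sequentially" .
  qed (use \<sigma> mean_value_on_continuous[OF mvF] contP in auto)
  have limEF: "(\<lambda>k. pairing \<sigma> (euler (F (r k))) (F (r k))) \<longlonglongrightarrow> pairing \<sigma> (euler P) P" if \<sigma>: "0 < \<sigma>" "\<sigma> < 1" for \<sigma>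
  proof (rule pairing_limit[where R = 1])
    have sub: "cball 0 \<sigma> \<subseteq> ball (0::'a) 1" using \<sigma> by auto
    show "uniform_limit (cball 0 \<sigma>) (\<lambda>k. F (r k)) P sequentially"
      using lim sub by (rule uniform_limit_on_subset)
    show "uniform_limit (cball 0 \<sigma>) (\<lambda>k. euler (F (r k))) (euler P) sequentially"
      by (rule euler_uniform_limit[OF mvF lim]) (use \<sigma> in auto)
  qed (use \<sigma> mean_value_on_continuous[OF mvF] mean_value_on_continuous[OF mean_value_on_euler[OF mvF]] contP contEP in auto)
  have EPP: "pairing \<sigma> (euler P) P = m * pairing \<sigma> P P" if \<sigma>: "0 < \<sigma>" "\<sigma> < 1" for \<sigma>
  proof -
    have eq: "pairing \<sigma> (euler (F (r k))) (F (r k)) = N (\<tau> k * \<sigma>) * pairing \<sigma> (F (r k)) (F (r k))" for k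
    proof -
      have "H (s (r k) * \<sigma>) > 0" using Hpos s\<sigma>[OF \<sigma>] by simp
      then show ?thesis using pEF[of \<sigma> "r k"] \<sigma> unfolding pFF N_def \<tau>_def by simp
    qed
    have "(\<lambda>k. N (\<tau> k * \<sigma>)) \<longlonglongrightarrow> m"
    proof (rule Nlim)
      show "(\<lambda>k. \<tau> k * \<sigma>) \<longlonglongrightarrow> 0" using tendsto_mult[OF \<tau>lim tendsto_const[of \<sigma>]] by simp
    qed (use s\<sigma>[OF \<sigma>] in \<open>auto simp: \<tau>_def\<close>)
    then have "(\<lambda>k. N (\<tau> k * \<sigma>) * pairing \<sigma> (F (r k)) (F (r k))) \<longlonglongrightarrow> m * pairing \<sigma> P P"
      by (rule tendsto_mult[OF _ limFF[OF \<sigma>]])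
    then show ?thesis using limEF[OF \<sigma>] unfolding eq using LIMSEQ_unique by blast
  qed
  have nz: "\<exists>z\<in>ball 0 1. P z \<noteq> 0"
  proof (rule ccontr)
    assume "\<not> ?thesis"
    then have z: "P z = 0" if "z \<in> ball 0 1" for z using that by blast
    have "pairing (1/2) P P = integral (cball 0 1) (\<lambda>z::'a. 0::real)"
      unfolding pairing_def
    proof (rule integral_cong)
      fix z :: 'a assume "z \<in> cball 0 1"
      then have "(1/2) *\<^sub>R z \<in> ball 0 1" by (intro scaled_mem) auto
      then show "(bump z)\<^sup>2 * (P ((1/2) *\<^sub>R z) \<bullet> P ((1/2) *\<^sub>R z)) = 0" using z by simp
    qed
    then have "pairing (1/2) P P = 0" by simp
    \<comment> \<open>the growth bound from radius \<open>s k / 2\<close> to \<open>s k\<close>, in the limit\<close>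
    moreover have "(1/2) powr (2 * N1) \<le> pairing (1/2) P P"
    proof (rule LIMSEQ_le_const[OF limFF])
      have "(1/2) powr (2 * N1) \<le> pairing (1/2) (F (r k)) (F (r k))" for k
      proof -
        let ?s = "s (r k)"
        have "H ?s * ?s powr (-2 * N1) \<le> H (?s * (1/2)) * (?s * (1/2)) powr (-2 * N1)"
          using decay[of "?s * (1/2)" ?s] s[of "r k"] by simp
        then have "H ?s * ?s powr (-2 * N1) \<le> H (?s * (1/2)) * (1/2) powr (-2 * N1) * ?s powr (-2 * N1)"
          using s[of "r k"] powr_mult[of ?s "1/2" "-2 * N1"] by (simp add: mult_ac)
        then have "H ?s \<le> H (?s * (1/2)) * (1/2) powr (-2 * N1)" using s(1)[of "r k"] by simp
        moreover have "(1/2) powr (-2 * N1) = 1 / (1/2) powr (2 * N1)"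
          using powr_minus_divide[of "1/2" "2 * N1"] by simp
        ultimately have "H ?s \<le> H (?s * (1/2)) / (1/2) powr (2 * N1)" by (simp only: mult_1_right times_divide_eq_right)
        moreover have "(0::real) < (1/2) powr (2 * N1)" by simp
        ultimately have "H ?s * (1/2) powr (2 * N1) \<le> H (?s * (1/2))" by (simp only: pos_le_divide_eq)
        then show ?thesis unfolding pFF using Hs[of "r k"] by (simp only: pos_le_divide_eq mult.commute)
      qed
      then show "\<exists>N. \<forall>n\<ge>N. (1/2) powr (2 * N1) \<le> pairing (1/2) (F (r n)) (F (r n))" by blast
    qed auto
    moreover have "(0::real) < (1/2) powr (2 * N1)" by simp
    ultimately show False by linarith
  qed
  have eig: "euler P z = m *\<^sub>R P z" if z: "z \<in> ball 0 1" for z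
  proof -
    define \<sigma> where "\<sigma> = (norm z + 1) / 2"
    have \<sigma>: "norm z < \<sigma>" "\<sigma> < 1" using z by (auto simp: \<sigma>_def)
    have \<sigma>0: "0 < \<sigma>" using \<sigma> norm_ge_zero[of z] by linarith
    have d1: "((\<lambda>t. pairing t (euler P) P) has_real_derivative 2 * pairing \<sigma> (euler P) (euler P) / \<sigma>) (at \<sigma>)"
      by (rule pairing_euler_derivative[OF mvP \<sigma>0 \<sigma>(2)])
    have "((\<lambda>t. m * pairing t P P) has_real_derivative m * (2 * pairing \<sigma> (euler P) P / \<sigma>)) (at \<sigma>)"
      by (rule DERIV_cmult[OF pairing_self_derivative[OF mvP \<sigma>0 \<sigma>(2)]])
    then have d2: "((\<lambda>t. pairing t (euler P) P) has_real_derivative m * (2 * pairing \<sigma> (euler P) P / \<sigma>)) (at \<sigma>)"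
      by (rule has_field_derivative_transform_within_open[where S = "{0<..<1}"]) (use \<sigma>0 \<sigma> EPP in auto)
    have EE: "pairing \<sigma> (euler P) (euler P) = m * pairing \<sigma> (euler P) P"
      using DERIV_unique[OF d1 d2] \<sigma>0 by (simp add: field_simps)
    have "pairing \<sigma> (\<lambda>x. 1 *\<^sub>R euler P x - m *\<^sub>R P x) (\<lambda>x. 1 *\<^sub>R euler P x - m *\<^sub>R P x) = 0"
      unfolding pairing_combine[OF contEP contP less_imp_le[OF \<sigma>0] \<sigma>(2)] EE EPP[OF \<sigma>0 \<sigma>(2)]
      by (simp add: power2_eq_square)
    then have "1 *\<^sub>R euler P z - m *\<^sub>R P z = 0"
      by (intro pairing_zero_imp[of 1 "\<lambda>x. 1 *\<^sub>R euler P x - m *\<^sub>R P x" \<sigma> z] \<sigma> \<sigma>0)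
         (intro continuous_on_diff continuous_on_scaleR continuous_on_const contP contEP)
    then show ?thesis by simp
  qed
  show ?thesis
  proof (rule that[of \<tau> a P m])
    show "0 < \<tau> k" "\<tau> k < R" for k using s[of "r k"] t1 by (auto simp: \<tau>_def)
    show "uniform_limit (ball 0 1) (\<lambda>k z. a k *\<^sub>R f (\<tau> k *\<^sub>R z)) P sequentially"
      using lim unfolding Feq .
  qed (use \<tau>lim c mvP nz m0 eig in \<open>auto simp: a_def\<close>)
qed

section \<open>Change of variables for an arbitrary finite index type\<close>

text \<open>
  The change of variables theorem for injective differentiable maps is stated for index types of class
  \<open>wellorder\<close>. A copy of the index type, ordered by an arbitrary enumeration, transports it to
  every finite index type.
\<close>

typedef 'a wo = "UNIV :: 'a set" morphisms un_wo mk_wo by auto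

lemmas wo_simps [simp] = un_wo_inverse mk_wo_inverse[OF UNIV_I]

lemma bij_mk_wo: "bij mk_wo"
  by (rule bijI'[where f = mk_wo]) (metis mk_wo_inverse UNIV_I, metis un_wo_inverse)

instance wo :: (finite) finite
proof
  have "(UNIV :: 'a wo set) = range mk_wo" using bij_mk_wo by (metis bij_is_surj)
  then show "finite (UNIV :: 'a wo set)" by (metis finite finite_imageI)
qed

definition wo_index :: "'a::finite \<Rightarrow> nat" where
  "wo_index = (SOME f. inj f)"

lemma inj_wo_index: "inj wo_index"
proof -
  have "\<exists>f :: 'a::finite \<Rightarrow> nat. inj f"
    using finite_imp_inj_to_nat_seg[OF finite[of "UNIV :: 'a set"]] by blast
  then show ?thesis unfolding wo_index_def by (rule someI_ex)
qed

instantiation wo :: (finite) wellorder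
begin

definition "x \<le> y \<longleftrightarrow> wo_index (un_wo x) \<le> wo_index (un_wo y)"
definition "x < y \<longleftrightarrow> wo_index (un_wo x) < wo_index (un_wo y)"

instance
proof
  fix P :: "'a wo \<Rightarrow> bool" and a
  assume "\<And>x. (\<And>y. y < x \<Longrightarrow> P y) \<Longrightarrow> P x"
  then show "P a"
    by (rule measure_induct_rule[where f = "\<lambda>x. wo_index (un_wo x)"]) (simp add: less_wo_def)
next
  fix x y :: "'a wo"
  assume "x \<le> y" "y \<le> x"
  then have "wo_index (un_wo x) = wo_index (un_wo y)" by (simp add: less_eq_wo_def)
  then have "un_wo x = un_wo y" by (rule injD[OF inj_wo_index])
  then show "x = y" by (simp add: un_wo_inject)
qed (auto simp: less_eq_wo_def less_wo_def)

end

definition to_wo :: "real ^ 'n \<Rightarrow> real ^ 'n wo" where "to_wo x = (\<chi> i. x $ un_wo i)"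
definition of_wo :: "real ^ 'n wo \<Rightarrow> real ^ 'n" where "of_wo y = (\<chi> i. y $ mk_wo i)"

lemma of_to_wo [simp]: "of_wo (to_wo x) = x" by (simp add: to_wo_def of_wo_def vec_eq_iff)

lemma to_of_wo [simp]: "to_wo (of_wo x) = x" by (simp add: to_wo_def of_wo_def vec_eq_iff)

lemma linear_to_wo: "linear (to_wo :: real ^ 'n::finite \<Rightarrow> _)"
  by (rule linearI) (auto simp: to_wo_def vec_eq_iff)

lemma linear_of_wo: "linear (of_wo :: real ^ 'n::finite wo \<Rightarrow> _)"
  by (rule linearI) (auto simp: of_wo_def vec_eq_iff)

lemma norm_to_wo [simp]: "norm (to_wo (x :: real ^ 'n::finite)) = norm x"
proof -
  have "(\<Sum>i\<in>UNIV. (x $ un_wo i)\<^sup>2) = (\<Sum>i\<in>UNIV. (x $ i)\<^sup>2)"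
    by (rule sum.reindex_bij_witness[of _ mk_wo un_wo]) auto
  then show ?thesis by (simp add: norm_vec_def L2_set_def to_wo_def)
qed

lemma norm_of_wo [simp]: "norm (of_wo (x :: real ^ 'n::finite wo)) = norm x"
  using norm_to_wo[of "of_wo x"] by simp

lemma to_wo_cbox: "to_wo ` cbox a b = cbox (to_wo a) (to_wo (b :: real ^ 'n::finite))"
proof
  show "to_wo ` cbox a b \<subseteq> cbox (to_wo a) (to_wo b)" by (auto simp: mem_box_cart to_wo_def)
  show "cbox (to_wo a) (to_wo b) \<subseteq> to_wo ` cbox a b"
  proof
    fix y assume y: "y \<in> cbox (to_wo a) (to_wo b)"
    have "of_wo y \<in> cbox a b"
      unfolding mem_box_cart
    proof
      fix i
      have "to_wo a $ mk_wo i \<le> y $ mk_wo i \<and> y $ mk_wo i \<le> to_wo b $ mk_wo i"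
        using y unfolding mem_box_cart by blast
      then show "a $ i \<le> of_wo y $ i \<and> of_wo y $ i \<le> b $ i" by (simp add: to_wo_def of_wo_def)
    qed
    then show "y \<in> to_wo ` cbox a b" by (metis image_eqI to_of_wo)
  qed
qed

lemma of_wo_cbox: "of_wo ` cbox a b = cbox (of_wo a) (of_wo (b :: real ^ 'n::finite wo))"
proof -
  have "of_wo ` cbox a b = of_wo ` to_wo ` cbox (of_wo a) (of_wo b)" by (simp add: to_wo_cbox)
  then show ?thesis by (simp add: image_image)
qed

lemma measure_to_wo_cbox: "measure lborel (to_wo ` cbox a b) = measure lborel (cbox a (b :: real ^ 'n::finite))"
proof (cases "cbox a b = {}")
  case False
  then have ne: "cbox (to_wo a) (to_wo b) \<noteq> {}" unfolding to_wo_cbox[symmetric] by simp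
  have "(\<Prod>i\<in>UNIV. to_wo b $ i - to_wo a $ i) = (\<Prod>i\<in>UNIV. b $ i - a $ i)"
    by (rule prod.reindex_bij_witness[of _ mk_wo un_wo]) (auto simp: to_wo_def)
  then show ?thesis unfolding to_wo_cbox using False ne by (simp add: content_cbox_cart)
qed simp

lemma has_integral_cbox_wo:
  fixes f :: "real ^ 'n::finite wo \<Rightarrow> real"
  assumes "(f has_integral i) (cbox a b)"
  shows "((\<lambda>x. f (to_wo x)) has_integral i) (cbox (of_wo a) (of_wo b))"
proof -
  have "((\<lambda>x. f (to_wo x)) has_integral (1 / 1) *\<^sub>R i) (of_wo ` cbox a b)"
  proof (rule has_integral_twiddle[OF _ _ _ _ _ _ _ assms])
    show "continuous (at x) to_wo" for x :: "real ^ 'n"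
      using linear_to_wo linear_conv_bounded_linear linear_continuous_at by blast
    show "\<exists>w z. to_wo ` cbox u v = cbox w z" for u v :: "real ^ 'n" using to_wo_cbox by blast
    show "\<exists>w z. of_wo ` cbox u v = cbox w z" for u v :: "real ^ 'n wo" using of_wo_cbox by blast
    show "measure lborel (to_wo ` cbox u v) = 1 * measure lborel (cbox u v)" for u v :: "real ^ 'n"
      by (simp add: measure_to_wo_cbox)
  qed auto
  then show ?thesis by (simp add: of_wo_cbox)
qed

lemma has_integral_wo:
  fixes f :: "real ^ 'n::finite wo \<Rightarrow> real"
  assumes "(f has_integral i) S"
  shows "((\<lambda>x. f (to_wo x)) has_integral i) (of_wo ` S)"
proof -
  have mem: "x \<in> of_wo ` S \<longleftrightarrow> to_wo x \<in> S" for x :: "real ^ 'n"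
    by (metis image_iff of_to_wo to_of_wo)
  let ?g = "\<lambda>x. if x \<in> S then f x else 0"
  have g: "?g integrable_on cbox a b" for a b using assms unfolding has_integral_alt' by blast
  have tr: "((\<lambda>x. if x \<in> of_wo ` S then f (to_wo x) else 0) has_integral integral (cbox (to_wo a) (to_wo b)) ?g) (cbox a b)"
    for a b :: "real ^ 'n"
    using has_integral_cbox_wo[OF integrable_integral[OF g], of "to_wo a" "to_wo b"] by (simp add: mem)
  show ?thesis
    unfolding has_integral_alt'
  proof (intro conjI allI impI)
    fix e :: real assume "e > 0"
    then obtain B where B: "B > 0" "\<And>a b. ball 0 B \<subseteq> cbox a b \<Longrightarrow> norm (integral (cbox a b) ?g - i) < e"
      using assms unfolding has_integral_alt' by blast
    have "norm (integral (cbox a b) (\<lambda>x. if x \<in> of_wo ` S then f (to_wo x) else 0) - i) < e"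
      if "ball 0 B \<subseteq> cbox a b" for a b :: "real ^ 'n"
    proof -
      have "ball 0 B \<subseteq> to_wo ` cbox a b"
      proof
        fix y :: "real ^ 'n wo" assume "y \<in> ball 0 B"
        then have "of_wo y \<in> cbox a b" using that by (auto simp: subset_iff)
        then show "y \<in> to_wo ` cbox a b" by (metis image_eqI to_of_wo)
      qed
      then show ?thesis unfolding integral_unique[OF tr] to_wo_cbox by (rule B(2))
    qed
    then show "\<exists>B>0. \<forall>a b. ball 0 B \<subseteq> cbox a b \<longrightarrow>
        norm (integral (cbox a b) (\<lambda>x. if x \<in> of_wo ` S then f (to_wo x) else 0) - i) < e"
      using B(1) by blast
  qed (use tr in blast)
qed

lemma has_integral_wo':
  fixes f :: "real ^ 'n::finite \<Rightarrow> real"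
  assumes "(f has_integral i) S"
  shows "((\<lambda>x. f (of_wo x)) has_integral i) (to_wo ` S)"
proof -
  have cb: "((\<lambda>x. f (of_wo x)) has_integral i) (cbox (to_wo a) (to_wo b))" if "(f has_integral i) (cbox a b)"
    for a b i and f :: "real ^ 'n \<Rightarrow> real"
  proof -
    have "((\<lambda>x. f (of_wo x)) has_integral (1 / 1) *\<^sub>R i) (to_wo ` cbox a b)"
    proof (rule has_integral_twiddle[OF _ _ _ _ _ _ _ that])
      show "continuous (at x) of_wo" for x :: "real ^ 'n wo"
        using linear_of_wo linear_conv_bounded_linear linear_continuous_at by blast
      show "\<exists>w z. to_wo ` cbox u v = cbox w z" for u v :: "real ^ 'n" using to_wo_cbox by blast
      show "\<exists>w z. of_wo ` cbox u v = cbox w z" for u v :: "real ^ 'n wo" using of_wo_cbox by blast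
      show "measure lborel (of_wo ` cbox u v) = 1 * measure lborel (cbox u v)" for u v :: "real ^ 'n wo"
        using measure_to_wo_cbox[of "of_wo u" "of_wo v"] by (simp add: to_wo_cbox of_wo_cbox)
    qed auto
    then show ?thesis by (simp add: to_wo_cbox)
  qed
  have mem: "x \<in> to_wo ` S \<longleftrightarrow> of_wo x \<in> S" for x :: "real ^ 'n wo"
    by (metis image_iff of_to_wo to_of_wo)
  let ?g = "\<lambda>x. if x \<in> S then f x else 0"
  have g: "?g integrable_on cbox a b" for a b using assms unfolding has_integral_alt' by blast
  have tr: "((\<lambda>x. if x \<in> to_wo ` S then f (of_wo x) else 0) has_integral integral (cbox (of_wo a) (of_wo b)) ?g) (cbox a b)"
    for a b :: "real ^ 'n wo"
    using cb[OF integrable_integral[OF g], of "of_wo a" "of_wo b"] by (simp add: mem)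
  show ?thesis
    unfolding has_integral_alt'
  proof (intro conjI allI impI)
    fix e :: real assume "e > 0"
    then obtain B where B: "B > 0" "\<And>a b. ball 0 B \<subseteq> cbox a b \<Longrightarrow> norm (integral (cbox a b) ?g - i) < e"
      using assms unfolding has_integral_alt' by blast
    have "norm (integral (cbox a b) (\<lambda>x. if x \<in> to_wo ` S then f (of_wo x) else 0) - i) < e"
      if "ball 0 B \<subseteq> cbox a b" for a b :: "real ^ 'n wo"
    proof -
      have "ball 0 B \<subseteq> of_wo ` cbox a b"
      proof
        fix y :: "real ^ 'n" assume "y \<in> ball 0 B"
        then have "to_wo y \<in> cbox a b" using that by (auto simp: subset_iff)
        then show "y \<in> of_wo ` cbox a b" by (metis image_eqI of_to_wo)
      qed
      then show ?thesis unfolding integral_unique[OF tr] of_wo_cbox by (rule B(2))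
    qed
    then show "\<exists>B>0. \<forall>a b. ball 0 B \<subseteq> cbox a b \<longrightarrow>
        norm (integral (cbox a b) (\<lambda>x. if x \<in> to_wo ` S then f (of_wo x) else 0) - i) < e"
      using B(1) by blast
  qed (use tr in blast)
qed

lemma to_wo_lmeasurable:
  fixes S :: "(real ^ 'n::finite) set"
  shows "to_wo ` S \<in> lmeasurable \<and> measure lebesgue (to_wo ` S) = m \<longleftrightarrow> S \<in> lmeasurable \<and> measure lebesgue S = m"
proof -
  have eq: "T \<in> lmeasurable \<and> measure lebesgue T = m \<longleftrightarrow> ((\<lambda>x. 1) has_integral m) T" for T :: "'b::euclidean_space set"
    by (auto simp: has_integral_iff lmeasurable_iff_integrable_on lmeasure_integral)
  have "((\<lambda>x. 1::real) has_integral m) S \<longleftrightarrow> ((\<lambda>x. 1) has_integral m) (to_wo ` S)"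
    using has_integral_wo'[of "\<lambda>_. 1" m S] has_integral_wo[of "\<lambda>_. 1" m "to_wo ` S"]
    by (auto simp: image_image)
  then show ?thesis unfolding eq by blast
qed

lemma det_wo:
  fixes A :: "real ^ 'n::finite ^ 'n"
  shows "det (\<chi> i j. A $ un_wo i $ un_wo j) = det A"
proof -
  let ?m = "map_permutation (UNIV :: 'n set) mk_wo"
  have inj: "inj mk_wo" and surj: "range mk_wo = UNIV" using bij_mk_wo by (auto simp: bij_def)
  have mp: "?m = (\<lambda>p x. if x \<in> UNIV then mk_wo (p (inv_into UNIV mk_wo x)) else x)"
    by (auto simp: fun_eq_iff map_permutation_def restrict_id_def surj)
  have bij: "bij_betw ?m {p. p permutes (UNIV :: 'n set)} {p. p permutes (UNIV :: 'n wo set)}"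
    unfolding mp by (rule bij_betw_permutations[OF bij_mk_wo])
  have "det (\<chi> i j. A $ un_wo i $ un_wo j) =
     (\<Sum>p\<in>{p. p permutes (UNIV :: 'n set)}. of_int (sign (?m p)) * (\<Prod>i\<in>UNIV. A $ un_wo i $ un_wo (?m p i)))"
    unfolding det_def using sum.reindex_bij_betw[OF bij, of "\<lambda>q. of_int (sign q) * (\<Prod>i\<in>UNIV. A $ un_wo i $ un_wo (q i))"]
    by simp
  also have "\<dots> = (\<Sum>p\<in>{p. p permutes (UNIV :: 'n set)}. of_int (sign p) * (\<Prod>i\<in>UNIV. A $ i $ p i))"
  proof (rule sum.cong[OF refl])
    fix p assume p: "p \<in> {p. p permutes (UNIV :: 'n set)}"
    have "sign (?m p) = sign p" by (rule sign_map_permutation[OF inj]) (use p in auto)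
    moreover have "(\<Prod>i\<in>UNIV. A $ un_wo i $ un_wo (?m p i)) = (\<Prod>i\<in>UNIV. A $ i $ p i)"
    proof (rule prod.reindex_bij_witness[of _ mk_wo un_wo])
      fix i :: "'n wo"
      have "?m p (mk_wo (un_wo i)) = mk_wo (p (un_wo i))" by (rule map_permutation_apply[OF inj]) simp
      then show "A $ un_wo i $ p (un_wo i) = A $ un_wo i $ un_wo (?m p i)" by simp
    qed auto
    ultimately show "of_int (sign (?m p)) * (\<Prod>i\<in>UNIV. A $ un_wo i $ un_wo (?m p i)) = of_int (sign p) * (\<Prod>i\<in>UNIV. A $ i $ p i)" by simp
  qed
  finally show ?thesis unfolding det_def .
qed

lemma matrix_wo:
  fixes L :: "real ^ 'n::finite \<Rightarrow> real ^ 'n"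
  shows "matrix (\<lambda>x. to_wo (L (of_wo x))) = (\<chi> i j. matrix L $ un_wo i $ un_wo j)"
proof -
  have "of_wo (axis j (1::real)) = axis (un_wo j) (1::real)" for j :: "'n wo"
    by (auto simp: of_wo_def axis_def vec_eq_iff)
  then show ?thesis by (simp add: matrix_def to_wo_def)
qed

text \<open>
  Conjugate by the isometry \<open>to_wo\<close>, which preserves integrals, measures and determinants.
\<close>

theorem has_measure_differentiable_image_finite:
  fixes f :: "real ^ 'n::finite \<Rightarrow> real ^ 'n"
  assumes S: "S \<in> sets lebesgue"
    and der: "\<And>x. x \<in> S \<Longrightarrow> (f has_derivative f' x) (at x within S)"
    and inj: "inj_on f S"
  shows "f ` S \<in> lmeasurable \<and> measure lebesgue (f ` S) = m
     \<longleftrightarrow> ((\<lambda>x. \<bar>det (matrix (f' x))\<bar>) has_integral m) S"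
proof -
  let ?f = "\<lambda>y. to_wo (f (of_wo y))" and ?S = "to_wo ` S"
  let ?f' = "\<lambda>y w. to_wo (f' (of_wo y) (of_wo w))"
  have bl: "bounded_linear (to_wo :: real ^ 'n \<Rightarrow> _)" "bounded_linear (of_wo :: real ^ 'n wo \<Rightarrow> _)"
    using linear_to_wo linear_of_wo linear_conv_bounded_linear by auto
  have mem: "y \<in> ?S \<longleftrightarrow> of_wo y \<in> S" for y by (metis image_iff of_to_wo to_of_wo)
  have S': "?S \<in> sets lebesgue"
  proof (rule differentiable_image_in_sets_lebesgue[OF S])
    show "to_wo differentiable_on S"
      using bl(1) by (simp add: linear_imp_differentiable_on linear_to_wo)
    have "CARD('n wo) = CARD('n)" using bij_mk_wo bij_betw_same_card by metis
    then show "DIM(real ^ 'n) \<le> DIM(real ^ 'n wo)" by simp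
  qed
  have der': "(?f has_derivative ?f' y) (at y within ?S)" if "y \<in> ?S" for y
  proof -
    have y: "of_wo y \<in> S" using that mem by blast
    have im: "of_wo ` ?S = S" by (simp add: image_image)
    have "(of_wo has_derivative of_wo) (at y within ?S)" by (rule bounded_linear_imp_has_derivative[OF bl(2)])
    from diff_chain_within[OF this] der[OF y]
    have "((f \<circ> of_wo) has_derivative (f' (of_wo y) \<circ> of_wo)) (at y within ?S)" unfolding im by simp
    from bounded_linear.has_derivative[OF bl(1) this]
    show ?thesis by (simp add: o_def)
  qed
  have inj': "inj_on ?f ?S"
  proof (rule inj_onI)
    fix x y assume *: "x \<in> ?S" "y \<in> ?S" "?f x = ?f y"
    then have "f (of_wo x) = f (of_wo y)" by (metis of_to_wo)
    then have "of_wo x = of_wo y" using inj * mem by (auto dest: inj_onD)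
    then show "x = y" by (metis to_of_wo)
  qed
  have "?f ` ?S = to_wo ` f ` S" by (simp add: image_image)
  then have 1: "f ` S \<in> lmeasurable \<and> measure lebesgue (f ` S) = m \<longleftrightarrow> ?f ` ?S \<in> lmeasurable \<and> measure lebesgue (?f ` ?S) = m"
    by (metis to_wo_lmeasurable)
  have 2: "?f ` ?S \<in> lmeasurable \<and> measure lebesgue (?f ` ?S) = m \<longleftrightarrow> ((\<lambda>x. \<bar>det (matrix (?f' x))\<bar>) has_integral m) ?S"
    by (rule has_measure_differentiable_image[OF S' der' inj'])
  have "det (matrix (?f' y)) = det (matrix (f' (of_wo y)))" for y
    unfolding matrix_wo det_wo ..
  then have 3: "((\<lambda>x. \<bar>det (matrix (?f' x))\<bar>) has_integral m) ?S \<longleftrightarrow> ((\<lambda>x. \<bar>det (matrix (f' (of_wo x)))\<bar>) has_integral m) ?S"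
    by simp
  have 4: "((\<lambda>x. \<bar>det (matrix (f' (of_wo x)))\<bar>) has_integral m) ?S \<longleftrightarrow> ((\<lambda>x. \<bar>det (matrix (f' x))\<bar>) has_integral m) S"
    using has_integral_wo'[of "\<lambda>x. \<bar>det (matrix (f' x))\<bar>" m S] has_integral_wo[of "\<lambda>x. \<bar>det (matrix (f' (of_wo x)))\<bar>" m ?S]
    by (auto simp: image_image)
  show ?thesis unfolding 1 2 3 4 ..
qed

section \<open>Limits of injective maps with bounded distortion\<close>

abbreviation jac :: "(real ^ 'n::finite \<Rightarrow> real ^ 'n) \<Rightarrow> real ^ 'n \<Rightarrow> real" where
  "jac f x \<equiv> det (matrix (fd f x))"

text \<open>
  On every compact set, \<open>f\<close> is arbitrarily \<open>C\<^sup>1\<close>-close to an injective map. Limits of injective maps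
  have this property, and unlike injectivity it passes to further limits; what remains of injectivity
  is the area inequality \<open>approx_injective_area\<close> and the use of \<open>stable_local_surjectivity\<close> in
  \<open>critical_point_imp_zero\<close>.
\<close>

definition approx_injective_on :: "(real ^ 'n::finite) set \<Rightarrow> (real ^ 'n \<Rightarrow> real ^ 'n) \<Rightarrow> bool" where
  "approx_injective_on U f \<longleftrightarrow> (\<forall>C \<epsilon>. compact C \<and> C \<subseteq> U \<and> 0 < \<epsilon> \<longrightarrow>
     (\<exists>g. inj_on g C \<and> (\<forall>x\<in>C. g differentiable (at x) \<and> norm (g x - f x) \<le> \<epsilon> \<and>
        (\<forall>v. norm (fd g x v - fd f x v) \<le> \<epsilon> * norm v))))"

definition distortion_on :: "real \<Rightarrow> (real ^ 'n::finite) set \<Rightarrow> (real ^ 'n \<Rightarrow> real ^ 'n) \<Rightarrow> bool" where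
  "distortion_on K U f \<longleftrightarrow> (\<forall>x\<in>U. \<forall>v. norm (fd f x v) ^ CARD('n) \<le> K * \<bar>jac f x\<bar> * norm v ^ CARD('n))"

lemma continuous_on_det:
  fixes A :: "'a::topological_space \<Rightarrow> real ^ 'n::finite ^ 'n"
  assumes "continuous_on S A"
  shows "continuous_on S (\<lambda>x. det (A x))"
  unfolding det_def by (intro continuous_intros assms)

lemma continuous_on_matrix_fd:
  assumes "\<And>v. continuous_on S (\<lambda>x. fd f x v)"
  shows "continuous_on S (\<lambda>x. matrix (fd f x :: real ^ 'n::finite \<Rightarrow> real ^ 'n))"
  unfolding matrix_def by (intro continuous_intros assms)

lemma norm_matrix_diff_le:
  fixes L L' :: "real ^ 'n::finite \<Rightarrow> real ^ 'n"
  assumes "\<And>v. norm (L v - L' v) \<le> \<epsilon> * norm v"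
  shows "norm (matrix L - matrix L') \<le> (real (CARD('n)))\<^sup>2 * \<epsilon>"
proof -
  have "norm (matrix L - matrix L') \<le> (\<Sum>i\<in>UNIV. norm ((matrix L - matrix L') $ i))"
    unfolding norm_vec_def[of "matrix L - matrix L'"] by (rule L2_set_le_sum) simp
  also have "\<dots> \<le> (\<Sum>i\<in>(UNIV::'n set). real (CARD('n)) * \<epsilon>)"
  proof (rule sum_mono)
    fix i
    have "norm ((matrix L - matrix L') $ i) \<le> (\<Sum>j\<in>UNIV. \<bar>(matrix L - matrix L') $ i $ j\<bar>)"
      by (rule norm_le_l1_cart)
    also have "\<dots> \<le> (\<Sum>j\<in>(UNIV::'n set). \<epsilon>)"
    proof (rule sum_mono)
      fix j
      have "\<bar>(matrix L - matrix L') $ i $ j\<bar> = \<bar>(L (axis j 1) - L' (axis j 1)) $ i\<bar>"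
        by (simp add: matrix_def)
      also have "\<dots> \<le> norm (L (axis j 1) - L' (axis j 1))" by (rule component_le_norm_cart)
      also have "\<dots> \<le> \<epsilon>" using assms[of "axis j 1"] by simp
      finally show "\<bar>(matrix L - matrix L') $ i $ j\<bar> \<le> \<epsilon>" .
    qed
    finally show "norm ((matrix L - matrix L') $ i) \<le> real (CARD('n)) * \<epsilon>" by simp
  qed
  finally show ?thesis by (simp add: power2_eq_square mult.assoc)
qed

lemma det_uniformly_close:
  fixes f :: "real ^ 'n::finite \<Rightarrow> real ^ 'n"
  assumes C: "compact C" and cont: "\<And>v. continuous_on C (\<lambda>x. fd f x v)" and \<eta>: "\<eta> > 0"
  obtains \<epsilon> where "\<epsilon> > 0" "\<And>x L. x \<in> C \<Longrightarrow> (\<And>v. norm (L v - fd f x v) \<le> \<epsilon> * norm v) \<Longrightarrow> \<bar>det (matrix L) - jac f x\<bar> \<le> \<eta>"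
proof -
  let ?A = "\<lambda>x. matrix (fd f x)"
  have "bounded (?A ` C)"
    by (intro compact_imp_bounded compact_continuous_image continuous_on_matrix_fd cont C)
  then obtain R where R: "\<And>x. x \<in> C \<Longrightarrow> norm (?A x) \<le> R" by (auto simp: bounded_iff)
  have "uniformly_continuous_on (cball 0 (R + 1)) (det :: real ^ 'n ^ 'n \<Rightarrow> real)"
    by (intro compact_uniformly_continuous continuous_on_det[where A = "\<lambda>x. x", simplified]) (auto intro: continuous_on_id)
  then obtain d where d: "d > 0" "\<And>A B :: real ^ 'n ^ 'n. A \<in> cball 0 (R + 1) \<Longrightarrow> B \<in> cball 0 (R + 1) \<Longrightarrow> dist B A < d \<Longrightarrow> dist (det B) (det A) < \<eta>"
    unfolding uniformly_continuous_on_def using \<eta> by metis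
  define \<epsilon> where "\<epsilon> = min 1 d / (2 * (real (CARD('n)))\<^sup>2)"
  have n0: "real (CARD('n)) > 0" by simp
  have \<epsilon>: "\<epsilon> > 0" using d n0 by (simp add: \<epsilon>_def)
  show ?thesis
  proof (rule that[OF \<epsilon>])
    fix x and L :: "real ^ 'n \<Rightarrow> real ^ 'n" assume x: "x \<in> C" and L: "\<And>v. norm (L v - fd f x v) \<le> \<epsilon> * norm v"
    have "norm (matrix L - ?A x) \<le> (real (CARD('n)))\<^sup>2 * \<epsilon>" by (rule norm_matrix_diff_le[OF L])
    also have "\<dots> = min 1 d / 2" using n0 by (simp add: \<epsilon>_def field_simps)
    finally have 1: "norm (matrix L - ?A x) \<le> min 1 d / 2" .
    then have "norm (matrix L) \<le> R + 1" using R[OF x] norm_triangle_sub[of "matrix L" "?A x"] by (simp add: min_def split: if_splits)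
    moreover have "dist (matrix L) (?A x) < d" using 1 d by (simp add: dist_norm min_def split: if_splits)
    ultimately have "dist (det (matrix L)) (det (?A x)) < \<eta>" using d(2)[of "?A x" "matrix L"] R[OF x] by simp
    then show "\<bar>det (matrix L) - jac f x\<bar> \<le> \<eta>" by (simp add: dist_real_def)
  qed
qed

text \<open>
  Equality holds for the injective approximations; their images lie in any given neighbourhood of the
  compact image of \<open>f\<close>, and their Jacobians are uniformly close to that of \<open>f\<close>.
\<close>

lemma approx_injective_area:
  fixes f :: "real ^ 'n::finite \<Rightarrow> real ^ 'n"
  assumes app: "approx_injective_on U f" and C: "compact C" "C \<subseteq> U"
    and contf: "continuous_on C f" and cont: "\<And>v. continuous_on C (\<lambda>x. fd f x v)"
  shows "integral C (\<lambda>x. \<bar>jac f x\<bar>) \<le> measure lebesgue (f ` C)"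
proof (rule field_le_epsilon)
  fix e :: real assume e: "e > 0"
  define V where "V = measure lebesgue C"
  have Cl: "C \<in> lmeasurable" by (rule lmeasurable_compact[OF C(1)])
  have V: "V \<ge> 0" by (simp add: V_def)
  define \<eta> where "\<eta> = e / (2 * (V + 1))"
  have \<eta>: "\<eta> > 0" using e V by (simp add: \<eta>_def add_nonneg_pos)
  obtain \<epsilon>1 where \<epsilon>1: "\<epsilon>1 > 0" "\<And>x L. x \<in> C \<Longrightarrow> (\<And>v. norm (L v - fd f x v) \<le> \<epsilon>1 * norm v) \<Longrightarrow> \<bar>det (matrix L) - jac f x\<bar> \<le> \<eta>"
    using det_uniformly_close[OF C(1) cont \<eta>] by metis
  have cfC: "compact (f ` C)" by (rule compact_continuous_image[OF contf C(1)])
  have fC: "f ` C \<in> lmeasurable" by (rule lmeasurable_compact[OF cfC])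
  obtain T where T: "open T" "f ` C \<subseteq> T" "T - f ` C \<in> lmeasurable" "emeasure lebesgue (T - f ` C) < ennreal (e / 2)"
    using sets_lebesgue_outer_open[of "f ` C" "e / 2"] fC e by (auto simp: fmeasurableD)
  have mT: "measure lebesgue (T - f ` C) \<le> e / 2"
  proof -
    have "ennreal (measure lebesgue (T - f ` C)) < ennreal (e / 2)"
      using T(3,4) by (simp add: emeasure_eq_measure2)
    then show ?thesis using e by (simp add: ennreal_less_iff)
  qed
  have Teq: "T = f ` C \<union> (T - f ` C)" using T(2) by blast
  have Tl: "T \<in> lmeasurable" using fmeasurable.Un[OF fC T(3)] Teq by simp
  have mT': "measure lebesgue T \<le> measure lebesgue (f ` C) + e / 2"
    using measure_Un_le[of "f ` C" lebesgue "T - f ` C"] fC T(3) mT Teq by (simp add: fmeasurableD)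
  obtain \<epsilon>2 where \<epsilon>2: "\<epsilon>2 > 0" "(\<Union>x\<in>f ` C. ball x \<epsilon>2) \<subseteq> T"
    using compact_subset_open_imp_ball_epsilon_subset[OF cfC T(1,2)] by blast
  define \<epsilon> where "\<epsilon> = min \<epsilon>1 (\<epsilon>2 / 2)"
  have \<epsilon>: "\<epsilon> > 0" "\<epsilon> \<le> \<epsilon>1" "\<epsilon> < \<epsilon>2" using \<epsilon>1 \<epsilon>2 by (auto simp: \<epsilon>_def)
  obtain g where g: "inj_on g C" "\<And>x. x \<in> C \<Longrightarrow> g differentiable (at x)" "\<And>x. x \<in> C \<Longrightarrow> norm (g x - f x) \<le> \<epsilon>"
     "\<And>x v. x \<in> C \<Longrightarrow> norm (fd g x v - fd f x v) \<le> \<epsilon> * norm v"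
    using app C \<epsilon> unfolding approx_injective_on_def by metis
  have gd: "(g has_derivative fd g x) (at x within C)" if "x \<in> C" for x
    using g(2)[OF that] frechet_derivative_works has_derivative_at_withinI by blast
  have contg: "continuous_on C g" by (rule has_derivative_continuous_on[OF gd])
  have gC: "g ` C \<in> lmeasurable" by (rule lmeasurable_compact[OF compact_continuous_image[OF contg C(1)]])
  have hi: "((\<lambda>x. \<bar>jac g x\<bar>) has_integral measure lebesgue (g ` C)) C"
    using has_measure_differentiable_image_finite[OF fmeasurableD[OF Cl] gd g(1), of "measure lebesgue (g ` C)"] gC by blast
  have i1: "((\<lambda>x::real^'n. \<eta>) has_integral V * \<eta>) C"
  proof -
    have "((\<lambda>x::real^'n. 1::real) has_integral V) C"
      using Cl by (simp add: V_def has_integral_iff lmeasurable_iff_integrable_on lmeasure_integral)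
    from has_integral_mult_left[OF this, of \<eta>] show ?thesis by simp
  qed
  have "integral C (\<lambda>x. \<bar>jac f x\<bar>) \<le> integral C (\<lambda>x. \<bar>jac g x\<bar> + \<eta>)"
  proof (rule integral_le)
    show "(\<lambda>x. \<bar>jac f x\<bar>) integrable_on C"
      by (intro integrable_on_compact C continuous_on_rabs continuous_on_det continuous_on_matrix_fd cont)
    show "(\<lambda>x. \<bar>jac g x\<bar> + \<eta>) integrable_on C"
      using has_integral_add[OF hi i1] by blast
    fix x assume x: "x \<in> C"
    have "\<bar>det (matrix (fd g x)) - jac f x\<bar> \<le> \<eta>"
    proof (rule \<epsilon>1(2)[OF x])
      fix v
      have "norm (fd g x v - fd f x v) \<le> \<epsilon> * norm v" by (rule g(4)[OF x])
      also have "\<dots> \<le> \<epsilon>1 * norm v" using \<epsilon> by (intro mult_right_mono) auto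
      finally show "norm (fd g x v - fd f x v) \<le> \<epsilon>1 * norm v" .
    qed
    then show "\<bar>jac f x\<bar> \<le> \<bar>jac g x\<bar> + \<eta>" by linarith
  qed
  also have "\<dots> = measure lebesgue (g ` C) + V * \<eta>" by (rule integral_unique[OF has_integral_add[OF hi i1]])
  also have "measure lebesgue (g ` C) \<le> measure lebesgue T"
  proof (rule measure_mono_fmeasurable[OF _ fmeasurableD[OF gC] Tl])
    show "g ` C \<subseteq> T"
    proof
      fix y assume "y \<in> g ` C"
      then obtain x where x: "x \<in> C" "y = g x" by blast
      then have "y \<in> ball (f x) \<epsilon>2" using g(3)[OF x(1)] \<epsilon> by (simp add: dist_norm norm_minus_commute)
      then show "y \<in> T" using \<epsilon>2(2) x by blast
    qed
  qed
  also have "V * \<eta> \<le> e / 2" using V e by (simp add: \<eta>_def divide_simps add_nonneg_pos)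
  finally show "integral C (\<lambda>x. \<bar>jac f x\<bar>) \<le> measure lebesgue (f ` C) + e" using mT' by simp
qed

lemma approx_injective_on_inj:
  assumes "inj_on f U" "\<And>x. x \<in> U \<Longrightarrow> f differentiable (at x)"
  shows "approx_injective_on U f"
  unfolding approx_injective_on_def
proof (intro allI impI, elim conjE)
  fix C and \<epsilon> :: real assume "C \<subseteq> U" "0 < \<epsilon>"
  then show "\<exists>g. inj_on g C \<and> (\<forall>x\<in>C. g differentiable (at x) \<and> norm (g x - f x) \<le> \<epsilon> \<and> (\<forall>v. norm (fd g x v - fd f x v) \<le> \<epsilon> * norm v))"
    using assms by (intro exI[of _ f]) (auto intro: inj_on_subset)
qed

lemma approx_injective_on_limit:
  fixes F :: "nat \<Rightarrow> real ^ 'n::finite \<Rightarrow> real ^ 'n"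
  assumes app: "\<And>k. approx_injective_on U (F k)"
    and lim: "\<And>C \<epsilon>. compact C \<Longrightarrow> C \<subseteq> U \<Longrightarrow> \<epsilon> > 0 \<Longrightarrow>
       \<exists>k. \<forall>x\<in>C. norm (F k x - P x) \<le> \<epsilon> \<and> (\<forall>v. norm (fd (F k) x v - fd P x v) \<le> \<epsilon> * norm v)"
  shows "approx_injective_on U P"
  unfolding approx_injective_on_def
proof (intro allI impI, elim conjE)
  fix C and \<epsilon> :: real assume C: "compact C" "C \<subseteq> U" and \<epsilon>: "0 < \<epsilon>"
  obtain k where k: "\<And>x. x \<in> C \<Longrightarrow> norm (F k x - P x) \<le> \<epsilon> / 2" "\<And>x v. x \<in> C \<Longrightarrow> norm (fd (F k) x v - fd P x v) \<le> \<epsilon> / 2 * norm v"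
    using lim[OF C, of "\<epsilon> / 2"] \<epsilon> by auto
  obtain g where g: "inj_on g C" "\<And>x. x \<in> C \<Longrightarrow> g differentiable (at x)" "\<And>x. x \<in> C \<Longrightarrow> norm (g x - F k x) \<le> \<epsilon> / 2"
     "\<And>x v. x \<in> C \<Longrightarrow> norm (fd g x v - fd (F k) x v) \<le> \<epsilon> / 2 * norm v"
    using app[of k] C \<epsilon> unfolding approx_injective_on_def by (metis half_gt_zero)
  show "\<exists>g. inj_on g C \<and> (\<forall>x\<in>C. g differentiable (at x) \<and> norm (g x - P x) \<le> \<epsilon> \<and> (\<forall>v. norm (fd g x v - fd P x v) \<le> \<epsilon> * norm v))"
  proof (intro exI[of _ g] conjI ballI allI g(1,2))
    fix x v assume x: "x \<in> C"
    show "norm (g x - P x) \<le> \<epsilon>"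
      using norm_triangle_ineq[of "g x - F k x" "F k x - P x"] g(3)[OF x] k(1)[OF x] by simp
    have "norm (fd g x v - fd P x v) \<le> \<epsilon> / 2 * norm v + \<epsilon> / 2 * norm v"
      using norm_triangle_ineq[of "fd g x v - fd (F k) x v" "fd (F k) x v - fd P x v"] g(4)[OF x, of v] k(2)[OF x, of v] by simp
    then show "norm (fd g x v - fd P x v) \<le> \<epsilon> * norm v" by simp
  qed
qed

lemma approx_injective_on_affine:
  fixes f :: "real ^ 'n::finite \<Rightarrow> real ^ 'n"
  assumes app: "approx_injective_on U f" and d: "\<And>x. x \<in> U \<Longrightarrow> f differentiable (at x)"
    and s: "0 < s" and a: "0 < a" and sub: "\<And>z. z \<in> V \<Longrightarrow> x0 + s *\<^sub>R z \<in> U"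
  shows "approx_injective_on V (\<lambda>z. a *\<^sub>R f (x0 + s *\<^sub>R z))"
  unfolding approx_injective_on_def
proof (intro allI impI, elim conjE)
  fix C and \<epsilon> :: real assume C: "compact C" "C \<subseteq> V" and \<epsilon>: "0 < \<epsilon>"
  let ?T = "\<lambda>z. x0 + s *\<^sub>R z"
  have C': "compact (?T ` C)" "?T ` C \<subseteq> U"
    using C sub by (auto intro!: compact_continuous_image continuous_intros)
  define \<epsilon>' where "\<epsilon>' = \<epsilon> / (a * (1 + s))"
  have \<epsilon>': "\<epsilon>' > 0" using \<epsilon> a s by (simp add: \<epsilon>'_def)
  have ea: "a * \<epsilon>' \<le> \<epsilon>" "a * s * \<epsilon>' \<le> \<epsilon>"
    using \<epsilon> a s by (simp_all add: \<epsilon>'_def divide_simps)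
  obtain g where g: "inj_on g (?T ` C)" "\<And>x. x \<in> ?T ` C \<Longrightarrow> g differentiable (at x)" "\<And>x. x \<in> ?T ` C \<Longrightarrow> norm (g x - f x) \<le> \<epsilon>'"
     "\<And>x v. x \<in> ?T ` C \<Longrightarrow> norm (fd g x v - fd f x v) \<le> \<epsilon>' * norm v"
    using app C' \<epsilon>' unfolding approx_injective_on_def by metis
  let ?g = "\<lambda>z. a *\<^sub>R g (?T z)" and ?f = "\<lambda>z. a *\<^sub>R f (?T z)"
  show "\<exists>g. inj_on g C \<and> (\<forall>x\<in>C. g differentiable (at x) \<and> norm (g x - ?f x) \<le> \<epsilon> \<and> (\<forall>v. norm (fd g x v - fd ?f x v) \<le> \<epsilon> * norm v))"
  proof (intro exI[of _ ?g] conjI ballI allI)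
    show "inj_on ?g C"
    proof (rule inj_onI)
      fix x y assume xy: "x \<in> C" "y \<in> C" "?g x = ?g y"
      then have "g (?T x) = g (?T y)" using a by simp
      then have "?T x = ?T y" using inj_onD[OF g(1)] xy by blast
      then show "x = y" using s by simp
    qed
    fix x v assume x: "x \<in> C"
    then have Tx: "?T x \<in> ?T ` C" "?T x \<in> U" using C'(2) by auto
    have gd: "(g has_derivative fd g (?T x)) (at (?T x))" using g(2)[OF Tx(1)] frechet_derivative_works by blast
    have fdv: "(f has_derivative fd f (?T x)) (at (?T x))" using d[OF Tx(2)] frechet_derivative_works by blast
    have Td: "(?T has_derivative (\<lambda>v. s *\<^sub>R v)) (at x)" by (auto intro!: derivative_eq_intros)
    show "?g differentiable (at x)"
      using has_derivative_scaleR_right[OF has_derivative_compose[OF Td gd], of a] differentiableI by blast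
    have "norm (?g x - ?f x) = a * norm (g (?T x) - f (?T x))"
      using a by (simp flip: scaleR_diff_right)
    also have "\<dots> \<le> a * \<epsilon>'" using g(3)[OF Tx(1)] a by (intro mult_left_mono) auto
    finally show "norm (?g x - ?f x) \<le> \<epsilon>" using ea by simp
    have "norm (fd ?g x v - fd ?f x v) = (a * s) * norm (fd g (?T x) v - fd f (?T x) v)"
      unfolding fd_scaled[OF gd] fd_scaled[OF fdv] using a s by (simp flip: scaleR_diff_right)
    also have "\<dots> \<le> (a * s) * (\<epsilon>' * norm v)" using g(4)[OF Tx(1)] a s by (intro mult_left_mono) auto
    also have "\<dots> \<le> \<epsilon> * norm v" using mult_right_mono[OF ea(2), of "norm v"] by (simp add: mult_ac)
    finally show "norm (fd ?g x v - fd ?f x v) \<le> \<epsilon> * norm v" .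
  qed
qed

lemma det_matrix_scale:
  fixes L :: "real ^ 'n::finite \<Rightarrow> real ^ 'n"
  assumes "linear L"
  shows "det (matrix (\<lambda>v. c *\<^sub>R L v)) = c ^ CARD('n) * det (matrix L)"
proof -
  have "matrix ((\<lambda>v. c *\<^sub>R v) \<circ> L) = matrix ((*\<^sub>R) c) ** matrix L"
    by (rule matrix_compose[OF assms]) (rule linear_scale_self)
  then show ?thesis by (simp add: o_def det_mul)
qed

lemma distortion_on_affine:
  fixes f :: "real ^ 'n::finite \<Rightarrow> real ^ 'n"
  assumes dist: "distortion_on K U f" and d: "\<And>x. x \<in> U \<Longrightarrow> f differentiable (at x)"
    and s: "0 < s" and a: "0 < a" and sub: "\<And>z. z \<in> V \<Longrightarrow> x0 + s *\<^sub>R z \<in> U"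
  shows "distortion_on K V (\<lambda>z. a *\<^sub>R f (x0 + s *\<^sub>R z))"
  unfolding distortion_on_def
proof (intro ballI allI)
  fix z v assume z: "z \<in> V"
  let ?y = "x0 + s *\<^sub>R z"
  have y: "?y \<in> U" by (rule sub[OF z])
  have fdv: "(f has_derivative fd f ?y) (at ?y)" using d[OF y] frechet_derivative_works by blast
  have "norm (fd f ?y v) ^ CARD('n) \<le> K * \<bar>jac f ?y\<bar> * norm v ^ CARD('n)"
    using dist y unfolding distortion_on_def by blast
  then have "(a * s) ^ CARD('n) * norm (fd f ?y v) ^ CARD('n) \<le> (a * s) ^ CARD('n) * (K * \<bar>jac f ?y\<bar> * norm v ^ CARD('n))"
    using a s by (intro mult_left_mono) auto
  then show "norm (fd (\<lambda>z. a *\<^sub>R f (x0 + s *\<^sub>R z)) z v) ^ CARD('n) \<le> K * \<bar>jac (\<lambda>z. a *\<^sub>R f (x0 + s *\<^sub>R z)) z\<bar> * norm v ^ CARD('n)"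
    unfolding fd_scaled[OF fdv] det_matrix_scale[OF has_derivative_linear[OF fdv]]
    using a s by (simp add: power_mult_distrib abs_mult mult_ac)
qed

lemma distortion_on_limit:
  fixes F :: "nat \<Rightarrow> real ^ 'n::finite \<Rightarrow> real ^ 'n" and P :: "real ^ 'n \<Rightarrow> real ^ 'n"
  assumes dist: "\<And>k. distortion_on K U (F k)" and lim: "\<And>x v. x \<in> U \<Longrightarrow> (\<lambda>k. fd (F k) x v) \<longlonglongrightarrow> fd P x v"
  shows "distortion_on K U P"
  unfolding distortion_on_def
proof (intro ballI allI)
  fix x v :: "real ^ 'n" assume x: "x \<in> U"
  have "(\<lambda>k. matrix (fd (F k) x)) \<longlonglongrightarrow> matrix (fd P x)"
    unfolding matrix_def by (intro tendsto_vec_lambda tendsto_vec_nth lim x)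
  moreover have "isCont (det :: real ^ 'n ^ 'n \<Rightarrow> real) A" for A :: "real ^ 'n ^ 'n"
    using continuous_on_det[of UNIV "\<lambda>x :: real ^ 'n ^ 'n. x"] by (simp add: continuous_on_eq_continuous_at continuous_on_id)
  ultimately have "(\<lambda>k. jac (F k) x) \<longlonglongrightarrow> jac P x" by (rule isCont_tendsto_compose[rotated])
  then have "(\<lambda>k. K * \<bar>jac (F k) x\<bar> * norm v ^ CARD('n)) \<longlonglongrightarrow> K * \<bar>jac P x\<bar> * norm v ^ CARD('n)"
    by (intro tendsto_intros)
  moreover have "(\<lambda>k. norm (fd (F k) x v) ^ CARD('n)) \<longlonglongrightarrow> norm (fd P x v) ^ CARD('n)"
    by (intro tendsto_intros lim x)
  moreover have "norm (fd (F k) x v) ^ CARD('n) \<le> K * \<bar>jac (F k) x\<bar> * norm v ^ CARD('n)" for k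
    using dist x unfolding distortion_on_def by blast
  ultimately show "norm (fd P x v) ^ CARD('n) \<le> K * \<bar>jac P x\<bar> * norm v ^ CARD('n)"
    by (intro LIMSEQ_le) auto
qed

text \<open>
  If \<open>B\<close> is the inverse of the derivative, \<open>y \<mapsto> y - B (g y - f x0)\<close> maps a small ball around \<open>x0\<close>
  into itself for every \<open>g\<close> close to \<open>f\<close>, and Brouwer's theorem gives a fixed point.
\<close>

lemma stable_local_surjectivity:
  fixes f :: "'a::euclidean_space \<Rightarrow> 'a"
  assumes f: "(f has_derivative f') (at x0)" and inj: "inj f'" and \<delta>: "\<delta> > 0"
  obtains d \<epsilon> where "0 < d" "d \<le> \<delta>" "0 < \<epsilon>"
    "\<And>g. continuous_on (cball x0 d) g \<Longrightarrow> (\<And>x. x \<in> cball x0 d \<Longrightarrow> norm (g x - f x) \<le> \<epsilon>) \<Longrightarrow> \<exists>y\<in>cball x0 d. g y = f x0"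
proof -
  have lin: "linear f'" by (rule has_derivative_linear[OF f])
  obtain B where B: "linear B" "B \<circ> f' = id" using linear_injective_left_inverse[OF lin inj] by blast
  have Bf: "B (f' v) = v" for v using B(2) by (metis comp_apply id_apply)
  obtain b where b: "b > 0" "\<And>w. norm (B w) \<le> b * norm w" using linear_bounded_pos[OF B(1)] by blast
  have injB: "inj B"
  proof -
    have "surj f'" by (rule linear_injective_imp_surjective[OF lin inj]) simp
    show ?thesis
    proof (rule injI)
      fix u w assume "B u = B w"
      moreover obtain u' w' where "u = f' u'" "w = f' w'" using \<open>surj f'\<close> by (meson surjD)
      ultimately show "u = w" by (simp add: Bf)
    qed
  qed
  have "1 / (2 * b) > 0" using b by simp
  then obtain d0 where d0: "d0 > 0" "\<And>y. norm (y - x0) < d0 \<Longrightarrow> norm (f y - f x0 - f' (y - x0)) \<le> 1 / (2 * b) * norm (y - x0)"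
    using f[unfolded has_derivative_at_alt] by blast
  define d where "d = min \<delta> (d0 / 2)"
  have d: "0 < d" "d \<le> \<delta>" "d < d0" using d0 \<delta> by (auto simp: d_def)
  define \<epsilon> where "\<epsilon> = d / (2 * b)"
  have \<epsilon>: "\<epsilon> > 0" using d b by (simp add: \<epsilon>_def)
  show ?thesis
  proof (rule that[OF d(1,2) \<epsilon>])
    fix g assume contg: "continuous_on (cball x0 d) g" and close: "\<And>x. x \<in> cball x0 d \<Longrightarrow> norm (g x - f x) \<le> \<epsilon>"
    define T where "T y = y - B (g y - f x0)" for y
    have "continuous_on UNIV B" using B(1) by (simp add: linear_continuous_on linear_conv_bounded_linear)
    then have contT: "continuous_on (cball x0 d) T"
      unfolding T_def by (intro continuous_intros continuous_on_compose2[OF \<open>continuous_on UNIV B\<close>] contg) auto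
    have "T y \<in> cball x0 d" if y: "y \<in> cball x0 d" for y
    proof -
      have ny: "norm (y - x0) \<le> d" using y by (simp add: dist_norm norm_minus_commute)
      have "B (g y - f x0) = B ((f y - f x0 - f' (y - x0)) + (g y - f y) + f' (y - x0))" by simp
      also have "\<dots> = B (f y - f x0 - f' (y - x0)) + B (g y - f y) + (y - x0)" by (simp only: linear_add[OF B(1)] Bf)
      finally have eq: "T y - x0 = - (B (f y - f x0 - f' (y - x0)) + B (g y - f y))"
        unfolding T_def by simp
      have "norm (T y - x0) \<le> norm (B (f y - f x0 - f' (y - x0))) + norm (B (g y - f y))"
        unfolding eq norm_minus_cancel by (rule norm_triangle_ineq)
      also have "\<dots> \<le> b * (1 / (2 * b) * norm (y - x0)) + b * \<epsilon>"
      proof (rule add_mono)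
        have "norm (B (f y - f x0 - f' (y - x0))) \<le> b * norm (f y - f x0 - f' (y - x0))" by (rule b(2))
        also have "\<dots> \<le> b * (1 / (2 * b) * norm (y - x0))" using d0(2)[of y] ny d b by (intro mult_left_mono) auto
        finally show "norm (B (f y - f x0 - f' (y - x0))) \<le> b * (1 / (2 * b) * norm (y - x0))" .
        have "norm (B (g y - f y)) \<le> b * norm (g y - f y)" by (rule b(2))
        also have "\<dots> \<le> b * \<epsilon>" using close[OF y] b by (intro mult_left_mono) auto
        finally show "norm (B (g y - f y)) \<le> b * \<epsilon>" .
      qed
      also have "\<dots> \<le> d" using b ny by (simp add: \<epsilon>_def field_simps)
      finally show ?thesis by (simp add: dist_norm norm_minus_commute)
    qed
    then obtain y where y: "y \<in> cball x0 d" "T y = y"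
      using brouwer[OF compact_cball convex_cball _ contT] d by (auto simp: Pi_iff)
    then have "B (g y - f x0) = B 0" using linear_0[OF B(1)] by (simp add: T_def)
    then have "g y - f x0 = 0" using injB by (simp add: inj_eq)
    then show "\<exists>y\<in>cball x0 d. g y = f x0" using y by auto
  qed
qed

text \<open>
  The class of maps in which the blow-up arguments take place. It contains the injective harmonic
  maps of bounded distortion and is closed under rescaling and under uniform limits.
\<close>

definition qc_limit_on :: "real \<Rightarrow> (real ^ 'n::finite) set \<Rightarrow> (real ^ 'n \<Rightarrow> real ^ 'n) \<Rightarrow> bool" where
  "qc_limit_on K U f \<longleftrightarrow> mean_value_on U f \<and> approx_injective_on U f \<and> distortion_on K U f"

lemma mean_value_differentiable:
  fixes f :: "'a::euclidean_space \<Rightarrow> 'b::euclidean_space"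
  shows "open U \<Longrightarrow> mean_value_on U f \<Longrightarrow> x \<in> U \<Longrightarrow> f differentiable (at x)"
  by (rule differentiableI[OF mean_value_has_fd])

lemma qc_limit_on_affine:
  assumes f: "qc_limit_on K U f" and U: "open U" and s: "0 < s" and a: "0 < a" and sub: "\<And>z. z \<in> V \<Longrightarrow> x0 + s *\<^sub>R z \<in> U"
  shows "qc_limit_on K V (\<lambda>z. a *\<^sub>R f (x0 + s *\<^sub>R z))"
proof -
  have d: "f differentiable (at x)" if "x \<in> U" for x
    using f that mean_value_differentiable[OF U] unfolding qc_limit_on_def by blast
  show ?thesis
    using f unfolding qc_limit_on_def
    by (auto intro: mean_value_on_scaleR[OF mean_value_on_affine[OF _ s sub]]
          approx_injective_on_affine[OF _ d s a sub] distortion_on_affine[OF _ d s a sub])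
qed

lemma compact_subset_ball:
  fixes C :: "'a::euclidean_space set"
  assumes "compact C" "C \<subseteq> ball 0 r"
  obtains \<rho> where "\<rho> < r" "C \<subseteq> cball 0 \<rho>"
proof (cases "C = {}")
  case True
  then show ?thesis using that[of "r - 1"] by auto
next
  case False
  have "compact (norm ` C)" by (intro compact_continuous_image continuous_on_norm continuous_on_id assms)
  then obtain \<rho> where \<rho>: "\<rho> \<in> norm ` C" "\<And>x. x \<in> norm ` C \<Longrightarrow> x \<le> \<rho>"
    using compact_attains_sup[of "norm ` C"] False by auto
  then have "\<rho> < r" "C \<subseteq> cball 0 \<rho>" using assms(2) by auto
  then show ?thesis using that by blast
qed

lemma fd_tendsto:
  fixes F :: "nat \<Rightarrow> 'a::euclidean_space \<Rightarrow> 'b::euclidean_space"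
  assumes mv: "\<And>k. mean_value_on (ball 0 r) (F k)" and lim: "uniform_limit (ball 0 r) F P sequentially"
    and x: "x \<in> ball 0 r"
  shows "(\<lambda>k. fd (F k) x v) \<longlonglongrightarrow> fd P x v"
proof (rule LIMSEQ_I)
  fix e :: real assume e: "e > 0"
  define d where "d = e / (norm v + 1)"
  have d: "d > 0" "d * norm v < e" using e by (auto simp: d_def divide_simps add_nonneg_pos)
  have "\<forall>\<^sub>F k in sequentially. \<forall>y\<in>cball 0 (norm x). \<forall>v. norm (fd (F k) y v - fd P y v) \<le> d * norm v"
    by (rule mean_value_fd_uniform_limit[OF mv lim _ d(1)]) (use x in simp)
  then obtain N where "\<And>k. k \<ge> N \<Longrightarrow> norm (fd (F k) x v - fd P x v) \<le> d * norm v"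
    unfolding eventually_sequentially by fastforce
  then show "\<exists>no. \<forall>n\<ge>no. norm (fd (F n) x v - fd P x v) < e" using d(2) by (meson le_less_trans)
qed

lemma qc_limit_on_limit:
  fixes F :: "nat \<Rightarrow> real ^ 'n::finite \<Rightarrow> real ^ 'n"
  assumes F: "\<And>k. qc_limit_on K (ball 0 r) (F k)" and lim: "uniform_limit (ball 0 r) F P sequentially"
  shows "qc_limit_on K (ball 0 r) P"
  unfolding qc_limit_on_def
proof (intro conjI)
  have mv: "mean_value_on (ball 0 r) (F k)" for k using F unfolding qc_limit_on_def by blast
  show "mean_value_on (ball 0 r) P" by (rule mean_value_on_uniform_limit[OF mv lim])
  show "approx_injective_on (ball 0 r) P"
  proof (rule approx_injective_on_limit[where F = F])
    show "approx_injective_on (ball 0 r) (F k)" for k using F unfolding qc_limit_on_def by blast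
    fix C :: "(real ^ 'n) set" and \<epsilon> :: real assume C: "compact C" "C \<subseteq> ball 0 r" and \<epsilon>: "0 < \<epsilon>"
    obtain \<rho> where \<rho>: "\<rho> < r" "C \<subseteq> cball 0 \<rho>" using compact_subset_ball[OF C] by blast
    have "\<forall>\<^sub>F k in sequentially. \<forall>x\<in>cball 0 \<rho>. \<forall>v. norm (fd (F k) x v - fd P x v) \<le> \<epsilon> * norm v"
      by (rule mean_value_fd_uniform_limit[OF mv lim \<rho>(1) \<epsilon>])
    moreover have "\<forall>\<^sub>F k in sequentially. \<forall>x\<in>ball 0 r. dist (F k x) (P x) < \<epsilon>"
      using lim \<epsilon> unfolding uniform_limit_iff by blast
    ultimately have "\<forall>\<^sub>F k in sequentially. \<forall>x\<in>C. norm (F k x - P x) \<le> \<epsilon> \<and> (\<forall>v. norm (fd (F k) x v - fd P x v) \<le> \<epsilon> * norm v)"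
    proof (rule eventually_elim2)
      fix k assume "\<forall>x\<in>cball 0 \<rho>. \<forall>v. norm (fd (F k) x v - fd P x v) \<le> \<epsilon> * norm v" "\<forall>x\<in>ball 0 r. dist (F k x) (P x) < \<epsilon>"
      then show "\<forall>x\<in>C. norm (F k x - P x) \<le> \<epsilon> \<and> (\<forall>v. norm (fd (F k) x v - fd P x v) \<le> \<epsilon> * norm v)"
        using \<rho>(2) C(2) by (auto simp: dist_norm subset_iff less_imp_le)
    qed
    then show "\<exists>k. \<forall>x\<in>C. norm (F k x - P x) \<le> \<epsilon> \<and> (\<forall>v. norm (fd (F k) x v - fd P x v) \<le> \<epsilon> * norm v)"
      unfolding eventually_sequentially by blast
  qed
  show "distortion_on K (ball 0 r) P"
  proof (rule distortion_on_limit[where F = F])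
    show "distortion_on K (ball 0 r) (F k)" for k using F unfolding qc_limit_on_def by blast
    fix x v :: "real ^ 'n" assume x: "x \<in> ball 0 r"
    show "(\<lambda>k. fd (F k) x v) \<longlonglongrightarrow> fd P x v"
      by (rule fd_tendsto[OF mv lim x])
  qed
qed

section \<open>Homogeneous limits\<close>

lemma zero_jacobian_imp_constant:
  fixes f :: "real ^ 'n::finite \<Rightarrow> real ^ 'n"
  assumes q: "qc_limit_on K (ball 0 r) f" and jac: "\<And>x. x \<in> ball 0 r \<Longrightarrow> jac f x = 0" and x: "x \<in> ball 0 r"
  shows "f x = f 0"
proof -
  have mv: "mean_value_on (ball 0 r) f" using q unfolding qc_limit_on_def by blast
  have r: "0 < r" using x by (auto intro: le_less_trans[OF norm_ge_zero])
  have z: "fd f y v = 0" if "y \<in> ball 0 r" for y v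
  proof -
    have "norm (fd f y v) ^ CARD('n) \<le> K * \<bar>jac f y\<bar> * norm v ^ CARD('n)"
      using q that unfolding qc_limit_on_def distortion_on_def by blast
    then have "norm (fd f y v) ^ CARD('n) \<le> 0" using jac[OF that] by simp
    moreover have "0 \<le> norm (fd f y v) ^ CARD('n)" by simp
    ultimately have "norm (fd f y v) ^ CARD('n) = 0" by linarith
    then show ?thesis by simp
  qed
  have "\<exists>c. \<forall>y\<in>ball 0 r. f y = c"
  proof (rule has_derivative_zero_constant)
    fix y :: "real ^ 'n" assume y: "y \<in> ball 0 r"
    have "fd f y = (\<lambda>v. 0)" using z[OF y] by auto
    then show "(f has_derivative (\<lambda>v. 0)) (at y within ball 0 r)"
      using mean_value_has_fd[OF open_ball mv y] has_derivative_at_withinI by metis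
  qed auto
  then show ?thesis using x r by (metis centre_in_ball)
qed

text \<open>
  Blow up \<open>P\<close> a second time, at a zero \<open>z1\<close> other than the origin. By homogeneity \<open>P\<close> is
  controlled along the ray through \<open>z1\<close>, so the limit \<open>Q\<close> is invariant in the direction \<open>z1\<close>. Its
  Jacobian vanishes, bounded distortion makes \<open>Q\<close> constant, and the constant is \<open>Q 0 = 0\<close>, a
  contradiction.
\<close>

lemma homogeneous_nonzero:
  fixes P :: "real ^ 'n::finite \<Rightarrow> real ^ 'n"
  assumes q: "qc_limit_on K (ball 0 1) P" and eig: "\<And>z. z \<in> ball 0 1 \<Longrightarrow> euler P z = m *\<^sub>R P z"
    and nz: "\<exists>z\<in>ball 0 1. P z \<noteq> 0" and z0: "z0 \<in> ball 0 1" "z0 \<noteq> 0"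
  shows "P z0 \<noteq> 0"
proof
  assume Pz0: "P z0 = 0"
  have mvP: "mean_value_on (ball 0 1) P" using q unfolding qc_limit_on_def by blast
  \<comment> \<open>By homogeneity the zero may be moved towards the origin. Then the ball of radius \<open>1/3\<close> about the
     origin, from which unique continuation starts, lies in a ball about \<open>z1\<close> inside the unit ball.\<close>
  define z1 where "z1 = (1/3) *\<^sub>R z0"
  have Pz1: "P z1 = 0" unfolding z1_def using euler_eigen_homogeneous[OF mvP eig z0(1), of "1/3"] Pz0 by simp
  have z1: "norm z1 < 1/3" "z1 \<noteq> 0" using z0 by (auto simp: z1_def)
  define R where "R = 1 - norm z1"
  have R: "R > 2/3" using z1 by (simp add: R_def)
  have mem: "z1 + y \<in> ball 0 1" if "y \<in> ball 0 R" for y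
    using that norm_triangle_ineq[of z1 y] by (simp add: R_def)
  define f where "f y = P (z1 + y)" for y
  have qf: "qc_limit_on K (ball 0 R) f"
    using qc_limit_on_affine[OF q open_ball, of 1 1 "ball 0 R" z1] mem by (simp add: f_def [abs_def])
  have mvf: "mean_value_on (ball 0 R) f" using qf unfolding qc_limit_on_def by blast
  have "\<exists>x\<in>ball 0 R. f x \<noteq> 0"
  proof (rule ccontr)
    assume "\<not> ?thesis"
    then have fz: "f y = 0" if "y \<in> ball 0 R" for y using that by blast
    have "P z = 0" if "z \<in> ball 0 1" for z
    proof (rule unique_continuation[OF mvP _ _ that, of "1/3"])
      fix x :: "real ^ 'n" assume "x \<in> ball 0 (1/3)"
      then have "norm (x - z1) < R" using norm_triangle_ineq4[of x z1] z1 R by simp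
      then have "f (x - z1) = 0" using fz by simp
      then show "P x = 0" by (simp add: f_def)
    qed simp
    then show False using nz by blast
  qed
  then obtain x where x: "x \<in> ball 0 R" "f x \<noteq> 0" by blast
  obtain \<tau> a Q m' where \<tau>: "\<And>k::nat. 0 < \<tau> k" "\<And>k. \<tau> k < R" "\<tau> \<longlonglongrightarrow> 0" and a: "\<And>k. 0 < a k"
    and mvQ: "mean_value_on (ball 0 1) Q"
    and lim: "uniform_limit (ball 0 1) (\<lambda>k z. a k *\<^sub>R f (\<tau> k *\<^sub>R z)) Q sequentially"
    and Qnz: "\<exists>z\<in>ball 0 1. Q z \<noteq> 0" and "0 \<le> m'" "\<And>z. z \<in> ball 0 1 \<Longrightarrow> euler Q z = m' *\<^sub>R Q z"
    by (rule blow_up[OF mvf x]) (rule that; (assumption | blast))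
  define F where "F k z = a k *\<^sub>R f (\<tau> k *\<^sub>R z)" for k z
  have mem1: "\<tau> k *\<^sub>R z \<in> ball 0 R" if "z \<in> ball 0 1" for k and z :: "real ^ 'n"
  proof -
    have "\<tau> k * norm z \<le> \<tau> k * 1" using \<tau>(1)[of k] that by (intro mult_left_mono) auto
    then have "\<tau> k * norm z < R" using \<tau>(2)[of k] by simp
    then show ?thesis using \<tau>(1)[of k] by simp
  qed
  have qF: "qc_limit_on K (ball 0 1) (F k)" for k
    using qc_limit_on_affine[OF qf open_ball \<tau>(1) a, of "ball 0 1" 0 k k] mem1 by (simp add: F_def [abs_def])
  have lim': "uniform_limit (ball 0 1) F Q sequentially" using lim by (simp add: F_def [abs_def])
  have mvF': "mean_value_on (ball 0 1) (F k)" for k using qF unfolding qc_limit_on_def by blast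
  have qQ: "qc_limit_on K (ball 0 1) Q" by (rule qc_limit_on_limit[OF qF lim'])
  have Qz: "fd Q z z1 = 0" if z: "z \<in> ball 0 1" for z
  proof -
    \<comment> \<open>Euler's identity at \<open>z1 + \<tau> k *\<^sub>R z\<close>, solved for the derivative in the direction \<open>z1\<close>\<close>
    have eq: "fd (F k) z z1 = \<tau> k *\<^sub>R (m *\<^sub>R F k z - fd (F k) z z)" for k
    proof -
      let ?y = "z1 + \<tau> k *\<^sub>R z"
      have y: "?y \<in> ball 0 1" by (rule mem[OF mem1[OF z]])
      note d = mean_value_has_fd[OF open_ball mvP y]
      have Fk: "F k = (\<lambda>z. a k *\<^sub>R P (z1 + \<tau> k *\<^sub>R z))" by (simp add: F_def [abs_def] f_def)
      have f1: "fd (F k) z v = (a k * \<tau> k) *\<^sub>R fd P ?y v" for v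
        unfolding Fk using fd_scaled[OF d, of "a k"] by simp
      have "fd P ?y ?y = m *\<^sub>R P ?y" using eig[OF y] by (simp add: euler_def)
      then have "fd P ?y z1 + \<tau> k *\<^sub>R fd P ?y z = m *\<^sub>R P ?y"
        using linear_add[OF has_derivative_linear[OF d], of z1 "\<tau> k *\<^sub>R z"] linear_cmul[OF has_derivative_linear[OF d], of "\<tau> k" z] by simp
      then have e: "fd P ?y z1 = m *\<^sub>R P ?y - \<tau> k *\<^sub>R fd P ?y z" by (simp add: algebra_simps)
      show ?thesis unfolding f1 e unfolding Fk by (simp add: algebra_simps)
    qed
    have "(\<lambda>k. \<tau> k *\<^sub>R (m *\<^sub>R F k z - fd (F k) z z)) \<longlonglongrightarrow> 0 *\<^sub>R (m *\<^sub>R Q z - fd Q z z)"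
      by (intro tendsto_intros \<tau>(3) tendsto_uniform_limitI[OF lim' z] fd_tendsto[OF mvF' lim' z])
    then have "(\<lambda>k. fd (F k) z z1) \<longlonglongrightarrow> 0" unfolding eq by simp
    then show ?thesis using fd_tendsto[OF mvF' lim' z] LIMSEQ_unique by blast
  qed
  have "jac Q z = 0" if z: "z \<in> ball 0 1" for z
  proof (rule ccontr)
    assume nz: "jac Q z \<noteq> 0"
    have lin: "linear (fd Q z)" by (rule has_derivative_linear[OF mean_value_has_fd[OF open_ball mvQ z]])
    have "inj (fd Q z)" using nz det_nz_iff_inj[OF lin] by blast
    moreover have "fd Q z z1 = fd Q z 0" using Qz[OF z] linear_0[OF lin] by simp
    ultimately show False using z1 by (simp add: inj_eq)
  qed
  then have const: "Q z = Q 0" if "z \<in> ball 0 1" for z using zero_jacobian_imp_constant[OF qQ _ that] by blast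
  have "(\<lambda>k. F k 0) \<longlonglongrightarrow> Q 0" by (rule tendsto_uniform_limitI[OF lim']) simp
  moreover have "(\<lambda>k. F k 0) = (\<lambda>k. 0)" by (simp add: F_def f_def Pz1)
  ultimately have "(\<lambda>k. 0) \<longlonglongrightarrow> Q 0" by simp
  then have "Q 0 = 0" using LIMSEQ_unique[OF tendsto_const] by metis
  moreover obtain z where "z \<in> ball 0 1" "Q z \<noteq> 0" using Qnz by blast
  ultimately show False using const[of z] by simp
qed

text \<open>
  Adding a combination of the other rows to row \<open>k\<close> reduces the matrix to a diagonal one.
\<close>

lemma det_rank_one_axis:
  fixes \<phi> :: "real ^ 'n::finite \<Rightarrow> real"
  shows "det (matrix (\<lambda>v. c *\<^sub>R v + \<phi> v *\<^sub>R axis k 1)) = c ^ (CARD('n) - 1) * (c + \<phi> (axis k 1))"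
proof (cases "c = 0")
  case False
  let ?M = "matrix (\<lambda>v. c *\<^sub>R v + \<phi> v *\<^sub>R axis k 1)"
  define A where "A = (\<chi> i j. if i = j then (if i = k then c + \<phi> (axis k 1) else c) else 0)"
  have M: "?M $ i $ j = (if i = j then c else 0) + (if i = k then \<phi> (axis j 1) else 0)" for i j
    by (auto simp: matrix_def axis_def)
  have rowA: "row j A = c *s axis j 1" if "j \<noteq> k" for j
    using that by (auto simp: row_def A_def vec_eq_iff axis_def)
  let ?x = "\<Sum>j\<in>UNIV - {k}. (\<phi> (axis j 1) / c) *s row j A"
  have x: "?x \<in> vec.span {row j A |j. j \<noteq> k}"
    by (intro vec.span_sum vec.span_scale vec.span_base) auto
  have "?x $ i = (if i = k then 0 else \<phi> (axis i 1))" for i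
  proof -
    have "?x $ i = (\<Sum>j\<in>UNIV - {k}. (\<phi> (axis j 1) / c) * (row j A $ i))" by simp
    also have "\<dots> = (\<Sum>j\<in>UNIV - {k}. if j = i then \<phi> (axis i 1) else 0)"
      by (rule sum.cong) (use False in \<open>auto simp: rowA axis_def\<close>)
    also have "\<dots> = (if i = k then 0 else \<phi> (axis i 1))" by (simp add: sum.delta)
    finally show ?thesis .
  qed
  then have "(\<chi> i. if i = k then row k A + ?x else row i A) = ?M"
    by (auto simp: vec_eq_iff M A_def row_def)
  then have "det ?M = det A" using det_row_span[OF x] by simp
  also have "det A = (\<Prod>i\<in>UNIV. A $ i $ i)" by (rule det_diagonal) (simp add: A_def)
  also have "\<dots> = (\<Prod>i\<in>UNIV. if i = k then c + \<phi> (axis k 1) else c)" by (simp add: A_def)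
  also have "\<dots> = (c + \<phi> (axis k 1)) * (\<Prod>i\<in>UNIV - {k}. if i = k then c + \<phi> (axis k 1) else c)"
    by (subst prod.remove[of UNIV k]) auto
  also have "(\<Prod>i\<in>UNIV - {k}. if i = k then c + \<phi> (axis k 1) else c) = (\<Prod>i\<in>UNIV - {k}. c)"
    by (rule prod.cong) auto
  also have "\<dots> = c ^ (CARD('n) - 1)" by (simp add: card_Diff_singleton)
  finally show ?thesis by simp
next
  case True
  show ?thesis
  proof (cases "CARD('n) = 1")
    case True1: True
    have uk: "i = k" for i :: 'n using True1 by (metis (full_types) UNIV_I card_1_singletonE singletonD)
    have "det (matrix (\<lambda>v. c *\<^sub>R v + \<phi> v *\<^sub>R axis k 1)) = (\<Prod>i\<in>UNIV. (matrix (\<lambda>v. c *\<^sub>R v + \<phi> v *\<^sub>R axis k 1)) $ i $ i)"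
      by (rule det_diagonal) (metis uk)
    also have "\<dots> = (\<Prod>i\<in>(UNIV::'n set). \<phi> (axis k 1))"
    proof (rule prod.cong[OF refl])
      fix i :: 'n
      have "i = k" by (rule uk)
      then show "(matrix (\<lambda>v. c *\<^sub>R v + \<phi> v *\<^sub>R axis k 1)) $ i $ i = \<phi> (axis k 1)"
        by (simp add: matrix_def True axis_def)
    qed
    finally show ?thesis using True True1 by simp
  next
    case False
    then have c2: "CARD('n) - 1 \<noteq> 0" using zero_less_card_finite[where 'a='n] by linarith
    then obtain i where i: "i \<noteq> k" by (metis (full_types) False UNIV_eq_I card_1_singleton_iff insertCI is_singletonI' singletonI One_nat_def ex_in_conv)
    have "row i (matrix (\<lambda>v. c *\<^sub>R v + \<phi> v *\<^sub>R axis k 1)) = 0"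
      using i by (auto simp: row_def matrix_def True axis_def vec_eq_iff)
    then show ?thesis using c2 True by (simp add: det_zero_row)
  qed
qed

text \<open>
  An orthogonal change of basis moves \<open>z\<close> to a multiple of a coordinate vector.
\<close>

lemma det_rank_one_update:
  fixes \<phi> :: "real ^ 'n::finite \<Rightarrow> real" and z :: "real ^ 'n"
  assumes lin: "linear \<phi>"
  shows "det (matrix (\<lambda>v. c *\<^sub>R v + \<phi> v *\<^sub>R z)) = c ^ (CARD('n) - 1) * (c + \<phi> z)"
proof -
  obtain k :: 'n where True by blast
  have "norm (norm z *\<^sub>R axis k (1::real)) = norm z" by simp
  then obtain f :: "real ^ 'n \<Rightarrow> real ^ 'n" where f: "orthogonal_transformation f" "f (norm z *\<^sub>R axis k 1) = z"
    using orthogonal_transformation_exists by blast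
  have lf: "linear f" using f(1) by (rule orthogonal_transformation_linear)
  let ?L = "\<lambda>v. c *\<^sub>R v + \<phi> v *\<^sub>R z"
  define \<psi> where "\<psi> v = \<phi> (f v) * norm z" for v
  let ?L' = "\<lambda>v. c *\<^sub>R v + \<psi> v *\<^sub>R axis k 1"
  have l\<psi>: "linear \<psi>" unfolding \<psi>_def
    by (rule linearI) (simp_all add: linear_add[OF lf] linear_add[OF lin] linear_cmul[OF lf] linear_cmul[OF lin] algebra_simps)
  have lL: "linear ?L" by (rule linearI) (simp_all add: linear_add[OF lin] linear_cmul[OF lin] algebra_simps)
  have lL': "linear ?L'" by (rule linearI) (simp_all add: linear_add[OF l\<psi>] linear_cmul[OF l\<psi>] algebra_simps)
  have "?L \<circ> f = f \<circ> ?L'"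
  proof
    fix v
    have "f (?L' v) = c *\<^sub>R f v + \<phi> (f v) *\<^sub>R f (norm z *\<^sub>R axis k 1)"
      by (simp add: linear_add[OF lf] linear_cmul[OF lf] \<psi>_def)
    then show "(?L \<circ> f) v = (f \<circ> ?L') v" using f(2) by simp
  qed
  then have "matrix ?L ** matrix f = matrix f ** matrix ?L'"
    using matrix_compose[OF lf lL] matrix_compose[OF lL' lf] by simp
  then have "det (matrix ?L) * det (matrix f) = det (matrix f) * det (matrix ?L')"
    using arg_cong[of _ _ det] det_mul by (simp only: det_mul[symmetric])
  moreover have "det (matrix f) \<noteq> 0"
    using det_nz_iff_inj[OF lf] orthogonal_transformation_inj[OF f(1)] by blast
  ultimately have "det (matrix ?L) = det (matrix ?L')" by simp
  also have "\<dots> = c ^ (CARD('n) - 1) * (c + \<psi> (axis k 1))" by (rule det_rank_one_axis)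
  also have "\<psi> (axis k 1) = \<phi> (f (norm z *\<^sub>R axis k 1))"
    unfolding \<psi>_def linear_cmul[OF lf] linear_cmul[OF lin] by (simp add: mult.commute)
  also have "\<dots> = \<phi> z" by (simp only: f(2))
  finally show ?thesis .
qed

lemma powr_lt_one: "0 \<le> x \<Longrightarrow> x < 1 \<Longrightarrow> 0 < a \<Longrightarrow> x powr a < (1::real)"
  using powr_less_mono2[of a x 1] by simp

text \<open>
  Compare \<open>P\<close> with the radial map \<open>S z = lam z *\<^sub>R z\<close>, where \<open>lam z = norm (P z) / norm z\<close>, on the
  part of the ball of radius \<open>1/2\<close> where \<open>norm (P z) < \<eta>\<close>. Here \<open>\<eta>\<close> is the minimum of
  \<open>norm (P z)\<close> on the sphere of this radius, so every ray leaves the set in the interior.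
  The map \<open>S\<close> takes this set injectively onto the punctured ball of radius \<open>\<eta>\<close>, and
  since \<open>lam\<close> is homogeneous of degree \<open>m - 1\<close> its Jacobian is \<open>m * lam z ^ n\<close>. The radial
  derivative of \<open>P\<close> has norm \<open>m * lam z\<close> in the unit direction, so the distortion inequality says that
  \<open>m ^ (n - 1)\<close> times this Jacobian is at most \<open>K\<close> times the Jacobian of \<open>P\<close>. Now integrate: \<open>S\<close>
  covers the whole ball, and by \<open>approx_injective_area\<close> the integral of the Jacobian of \<open>P\<close> is at most
  the volume of the same ball.
\<close>

lemma homogeneity_degree_bound:
  fixes P :: "real ^ 'n::finite \<Rightarrow> real ^ 'n"
  assumes q: "qc_limit_on K (ball 0 1) P" and eig: "\<And>z. z \<in> ball 0 1 \<Longrightarrow> euler P z = m *\<^sub>R P z"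
    and nz: "\<And>z. z \<in> ball 0 1 \<Longrightarrow> z \<noteq> 0 \<Longrightarrow> P z \<noteq> 0" and m: "0 < m"
  shows "m ^ (CARD('n) - 1) \<le> K"
proof -
  have mvP: "mean_value_on (ball 0 1) P" and app: "approx_injective_on (ball 0 1) P" and dist: "distortion_on K (ball 0 1) P"
    using q unfolding qc_limit_on_def by auto
  let ?n = "CARD('n)"
  have n: "?n = Suc (?n - 1)" by simp
  have contP: "continuous_on (ball 0 1) P" by (rule mean_value_on_continuous[OF mvP])
  have hom: "P (l *\<^sub>R z) = l powr m *\<^sub>R P z" if "z \<in> ball 0 1" "0 < l" "l \<le> 1" for z l
    by (rule euler_eigen_homogeneous[OF mvP eig that])
  have s_sub: "sphere 0 (1/2) \<subseteq> ball (0 :: real ^ 'n) 1" by auto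
  have cs: "continuous_on (sphere 0 (1/2)) (\<lambda>z. norm (P z))"
    by (intro continuous_on_norm continuous_on_subset[OF contP s_sub])
  have "sphere (0 :: real ^ 'n) (1/2) \<noteq> {}" by simp
  then obtain w where w: "w \<in> sphere 0 (1/2)" "\<And>z. z \<in> sphere 0 (1/2) \<Longrightarrow> norm (P w) \<le> norm (P z)"
    using continuous_attains_inf[OF compact_sphere _ cs] by blast
  define \<eta> where "\<eta> = norm (P w)"
  have \<eta>: "\<eta> > 0" using nz[of w] w(1) s_sub unfolding \<eta>_def by force
  define \<Omega> where "\<Omega> = {z \<in> ball 0 (1/2). z \<noteq> 0 \<and> norm (P z) < \<eta>}"
  have \<Omega>1: "z \<in> ball 0 1" "z \<noteq> 0" "P z \<noteq> 0" if "z \<in> \<Omega>" for z using that nz[of z] by (auto simp: \<Omega>_def)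
  define S where "S z = (norm (P z) / norm z) *\<^sub>R z" for z
  have nS: "norm (S z) = norm (P z)" if "z \<noteq> 0" for z using that by (simp add: S_def)
  have S0: "P 0 = 0"
  proof -
    have z0: "(0 :: real ^ 'n) \<in> ball 0 1" by simp
    have "P 0 = (1/2) powr m *\<^sub>R P 0" using hom[OF z0, of "1/2"] by simp
    then have "(1 - (1/2) powr m) *\<^sub>R P 0 = 0" by (simp add: scaleR_left_diff_distrib)
    moreover have "(1/2::real) powr m < 1" using m by (simp add: powr_lt_one)
    ultimately show ?thesis using m by auto
  qed
  have injS: "inj_on S \<Omega>"
  proof (rule inj_onI)
    have main: "x = y" if xy: "x \<in> \<Omega>" "y \<in> \<Omega>" "S x = S y" "norm x \<le> norm y" for x y
    proof -
      define c where "c = norm x / norm y"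
      have c: "0 < c" "c \<le> 1" using \<Omega>1(2)[OF xy(1)] \<Omega>1(2)[OF xy(2)] xy(4) by (auto simp: c_def divide_simps)
      have eqn: "norm (P x) = norm (P y)" using nS[OF \<Omega>1(2)[OF xy(1)]] nS[OF \<Omega>1(2)[OF xy(2)]] xy(3) by simp
      have "(norm (P x) / norm x) *\<^sub>R x = (norm (P x) / norm y) *\<^sub>R y" using xy(3) eqn by (simp add: S_def)
      then have "(norm x / norm (P x)) *\<^sub>R ((norm (P x) / norm x) *\<^sub>R x) = (norm x / norm (P x)) *\<^sub>R ((norm (P x) / norm y) *\<^sub>R y)" by simp
      then have xc: "x = c *\<^sub>R y" using \<Omega>1[OF xy(1)] \<Omega>1[OF xy(2)] by (simp add: c_def)
      have "norm (P x) = c powr m * norm (P y)"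
        using hom[OF \<Omega>1(1)[OF xy(2)] c] by (simp add: xc)
      then have "c powr m = 1" using eqn \<Omega>1(3)[OF xy(2)] by simp
      then have "c = 1" using powr_lt_one[of c m] c m by force
      then show "x = y" using xc by simp
    qed
    fix x y assume "x \<in> \<Omega>" "y \<in> \<Omega>" "S x = S y"
    then show "x = y" using main[of x y] main[of y x] by (metis linear)
  qed
  have imS: "S ` \<Omega> = ball 0 \<eta> - {0}"
  proof
    show "S ` \<Omega> \<subseteq> ball 0 \<eta> - {0}"
    proof
      fix y assume "y \<in> S ` \<Omega>"
      then obtain z where z: "z \<in> \<Omega>" "y = S z" by blast
      have "norm y = norm (P z)" using nS[OF \<Omega>1(2)[OF z(1)]] z by simp
      then show "y \<in> ball 0 \<eta> - {0}" using z(1) \<Omega>1(3)[OF z(1)] by (auto simp: \<Omega>_def)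
    qed
    show "ball 0 \<eta> - {0} \<subseteq> S ` \<Omega>"
    proof
      fix y :: "real ^ 'n" assume y: "y \<in> ball 0 \<eta> - {0}"
      define e where "e = (1 / (2 * norm y)) *\<^sub>R y"
      have e: "e \<in> sphere 0 (1/2)" "e \<in> ball 0 1" using y by (auto simp: e_def)
      have Pe: "norm (P e) \<ge> \<eta>" using w(2)[OF e(1)] by (simp add: \<eta>_def)
      define l where "l = (norm y / norm (P e)) powr (1 / m)"
      have r: "0 < norm y / norm (P e)" "norm y / norm (P e) < 1" using y Pe \<eta> by (auto simp: divide_simps)
      have l: "0 < l" "l < 1" using r m by (auto simp: l_def powr_lt_one)
      have lm: "l powr m = norm y / norm (P e)" using r m by (simp add: l_def powr_powr)
      define z where "z = l *\<^sub>R e"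
      have "P z = l powr m *\<^sub>R P e" unfolding z_def using hom[OF e(2)] l by simp
      then have "norm (P z) = (norm y / norm (P e)) * norm (P e)" using r by (simp add: lm)
      moreover have "norm (P e) \<noteq> 0" using Pe \<eta> by linarith
      ultimately have nP: "norm (P z) = norm y" by simp
      have nz: "norm z = l / 2" using l e(1) by (simp add: z_def)
      have z\<Omega>: "z \<in> \<Omega>" using nz nP y l by (auto simp: \<Omega>_def)
      have "S z = (norm y / (l / 2)) *\<^sub>R z" by (simp add: S_def nP nz)
      also have "\<dots> = y" using l y by (simp add: z_def e_def)
      finally show "y \<in> S ` \<Omega>" using z\<Omega> by blast
    qed
  qed
  define lam where "lam z = norm (P z) / norm z" for z
  define D where "D z v = (P z \<bullet> fd P z v / norm (P z)) / norm z - norm (P z) * (z \<bullet> v / norm z) / (norm z)\<^sup>2" for z v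
  define S' where "S' z v = lam z *\<^sub>R v + D z v *\<^sub>R z" for z v
  have derS: "(S has_derivative S' z) (at z)" and linD: "linear (D z)" and Dz: "D z z = (m - 1) * lam z" if z: "z \<in> \<Omega>" for z
  proof -
    note z1 = \<Omega>1[OF z]
    note d = mean_value_has_fd[OF open_ball mvP z1(1)]
    have dP: "((\<lambda>z. norm (P z)) has_derivative (\<lambda>v. P z \<bullet> fd P z v / norm (P z))) (at z)"
      using has_derivative_compose[OF d has_derivative_norm[OF z1(3)]]
      by (simp add: sgn_div_norm inner_commute divide_inverse mult.commute)
    have dz: "(norm has_derivative (\<lambda>v. z \<bullet> v / norm z)) (at z)"
      using has_derivative_norm[OF z1(2)] by (simp add: sgn_div_norm inner_commute divide_inverse mult.commute)
    have dl: "(lam has_derivative D z) (at z)"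
      unfolding lam_def [abs_def] D_def [abs_def]
      by (rule has_derivative_eq_rhs[OF has_derivative_divide'[OF dP dz]])
         (use z1(2) in \<open>auto simp: fun_eq_iff power2_eq_square field_simps\<close>)
    show "linear (D z)" by (rule has_derivative_linear[OF dl])
    show "(S has_derivative S' z) (at z)"
      using has_derivative_scaleR[OF dl has_derivative_ident]
      unfolding S_def [abs_def] S'_def [abs_def] lam_def [abs_def] by (simp add: add.commute)
    have "fd P z z = m *\<^sub>R P z" using eig[OF z1(1)] by (simp add: euler_def)
    then have "P z \<bullet> fd P z z / norm (P z) = m * norm (P z)"
      using z1(3) by (simp add: power2_norm_eq_inner[symmetric] power2_eq_square)
    then show "D z z = (m - 1) * lam z"
      unfolding D_def lam_def using z1(2)
      by (simp add: power2_norm_eq_inner[symmetric] power2_eq_square field_simps)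
  qed
  have detS: "det (matrix (S' z)) = m * lam z ^ ?n" if z: "z \<in> \<Omega>" for z
  proof -
    have "det (matrix (S' z)) = lam z ^ (?n - 1) * (lam z + D z z)"
      unfolding S'_def by (rule det_rank_one_update[OF linD[OF z]])
    also have "\<dots> = m * (lam z * lam z ^ (?n - 1))" unfolding Dz[OF z] by (simp add: algebra_simps)
    also have "lam z * lam z ^ (?n - 1) = lam z ^ ?n" by (metis n power_Suc)
    finally show ?thesis .
  qed
  have lam0: "lam z \<ge> 0" for z by (simp add: lam_def)
  have open\<Omega>: "open \<Omega>"
  proof -
    have "continuous_on (ball 0 (1/2)) (\<lambda>z. norm (P z))"
      by (intro continuous_on_norm continuous_on_subset[OF contP]) auto
    then have "open (ball 0 (1/2) \<inter> (\<lambda>z. norm (P z)) -` {..<\<eta>})"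
      by (intro continuous_open_preimage) auto
    then have "open ((ball 0 (1/2) \<inter> (\<lambda>z. norm (P z)) -` {..<\<eta>}) - {0})" by (intro open_Diff) auto
    moreover have "(ball 0 (1/2) \<inter> (\<lambda>z. norm (P z)) -` {..<\<eta>}) - {0} = \<Omega>" by (auto simp: \<Omega>_def)
    ultimately show ?thesis by simp
  qed
  define b where "b = measure lebesgue (ball (0 :: real ^ 'n) \<eta>)"
  have bpos: "b > 0" unfolding b_def using \<eta> content_ball_pos[of \<eta> "0 :: real ^ 'n"] by simp
  have "S ` \<Omega> \<in> lmeasurable \<and> measure lebesgue (S ` \<Omega>) = b"
  proof -
    have "ball (0 :: real ^ 'n) \<eta> \<in> lmeasurable" "{0 :: real ^ 'n} \<in> lmeasurable" "measure lebesgue {0 :: real ^ 'n} = 0"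
      by (auto simp: lmeasurable_compact)
    then show ?thesis unfolding imS b_def
      using measurable_measure_Diff[of "ball (0 :: real ^ 'n) \<eta>" lebesgue "{0}"] \<eta> by auto
  qed
  then have "((\<lambda>z. \<bar>det (matrix (S' z))\<bar>) has_integral b) \<Omega>"
    using has_measure_differentiable_image_finite[OF _ has_derivative_at_withinI[OF derS] injS, where m = b] open\<Omega> by simp
  then have "((\<lambda>z. m * lam z ^ ?n) has_integral b) \<Omega>"
    by (rule has_integral_eq[rotated]) (use detS lam0 m in \<open>simp add: abs_mult\<close>)
  then have "((\<lambda>z. m ^ (?n - 1) * (m * lam z ^ ?n)) has_integral m ^ (?n - 1) * b) \<Omega>"
    by (rule has_integral_mult_right)
  moreover have "m ^ (?n - 1) * (m * x) = m ^ ?n * x" for x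
    using n by (metis mult.assoc mult.commute power_Suc)
  ultimately have I1: "((\<lambda>z. m ^ ?n * lam z ^ ?n) has_integral m ^ (?n - 1) * b) \<Omega>" by (simp only:)
  \<comment> \<open>a compact set containing \<open>\<Omega>\<close>, since the area inequality is available on compact sets\<close>
  define C where "C = {z \<in> cball 0 (1/2). norm (P z) \<le> \<eta>}"
  have cb: "cball 0 (1/2) \<subseteq> ball (0 :: real ^ 'n) 1" by auto
  have Csub: "C \<subseteq> ball 0 1" unfolding C_def using cb by blast
  have "closed (cball 0 (1/2) \<inter> (\<lambda>z. norm (P z)) -` {..\<eta>})"
    by (intro continuous_closed_preimage continuous_on_norm continuous_on_subset[OF contP cb]) auto
  moreover have "C = cball 0 (1/2) \<inter> (\<lambda>z. norm (P z)) -` {..\<eta>}" by (auto simp: C_def)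
  ultimately have compC: "compact C" by (metis compact_Int_closed compact_cball inf.idem inf_assoc)
  have contfd: "continuous_on C (\<lambda>x. fd P x v)" for v
    by (rule continuous_on_subset[OF mean_value_continuous_fd[OF open_ball mvP] Csub])
  have area: "integral C (\<lambda>x. \<bar>jac P x\<bar>) \<le> measure lebesgue (P ` C)"
    by (rule approx_injective_area[OF app compC Csub continuous_on_subset[OF contP Csub] contfd])
  have "measure lebesgue (P ` C) \<le> measure lebesgue (cball (0 :: real ^ 'n) \<eta>)"
  proof (rule measure_mono_fmeasurable)
    show "P ` C \<subseteq> cball 0 \<eta>" by (auto simp: C_def)
    show "P ` C \<in> sets lebesgue"
      using lmeasurable_compact[OF compact_continuous_image[OF continuous_on_subset[OF contP Csub] compC]] by (rule fmeasurableD)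
  qed auto
  also have "\<dots> = b" unfolding b_def using \<eta> by (simp add: content_cball_conv_ball)
  finally have area': "integral C (\<lambda>x. \<bar>jac P x\<bar>) \<le> b" using area by linarith
  have K0: "0 \<le> K"
  proof (rule ccontr)
    assume "\<not> 0 \<le> K"
    have ww: "w \<in> ball 0 1" "w \<noteq> 0" using w(1) by auto
    have "norm (fd P w w) ^ ?n \<le> K * \<bar>jac P w\<bar> * norm w ^ ?n"
      using dist ww unfolding distortion_on_def by blast
    also have "\<dots> \<le> 0" using \<open>\<not> 0 \<le> K\<close> by (intro mult_nonpos_nonneg) (auto simp: mult_nonpos_nonneg)
    finally have "norm (fd P w w) ^ ?n = 0" by (metis norm_ge_zero order_antisym zero_le_power)
    then have "fd P w w = 0" by simp
    then have "m *\<^sub>R P w = 0" using eig[OF ww(1)] by (simp add: euler_def)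
    then show False using m \<eta> by (simp add: \<eta>_def)
  qed
  have Ij: "(\<lambda>x. K * \<bar>jac P x\<bar>) integrable_on C"
    by (intro integrable_on_compact compC continuous_on_mult continuous_on_const continuous_on_rabs continuous_on_det continuous_on_matrix_fd contfd)
  have \<Omega>C: "\<Omega> \<subseteq> C" by (auto simp: \<Omega>_def C_def)
  have I2: "((\<lambda>z. if z \<in> \<Omega> then m ^ ?n * lam z ^ ?n else 0) has_integral m ^ (?n - 1) * b) C"
    unfolding has_integral_restrict[OF \<Omega>C] by (rule I1)
  have "m ^ (?n - 1) * b \<le> integral C (\<lambda>x. K * \<bar>jac P x\<bar>)"
  proof (rule has_integral_le[OF I2 integrable_integral[OF Ij]])
    fix z assume z: "z \<in> C"
    show "(if z \<in> \<Omega> then m ^ ?n * lam z ^ ?n else 0) \<le> K * \<bar>jac P z\<bar>"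
    proof (cases "z \<in> \<Omega>")
      case True
      note z1 = \<Omega>1[OF True]
      have "norm (fd P z z) ^ ?n \<le> K * \<bar>jac P z\<bar> * norm z ^ ?n"
        using dist z1(1) unfolding distortion_on_def by blast
      moreover have "norm (fd P z z) = m * norm (P z)" using eig[OF z1(1)] m by (simp add: euler_def)
      ultimately have "(m * norm (P z)) ^ ?n / norm z ^ ?n \<le> K * \<bar>jac P z\<bar>"
        using z1(2) by (simp add: divide_simps)
      then show ?thesis using True by (simp add: lam_def power_mult_distrib power_divide)
    next
      case False
      then show ?thesis using K0 by simp
    qed
  qed
  also have "\<dots> = K * integral C (\<lambda>x. \<bar>jac P x\<bar>)" by (rule integral_mult_right)
  also have "\<dots> \<le> K * b" using area' K0 by (intro mult_left_mono)
  finally show ?thesis using bpos by simp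
qed

section \<open>Critical points\<close>

lemma norm_le_derivative_bound:
  fixes \<phi> :: "real \<Rightarrow> 'b::euclidean_space"
  assumes d: "\<And>s. s \<in> {0..t} \<Longrightarrow> (\<phi> has_vector_derivative \<phi>' s) (at s within {0..t})" and z: "\<phi> 0 = 0"
    and B: "\<And>s. s \<in> {0..t} \<Longrightarrow> norm (\<phi>' s) \<le> B" and t: "0 \<le> t"
  shows "norm (\<phi> t) \<le> B * t"
proof -
  have "norm (\<phi> t - \<phi> 0) \<le> B * norm (t - 0)"
  proof (rule differentiable_bound[where S = "{0..t}" and f' = "\<lambda>s h. h *\<^sub>R \<phi>' s"])
    fix s assume s: "s \<in> {0..t}"
    show "(\<phi> has_derivative (\<lambda>h. h *\<^sub>R \<phi>' s)) (at s within {0..t})" using d[OF s] unfolding has_vector_derivative_def .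
    show "onorm (\<lambda>h. h *\<^sub>R \<phi>' s) \<le> B"
      by (rule onorm_le) (auto simp: mult.commute[of B] intro!: mult_left_mono B[OF s])
  qed (use t in auto)
  then show ?thesis using z t by simp
qed

text \<open>
  The odd part \<open>P z - P (- z)\<close> has vanishing derivatives of order \<open>0\<close> and \<open>2\<close> at the origin by
  symmetry, and of order \<open>1\<close> by assumption. So it is of third order along each ray, which
  homogeneity of degree less than \<open>3\<close> permits only for the zero map.
\<close>

lemma homogeneous_imp_even:
  fixes P :: "'a::euclidean_space \<Rightarrow> 'b::euclidean_space"
  assumes mv: "mean_value_on (ball 0 1) P" and eig: "\<And>z. z \<in> ball 0 1 \<Longrightarrow> euler P z = m *\<^sub>R P z"
    and m: "m < 3" and d0: "\<And>v. fd P 0 v = 0" and z: "z \<in> ball 0 1"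
  shows "P (- z) = P z"
proof -
  have U: "open (ball (0::'a) 1)" by simp
  define D1 where "D1 y = fd P y z" for y
  define D2 where "D2 y = fd D1 y z" for y
  define D3 where "D3 y = fd D2 y z" for y
  have mv1: "mean_value_on (ball 0 1) D1" unfolding D1_def [abs_def] by (rule mean_value_on_fd[OF U mv])
  have mv2: "mean_value_on (ball 0 1) D2" unfolding D2_def [abs_def] by (rule mean_value_on_fd[OF U mv1])
  have mv3: "mean_value_on (ball 0 1) D3" unfolding D3_def [abs_def] by (rule mean_value_on_fd[OF U mv2])
  have mem: "s *\<^sub>R z \<in> ball 0 1" "- (s *\<^sub>R z) \<in> ball 0 1" if "s \<in> {0..1}" for s
  proof -
    have "s * norm z \<le> norm z" using that by (simp add: mult_left_le_one_le)
    then show "s *\<^sub>R z \<in> ball 0 1" "- (s *\<^sub>R z) \<in> ball 0 1" using z that by auto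
  qed
  have dp: "((\<lambda>s. h (s *\<^sub>R z)) has_vector_derivative fd h (s *\<^sub>R z) z) (at s within T)"
    if h: "mean_value_on (ball 0 1) h" and s: "s \<in> {0..1}" for h :: "'a \<Rightarrow> 'b" and s T
  proof -
    note d = mean_value_has_fd[OF U h mem(1)[OF s]]
    have "((\<lambda>s. s *\<^sub>R z) has_derivative (\<lambda>k. k *\<^sub>R z)) (at s)" by (auto intro!: derivative_eq_intros)
    from has_derivative_compose[OF this d]
    show ?thesis unfolding has_vector_derivative_def
      using linear_cmul[OF has_derivative_linear[OF d]] has_derivative_at_withinI by auto
  qed
  have dm: "((\<lambda>s. h (- (s *\<^sub>R z))) has_vector_derivative - fd h (- (s *\<^sub>R z)) z) (at s within T)"
    if h: "mean_value_on (ball 0 1) h" and s: "s \<in> {0..1}" for h :: "'a \<Rightarrow> 'b" and s T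
  proof -
    note d = mean_value_has_fd[OF U h mem(2)[OF s]]
    have "((\<lambda>s. - (s *\<^sub>R z)) has_derivative (\<lambda>k. - (k *\<^sub>R z))) (at s)" by (auto intro!: derivative_eq_intros)
    from has_derivative_compose[OF this d]
    have "((\<lambda>s. h (- (s *\<^sub>R z))) has_derivative (\<lambda>k. fd h (- (s *\<^sub>R z)) (- (k *\<^sub>R z)))) (at s)" .
    moreover have "(\<lambda>k. fd h (- (s *\<^sub>R z)) (- (k *\<^sub>R z))) = (\<lambda>k. k *\<^sub>R - fd h (- (s *\<^sub>R z)) z)"
      using linear_cmul[OF has_derivative_linear[OF d]] linear_neg[OF has_derivative_linear[OF d]] by (simp add: fun_eq_iff)
    ultimately show ?thesis unfolding has_vector_derivative_def
      by (metis has_derivative_at_withinI)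
  qed
  have "bounded ((\<lambda>s. D3 (s *\<^sub>R z) + D3 (- (s *\<^sub>R z))) ` {0..1})"
  proof (intro compact_imp_bounded compact_continuous_image continuous_on_add)
    show "continuous_on {0..1} (\<lambda>s. D3 (s *\<^sub>R z))"
    proof (rule continuous_on_compose2[OF mean_value_on_continuous[OF mv3]])
      show "(\<lambda>s. s *\<^sub>R z) ` {0..1} \<subseteq> ball 0 1" using mem(1) by blast
    qed (intro continuous_intros)
    show "continuous_on {0..1} (\<lambda>s. D3 (- (s *\<^sub>R z)))"
    proof (rule continuous_on_compose2[OF mean_value_on_continuous[OF mv3]])
      show "(\<lambda>s. - (s *\<^sub>R z)) ` {0..1} \<subseteq> ball 0 1" using mem(2) by blast
    qed (intro continuous_intros)
  qed auto
  then obtain M where "\<forall>y\<in>(\<lambda>s. D3 (s *\<^sub>R z) + D3 (- (s *\<^sub>R z))) ` {0..1}. norm y \<le> M"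
    unfolding bounded_iff by blast
  then have M: "\<And>s. s \<in> {0..1} \<Longrightarrow> norm (D3 (s *\<^sub>R z) + D3 (- (s *\<^sub>R z))) \<le> M" by blast
  have M0: "0 \<le> M" using M[of 0] norm_ge_zero order_trans by (metis atLeastAtMost_iff order_refl zero_le_one)
  have b2: "norm (D2 (t *\<^sub>R z) - D2 (- (t *\<^sub>R z))) \<le> M * t" if t: "t \<in> {0..1}" for t
  proof (rule norm_le_derivative_bound[where \<phi> = "\<lambda>s. D2 (s *\<^sub>R z) - D2 (- (s *\<^sub>R z))" and \<phi>' = "\<lambda>s. D3 (s *\<^sub>R z) + D3 (- (s *\<^sub>R z))"])
    fix s assume "s \<in> {0..t}"
    then have s: "s \<in> {0..1}" using t by auto
    show "norm (D3 (s *\<^sub>R z) + D3 (- (s *\<^sub>R z))) \<le> M" by (rule M[OF s])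
    show "((\<lambda>s. D2 (s *\<^sub>R z) - D2 (- (s *\<^sub>R z))) has_vector_derivative D3 (s *\<^sub>R z) + D3 (- (s *\<^sub>R z))) (at s within {0..t})"
      using has_vector_derivative_diff[OF dp[OF mv2 s] dm[OF mv2 s]] by (simp add: D3_def)
  qed (use t in auto)
  have b1: "norm (D1 (t *\<^sub>R z) + D1 (- (t *\<^sub>R z))) \<le> M * t * t" if t: "t \<in> {0..1}" for t
  proof (rule norm_le_derivative_bound[where \<phi> = "\<lambda>s. D1 (s *\<^sub>R z) + D1 (- (s *\<^sub>R z))" and \<phi>' = "\<lambda>s. D2 (s *\<^sub>R z) - D2 (- (s *\<^sub>R z))"])
    fix s assume st: "s \<in> {0..t}"
    then have s: "s \<in> {0..1}" using t by auto
    show "norm (D2 (s *\<^sub>R z) - D2 (- (s *\<^sub>R z))) \<le> M * t"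
      using b2[OF s] mult_left_mono[of s t M] st M0 by simp
    show "((\<lambda>s. D1 (s *\<^sub>R z) + D1 (- (s *\<^sub>R z))) has_vector_derivative D2 (s *\<^sub>R z) - D2 (- (s *\<^sub>R z))) (at s within {0..t})"
      using has_vector_derivative_add[OF dp[OF mv1 s] dm[OF mv1 s]] by (simp add: D2_def)
  qed (use t d0 in \<open>auto simp: D1_def\<close>)
  have b0: "norm (P (t *\<^sub>R z) - P (- (t *\<^sub>R z))) \<le> M * t * t * t" if t: "t \<in> {0..1}" for t
  proof (rule norm_le_derivative_bound[where \<phi> = "\<lambda>s. P (s *\<^sub>R z) - P (- (s *\<^sub>R z))" and \<phi>' = "\<lambda>s. D1 (s *\<^sub>R z) + D1 (- (s *\<^sub>R z))"])
    fix s assume st: "s \<in> {0..t}"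
    then have s: "s \<in> {0..1}" using t by auto
    have "M * s * s \<le> M * t * t" using st M0 by (intro mult_mono) auto
    then show "norm (D1 (s *\<^sub>R z) + D1 (- (s *\<^sub>R z))) \<le> M * t * t" using b1[OF s] by simp
    show "((\<lambda>s. P (s *\<^sub>R z) - P (- (s *\<^sub>R z))) has_vector_derivative D1 (s *\<^sub>R z) + D1 (- (s *\<^sub>R z))) (at s within {0..t})"
      using has_vector_derivative_diff[OF dp[OF mv s] dm[OF mv s]] by (simp add: D1_def)
  qed (use t in auto)
  have b: "norm (P z - P (- z)) \<le> M * t powr (3 - m)" if t: "0 < t" "t \<le> 1" for t
  proof -
    have "P (t *\<^sub>R z) - P (- (t *\<^sub>R z)) = t powr m *\<^sub>R (P z - P (- z))"
      using euler_eigen_homogeneous[OF mv eig z t] euler_eigen_homogeneous[OF mv eig _ t, of "- z"] z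
      by (simp add: scaleR_diff_right)
    then have "t powr m * norm (P z - P (- z)) \<le> M * t powr 3"
      using b0[of t] t by (simp add: powr_numeral power3_eq_cube mult.assoc)
    then have "norm (P z - P (- z)) \<le> M * t powr 3 / t powr m" using t by (simp add: pos_le_divide_eq mult.commute)
    then show ?thesis by (simp add: powr_diff)
  qed
  have lim: "((\<lambda>t. M * t powr (3 - m)) \<longlongrightarrow> M * 0) (at_right 0)"
  proof (intro tendsto_mult tendsto_const)
    show "((\<lambda>t. t powr (3 - m)) \<longlongrightarrow> 0) (at_right 0)"
      by (rule tendsto_zero_powrI[OF tendsto_ident_at tendsto_const]) (use m in \<open>auto simp: eventually_at_filter\<close>)
  qed
  have "norm (P z - P (- z)) \<le> M * 0"
  proof (rule tendsto_lowerbound[OF lim])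
    show "\<forall>\<^sub>F t in at_right 0. norm (P z - P (- z)) \<le> M * t powr (3 - m)"
      by (rule eventually_mono[OF eventually_at_right_real[of 0 1]]) (use b in auto)
  qed simp
  then show ?thesis by simp
qed

text \<open>
  If \<open>f\<close> did not vanish, its blow-up \<open>P\<close> at the origin would be even, with invertible derivative at two
  antipodal points. An injective map close to \<open>P\<close> would take the value \<open>P z0 = P (- z0)\<close> near both
  of them.
\<close>

theorem critical_point_imp_zero:
  fixes f :: "real ^ 'n::finite \<Rightarrow> real ^ 'n"
  assumes q: "qc_limit_on K (ball 0 R) f" and K: "K < 3 ^ (CARD('n) - 1)"
    and f0: "f 0 = 0" and d0: "\<And>v. fd f 0 v = 0" and x: "x \<in> ball 0 R"
  shows "f x = 0"
proof (rule ccontr)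
  assume fx: "f x \<noteq> 0"
  have mvf: "mean_value_on (ball 0 R) f" using q unfolding qc_limit_on_def by blast
  obtain \<tau> a P m where \<tau>: "\<And>k::nat. 0 < \<tau> k" "\<And>k. \<tau> k < R" "\<tau> \<longlonglongrightarrow> 0" and a: "\<And>k. 0 < a k"
    and mvP: "mean_value_on (ball 0 1) P"
    and lim: "uniform_limit (ball 0 1) (\<lambda>k z. a k *\<^sub>R f (\<tau> k *\<^sub>R z)) P sequentially"
    and Pnz: "\<exists>z\<in>ball 0 1. P z \<noteq> 0" and m0: "0 \<le> m" and eig: "\<And>z. z \<in> ball 0 1 \<Longrightarrow> euler P z = m *\<^sub>R P z"
    by (rule blow_up[OF mvf x fx]) (rule that; (assumption | blast))
  define F where "F k z = a k *\<^sub>R f (\<tau> k *\<^sub>R z)" for k z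
  have lim': "uniform_limit (ball 0 1) F P sequentially" using lim by (simp add: F_def [abs_def])
  have mem1: "\<tau> k *\<^sub>R z \<in> ball 0 R" if "z \<in> ball 0 1" for k and z :: "real ^ 'n"
  proof -
    have "\<tau> k * norm z \<le> \<tau> k * 1" using \<tau>(1)[of k] that by (intro mult_left_mono) auto
    then have "\<tau> k * norm z < R" using \<tau>(2)[of k] by simp
    then show ?thesis using \<tau>(1)[of k] by simp
  qed
  have qF: "qc_limit_on K (ball 0 1) (F k)" for k
    using qc_limit_on_affine[OF q open_ball \<tau>(1) a, of "ball 0 1" 0 k k] mem1 by (simp add: F_def [abs_def])
  have mvF': "mean_value_on (ball 0 1) (F k)" for k using qF unfolding qc_limit_on_def by blast
  have qP: "qc_limit_on K (ball 0 1) P" by (rule qc_limit_on_limit[OF qF lim'])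
  have z01: "(0 :: real ^ 'n) \<in> ball 0 1" by simp
  have "(\<lambda>k. F k 0) \<longlonglongrightarrow> P 0" by (rule tendsto_uniform_limitI[OF lim' z01])
  moreover have "(\<lambda>k. F k 0) = (\<lambda>k. 0)" by (simp add: F_def f0)
  ultimately have P0: "P 0 = 0" using LIMSEQ_unique[OF tendsto_const] by metis
  have dP0: "fd P 0 v = 0" for v
  proof -
    have R0: "(0 :: real ^ 'n) \<in> ball 0 R" using mem1[OF z01] by simp
    note d = mean_value_has_fd[OF open_ball mvf R0]
    have "fd (F k) 0 v = 0" for k
      using fd_scaled[of f 0 "\<tau> k" 0 "a k"] d d0 by (simp add: F_def [abs_def])
    then show ?thesis using fd_tendsto[OF mvF' lim' z01, of v] LIMSEQ_unique[OF tendsto_const] by (simp add: LIMSEQ_const_iff)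
  qed
  have mpos: "0 < m"
  proof (rule ccontr)
    assume "\<not> 0 < m"
    then have m: "m = 0" using m0 by simp
    have "P z = 0" if z: "z \<in> ball 0 1" for z
    proof -
      have "(\<lambda>k. inverse (real (Suc k)) *\<^sub>R z) \<longlonglongrightarrow> 0 *\<^sub>R z"
        by (intro tendsto_intros LIMSEQ_inverse_real_of_nat)
      moreover have "isCont P 0"
        using mean_value_on_continuous[OF mvP] z01 by (simp add: continuous_on_eq_continuous_at)
      ultimately have "(\<lambda>k. P (inverse (real (Suc k)) *\<^sub>R z)) \<longlonglongrightarrow> P 0"
        by (intro isCont_tendsto_compose[of 0 P]) auto
      moreover have "P (inverse (real (Suc k)) *\<^sub>R z) = P z" for k
        using euler_eigen_homogeneous[OF mvP eig z, of "inverse (real (Suc k))"] m by (simp add: field_simps)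
      ultimately show ?thesis using P0 by (simp add: LIMSEQ_const_iff)
    qed
    then show False using Pnz by blast
  qed
  have nz: "P z \<noteq> 0" if "z \<in> ball 0 1" "z \<noteq> 0" for z
    by (rule homogeneous_nonzero[OF qP eig Pnz that])
  have "m ^ (CARD('n) - 1) \<le> K" by (rule homogeneity_degree_bound[OF qP eig nz mpos])
  then have "m ^ (CARD('n) - 1) < 3 ^ (CARD('n) - 1)" using K by simp
  then have m3: "m < 3" by (rule power_less_imp_less_base) simp
  have even: "P (- z) = P z" if "z \<in> ball 0 1" for z
    by (rule homogeneous_imp_even[OF mvP eig m3 dP0 that])
  obtain z0 where z0: "z0 \<in> ball 0 1" "jac P z0 \<noteq> 0"
    using zero_jacobian_imp_constant[OF qP] Pnz P0 by metis
  have lin: "linear (fd P z)" if "z \<in> ball 0 1" for z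
    by (rule has_derivative_linear[OF mean_value_has_fd[OF open_ball mvP that]])
  have z0n: "z0 \<noteq> 0"
  proof
    assume "z0 = 0"
    then have "inj (fd P 0)" using z0 det_nz_iff_inj[OF lin[OF z01]] by simp
    moreover have "fd P 0 (axis undefined 1) = fd P 0 0" using dP0 by simp
    ultimately have "axis undefined (1::real) = (0 :: real ^ 'n)" by (simp add: inj_eq)
    then show False by simp
  qed
  define w where "w = - z0"
  have w: "w \<in> ball 0 1" "P w = P z0" using z0 even[of z0] by (auto simp: w_def)
  have inj0: "inj (fd P z0)" using z0 det_nz_iff_inj[OF lin] by blast
  have injw: "inj (fd P w)"
  proof -
    have "((\<lambda>z. - z) has_derivative (\<lambda>v. - v)) (at z0)" by (auto intro!: derivative_eq_intros)
    from has_derivative_compose[OF this mean_value_has_fd[OF open_ball mvP w(1), unfolded w_def]]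
    have "((\<lambda>z. P (- z)) has_derivative (\<lambda>v. fd P w (- v))) (at z0)" by (simp add: w_def)
    then have "(P has_derivative (\<lambda>v. fd P w (- v))) (at z0)"
      by (rule has_derivative_transform_within_open[OF _ open_ball z0(1)]) (rule even)
    then have e: "fd P z0 = (\<lambda>v. fd P w (- v))" by (rule has_derivative_imp_fd)
    show ?thesis
    proof (rule injI)
      fix u v assume "fd P w u = fd P w v"
      then have "fd P z0 (- u) = fd P z0 (- v)" by (simp add: e)
      then show "u = v" using inj0 by (simp add: inj_eq)
    qed
  qed
  \<comment> \<open>small enough that the closed balls of radius \<open>\<delta>\<close> about the antipodal points lie in the unit ball and
     are disjoint\<close>
  define \<delta> where "\<delta> = min (norm z0 / 2) ((1 - norm z0) / 2)"
  have \<delta>: "\<delta> > 0" using z0 z0n by (auto simp: \<delta>_def)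
  obtain d1 \<epsilon>1 where 1: "0 < d1" "d1 \<le> \<delta>" "0 < \<epsilon>1"
    "\<And>g. continuous_on (cball z0 d1) g \<Longrightarrow> (\<And>x. x \<in> cball z0 d1 \<Longrightarrow> norm (g x - P x) \<le> \<epsilon>1) \<Longrightarrow> \<exists>y\<in>cball z0 d1. g y = P z0"
    by (rule stable_local_surjectivity[OF mean_value_has_fd[OF open_ball mvP z0(1)] inj0 \<delta>]) (rule that; (assumption | blast))
  obtain d2 \<epsilon>2 where 2: "0 < d2" "d2 \<le> \<delta>" "0 < \<epsilon>2"
    "\<And>g. continuous_on (cball w d2) g \<Longrightarrow> (\<And>x. x \<in> cball w d2 \<Longrightarrow> norm (g x - P x) \<le> \<epsilon>2) \<Longrightarrow> \<exists>y\<in>cball w d2. g y = P w"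
    by (rule stable_local_surjectivity[OF mean_value_has_fd[OF open_ball mvP w(1)] injw \<delta>]) (rule that; (assumption | blast))
  define C where "C = cball z0 d1 \<union> cball w d2"
  have compC: "compact C" by (auto simp: C_def)
  have sub: "cball u d \<subseteq> ball 0 1" if "norm u = norm z0" "d \<le> \<delta>" for u :: "real ^ 'n" and d
  proof
    fix y assume "y \<in> cball u d"
    then have "norm (y - u) \<le> (1 - norm z0) / 2" using that by (simp add: dist_norm norm_minus_commute \<delta>_def)
    then show "y \<in> ball 0 1" using norm_triangle_sub[of y u] that z0 by simp
  qed
  have Csub: "C \<subseteq> ball 0 1" unfolding C_def using sub[of z0 d1] sub[of w d2] 1 2 by (auto simp: w_def)
  obtain g where g: "inj_on g C" "\<And>x. x \<in> C \<Longrightarrow> g differentiable (at x)" "\<And>x. x \<in> C \<Longrightarrow> norm (g x - P x) \<le> min \<epsilon>1 \<epsilon>2"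
    using qP compC Csub 1(3) 2(3) unfolding qc_limit_on_def approx_injective_on_def
    by (metis min_less_iff_conj)
  have contg: "continuous_on C g"
    using g(2) differentiable_imp_continuous_within continuous_at_imp_continuous_on by blast
  obtain y1 where y1: "y1 \<in> cball z0 d1" "g y1 = P z0"
    using 1(4)[OF continuous_on_subset[OF contg]] g(3) unfolding C_def by fastforce
  obtain y2 where y2: "y2 \<in> cball w d2" "g y2 = P w"
    using 2(4)[OF continuous_on_subset[OF contg]] g(3) unfolding C_def by fastforce
  have "y1 \<in> C" "y2 \<in> C" "g y1 = g y2" using y1 y2 w(2) by (auto simp: C_def)
  then have "y1 = y2" using inj_onD[OF g(1)] by blast
  have "norm (z0 - w) \<le> norm (z0 - y1) + norm (y1 - w)" using norm_triangle_ineq[of "z0 - y1" "y1 - w"] by simp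
  also have "\<dots> \<le> norm z0 / 2 + norm z0 / 2"
    using y1(1) y2(1) \<open>y1 = y2\<close> 1(2) 2(2) by (intro add_mono) (auto simp: dist_norm \<delta>_def norm_minus_commute)
  finally have "norm (2 *\<^sub>R z0) \<le> norm z0" by (simp add: w_def scaleR_2)
  then show False using z0n by simp
qed

section \<open>A capacity estimate\<close>

text \<open>
  A continuously differentiable transition from \<open>0\<close> to \<open>1\<close> on the unit interval, obtained by composing
  two truncated cubes.
\<close>

definition smooth_step :: "real \<Rightarrow> real" where
  "smooth_step s = 1 - (max 0 (1 - (max 0 s) ^ 3)) ^ 3"

definition smooth_step' :: "real \<Rightarrow> real" where
  "smooth_step' s = 9 * (max 0 (1 - (max 0 s) ^ 3))\<^sup>2 * (max 0 s)\<^sup>2"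

lemma smooth_step_derivative: "(smooth_step has_field_derivative smooth_step' s) (at s)"
proof -
  have "((\<lambda>s. 1 - (max 0 s) ^ 3) has_field_derivative - (3 * (max 0 s)\<^sup>2)) (at s)"
    using DERIV_diff[OF DERIV_const DERIV_pos_part_cube[of s], of 1] by simp
  from DERIV_chain2[OF DERIV_pos_part_cube this]
  have "((\<lambda>s. (max 0 (1 - (max 0 s) ^ 3)) ^ 3) has_field_derivative
      3 * (max 0 (1 - (max 0 s) ^ 3))\<^sup>2 * - (3 * (max 0 s)\<^sup>2)) (at s)" .
  from DERIV_diff[OF DERIV_const this, of 1] show ?thesis
    unfolding smooth_step_def [abs_def] smooth_step'_def by (simp add: mult_ac)
qed

lemma smooth_step_le0: "s \<le> 0 \<Longrightarrow> smooth_step s = 0"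
  by (simp add: smooth_step_def max_def)

lemma smooth_step_ge1: "1 \<le> s \<Longrightarrow> smooth_step s = 1"
proof -
  assume s: "1 \<le> s"
  then have "1 \<le> s ^ 3" by simp
  then have "max 0 (1 - s ^ 3) = 0" "max 0 s = s" using s by auto
  then show ?thesis by (simp add: smooth_step_def)
qed

lemma smooth_step'_zero: "s \<le> 0 \<or> 1 \<le> s \<Longrightarrow> smooth_step' s = 0"
proof (elim disjE)
  assume s: "1 \<le> s"
  then have "1 \<le> s ^ 3" by simp
  then have "max 0 (1 - s ^ 3) = 0" "max 0 s = s" using s by auto
  then show ?thesis by (simp add: smooth_step'_def)
qed (simp add: smooth_step'_def max_def)

lemma smooth_step'_bounds: "0 \<le> smooth_step' s" "smooth_step' s \<le> 9"
proof -
  show "0 \<le> smooth_step' s" by (simp add: smooth_step'_def)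
  show "smooth_step' s \<le> 9"
  proof (cases "s \<le> 0 \<or> 1 \<le> s")
    case False
    have "(max 0 (1 - (max 0 s) ^ 3))\<^sup>2 \<le> 1" using False by (intro power_le_one) (auto simp: max_def)
    moreover have "(max 0 s)\<^sup>2 \<le> 1" using False by (intro power_le_one) auto
    ultimately have "(max 0 (1 - (max 0 s) ^ 3))\<^sup>2 * (max 0 s)\<^sup>2 \<le> 1 * 1" by (intro mult_mono) auto
    then show ?thesis by (simp add: smooth_step'_def)
  qed (simp add: smooth_step'_zero)
qed

lemma continuous_on_smooth_step': "continuous_on S smooth_step'"
  unfolding smooth_step'_def [abs_def] by (intro continuous_intros)

text \<open>
  Affine in \<open>norm v ^ 2\<close>, hence smooth, and increasing from \<open>0\<close> to \<open>1\<close> across the shell between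
  the radii \<open>a\<close> and \<open>2 * a\<close>.
\<close>

definition shell :: "real \<Rightarrow> 'a::real_inner \<Rightarrow> real" where
  "shell a v = (v \<bullet> v - a\<^sup>2) / (3 * a\<^sup>2)"

lemma shell_le0: "norm v \<le> a \<Longrightarrow> shell a v \<le> 0"
  unfolding shell_def power2_norm_eq_inner[symmetric]
  using power_mono[of "norm v" a 2] by (intro divide_nonpos_nonneg) auto

lemma shell_ge1: "0 < a \<Longrightarrow> 2 * a \<le> norm v \<Longrightarrow> 1 \<le> shell a v"
  unfolding shell_def power2_norm_eq_inner[symmetric]
  using power_mono[of "2 * a" "norm v" 2] by (simp add: power_mult_distrib divide_simps)

text \<open>
  Young's inequality without sharp constants: either \<open>t \<le> l\<close>, or \<open>t\<close> is at most \<open>t * (t / l) ^ (n - 1)\<close>.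
\<close>

lemma young_split:
  fixes t l :: real
  assumes "0 \<le> t" "0 < l" "n \<ge> 1"
  shows "t \<le> l + t ^ n / l ^ (n - 1)"
proof (cases "t \<le> l")
  case True
  moreover have "0 \<le> t ^ n / l ^ (n - 1)" using assms by simp
  ultimately show ?thesis by simp
next
  case False
  have "l ^ (n - 1) \<le> t ^ (n - 1)" using False assms by (intro power_mono) auto
  then have "t * l ^ (n - 1) \<le> t * t ^ (n - 1)" using assms by (intro mult_left_mono)
  also have "\<dots> = t ^ n" using assms(3) by (metis Suc_diff_le diff_Suc_Suc diff_zero plus_1_eq_Suc power_Suc le_add_diff_inverse)
  finally have "t \<le> t ^ n / l ^ (n - 1)" using assms by (simp add: pos_le_divide_eq)
  then show ?thesis using assms by simp
qed

lemma measure_ball_scale: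
  fixes c :: "real ^ 'n::finite"
  assumes "0 \<le> r"
  shows "measure lebesgue (ball c r) = unit_ball_vol (real (CARD('n))) * r ^ CARD('n)"
    and "measure lebesgue (cball c r) = unit_ball_vol (real (CARD('n))) * r ^ CARD('n)"
  using assms by (simp_all add: content_ball content_cball)

text \<open>
  Let \<open>W\<close> be the smooth step of \<open>shell a (h y - h x)\<close>, extended by \<open>1\<close> outside \<open>U\<close>. It is \<open>0\<close> on
  \<open>cball x (d/2)\<close>, and \<open>1\<close> on the translate of this ball by \<open>3/2 * d\<close> in the direction \<open>e\<close>, which lies
  outside \<open>U\<close>. Hence some intermediate translate sees a large integral of the derivative of \<open>W\<close>,
  which is supported in \<open>A\<close>. Young's inequality splits this integral into the measure of \<open>A\<close> and the
  \<open>n\<close>-energy of \<open>W\<close>, and the energy is at most a constant by bounded distortion, because the integral of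
  the Jacobian over \<open>A\<close> is the volume of an image contained in a ball of radius \<open>2 * a\<close>.
\<close>

lemma shell_crossing:
  fixes h :: "real ^ 'n::finite \<Rightarrow> real ^ 'n"
  assumes U: "open U" and inj: "inj_on h U" and der: "\<And>y. y \<in> U \<Longrightarrow> (h has_derivative fd h y) (at y)"
    and cont: "\<And>v. continuous_on U (\<lambda>y. fd h y v)" and dist: "distortion_on K U h" and K: "0 < K"
    and d: "0 < d" and e: "norm e = 1"
    and sub: "cball x (d/2) \<subseteq> U" and exit: "\<And>y. y \<in> cball x (d/2) \<Longrightarrow> y + (3/2 * d) *\<^sub>R e \<notin> U"
    and a: "0 < a" and img: "cball (h x) (2 * a) \<subseteq> h ` U"
    and inner: "\<And>y. y \<in> cball x (d/2) \<Longrightarrow> norm (h y - h x) \<le> a"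
    and l: "0 < l"
  defines "A \<equiv> {y \<in> U. a < norm (h y - h x) \<and> norm (h y - h x) < 2 * a}"
    and "b1 \<equiv> unit_ball_vol (real (CARD('n)))"
  shows "b1 * (d/2) ^ CARD('n) \<le> (3/2 * d) * (l * measure lebesgue (A \<inter> cball x (2 * d)) + 24 ^ CARD('n) * K * b1 / l ^ (CARD('n) - 1))"
proof -
  let ?n = "CARD('n)"
  let ?s = "\<lambda>y. shell a (h y - h x)"
  have conth: "continuous_on U h"
    by (rule has_derivative_continuous_on) (use der has_derivative_at_withinI in blast)
  \<comment> \<open>\<open>G\<close> is the preimage of a closed ball inside the open image, hence compact. So the extension of \<open>W\<close> by
     the constant \<open>1\<close> is smooth across the boundary of \<open>U\<close>.\<close>
  define G where "G = {y \<in> U. norm (h y - h x) \<le> 2 * a}"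
  have compG: "compact G"
  proof -
    obtain k where k: "homeomorphism U (h ` U) h k" using invariance_of_domain_homeomorphism[OF U conth _ inj] by auto
    have "G = k ` cball (h x) (2 * a)"
    proof
      show "G \<subseteq> k ` cball (h x) (2 * a)"
      proof
        fix y assume "y \<in> G"
        then have "h y \<in> cball (h x) (2 * a)" "k (h y) = y"
          using k by (auto simp: G_def dist_norm norm_minus_commute homeomorphism_def)
        then show "y \<in> k ` cball (h x) (2 * a)" by (metis imageI)
      qed
      show "k ` cball (h x) (2 * a) \<subseteq> G"
      proof
        fix y assume "y \<in> k ` cball (h x) (2 * a)"
        then obtain p where p: "p \<in> cball (h x) (2 * a)" "y = k p" by blast
        then have "p \<in> h ` U" using img by blast
        then have "y \<in> U" "h y = p" using k p(2) by (auto simp: homeomorphism_def)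
        then show "y \<in> G" using p(1) by (simp add: G_def dist_norm norm_minus_commute)
      qed
    qed
    moreover have "continuous_on (cball (h x) (2 * a)) k"
      by (rule continuous_on_subset[OF homeomorphism_cont2[OF k] img])
    ultimately show ?thesis by (simp add: compact_continuous_image)
  qed
  have oG: "open (- G)" using compG by (simp add: compact_imp_closed open_Compl)
  define W where "W y = (if y \<in> U then smooth_step (?s y) else 1)" for y
  define W' where "W' y v = (if y \<in> U then smooth_step' (?s y) * (2 * ((h y - h x) \<bullet> fd h y v) / (3 * a\<^sup>2)) else 0)" for y v
  have outG: "W y = 1" "W' y v = 0" if "y \<notin> G" for y v
    using that a shell_ge1[of a "h y - h x"] smooth_step_ge1 smooth_step'_zero by (auto simp: W_def W'_def G_def)
  have derW: "(W has_derivative W' y) (at y)" for y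
  proof (cases "y \<in> U")
    case True
    have "((\<lambda>y. h y - h x) has_derivative fd h y) (at y)"
      using has_derivative_diff[OF der[OF True] has_derivative_const[of "h x"]] by simp
    from has_derivative_diff[OF has_derivative_inner[OF this this] has_derivative_const[of "a\<^sup>2"]]
    have "((\<lambda>y. (h y - h x) \<bullet> (h y - h x) - a\<^sup>2) has_derivative (\<lambda>v. 2 * ((h y - h x) \<bullet> fd h y v))) (at y)"
      by (rule has_derivative_eq_rhs) (auto simp: fun_eq_iff inner_commute)
    then have "(?s has_derivative (\<lambda>v. 2 * ((h y - h x) \<bullet> fd h y v) / (3 * a\<^sup>2))) (at y)"
      unfolding shell_def by (rule bounded_linear.has_derivative[OF bounded_linear_divide])
    from has_derivative_compose[OF this smooth_step_derivative[unfolded has_field_derivative_def]]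
    have "((\<lambda>y. smooth_step (?s y)) has_derivative W' y) (at y)" using True by (simp add: W'_def [abs_def])
    then show ?thesis
      by (rule has_derivative_transform_within_open[OF _ U True]) (simp add: W_def)
  next
    case False
    then have y: "y \<in> - G" by (simp add: G_def)
    have "((\<lambda>y. 1) has_derivative W' y) (at y)" using False by (simp add: W'_def [abs_def])
    then show ?thesis
      by (rule has_derivative_transform_within_open[OF _ oG y]) (use outG in auto)
  qed
  have contW': "continuous_on UNIV (\<lambda>y. W' y e)"
  proof -
    have 1: "continuous_on U (\<lambda>y. W' y e)"
    proof (rule continuous_on_eq)
      show "continuous_on U (\<lambda>y. smooth_step' (?s y) * (2 * ((h y - h x) \<bullet> fd h y e) / (3 * a\<^sup>2)))"
        unfolding shell_def
        by (intro continuous_intros continuous_on_compose2[OF continuous_on_smooth_step'[of UNIV]] conth cont) (use a in auto)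
    qed (simp add: W'_def)
    have 2: "continuous_on (- G) (\<lambda>y. W' y e)"
      by (rule continuous_on_eq[where f = "\<lambda>_. 0"]) (use outG in auto)
    have "continuous_on (U \<union> - G) (\<lambda>y. W' y e)"
      by (rule continuous_on_open_Un[OF U oG 1 2])
    moreover have "U \<union> - G = UNIV" by (auto simp: G_def)
    ultimately show ?thesis by simp
  qed
  have contW: "continuous_on UNIV W"
    by (rule has_derivative_continuous_on) (use derW has_derivative_at_withinI in blast)
  let ?Q = "cball x (d/2)" and ?T = "3/2 * d"
  define \<phi> where "\<phi> s = integral ?Q (\<lambda>y. W (y + s *\<^sub>R e))" for s
  have der\<phi>: "(\<phi> has_real_derivative integral ?Q (\<lambda>y. W' (y + s *\<^sub>R e) e)) (at s)" for s
    unfolding \<phi>_def has_real_derivative_iff_has_vector_derivative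
  proof (rule has_vector_derivative_integral_compact[where f' = "\<lambda>s y. W' (y + s *\<^sub>R e) e"])
    fix s y
    have "((\<lambda>s. y + s *\<^sub>R e) has_derivative (\<lambda>k. k *\<^sub>R e)) (at s)" by (auto intro!: derivative_eq_intros)
    from has_derivative_compose[OF this derW]
    show "((\<lambda>s. W (y + s *\<^sub>R e)) has_vector_derivative W' (y + s *\<^sub>R e) e) (at s)"
      unfolding has_vector_derivative_def
      using linear_cmul[OF has_derivative_linear[OF derW]] by (simp add: fun_eq_iff)
  next
    fix s show "continuous_on ?Q (\<lambda>y. W (y + s *\<^sub>R e))"
      by (rule continuous_on_compose2[OF contW]) (intro continuous_intros, simp)
  next
    show "continuous_on (UNIV \<times> ?Q) (\<lambda>(s, y). W' (y + s *\<^sub>R e) e)"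
      unfolding split_beta by (rule continuous_on_compose2[OF contW']) (intro continuous_intros, simp)
  qed auto
  have "\<exists>s. 0 < s \<and> s < ?T \<and> \<phi> ?T - \<phi> 0 = (?T - 0) * integral ?Q (\<lambda>y. W' (y + s *\<^sub>R e) e)"
    by (rule MVT2) (use d der\<phi> in auto)
  then obtain s where s: "0 < s" "s < ?T" "\<phi> ?T - \<phi> 0 = ?T * integral ?Q (\<lambda>y. W' (y + s *\<^sub>R e) e)" by auto
  have "\<phi> ?T = integral ?Q (\<lambda>y. 1)"
    unfolding \<phi>_def by (rule integral_cong) (use exit in \<open>auto simp: W_def\<close>)
  then have \<phi>T: "\<phi> ?T = b1 * (d/2) ^ ?n"
    using d measure_ball_scale(2)[of "d/2" x] by (simp add: b1_def lmeasure_integral[symmetric])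
  have "\<phi> 0 = integral ?Q (\<lambda>y. 0)"
    unfolding \<phi>_def
  proof (rule integral_cong)
    fix y assume y: "y \<in> ?Q"
    show "W (y + 0 *\<^sub>R e) = 0"
      using sub y smooth_step_le0[OF shell_le0[OF inner[OF y]]] by (auto simp: W_def)
  qed
  then have \<phi>0: "\<phi> 0 = 0" by simp
  have Aopen: "open A"
  proof -
    have "open (U \<inter> (\<lambda>y. norm (h y - h x)) -` {a<..<2 * a})"
      by (intro continuous_open_preimage continuous_intros conth U)
    moreover have "U \<inter> (\<lambda>y. norm (h y - h x)) -` {a<..<2 * a} = A" by (auto simp: A_def)
    ultimately show ?thesis by simp
  qed
  have Aleb: "A \<in> sets lebesgue" using Aopen by simp
  have hA: "h ` A \<subseteq> ball (h x) (2 * a)" by (auto simp: A_def dist_norm norm_minus_commute)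
  have AU: "A \<subseteq> U" by (auto simp: A_def)
  have hAl: "h ` A \<in> lmeasurable"
  proof -
    have "open (h ` A)"
      by (rule invariance_of_domain[OF continuous_on_subset[OF conth AU] Aopen inj_on_subset[OF inj AU]])
    moreover have "bounded (h ` A)" by (rule bounded_subset[OF bounded_ball hA])
    ultimately show ?thesis by (simp add: lmeasurable_open)
  qed
  have "((\<lambda>y. \<bar>jac h y\<bar>) has_integral measure lebesgue (h ` A)) A"
    using has_measure_differentiable_image_finite[OF Aleb _ inj_on_subset[OF inj AU], where f' = "fd h" and m = "measure lebesgue (h ` A)"]
      hAl AU der has_derivative_at_withinI by blast
  then have IJ: "((\<lambda>y. if y \<in> A then \<bar>jac h y\<bar> else 0) has_integral measure lebesgue (h ` A)) UNIV"
    by (simp add: has_integral_restrict_UNIV)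
  have mhA: "measure lebesgue (h ` A) \<le> b1 * (2 * a) ^ ?n"
    using measure_mono_fmeasurable[OF hA fmeasurableD[OF hAl]] measure_ball_scale(1)[of "2 * a" "h x"] a
    by (simp add: b1_def)
  have "A \<inter> cball x (2 * d) \<in> lmeasurable"
    using Aleb by (intro bounded_set_imp_lmeasurable) (auto intro: bounded_Int)
  then have IA: "(indicat_real (A \<inter> cball x (2 * d)) has_integral measure lebesgue (A \<inter> cball x (2 * d))) UNIV"
    by (simp add: lmeasurable_iff_has_integral)
  define Q' where "Q' = cball (x + s *\<^sub>R e) (d/2)"
  have Q'sub: "Q' \<subseteq> cball x (2 * d)"
  proof
    fix y assume "y \<in> Q'"
    then have "norm (y - (x + s *\<^sub>R e)) \<le> d/2" by (simp add: Q'_def dist_norm norm_minus_commute)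
    moreover have "norm (s *\<^sub>R e) \<le> ?T" using s e by simp
    ultimately have "norm (y - x) \<le> 2 * d" using norm_triangle_ineq[of "y - (x + s *\<^sub>R e)" "s *\<^sub>R e"] by simp
    then show "y \<in> cball x (2 * d)" by (simp add: dist_norm norm_minus_commute)
  qed
  have shift: "integral ?Q (\<lambda>y. W' (y + s *\<^sub>R e) e) = integral Q' (\<lambda>y. W' y e)"
  proof -
    have "integral Q' (\<lambda>y. W' y e) = integral (cball 0 (d/2)) (\<lambda>z. W' (z + (x + s *\<^sub>R e)) e)"
      unfolding Q'_def by (rule integral_cball_shift)
    moreover have "integral ?Q (\<lambda>y. W' (y + s *\<^sub>R e) e) = integral (cball 0 (d/2)) (\<lambda>z. W' ((z + x) + s *\<^sub>R e) e)"
      by (rule integral_cball_shift)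
    ultimately show ?thesis by (simp add: add.assoc)
  qed
  have "(\<lambda>y. W' y e) integrable_on Q'"
    unfolding Q'_def by (intro integrable_on_compact compact_cball continuous_on_subset[OF contW']) auto
  then have IW: "((\<lambda>y. if y \<in> Q' then W' y e else 0) has_integral integral Q' (\<lambda>y. W' y e)) UNIV"
    by (simp add: has_integral_restrict_UNIV integrable_integral)
  let ?\<mu> = "(12 / a) ^ ?n * K / l ^ (?n - 1)"
  have \<mu>0: "0 \<le> ?\<mu>" using a K l by simp
  have IR: "((\<lambda>y. l * indicat_real (A \<inter> cball x (2 * d)) y + ?\<mu> * (if y \<in> A then \<bar>jac h y\<bar> else 0)) has_integral
      l * measure lebesgue (A \<inter> cball x (2 * d)) + ?\<mu> * measure lebesgue (h ` A)) UNIV"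
    by (intro has_integral_add has_integral_mult_right IA IJ)
  have "integral Q' (\<lambda>y. W' y e) \<le> l * measure lebesgue (A \<inter> cball x (2 * d)) + ?\<mu> * measure lebesgue (h ` A)"
  proof (rule has_integral_le[OF IW IR])
    fix y
    show "(if y \<in> Q' then W' y e else 0) \<le> l * indicat_real (A \<inter> cball x (2 * d)) y + ?\<mu> * (if y \<in> A then \<bar>jac h y\<bar> else 0)"
    proof (cases "y \<in> Q' \<and> y \<in> A")
      case True
      then have yA: "y \<in> A" "y \<in> U" "y \<in> cball x (2 * d)" using AU Q'sub by auto
      let ?t = "12 / a * norm (fd h y e)"
      have "W' y e \<le> \<bar>smooth_step' (?s y)\<bar> * \<bar>2 * ((h y - h x) \<bullet> fd h y e) / (3 * a\<^sup>2)\<bar>"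
        unfolding abs_mult[symmetric] using yA(2) by (simp only: W'_def if_True abs_ge_self)
      also have "\<dots> \<le> 9 * (2 * (2 * a * norm (fd h y e)) / (3 * a\<^sup>2))"
      proof (rule mult_mono)
        show "\<bar>smooth_step' (?s y)\<bar> \<le> 9" using smooth_step'_bounds[of "?s y"] by simp
        have "\<bar>(h y - h x) \<bullet> fd h y e\<bar> \<le> norm (h y - h x) * norm (fd h y e)" by (rule Cauchy_Schwarz_ineq2)
        also have "\<dots> \<le> 2 * a * norm (fd h y e)" using yA by (intro mult_right_mono) (auto simp: A_def)
        finally show "\<bar>2 * ((h y - h x) \<bullet> fd h y e) / (3 * a\<^sup>2)\<bar> \<le> 2 * (2 * a * norm (fd h y e)) / (3 * a\<^sup>2)"
          by (simp add: abs_mult divide_right_mono)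
      qed auto
      also have "\<dots> = ?t" using a by (simp add: power2_eq_square field_simps)
      also have "\<dots> \<le> l + ?t ^ ?n / l ^ (?n - 1)" by (rule young_split) (use a l in auto)
      also have "?t ^ ?n / l ^ (?n - 1) \<le> ?\<mu> * \<bar>jac h y\<bar>"
      proof -
        have "norm (fd h y e) ^ ?n \<le> K * \<bar>jac h y\<bar> * norm e ^ ?n"
          using dist yA unfolding distortion_on_def by blast
        then have "norm (fd h y e) ^ ?n \<le> K * \<bar>jac h y\<bar>" using e by simp
        then have "(12 / a) ^ ?n * norm (fd h y e) ^ ?n \<le> (12 / a) ^ ?n * (K * \<bar>jac h y\<bar>)"
          using a by (intro mult_left_mono) auto
        then have "?t ^ ?n / l ^ (?n - 1) \<le> (12 / a) ^ ?n * (K * \<bar>jac h y\<bar>) / l ^ (?n - 1)"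
          unfolding power_mult_distrib using l by (intro divide_right_mono) auto
        then show ?thesis by (simp add: mult.assoc)
      qed
      finally show ?thesis using True yA by simp
    next
      case False
      have "W' y e \<le> 0" if "y \<in> Q'"
      proof (cases "y \<in> U")
        case True
        then have "norm (h y - h x) \<le> a \<or> 2 * a \<le> norm (h y - h x)" using False that by (auto simp: A_def)
        then have "?s y \<le> 0 \<or> 1 \<le> ?s y" using shell_le0 shell_ge1[OF a] by blast
        then show ?thesis using True smooth_step'_zero by (simp add: W'_def)
      qed (simp add: W'_def)
      moreover have "0 \<le> l * indicat_real (A \<inter> cball x (2 * d)) y + ?\<mu> * (if y \<in> A then \<bar>jac h y\<bar> else 0)"
        using l \<mu>0 by (intro add_nonneg_nonneg mult_nonneg_nonneg) (auto simp: indicator_def)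
      ultimately show ?thesis by (auto intro: order_trans)
    qed
  qed
  also have "?\<mu> * measure lebesgue (h ` A) \<le> ?\<mu> * (b1 * (2 * a) ^ ?n)"
    by (rule mult_left_mono[OF mhA \<mu>0])
  also have "?\<mu> * (b1 * (2 * a) ^ ?n) = 24 ^ ?n * K * b1 / l ^ (?n - 1)"
  proof -
    have "(12 / a) * (2 * a) = 24" using a by simp
    then have e: "(12 / a) ^ ?n * (2 * a) ^ ?n = 24 ^ ?n" by (metis power_mult_distrib)
    have "P * K / M * (b1 * Q) = (P * Q) * K * b1 / M" for P Q M :: real by simp
    then show ?thesis unfolding e[symmetric] .
  qed
  finally have "integral Q' (\<lambda>y. W' y e) \<le> l * measure lebesgue (A \<inter> cball x (2 * d)) + 24 ^ ?n * K * b1 / l ^ (?n - 1)" by simp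
  then have "?T * integral Q' (\<lambda>y. W' y e) \<le> ?T * (l * measure lebesgue (A \<inter> cball x (2 * d)) + 24 ^ ?n * K * b1 / l ^ (?n - 1))"
    using d by (intro mult_left_mono) auto
  then show ?thesis using s(3) \<phi>T \<phi>0 shift by simp
qed

text \<open>
  If the oscillation on \<open>cball x (d/2)\<close> were tiny compared with \<open>\<rho>\<close>, there would be many dyadic shells
  between the two scales. By \<open>shell_crossing\<close> the preimage of each occupies a fixed fraction of
  \<open>cball x (2 * d)\<close>, and they are disjoint.
\<close>

lemma oscillation_lower_bound:
  fixes h :: "real ^ 'n::finite \<Rightarrow> real ^ 'n"
  assumes n: "CARD('n) \<ge> 2"
    and U: "open U" and inj: "inj_on h U" and der: "\<And>y. y \<in> U \<Longrightarrow> (h has_derivative fd h y) (at y)"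
    and cont: "\<And>v. continuous_on U (\<lambda>y. fd h y v)" and dist: "distortion_on K U h" and K: "0 < K"
    and d: "0 < d" and e: "norm e = 1"
    and sub: "cball x (d/2) \<subseteq> U" and exit: "\<And>y. y \<in> cball x (d/2) \<Longrightarrow> y + (3/2 * d) *\<^sub>R e \<notin> U"
    and \<rho>: "0 < \<rho>" and img: "ball (h x) \<rho> \<subseteq> h ` U"
    and N: "\<And>y. y \<in> cball x (d/2) \<Longrightarrow> norm (h y - h x) \<le> \<rho> / 2 ^ N"
  shows "real N \<le> 1 + 3 * 4 ^ CARD('n) * (1 + 3 * 48 ^ CARD('n) * K)"
proof -
  let ?n = "CARD('n)"
  define b1 where "b1 = unit_ball_vol (real ?n)"
  have b1: "b1 > 0" unfolding b1_def by simp
  \<comment> \<open>With \<open>l = L / d\<close> in \<open>shell_crossing\<close>, this \<open>L\<close> makes the energy term at most half of the left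
     hand side.\<close>
  define L where "L = 1 + 3 * 48 ^ ?n * K"
  have L: "L \<ge> 1" "L > 0" using K by (auto simp: L_def add_pos_nonneg)
  define A where "A j = {y \<in> U. \<rho> / 2 ^ Suc j < norm (h y - h x) \<and> norm (h y - h x) < 2 * (\<rho> / 2 ^ Suc j)}" for j
  have conth: "continuous_on U h"
    by (rule has_derivative_continuous_on) (use der has_derivative_at_withinI in blast)
  have low: "b1 * d ^ ?n / (3 * 2 ^ ?n * L) \<le> measure lebesgue (A j \<inter> cball x (2 * d))" if j: "j \<in> {1..<N}" for j
  proof -
    let ?a = "\<rho> / 2 ^ Suc j" and ?m = "measure lebesgue (A j \<inter> cball x (2 * d))"
    have p: "b1 * (d/2) ^ ?n \<le> (3/2 * d) * ((L / d) * ?m + 24 ^ ?n * K * b1 / (L / d) ^ (?n - 1))"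
      unfolding A_def b1_def
    proof (rule shell_crossing[OF U inj der cont dist K d e sub exit])
      show "0 < ?a" using \<rho> by simp
      have "2 * ?a = \<rho> / 2 ^ j" by simp
      also have "\<dots> < \<rho> / 1" using \<rho> j by (intro divide_strict_left_mono) auto
      finally show "cball (h x) (2 * ?a) \<subseteq> h ` U" using img by (auto simp: subset_iff)
      fix y assume "y \<in> cball x (d/2)"
      from N[OF this] show "norm (h y - h x) \<le> ?a"
      proof (rule order_trans)
        show "\<rho> / 2 ^ N \<le> ?a" using \<rho> j by (intro divide_left_mono power_increasing) auto
      qed
    qed (use L d in auto)
    have Lp: "L \<le> L ^ (?n - 1)" using L n by (intro self_le_power) auto
    have "24 ^ ?n * K * b1 / (L / d) ^ (?n - 1) = 24 ^ ?n * K * b1 * d ^ (?n - 1) / L ^ (?n - 1)"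
      by (simp add: power_divide)
    also have "\<dots> \<le> 24 ^ ?n * K * b1 * d ^ (?n - 1) / L"
      using Lp L K b1 d by (intro divide_left_mono) auto
    finally have "(3/2 * d) * (24 ^ ?n * K * b1 / (L / d) ^ (?n - 1)) \<le> (3/2 * d) * (24 ^ ?n * K * b1 * d ^ (?n - 1) / L)"
      using d by (intro mult_left_mono) auto
    also have "\<dots> = (3/2) * (24 ^ ?n * K / L) * (b1 * d ^ ?n)"
      using n by (cases ?n) (auto simp: field_simps)
    also have "\<dots> \<le> (1 / (2 * 2 ^ ?n)) * (b1 * d ^ ?n)"
    proof (rule mult_right_mono)
      have "(48::real) ^ ?n = 2 ^ ?n * 24 ^ ?n" by (simp flip: power_mult_distrib)
      then have "3 * 24 ^ ?n * K * 2 ^ ?n \<le> L" by (simp add: L_def mult_ac)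
      then show "(3/2) * (24 ^ ?n * K / L) \<le> 1 / (2 * 2 ^ ?n)" using L by (simp add: divide_simps mult_ac)
    qed (use b1 d in auto)
    finally have q: "(3/2 * d) * (24 ^ ?n * K * b1 / (L / d) ^ (?n - 1)) \<le> (1 / (2 * 2 ^ ?n)) * (b1 * d ^ ?n)" .
    have "(1 / 2 ^ ?n) * (b1 * d ^ ?n) \<le> (3/2) * L * ?m + (1 / (2 * 2 ^ ?n)) * (b1 * d ^ ?n)"
      using p q d by (simp add: power_divide distrib_left)
    then have "(1 / (2 * 2 ^ ?n)) * (b1 * d ^ ?n) \<le> (3/2) * L * ?m" by (simp add: field_simps)
    then show ?thesis using L by (simp add: divide_simps mult_ac)
  qed
  have lm: "A j \<inter> cball x (2 * d) \<in> lmeasurable" for j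
  proof -
    have "open (U \<inter> (\<lambda>y. norm (h y - h x)) -` {\<rho> / 2 ^ Suc j<..<2 * (\<rho> / 2 ^ Suc j)})"
      by (intro continuous_open_preimage continuous_intros conth U)
    moreover have "U \<inter> (\<lambda>y. norm (h y - h x)) -` {\<rho> / 2 ^ Suc j<..<2 * (\<rho> / 2 ^ Suc j)} = A j" by (auto simp: A_def)
    ultimately have "A j \<in> sets lebesgue" by simp
    then show ?thesis by (intro bounded_set_imp_lmeasurable) (auto intro: bounded_Int)
  qed
  have disj: "A i \<inter> A j = {}" if "i < j" for i j
  proof -
    have "\<rho> / 2 ^ j \<le> \<rho> / 2 ^ Suc i" using \<rho> that by (intro divide_left_mono power_increasing) auto
    moreover have "2 * (\<rho> / 2 ^ Suc j) = \<rho> / 2 ^ j" by simp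
    ultimately show ?thesis unfolding A_def by (auto simp del: power_Suc)
  qed
  have "(\<Sum>j\<in>{1..<N}. b1 * d ^ ?n / (3 * 2 ^ ?n * L)) \<le> (\<Sum>j\<in>{1..<N}. measure lebesgue (A j \<inter> cball x (2 * d)))"
    by (rule sum_mono[OF low])
  also have "\<dots> = measure lebesgue (\<Union>j\<in>{1..<N}. A j \<inter> cball x (2 * d))"
  proof (rule measure_UNION'[symmetric])
    show "pairwise (\<lambda>i j. disjnt (A i \<inter> cball x (2 * d)) (A j \<inter> cball x (2 * d))) {1..<N}"
      using disj unfolding pairwise_def disjnt_def by (metis Int_commute Int_left_commute Int_empty_right linorder_neqE_nat inf_assoc)
  qed (use lm in auto)
  also have "\<dots> \<le> measure lebesgue (cball x (2 * d))"
  proof (rule measure_mono_fmeasurable)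
    show "(\<Union>j\<in>{1..<N}. A j \<inter> cball x (2 * d)) \<in> sets lebesgue"
      by (intro sets.finite_UN fmeasurableD[OF lm]) simp
  qed auto
  also have "\<dots> = b1 * (2 * d) ^ ?n" using measure_ball_scale(2)[of "2 * d" x] d by (simp add: b1_def)
  finally have "real (N - 1) * (b1 * d ^ ?n / (3 * 2 ^ ?n * L)) \<le> b1 * (2 * d) ^ ?n" by simp
  then have "real (N - 1) * (b1 * d ^ ?n) \<le> (3 * 2 ^ ?n * L) * (2 ^ ?n) * (b1 * d ^ ?n)"
    using L by (simp add: power_mult_distrib divide_simps mult_ac)
  then have "real (N - 1) \<le> (3 * 2 ^ ?n * L) * 2 ^ ?n" using b1 d by simp
  also have "\<dots> = 3 * 4 ^ ?n * L" by (simp flip: power_mult_distrib)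
  finally show ?thesis unfolding L_def by linarith
qed

section \<open>Positive harmonic functions\<close>

text \<open>
  Integrate the bound of the logarithmic derivative from \<open>nonneg_gradient_bound\<close>.
\<close>

lemma harnack_inequality:
  fixes u :: "'a::euclidean_space \<Rightarrow> real"
  assumes mv: "mean_value_on U u" and pos: "\<And>y. y \<in> U \<Longrightarrow> 0 < u y" and U: "open U"
    and S: "convex S" and t: "0 < t" and sub: "\<And>z. z \<in> S \<Longrightarrow> cball z (2 * t) \<subseteq> U" and xy: "x \<in> S" "y \<in> S"
  shows "u y \<le> exp (harnack_const TYPE('a) / t * norm (y - x)) * u x"
proof -
  let ?H = "harnack_const TYPE('a)"
  have SU: "z \<in> U" if "z \<in> S" for z using sub[OF that] t by (auto simp: subset_iff)
  have "norm (ln (u y) - ln (u x)) \<le> ?H / t * norm (y - x)"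
  proof (rule differentiable_bound[OF S _ _ xy(2,1), where f' = "\<lambda>z v. fd u z v / u z"])
    fix z assume z: "z \<in> S"
    note pz = pos[OF SU[OF z]]
    have "(ln has_derivative (\<lambda>k. k * inverse (u z))) (at (u z))"
      using DERIV_ln[OF pz] by (simp add: has_field_derivative_def mult_commute_abs)
    from has_derivative_compose[OF mean_value_has_fd[OF U mv SU[OF z]] this]
    show "((\<lambda>z. ln (u z)) has_derivative (\<lambda>v. fd u z v / u z)) (at z within S)"
      by (simp add: divide_inverse has_derivative_at_withinI)
    show "onorm (\<lambda>v. fd u z v / u z) \<le> ?H / t"
    proof (rule onorm_le)
      fix v
      have "\<bar>fd u z v\<bar> \<le> ?H / t * u z * norm v"
        by (rule nonneg_gradient_bound[OF mv t sub[OF z]]) (use sub[OF z] pos in \<open>force simp: less_imp_le\<close>)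
      then have "\<bar>fd u z v\<bar> / u z \<le> ?H / t * u z * norm v / u z" using pz by (intro divide_right_mono) auto
      also have "\<dots> = ?H / t * norm v" using pz by simp
      finally show "norm (fd u z v / u z) \<le> ?H / t * norm v" using pz by (simp add: abs_divide)
    qed
  qed
  then have "ln (u y) \<le> ?H / t * norm (y - x) + ln (u x)" by simp
  then have "exp (ln (u y)) \<le> exp (?H / t * norm (y - x) + ln (u x))" by simp
  then show ?thesis using pos[OF SU[OF xy(1)]] pos[OF SU[OF xy(2)]] by (simp add: exp_add)
qed

lemma second_derivative_at_max:
  fixes \<phi> :: "real \<Rightarrow> real"
  assumes \<delta>: "0 < \<delta>" and d: "\<And>s. \<bar>s\<bar> < \<delta> \<Longrightarrow> (\<phi> has_real_derivative \<phi>' s) (at s)"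
    and d2: "(\<phi>' has_real_derivative D) (at 0)" and mx: "\<And>s. \<bar>s\<bar> < \<delta> \<Longrightarrow> \<phi> s \<le> \<phi> 0"
  shows "D \<le> 0"
proof (rule ccontr)
  assume "\<not> D \<le> 0"
  then have D: "0 < D" by simp
  have "\<phi>' 0 = 0"
    by (rule DERIV_local_max[OF d[of 0] \<delta>]) (use \<delta> mx in auto)
  then obtain r where r: "r > 0" "\<And>h. 0 < h \<Longrightarrow> h < r \<Longrightarrow> 0 < \<phi>' h"
    using DERIV_pos_inc_right[OF d2 D] by auto
  define s where "s = min r \<delta> / 2"
  have s: "0 < s" "s < r" "s < \<delta>" using r \<delta> by (auto simp: s_def)
  have "\<phi> 0 < \<phi> s"
  proof (rule DERIV_pos_imp_increasing_open[OF s(1)])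
    show "\<exists>y. (\<phi> has_real_derivative y) (at x) \<and> 0 < y" if "0 < x" "x < s" for x
      using d[of x] r(2)[of x] that s by (intro exI[of _ "\<phi>' x"]) auto
    show "continuous_on {0..s} \<phi>"
    proof (rule DERIV_continuous_on)
      show "(\<phi> has_real_derivative \<phi>' x) (at x within {0..s})" if "x \<in> {0..s}" for x
        using has_field_derivative_at_within[OF d[of x]] that s by simp
    qed
  qed
  then show False using mx[of s] s by simp
qed

text \<open>
  The factors are the reciprocal of the Harnack factor from the centre to the ball of radius \<open>1/2\<close> and half of the
  slope at the sphere, \<open>\<alpha> * exp (- \<alpha>)\<close> for the barrier in \<open>hopf_lower_bound\<close>, with
  \<open>\<alpha> = 2 * DIM('a) + 1\<close>.
\<close>

definition hopf_const :: "'a::euclidean_space itself \<Rightarrow> real" where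
  "hopf_const _ = exp (- (5 / 2 * harnack_const TYPE('a))) *
     (exp (- (2 * real (DIM('a)) + 1)) * (2 * real (DIM('a)) + 1))"

lemma hopf_const_pos: "hopf_const TYPE('a::euclidean_space) > 0"
  unfolding hopf_const_def by (intro mult_pos_pos exp_gt_zero add_nonneg_pos) auto

text \<open>
  The Hopf barrier \<open>b y = \<epsilon> * (exp (- \<alpha> * (y \<bullet> y)) - exp (- \<alpha>))\<close> vanishes on the unit sphere, is
  at most \<open>\<epsilon>\<close>, and is strictly subharmonic for \<open>norm y > 1/2\<close> by the choice of \<open>\<alpha>\<close>. Harnack's inequality
  gives \<open>\<epsilon> \<le> u\<close> on the inner ball, so that a positive maximum of \<open>b - u\<close> lies in the outer
  shell, where the second derivative test excludes it.
\<close>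

lemma hopf_lower_bound:
  fixes u :: "'a::euclidean_space \<Rightarrow> real"
  assumes mv: "mean_value_on (ball 0 1) u" and pos: "\<And>y. y \<in> ball 0 1 \<Longrightarrow> 0 < u y" and x: "x \<in> ball 0 1"
  shows "hopf_const TYPE('a) * u 0 * (1 - norm x) \<le> u x"
proof -
  let ?H = "harnack_const TYPE('a)"
  have U: "open (ball (0::'a) 1)" by simp
  define \<alpha> where "\<alpha> = 2 * real (DIM('a)) + 1"
  have \<alpha>: "\<alpha> > 0" by (simp add: \<alpha>_def add_nonneg_pos)
  define \<epsilon> where "\<epsilon> = exp (- (5 / 2 * ?H)) * u 0"
  have \<epsilon>: "\<epsilon> > 0" using pos[of 0] by (simp add: \<epsilon>_def)
  have H0: "?H \<ge> 0" by (simp add: harnack_const_def)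
  have inner: "\<epsilon> \<le> u z" if z: "norm z \<le> 1/2" for z
  proof -
    have sub: "cball y (2 * (1/5)) \<subseteq> ball 0 1" if "y \<in> cball 0 (1/2)" for y :: 'a
    proof
      fix w assume "w \<in> cball y (2 * (1/5))"
      then have "norm (w - y) \<le> 2/5" by (simp add: dist_norm norm_minus_commute)
      then show "w \<in> ball 0 1" using norm_triangle_sub[of w y] that by simp
    qed
    have "u 0 \<le> exp (?H / (1/5) * norm (0 - z)) * u z"
      by (rule harnack_inequality[OF mv pos U convex_cball[of 0 "1/2"] _ sub]) (use z in auto)
    also have "\<dots> \<le> exp (5 / 2 * ?H) * u z"
    proof (rule mult_right_mono)
      have "?H * norm z \<le> ?H * (1/2)" using z H0 by (intro mult_left_mono) auto
      moreover have "?H / (1/5) * norm (0 - z) = 5 * (?H * norm z)" by simp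
      ultimately show "exp (?H / (1/5) * norm (0 - z)) \<le> exp (5 / 2 * ?H)" unfolding exp_le_cancel_iff by linarith
      show "0 \<le> u z" using pos[of z] z by simp
    qed
    finally have "exp (- (5 / 2 * ?H)) * u 0 \<le> exp (- (5 / 2 * ?H)) * (exp (5 / 2 * ?H) * u z)"
      by (intro mult_left_mono) auto
    also have "\<dots> = u z" by (simp add: exp_minus)
    finally show ?thesis by (simp add: \<epsilon>_def)
  qed
  define b where "b y = \<epsilon> * (exp (- \<alpha> * (y \<bullet> y)) - exp (- \<alpha>))" for y :: 'a
  have b_le: "b y \<le> \<epsilon>" for y
  proof -
    have "exp (- \<alpha> * (y \<bullet> y)) \<le> 1" using \<alpha> by simp
    then have "exp (- \<alpha> * (y \<bullet> y)) - exp (- \<alpha>) \<le> 1" using exp_gt_zero[of "- \<alpha>"] by linarith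
    then show ?thesis unfolding b_def using \<epsilon> by simp
  qed
  have lap: "(\<Sum>w\<in>Basis. fd (\<lambda>y. fd u y w) y w) = 0" if "y \<in> ball 0 1" for y
    by (rule mean_value_on_laplacian_zero[OF U mv that])
  have "b x \<le> u x"
  proof (rule ccontr)
    assume "\<not> b x \<le> u x"
    define \<eta> where "\<eta> = b x - u x"
    have \<eta>: "\<eta> > 0" using \<open>\<not> b x \<le> u x\<close> by (simp add: \<eta>_def)
    \<comment> \<open>so close to \<open>1\<close> that \<open>b < \<eta>\<close> on the sphere of radius \<open>r\<close>\<close>
    define r where "r = 1 - min ((1 - norm x) / 2) (\<eta> / (4 * (\<epsilon> * \<alpha>)))"
    have r: "norm x < r" "r < 1"
      using x \<eta> \<epsilon> \<alpha> by (auto simp: r_def min_def field_simps)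
    have r0: "0 < r" using r norm_ge_zero[of x] by linarith
    have bdr: "b y < \<eta>" if "norm y = r" for y
    proof -
      have "exp (- \<alpha> * (y \<bullet> y)) - exp (- \<alpha>) \<le> \<alpha> * (1 - r\<^sup>2)"
      proof -
        have yy: "y \<bullet> y = r\<^sup>2" using that by (simp add: power2_norm_eq_inner[symmetric])
        have "1 + (- \<alpha> * (1 - r\<^sup>2)) \<le> exp (- \<alpha> * (1 - r\<^sup>2))" by (rule exp_ge_add_one_self)
        then have "(1 - \<alpha> * (1 - r\<^sup>2)) * exp (- \<alpha> * r\<^sup>2) \<le> exp (- \<alpha> * (1 - r\<^sup>2)) * exp (- \<alpha> * r\<^sup>2)"
          by (intro mult_right_mono) auto
        also have "\<dots> = exp (- \<alpha>)" by (simp add: exp_add[symmetric] algebra_simps)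
        finally have "exp (- \<alpha> * r\<^sup>2) - exp (- \<alpha>) \<le> \<alpha> * (1 - r\<^sup>2) * exp (- \<alpha> * r\<^sup>2)" by (simp add: algebra_simps)
        also have "\<dots> \<le> \<alpha> * (1 - r\<^sup>2) * 1"
          using \<alpha> r r0 by (intro mult_left_mono mult_nonneg_nonneg) (auto simp: power_le_one)
        finally show ?thesis by (simp add: yy)
      qed
      also have "\<dots> \<le> \<alpha> * (2 * (1 - r))"
      proof (rule mult_left_mono)
        have "0 \<le> (1 - r)\<^sup>2" by simp
        then show "1 - r\<^sup>2 \<le> 2 * (1 - r)" by (simp add: power2_eq_square algebra_simps)
      qed (use \<alpha> in simp)
      also have "\<dots> \<le> \<alpha> * (2 * (\<eta> / (4 * (\<epsilon> * \<alpha>))))" using \<alpha> by (intro mult_left_mono) (auto simp: r_def)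
      also have "\<dots> = \<eta> / (2 * \<epsilon>)" using \<alpha> by simp
      finally have "\<epsilon> * (exp (- \<alpha> * (y \<bullet> y)) - exp (- \<alpha>)) \<le> \<epsilon> * (\<eta> / (2 * \<epsilon>))" using \<epsilon> by (intro mult_left_mono) auto
      also have "\<dots> = \<eta> / 2" using \<epsilon> by simp
      finally show ?thesis using \<eta> by (simp add: b_def)
    qed
    have cbs: "cball 0 r \<subseteq> ball (0::'a) 1" using r by auto
    have contv: "continuous_on (cball 0 r) (\<lambda>y. b y - u y)"
      unfolding b_def by (intro continuous_intros continuous_on_subset[OF mean_value_on_continuous[OF mv] cbs])
    have ne: "cball (0::'a) r \<noteq> {}" using r0 by auto
    obtain y where y: "y \<in> cball 0 r" "\<And>w. w \<in> cball 0 r \<Longrightarrow> b w - u w \<le> b y - u y"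
      using continuous_attains_sup[OF compact_cball ne contv] by blast
    have vy: "\<eta> \<le> b y - u y" using y(2)[of x] r by (simp add: \<eta>_def)
    have y1: "y \<in> ball 0 1" using y(1) cbs by blast
    have yr: "norm y < r"
      using bdr[of y] vy pos[OF y1] y(1) by force
    have yh: "1/2 < norm y"
      using inner[of y] b_le[of y] vy \<eta> by force
    define B2 where "B2 w = \<epsilon> * ((4 * \<alpha>\<^sup>2 * (y \<bullet> w)\<^sup>2 - 2 * \<alpha>) * exp (- \<alpha> * (y \<bullet> y)))" for w
    have le: "B2 w - fd (\<lambda>y. fd u y w) y w \<le> 0" if w: "w \<in> Basis" for w
    proof -
      define \<delta> where "\<delta> = r - norm y"
      have \<delta>: "\<delta> > 0" using yr by (simp add: \<delta>_def)
      have nw: "norm w = 1" "w \<bullet> w = 1" using w by (auto simp: inner_Basis)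
      have mem: "y + s *\<^sub>R w \<in> cball 0 r" if "\<bar>s\<bar> < \<delta>" for s
        using norm_triangle_ineq[of y "s *\<^sub>R w"] that nw by (simp add: \<delta>_def)
      have mem1: "y + s *\<^sub>R w \<in> ball 0 1" if "\<bar>s\<bar> < \<delta>" for s using mem[OF that] cbs by blast
      have ip: "(y + s *\<^sub>R w) \<bullet> (y + s *\<^sub>R w) = y \<bullet> y + 2 * (y \<bullet> w) * s + s\<^sup>2" for s
        using nw by (simp add: inner_simps inner_commute power2_eq_square algebra_simps)
      have du: "((\<lambda>s. g (y + s *\<^sub>R w)) has_real_derivative fd g (y + s *\<^sub>R w) w) (at s)"
        if "mean_value_on (ball 0 1) g" "\<bar>s\<bar> < \<delta>" for g :: "'a \<Rightarrow> real" and s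
      proof -
        note dg = mean_value_has_fd[OF U that(1) mem1[OF that(2)]]
        have "((\<lambda>s. y + s *\<^sub>R w) has_derivative (\<lambda>k. k *\<^sub>R w)) (at s)" by (auto intro!: derivative_eq_intros)
        from has_derivative_compose[OF this dg]
        show ?thesis unfolding has_field_derivative_def
          using linear_cmul[OF has_derivative_linear[OF dg]] by (simp add: fun_eq_iff mult_commute_abs mult.commute)
      qed
      let ?E = "\<lambda>s. exp (- \<alpha> * (y \<bullet> y + 2 * (y \<bullet> w) * s + s\<^sup>2))"
      define \<phi>' where "\<phi>' s = \<epsilon> * (?E s * (- \<alpha> * (2 * (y \<bullet> w) + 2 * s))) - fd u (y + s *\<^sub>R w) w" for s
      show ?thesis
      proof (rule second_derivative_at_max[OF \<delta>, where \<phi> = "\<lambda>s. b (y + s *\<^sub>R w) - u (y + s *\<^sub>R w)" and \<phi>' = \<phi>'])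
        fix s :: real assume s: "\<bar>s\<bar> < \<delta>"
        have "((\<lambda>s. \<epsilon> * (?E s - exp (- \<alpha>))) has_real_derivative \<epsilon> * (?E s * (- \<alpha> * (2 * (y \<bullet> w) + 2 * s)))) (at s)"
          by (auto intro!: derivative_eq_intros)
        from DERIV_diff[OF this du[OF mv s]]
        show "((\<lambda>s. b (y + s *\<^sub>R w) - u (y + s *\<^sub>R w)) has_real_derivative \<phi>' s) (at s)"
          unfolding b_def ip \<phi>'_def .
        show "b (y + s *\<^sub>R w) - u (y + s *\<^sub>R w) \<le> b (y + 0 *\<^sub>R w) - u (y + 0 *\<^sub>R w)"
          using y(2)[OF mem[OF s]] by simp
      next
        have "((\<lambda>s. \<epsilon> * (?E s * (- \<alpha> * (2 * (y \<bullet> w) + 2 * s)))) has_real_derivative B2 w) (at 0)"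
          by (auto intro!: derivative_eq_intros simp: B2_def power2_eq_square algebra_simps)
        from DERIV_diff[OF this du[OF mean_value_on_fd[OF U mv], of 0 w]] \<delta>
        show "(\<phi>' has_real_derivative B2 w - fd (\<lambda>y. fd u y w) y w) (at 0)"
          unfolding \<phi>'_def [abs_def] by simp
      qed
    qed
    have "(\<Sum>w\<in>Basis. B2 w - fd (\<lambda>y. fd u y w) y w) \<le> 0" by (rule sum_nonpos[OF le])
    then have "(\<Sum>w\<in>Basis. B2 w) \<le> 0" using lap[OF y1] by (simp add: sum_subtractf)
    moreover have "(\<Sum>w\<in>Basis. B2 w) = \<epsilon> * ((4 * \<alpha>\<^sup>2 * (norm y)\<^sup>2 - 2 * \<alpha> * DIM('a)) * exp (- \<alpha> * (y \<bullet> y)))"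
    proof -
      have "(\<Sum>w\<in>Basis. (y \<bullet> w)\<^sup>2) = (norm y)\<^sup>2"
        unfolding power2_norm_eq_inner euclidean_inner[of y y] by (simp add: power2_eq_square)
      moreover have "(\<Sum>w\<in>Basis. B2 w) = \<epsilon> * ((4 * \<alpha>\<^sup>2 * (\<Sum>w\<in>Basis. (y \<bullet> w)\<^sup>2) - 2 * \<alpha> * DIM('a)) * exp (- \<alpha> * (y \<bullet> y)))"
        by (simp add: B2_def sum_distrib_left[symmetric] sum_distrib_right[symmetric] sum_subtractf)
      ultimately show ?thesis by simp
    qed
    moreover have "4 * \<alpha>\<^sup>2 * (norm y)\<^sup>2 - 2 * \<alpha> * DIM('a) > 0"
    proof -
      have "(1/2)\<^sup>2 \<le> (norm y)\<^sup>2" using yh by (intro power_mono) auto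
      then have "4 * \<alpha>\<^sup>2 * (1/4) \<le> 4 * \<alpha>\<^sup>2 * (norm y)\<^sup>2" by (intro mult_left_mono) (auto simp: power_divide)
      moreover have "2 * \<alpha> * DIM('a) < \<alpha>\<^sup>2" using \<alpha> by (simp add: power2_eq_square \<alpha>_def algebra_simps)
      ultimately show ?thesis by simp
    qed
    ultimately show False using \<epsilon> by (simp add: mult_le_0_iff not_le[symmetric])
  qed
  moreover have "hopf_const TYPE('a) * u 0 * (1 - norm x) \<le> b x"
  proof -
    have nx: "norm x < 1" using x by simp
    have "1 + \<alpha> * (1 - (norm x)\<^sup>2) \<le> exp (\<alpha> * (1 - (norm x)\<^sup>2))" by (rule exp_ge_add_one_self)
    then have "exp (- \<alpha>) * (1 + \<alpha> * (1 - (norm x)\<^sup>2)) \<le> exp (- \<alpha>) * exp (\<alpha> * (1 - (norm x)\<^sup>2))"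
      by (intro mult_left_mono) auto
    also have "\<dots> = exp (- \<alpha> * (x \<bullet> x))" by (simp add: exp_add[symmetric] power2_norm_eq_inner algebra_simps)
    finally have "exp (- \<alpha>) * \<alpha> * (1 - (norm x)\<^sup>2) \<le> exp (- \<alpha> * (x \<bullet> x)) - exp (- \<alpha>)" by (simp add: algebra_simps)
    moreover have "exp (- \<alpha>) * \<alpha> * (1 - norm x) \<le> exp (- \<alpha>) * \<alpha> * (1 - (norm x)\<^sup>2)"
    proof (rule mult_left_mono)
      have "norm x * norm x \<le> norm x" using nx by (simp add: mult_left_le)
      then show "1 - norm x \<le> 1 - (norm x)\<^sup>2" by (simp add: power2_eq_square)
    qed (use \<alpha> in simp)
    ultimately have "exp (- \<alpha>) * \<alpha> * (1 - norm x) \<le> exp (- \<alpha> * (x \<bullet> x)) - exp (- \<alpha>)" by linarith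
    then have "\<epsilon> * (exp (- \<alpha>) * \<alpha> * (1 - norm x)) \<le> \<epsilon> * (exp (- \<alpha> * (x \<bullet> x)) - exp (- \<alpha>))"
      using \<epsilon> by (intro mult_left_mono) auto
    moreover have "hopf_const TYPE('a) * u 0 * (1 - norm x) = \<epsilon> * (exp (- \<alpha>) * \<alpha> * (1 - norm x))"
      unfolding hopf_const_def \<epsilon>_def \<alpha>_def by (simp only: mult.assoc mult.commute mult.left_commute)
    ultimately show ?thesis unfolding b_def by linarith
  qed
  ultimately show ?thesis by linarith
qed

section \<open>Harmonic and quasiconformal maps\<close>

lemma mean_value_on_vec:
  fixes f :: "'a::euclidean_space \<Rightarrow> real ^ 'm::finite"
  assumes mv: "\<And>i. mean_value_on U (\<lambda>x. f x $ i)"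
  shows "mean_value_on U f"
  unfolding mean_value_on_def
proof (intro conjI allI impI)
  have "continuous_on U (\<lambda>x. \<chi> i. f x $ i)"
    by (intro continuous_on_vec_lambda mean_value_on_continuous[OF mv])
  then show contf: "continuous_on U f" by simp
  fix x t assume xt: "0 < t \<and> cball x t \<subseteq> U"
  have i: "(\<lambda>z. (bump z)\<^sup>2 *\<^sub>R f (x + t *\<^sub>R z)) integrable_on cball 0 1"
    by (intro integrable_on_compact compact_cball continuous_on_scaleR continuous_on_power continuous_on_bump
          continuous_on_affine_cball[OF contf]) (use xt in auto)
  show "integral (cball 0 1) (\<lambda>z. (bump z)\<^sup>2 *\<^sub>R f (x + t *\<^sub>R z)) = bump_mass TYPE('a) *\<^sub>R f x"
  proof (rule vec_eq_iff[THEN iffD2], rule allI)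
    fix i
    have "integral (cball 0 1) ((\<lambda>v. v $ i) \<circ> (\<lambda>z. (bump z)\<^sup>2 *\<^sub>R f (x + t *\<^sub>R z))) =
       integral (cball 0 1) (\<lambda>z. (bump z)\<^sup>2 *\<^sub>R f (x + t *\<^sub>R z)) $ i"
      by (rule integral_linear[OF i bounded_linear_vec_nth])
    then show "integral (cball 0 1) (\<lambda>z. (bump z)\<^sup>2 *\<^sub>R f (x + t *\<^sub>R z)) $ i = (bump_mass TYPE('a) *\<^sub>R f x) $ i"
      using mean_value_onD[OF mv, of t x i] xt by (simp add: o_def)
  qed
qed

lemma C1_onD:
  assumes "C1_on U f" "x \<in> U"
  shows "(f has_derivative fd f x) (at x)"
proof -
  obtain D where "\<forall>x\<in>U. (f has_derivative blinfun_apply (D x)) (at x)"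
    using assms(1) unfolding C1_on_def by blast
  then have "(f has_derivative blinfun_apply (D x)) (at x)" using assms(2) by blast
  then show ?thesis using has_derivative_imp_fd by metis
qed

lemma C1_on_continuous_fd:
  fixes f :: "'a::euclidean_space \<Rightarrow> 'b::euclidean_space"
  assumes "C1_on U f"
  shows "continuous_on U (\<lambda>x. fd f x v)"
proof -
  obtain D :: "'a \<Rightarrow> 'a \<Rightarrow>\<^sub>L 'b" where D: "\<And>x. x \<in> U \<Longrightarrow> (f has_derivative blinfun_apply (D x)) (at x)" "continuous_on U D"
    using assms unfolding C1_on_def by blast
  have "continuous_on U (\<lambda>x. blinfun_apply (D x) v)" by (intro continuous_intros D(2))
  then show ?thesis by (rule continuous_on_eq) (use has_derivative_imp_fd[OF D(1)] in simp)
qed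

lemma harmonic_on_mean_value:
  fixes u :: "real ^ 'n::finite \<Rightarrow> real"
  assumes U: "open U" and u: "harmonic_on U u"
  shows "mean_value_on U u"
proof -
  have C1: "C1_on U u" "\<And>i. C1_on U (partial_deriv i u)" and lap: "\<And>x. x \<in> U \<Longrightarrow> laplacian u x = 0"
    using u unfolding harmonic_on_def C2_on_def by auto
  have pd: "partial_deriv i v = (\<lambda>y. fd v y (axis i 1))" for i and v :: "real ^ 'n \<Rightarrow> real"
    by (simp add: partial_deriv_def [abs_def])
  have basis: "(Basis :: (real ^ 'n) set) = range (\<lambda>i. axis i 1)" by (auto simp: Basis_vec_def)
  have inj: "inj (\<lambda>i::'n. axis i (1::real))" by (rule injI) (metis axis_eq_axis zero_neq_one)
  show ?thesis
  proof (rule mean_value_on_laplace[OF U, where u' = "fd u" and u'' = "\<lambda>b y. fd (\<lambda>y. fd u y b) y"])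
    show "(u has_derivative fd u y) (at y)" if "y \<in> U" for y by (rule C1_onD[OF C1(1) that])
    fix b :: "real ^ 'n" assume "b \<in> Basis"
    then obtain i where b: "b = axis i 1" using basis by auto
    show "((\<lambda>y. fd u y b) has_derivative fd (\<lambda>y. fd u y b) y) (at y)" if "y \<in> U" for y
      using C1_onD[OF C1(2)[of i] that] unfolding pd b .
    show "continuous_on U (\<lambda>y. fd (\<lambda>y. fd u y b) y b)"
      using C1_on_continuous_fd[OF C1(2)[of i]] unfolding pd b .
  next
    fix y assume y: "y \<in> U"
    have "(\<Sum>b\<in>Basis. fd (\<lambda>y. fd u y b) y b) = (\<Sum>i\<in>UNIV. fd (\<lambda>y. fd u y (axis i 1)) y (axis i 1))"
      unfolding basis by (subst sum.reindex[OF inj]) simp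
    also have "\<dots> = laplacian u y" unfolding laplacian_def pd ..
    finally show "(\<Sum>b\<in>Basis. fd (\<lambda>y. fd u y b) y b) = 0" using lap[OF y] by simp
  qed
qed

lemma max_stretch_bound:
  fixes f :: "real ^ 'n::finite \<Rightarrow> real ^ 'n"
  assumes "f differentiable (at x)"
  shows "norm (fd f x v) \<le> max_stretch f x * norm v" "min_stretch f x * norm v \<le> norm (fd f x v)"
proof -
  have lin: "linear (fd f x)" using assms frechet_derivative_works has_derivative_linear by blast
  have *: "norm (fd f x v) = norm v * norm (fd f x ((1 / norm v) *\<^sub>R v))" if "v \<noteq> 0"
    using that by (simp add: linear_cmul[OF lin])
  have s: "(1 / norm v) *\<^sub>R v \<in> sphere 0 1" if "v \<noteq> 0" using that by simp
  show "norm (fd f x v) \<le> max_stretch f x * norm v"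
    using stretch_attained(3)[OF assms s] * linear_0[OF lin] by (cases "v = 0") (auto simp: mult.commute mult_left_mono)
  show "min_stretch f x * norm v \<le> norm (fd f x v)"
    using stretch_attained(4)[OF assms s] * linear_0[OF lin] by (cases "v = 0") (auto simp: mult.commute mult_left_mono)
qed

text \<open>
  Both sides are continuous, so the inequality extends from almost every point to every point.
\<close>

lemma distortion_on_AE:
  fixes h :: "real ^ 'n::finite \<Rightarrow> real ^ 'n"
  assumes U: "open U" and diff: "\<And>x. x \<in> U \<Longrightarrow> h differentiable (at x)" and cont: "\<And>v. continuous_on U (\<lambda>x. fd h x v)"
    and ae: "AE x in lebesgue_on U. max_stretch h x ^ CARD('n) \<le> K * \<bar>jacobian_det h x\<bar>"
  shows "distortion_on K U h"
  unfolding distortion_on_def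
proof (intro ballI allI)
  fix x v assume x: "x \<in> U"
  let ?n = "CARD('n)"
  let ?q = "\<lambda>y. norm (fd h y v) ^ ?n - K * \<bar>jac h y\<bar> * norm v ^ ?n"
  have cq: "continuous_on U ?q"
    by (intro continuous_intros cont continuous_on_det continuous_on_matrix_fd)
  define V where "V = U \<inter> ?q -` {0<..}"
  have Vo: "open V" unfolding V_def by (rule continuous_open_preimage[OF cq U]) auto
  have "AE y in lebesgue. y \<in> U \<longrightarrow> max_stretch h y ^ ?n \<le> K * \<bar>jacobian_det h y\<bar>"
    using ae U by (simp add: AE_restrict_space_iff)
  then have "AE y in lebesgue. y \<notin> V"
  proof (rule eventually_mono)
    fix y assume y: "y \<in> U \<longrightarrow> max_stretch h y ^ ?n \<le> K * \<bar>jacobian_det h y\<bar>"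
    show "y \<notin> V"
    proof
      assume "y \<in> V"
      then have yU: "y \<in> U" and q: "0 < ?q y" by (auto simp: V_def)
      have "norm (fd h y v) ^ ?n \<le> (max_stretch h y * norm v) ^ ?n"
        by (intro power_mono max_stretch_bound diff yU) auto
      also have "\<dots> = max_stretch h y ^ ?n * norm v ^ ?n" by (rule power_mult_distrib)
      also have "\<dots> \<le> (K * \<bar>jacobian_det h y\<bar>) * norm v ^ ?n" using y yU by (intro mult_right_mono) auto
      finally show False using q by (simp add: jacobian_det_def)
    qed
  qed
  then have "negligible V"
    by (metis AE_iff_null_sets negligible_iff_null_sets Vo borel_open sets_completionI_sets sets_lborel)
  then have "V = {}" using open_not_negligible[OF Vo] by blast
  then have "x \<notin> V" by simp
  then show "norm (fd h x v) ^ ?n \<le> K * \<bar>jac h x\<bar> * norm v ^ ?n" using x by (auto simp: V_def)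
qed

section \<open>The derivative near the boundary\<close>

lemma fd_diff_const:
  assumes "(f has_derivative fd f x) (at x)"
  shows "fd (\<lambda>y. f y - c) x = fd f x"
  by (rule has_derivative_imp_fd) (use has_derivative_diff[OF assms has_derivative_const] in simp)

lemma qc_limit_on_diff_const:
  assumes U: "open U" and f: "qc_limit_on K U f"
  shows "qc_limit_on K U (\<lambda>x. f x - c)"
proof -
  have mv: "mean_value_on U f" and ai: "approx_injective_on U f" and di: "distortion_on K U f"
    using f unfolding qc_limit_on_def by auto
  have fdf: "fd (\<lambda>y. f y - c) x = fd f x" if "x \<in> U" for x
    by (rule fd_diff_const[OF mean_value_has_fd[OF U mv that]])
  have "approx_injective_on U (\<lambda>x. f x - c)"
    unfolding approx_injective_on_def
  proof (intro allI impI, elim conjE)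
    fix C and \<epsilon> :: real assume C: "compact C" "C \<subseteq> U" "0 < \<epsilon>"
    then obtain g where g: "inj_on g C" and gx: "\<And>x. x \<in> C \<Longrightarrow> g differentiable (at x) \<and> norm (g x - f x) \<le> \<epsilon> \<and>
        (\<forall>v. norm (fd g x v - fd f x v) \<le> \<epsilon> * norm v)"
      using ai unfolding approx_injective_on_def by metis
    have fdg: "fd (\<lambda>y. g y - c) x = fd g x" if "x \<in> C" for x
      by (rule fd_diff_const) (use gx[OF that] frechet_derivative_works in blast)
    show "\<exists>g. inj_on g C \<and> (\<forall>x\<in>C. g differentiable (at x) \<and> norm (g x - (f x - c)) \<le> \<epsilon> \<and>
        (\<forall>v. norm (fd g x v - fd (\<lambda>x. f x - c) x v) \<le> \<epsilon> * norm v))"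
    proof (intro exI[of _ "\<lambda>x. g x - c"] conjI ballI)
      show "inj_on (\<lambda>x. g x - c) C" using g by (auto simp: inj_on_def)
      fix x assume x: "x \<in> C"
      show "(\<lambda>x. g x - c) differentiable (at x)" using gx[OF x] by (intro differentiable_diff) auto
      show "norm (g x - c - (f x - c)) \<le> \<epsilon>" using gx[OF x] by simp
      show "\<forall>v. norm (fd (\<lambda>x. g x - c) x v - fd (\<lambda>x. f x - c) x v) \<le> \<epsilon> * norm v"
        using gx[OF x] fdf[OF subsetD[OF C(2) x]] fdg[OF x] by simp
    qed
  qed
  moreover have "mean_value_on U (\<lambda>x. f x - c)"
    by (rule mean_value_on_diff[OF mv mean_value_on_const])
  moreover have "distortion_on K U (\<lambda>x. f x - c)"
    using di fdf unfolding distortion_on_def by simp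
  ultimately show ?thesis unfolding qc_limit_on_def by blast
qed

text \<open>
  A singular map kills a unit vector. If \<open>A\<close> is invertible, choose \<open>v\<close> with \<open>A v = e\<close>; the bound on the
  component \<open>e \<bullet> A v = 1\<close> forces \<open>v\<close> to be long.
\<close>

lemma exists_unit_vector_image_le:
  fixes A :: "'a::euclidean_space \<Rightarrow> 'a"
  assumes lin: "linear A" and e: "norm e = 1" and M: "\<And>v. \<bar>e \<bullet> A v\<bar> \<le> M * norm v"
  obtains v where "norm v = 1" "norm (A v) \<le> M"
proof (cases "inj A")
  case True
  then obtain v where v: "A v = e" using linear_injective_imp_surjective[OF lin] by (metis surjD)
  have v0: "v \<noteq> 0" using v e linear_0[OF lin] by auto
  have "1 \<le> M * norm v" using M[of v] v e by (simp add: norm_eq_1)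
  then have "1 / norm v \<le> M" using v0 by (simp add: divide_simps)
  then have "norm (A ((1 / norm v) *\<^sub>R v)) \<le> M" by (simp add: linear_cmul[OF lin] v e)
  then show ?thesis using that[of "(1 / norm v) *\<^sub>R v"] v0 by simp
next
  case False
  then obtain v where v: "A v = 0" "v \<noteq> 0" using linear_injective_0[OF lin] by blast
  have "0 \<le> \<bar>e \<bullet> A v\<bar>" by simp
  also have "\<dots> \<le> M * norm v" by (rule M)
  finally have "0 \<le> M" using v(2) by (simp add: zero_le_mult_iff)
  then have "norm (A ((1 / norm v) *\<^sub>R v)) \<le> M" by (simp add: linear_cmul[OF lin] v)
  then show ?thesis using that[of "(1 / norm v) *\<^sub>R v"] v(2) by simp
qed

text \<open>
  Take \<open>p\<close> as a point of the complement nearest to \<open>c\<close>, and separate it from \<open>D\<close>.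
\<close>

lemma convex_supporting_functional:
  fixes D :: "'a::euclidean_space set"
  assumes D: "open D" "convex D" "D \<noteq> UNIV" and c: "c \<in> D"
  obtains \<rho> p e where "0 < \<rho>" "ball c \<rho> \<subseteq> D" "norm e = 1" "(p - c) \<bullet> e \<le> \<rho>" "\<And>w. w \<in> D \<Longrightarrow> 0 < (p - w) \<bullet> e"
proof -
  have cl: "closed (- D)" "- D \<noteq> {}" using D by auto
  obtain p where p: "p \<in> - D" "infdist c (- D) = dist c p" using infdist_attains_inf[OF cl] by blast
  have "D \<inter> {p} = {}" using p(1) by auto
  then obtain a b where a: "a \<noteq> 0" "\<forall>w\<in>D. a \<bullet> w \<le> b" "\<forall>w\<in>{p}. b \<le> a \<bullet> w"
    using separating_hyperplane_sets[OF D(2) convex_singleton[of p]] c by blast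
  have strict: "a \<bullet> w < a \<bullet> p" if w: "w \<in> D" for w
  proof -
    obtain \<epsilon> where \<epsilon>: "\<epsilon> > 0" "ball w \<epsilon> \<subseteq> D" using D(1) w openE by blast
    let ?w = "w + (\<epsilon> / 2 / norm a) *\<^sub>R a"
    have "?w \<in> ball w \<epsilon>" using \<epsilon> a by (simp add: dist_norm)
    then have "a \<bullet> ?w \<le> a \<bullet> p" using \<epsilon> a by (meson insertI1 order_trans subsetD)
    moreover have "a \<bullet> ?w = a \<bullet> w + (\<epsilon> / 2 / norm a) * (a \<bullet> a)" by (simp add: inner_add_right)
    moreover have "(\<epsilon> / 2 / norm a) * (a \<bullet> a) > 0" using \<epsilon> a by (intro mult_pos_pos) auto
    ultimately show ?thesis by linarith
  qed
  show ?thesis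
  proof (rule that[of "dist c p" "(1 / norm a) *\<^sub>R a" p])
    show "0 < dist c p" using p(1) c by auto
    show "ball c (dist c p) \<subseteq> D"
    proof
      fix w assume w: "w \<in> ball c (dist c p)"
      show "w \<in> D"
      proof (rule ccontr)
        assume "w \<notin> D"
        then have "infdist c (- D) \<le> dist c w" by (intro infdist_le) auto
        then show False using w p(2) by simp
      qed
    qed
    show ne: "norm ((1 / norm a) *\<^sub>R a) = 1" using a by simp
    have "(p - c) \<bullet> ((1 / norm a) *\<^sub>R a) \<le> norm (p - c) * norm ((1 / norm a) *\<^sub>R a)" by (rule norm_cauchy_schwarz)
    then show "(p - c) \<bullet> ((1 / norm a) *\<^sub>R a) \<le> dist c p" unfolding ne by (simp add: dist_norm norm_minus_commute)
    show "0 < (p - w) \<bullet> ((1 / norm a) *\<^sub>R a)" if "w \<in> D" for w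
      using strict[OF that] a(1) by (simp add: inner_diff_left inner_diff_right inner_commute)
  qed
qed

text \<open>
  The product of the gradient constant \<open>harnack_const / (d / 10)\<close> with the Harnack factor over the
  distance \<open>3/4 * d\<close>, without the power of \<open>d\<close>.
\<close>

definition stretch_const :: "'a::euclidean_space itself \<Rightarrow> real" where
  "stretch_const _ = 10 * harnack_const TYPE('a) * exp (15 / 2 * harnack_const TYPE('a))"

text \<open>
  The supporting functional of the image at the point \<open>p\<close> nearest to \<open>h x\<close> makes
  \<open>u y = (p - h y) \<bullet> e\<close> a positive harmonic function with \<open>u x \<le> \<rho>\<close> and \<open>R \<le> u 0\<close>. The Hopf bound for
  \<open>u\<close> is the lower bound of \<open>\<rho>\<close>. Harnack's inequality bounds the gradient of \<open>u\<close>, that is, one component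
  of the derivative of \<open>h\<close>, near \<open>x\<close>; then some direction is stretched little, and by the
  assumption on \<open>Q\<close> so are all.
\<close>

lemma boundary_rescaling:
  fixes h :: "'a::euclidean_space \<Rightarrow> 'a"
  assumes mv: "mean_value_on (ball 0 1) h"
    and D: "open (h ` ball 0 1)" "convex (h ` ball 0 1)" "h ` ball 0 1 \<noteq> UNIV"
    and R: "0 < R" "ball (h 0) R \<subseteq> h ` ball 0 1"
    and Q: "\<And>y v w. y \<in> ball 0 1 \<Longrightarrow> norm v = 1 \<Longrightarrow> norm (fd h y w) \<le> Q * norm (fd h y v) * norm w" and Q0: "0 \<le> Q"
    and x: "x \<in> ball 0 1"
  obtains \<rho> where "0 < \<rho>" "ball (h x) \<rho> \<subseteq> h ` ball 0 1" "hopf_const TYPE('a) * R * (1 - norm x) \<le> \<rho>"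
    "\<And>y. y \<in> ball x (3/4 * (1 - norm x)) \<Longrightarrow> norm (h y - h x) \<le> Q * stretch_const TYPE('a) * \<rho>"
proof -
  let ?B = "ball (0::'a) 1" and ?H = "harnack_const TYPE('a)"
  define d where "d = 1 - norm x"
  have d: "0 < d" using x by (simp add: d_def)
  have H0: "?H \<ge> 0" by (simp add: harnack_const_def)
  obtain \<rho> p e where \<rho>: "0 < \<rho>" "ball (h x) \<rho> \<subseteq> h ` ?B" and e: "norm e = 1" and le: "(p - h x) \<bullet> e \<le> \<rho>"
    and pos: "\<And>w. w \<in> h ` ?B \<Longrightarrow> 0 < (p - w) \<bullet> e"
    by (rule convex_supporting_functional[OF D imageI[OF x]]) (rule that; (assumption | blast))
  define u where "u y = (p - h y) \<bullet> e" for y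
  have mvu: "mean_value_on ?B u" unfolding u_def
    by (intro mean_value_on_inner mean_value_on_diff mean_value_on_const mv)
  have upos: "0 < u y" if "y \<in> ?B" for y unfolding u_def by (rule pos[OF imageI[OF that]])
  note dh = mean_value_has_fd[OF open_ball mv]
  have fdu: "fd u y v = - (e \<bullet> fd h y v)" if "y \<in> ?B" for y v
  proof -
    have "(u has_derivative (\<lambda>v. (0 - fd h y v) \<bullet> e)) (at y)"
      unfolding u_def by (intro has_derivative_inner_left has_derivative_diff has_derivative_const dh that)
    then show ?thesis by (simp add: has_derivative_imp_fd inner_commute)
  qed
  have R0: "R \<le> u 0"
  proof (rule ccontr)
    assume "\<not> R \<le> u 0"
    moreover have u0: "0 < u 0" by (rule upos) simp
    ultimately have "h 0 + u 0 *\<^sub>R e \<in> ball (h 0) R" using e by (simp add: dist_norm)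
    then have "0 < (p - (h 0 + u 0 *\<^sub>R e)) \<bullet> e" using R(2) pos by blast
    then show False using e by (simp add: u_def inner_diff_left inner_add_left norm_eq_1)
  qed
  show ?thesis
  proof (rule that[OF \<rho>])
    have hc: "hopf_const TYPE('a) > 0" by (rule hopf_const_pos)
    have "hopf_const TYPE('a) * R * (1 - norm x) \<le> hopf_const TYPE('a) * u 0 * (1 - norm x)"
      using R0 hc x by (intro mult_right_mono mult_left_mono) auto
    also have "\<dots> \<le> u x" by (rule hopf_lower_bound[OF mvu upos x])
    also have "\<dots> \<le> \<rho>" using le by (simp add: u_def)
    finally show "hopf_const TYPE('a) * R * (1 - norm x) \<le> \<rho>" .
  next
    fix y assume y: "y \<in> ball x (3/4 * (1 - norm x))"
    let ?S = "ball x (3/4 * d)"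
    have near: "cball z (2 * (d / 10)) \<subseteq> ?B" if z: "z \<in> ?S" for z
    proof
      fix w assume w: "w \<in> cball z (2 * (d / 10))"
      have "norm w \<le> norm x + dist x z + dist z w"
        by (smt (verit) dist_norm norm_triangle_sub norm_minus_commute)
      then show "w \<in> ?B" using z w d by (simp add: d_def)
    qed
    have zB: "z \<in> ?B" if "z \<in> ?S" for z using near[OF that] d by (auto simp: subset_iff)
    have xS: "x \<in> ?S" using d by simp
    have der: "norm (fd h z w) \<le> Q * stretch_const TYPE('a) * \<rho> / d * norm w" if z: "z \<in> ?S" for z w
    proof -
      let ?M = "stretch_const TYPE('a) * \<rho> / d"
      have "\<bar>e \<bullet> fd h z v\<bar> \<le> ?M * norm v" for v
      proof -
        have "u z \<le> exp (?H / (d / 10) * norm (z - x)) * u x"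
          by (rule harnack_inequality[OF mvu upos open_ball convex_ball _ near xS z]) (use d in auto)
        also have "\<dots> \<le> exp (15 / 2 * ?H) * \<rho>"
        proof (rule mult_mono)
          have "?H / (d / 10) * norm (z - x) \<le> ?H / (d / 10) * (3/4 * d)"
            using z H0 d by (intro mult_left_mono) (auto simp: dist_norm norm_minus_commute)
          also have "\<dots> = 15 / 2 * ?H" using d by simp
          finally show "exp (?H / (d / 10) * norm (z - x)) \<le> exp (15 / 2 * ?H)" by simp
        qed (use le upos[OF x] in \<open>auto simp: u_def\<close>)
        finally have uz: "u z \<le> exp (15 / 2 * ?H) * \<rho>" .
        have "\<bar>fd u z v\<bar> \<le> ?H / (d / 10) * u z * norm v"
          by (rule nonneg_gradient_bound[OF mvu _ near[OF z]]) (use d near[OF z] upos in \<open>auto simp: less_imp_le subset_iff\<close>)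
        also have "\<dots> \<le> ?H / (d / 10) * (exp (15 / 2 * ?H) * \<rho>) * norm v"
          using uz H0 d by (intro mult_right_mono mult_left_mono) auto
        also have "\<dots> = ?M * norm v" by (simp add: stretch_const_def)
        finally show ?thesis using fdu[OF zB[OF z]] by simp
      qed
      then obtain v where v: "norm v = 1" "norm (fd h z v) \<le> ?M"
        by (rule exists_unit_vector_image_le[OF has_derivative_linear[OF dh[OF zB[OF z]]] e]) blast
      have "norm (fd h z w) \<le> Q * norm (fd h z v) * norm w" by (rule Q[OF zB[OF z] v(1)])
      also have "\<dots> \<le> Q * ?M * norm w" using v(2) Q0 by (intro mult_right_mono mult_left_mono) auto
      finally show ?thesis by simp
    qed
    let ?L = "Q * stretch_const TYPE('a) * \<rho> / d"
    have L0: "0 \<le> ?L" using Q0 \<rho> d H0 by (simp add: stretch_const_def)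
    have yS: "y \<in> ?S" using y by (simp add: d_def)
    have "norm (h y - h x) \<le> ?L * norm (y - x)"
    proof (rule differentiable_bound[OF convex_ball _ _ yS xS, where f' = "fd h"])
      fix z assume z: "z \<in> ?S"
      show "(h has_derivative fd h z) (at z within ?S)" by (rule has_derivative_at_withinI[OF dh[OF zB[OF z]]])
      show "onorm (fd h z) \<le> ?L" by (rule onorm_le[OF der[OF z]])
    qed
    also have "\<dots> \<le> ?L * d"
      using yS L0 d by (intro mult_left_mono) (auto simp: dist_norm norm_minus_commute)
    also have "\<dots> = Q * stretch_const TYPE('a) * \<rho>" using d by simp
    finally show "norm (h y - h x) \<le> Q * stretch_const TYPE('a) * \<rho>" .
  qed
qed

text \<open>
  Otherwise rescaling \<open>h\<close> at points \<open>X k\<close> with ever smaller derivative produces a limit \<open>P\<close> with a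
  critical point at the origin. It is zero by \<open>critical_point_imp_zero\<close>, whereas
  \<open>oscillation_lower_bound\<close> keeps the rescaled maps away from zero.
\<close>

theorem derivative_lower_bound:
  fixes h :: "real ^ 'n::finite \<Rightarrow> real ^ 'n"
  assumes n: "CARD('n) \<ge> 2" and mv: "mean_value_on (ball 0 1) h" and inj: "inj_on h (ball 0 1)"
    and dist: "distortion_on K (ball 0 1) h" and K: "0 < K" "K < 3 ^ (CARD('n) - 1)"
    and D: "open (h ` ball 0 1)" "convex (h ` ball 0 1)" "bounded (h ` ball 0 1)"
    and R: "0 < R" "ball (h 0) R \<subseteq> h ` ball 0 1"
    and Q: "\<And>y v w. y \<in> ball 0 1 \<Longrightarrow> norm v = 1 \<Longrightarrow> norm (fd h y w) \<le> Q * norm (fd h y v) * norm w" and Q0: "0 \<le> Q"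
  obtains c where "0 < c" "\<And>x. x \<in> ball 0 1 \<Longrightarrow> \<exists>v. c * norm v < norm (fd h x v)"
proof (rule ccontr)
  assume no: "\<not> thesis"
  let ?B = "ball (0 :: real ^ 'n) 1" and ?n = "CARD('n)" and ?T = "TYPE(real ^ 'n)"
  have "h ` ?B \<noteq> UNIV" using D(3) not_bounded_UNIV by metis
  note resc = boundary_rescaling[OF mv D(1,2) this R Q Q0]
  have q: "qc_limit_on K ?B h"
    unfolding qc_limit_on_def
    by (intro conjI mv dist approx_injective_on_inj[OF inj] mean_value_differentiable[OF open_ball mv])
  note dh = mean_value_has_fd[OF open_ball mv]
  have "\<exists>x\<in>?B. \<forall>v. norm (fd h x v) \<le> 1 / real (Suc k) * norm v" for k
    using no that[of "1 / real (Suc k)"] by (force simp: not_less)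
  then obtain X where X: "\<And>k. X k \<in> ?B" and dX: "\<And>k v. norm (fd h (X k) v) \<le> 1 / real (Suc k) * norm v"
    by metis
  define d where "d k = 1 - norm (X k)" for k
  have d: "0 < d k" for k using X[of k] by (simp add: d_def)
  have "\<exists>\<rho>. 0 < \<rho> \<and> ball (h (X k)) \<rho> \<subseteq> h ` ?B \<and> hopf_const ?T * R * d k \<le> \<rho> \<and>
     (\<forall>y\<in>ball (X k) (3/4 * d k). norm (h y - h (X k)) \<le> Q * stretch_const ?T * \<rho>)" for k
    by (rule resc[OF _ _ X[of k]]) (auto simp: d_def)
  then obtain \<rho> where \<rho>: "\<And>k. 0 < \<rho> k" and img: "\<And>k. ball (h (X k)) (\<rho> k) \<subseteq> h ` ?B"
    and hopf: "\<And>k. hopf_const ?T * R * d k \<le> \<rho> k"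
    and bd: "\<And>k y. y \<in> ball (X k) (3/4 * d k) \<Longrightarrow> norm (h y - h (X k)) \<le> Q * stretch_const ?T * \<rho> k"
    by metis
  define g where "g k z = (1 / \<rho> k) *\<^sub>R (h (X k + d k *\<^sub>R z) - h (X k))" for k z
  have zB: "X k + d k *\<^sub>R z \<in> ?B" if "z \<in> ball 0 1" for k z
  proof -
    have "norm (X k + d k *\<^sub>R z) \<le> norm (X k) + d k * norm z"
      using norm_triangle_ineq[of "X k" "d k *\<^sub>R z"] d[of k] by simp
    also have "\<dots> < norm (X k) + d k * 1" using that d[of k] by (intro add_strict_left_mono mult_strict_left_mono) auto
    finally show ?thesis by (simp add: d_def)
  qed
  have qg: "qc_limit_on K (ball 0 r) (g k)" if "r \<le> 1" for k r
    unfolding g_def [abs_def]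
    by (rule qc_limit_on_affine[OF qc_limit_on_diff_const[OF open_ball q] open_ball d]) (use \<rho> zB that in auto)
  have mvg: "mean_value_on (ball 0 r) (g k)" if "r \<le> 1" for k r
    using qg[OF that] unfolding qc_limit_on_def by blast
  have gM: "norm (g k z) \<le> Q * stretch_const ?T" if "z \<in> ball 0 (3/4)" for k z
  proof -
    have "X k + d k *\<^sub>R z \<in> ball (X k) (3/4 * d k)" using that d[of k] by (simp add: dist_norm mult.commute)
    from bd[OF this] show ?thesis using \<rho>[of k] by (simp add: g_def divide_simps)
  qed
  obtain P \<kappa> where \<kappa>: "strict_mono (\<kappa> :: nat \<Rightarrow> nat)" and lim: "uniform_limit (ball 0 (5/8)) (\<lambda>k. g (\<kappa> k)) P sequentially"
    by (rule mean_value_compactness[OF mvg gM, of "3/4" "5/8"]) (auto intro: that)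
  have qP: "qc_limit_on K (ball 0 (5/8)) P" by (rule qc_limit_on_limit[OF qg lim]) simp
  have P0: "P 0 = 0"
  proof (rule LIMSEQ_unique)
    show "(\<lambda>k. g (\<kappa> k) 0) \<longlonglongrightarrow> P 0" by (rule tendsto_uniform_limitI[OF lim]) simp
    show "(\<lambda>k. g (\<kappa> k) 0) \<longlonglongrightarrow> 0" by (simp add: g_def)
  qed
  have fdP: "fd P 0 v = 0" for v
  proof (rule LIMSEQ_unique)
    show "(\<lambda>k. fd (g (\<kappa> k)) 0 v) \<longlonglongrightarrow> fd P 0 v"
      by (rule fd_tendsto[OF mvg lim]) auto
    let ?C = "norm v / (hopf_const ?T * R)"
    have bound: "norm (fd (g k) 0 v) \<le> ?C / real (Suc k)" for k
    proof -
      have fdh: "fd (\<lambda>y. h y - h (X k)) (X k) = fd h (X k)" by (rule fd_diff_const[OF dh[OF X]])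
      have dd: "((\<lambda>y. h y - h (X k)) has_derivative fd (\<lambda>y. h y - h (X k)) (X k + d k *\<^sub>R 0)) (at (X k + d k *\<^sub>R 0))"
        using has_derivative_diff[OF dh[OF X[of k]] has_derivative_const[of "h (X k)"]] fdh by simp
      have fg: "fd (g k) 0 = (\<lambda>v. (1 / \<rho> k * d k) *\<^sub>R fd h (X k) v)"
        using fd_scaled[OF dd, of "1 / \<rho> k"] fdh unfolding g_def [abs_def] by simp
      have hR: "hopf_const ?T * R > 0" using R hopf_const_pos by (intro mult_pos_pos)
      have "d k / \<rho> k \<le> 1 / (hopf_const ?T * R)"
        using hopf[of k] \<rho>[of k] hR by (simp add: divide_simps mult.commute)
      moreover have "norm (fd h (X k) v) \<le> norm v / real (Suc k)" using dX[of k v] by simp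
      ultimately have "(d k / \<rho> k) * norm (fd h (X k) v) \<le> (1 / (hopf_const ?T * R)) * (norm v / real (Suc k))"
        using hR by (intro mult_mono) auto
      then show ?thesis using d[of k] \<rho>[of k] by (simp add: fg)
    qed
    have "(\<lambda>k. ?C / real (Suc k)) \<longlonglongrightarrow> 0"
      using tendsto_mult_right_zero[OF LIMSEQ_inverse_real_of_nat, of ?C] by (simp add: divide_inverse)
    from LIMSEQ_subseq_LIMSEQ[OF this \<kappa>]
    show "(\<lambda>k. fd (g (\<kappa> k)) 0 v) \<longlonglongrightarrow> 0"
      by (rule Lim_null_comparison[rotated]) (use bound in \<open>simp add: o_def\<close>)
  qed
  have Pz: "P z = 0" if "z \<in> ball 0 (5/8)" for z
    by (rule critical_point_imp_zero[OF qP K(2) P0 fdP that])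
  define b where "b = 1 + 3 * 4 ^ ?n * (1 + 3 * 48 ^ ?n * K)"
  obtain N :: nat where N: "b < real N" using reals_Archimedean2 by blast
  have "\<forall>\<^sub>F k in sequentially. \<forall>z\<in>ball 0 (5/8). dist (g (\<kappa> k) z) (P z) < 1 / 2 ^ N"
    by (rule uniform_limitD[OF lim]) simp
  then obtain k where "\<forall>z\<in>ball 0 (5/8). dist (g (\<kappa> k) z) (P z) < 1 / 2 ^ N"
    unfolding eventually_sequentially by blast
  then have small: "norm (g (\<kappa> k) z) < 1 / 2 ^ N" if "z \<in> ball 0 (5/8)" for z
    using Pz[OF that] that by (force simp: dist_norm)
  let ?x = "X (\<kappa> k)" and ?d = "d (\<kappa> k)" and ?r = "\<rho> (\<kappa> k)"
  \<comment> \<open>the radial direction, in which a step of length \<open>3/2 * d\<close> leaves the unit ball\<close>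
  obtain e where e: "norm e = 1" "?x \<bullet> e = norm ?x"
  proof (cases "?x = 0")
    case True
    then show ?thesis using that[of "axis undefined 1"] by simp
  next
    case False
    then show ?thesis using that[of "sgn ?x"] by (simp add: norm_sgn sgn_div_norm power2_norm_eq_inner[symmetric] power2_eq_square)
  qed
  have "real N \<le> b" unfolding b_def
  proof (rule oscillation_lower_bound[OF n open_ball inj dh _ dist K(1) d e(1) _ _ \<rho> img])
    show "continuous_on ?B (\<lambda>y. fd h y v)" for v by (rule mean_value_continuous_fd[OF open_ball mv])
    show sub: "cball ?x (?d / 2) \<subseteq> ?B"
    proof
      fix y assume "y \<in> cball ?x (?d / 2)"
      then have "norm (y - ?x) \<le> ?d / 2" by (simp add: dist_norm norm_minus_commute)
      then show "y \<in> ?B" using norm_triangle_sub[of y ?x] d[of "\<kappa> k"] by (simp add: d_def)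
    qed
    fix y assume y: "y \<in> cball ?x (?d / 2)"
    then have ny: "norm (y - ?x) \<le> ?d / 2" by (simp add: dist_norm norm_minus_commute)
    show "y + (3/2 * ?d) *\<^sub>R e \<notin> ?B"
    proof
      assume "y + (3/2 * ?d) *\<^sub>R e \<in> ?B"
      moreover have "(y + (3/2 * ?d) *\<^sub>R e) \<bullet> e \<le> norm (y + (3/2 * ?d) *\<^sub>R e) * norm e" by (rule norm_cauchy_schwarz)
      ultimately have "(y + (3/2 * ?d) *\<^sub>R e) \<bullet> e < 1" using e by simp
      moreover have "(y + (3/2 * ?d) *\<^sub>R e) \<bullet> e = norm ?x - (?x - y) \<bullet> e + 3/2 * ?d"
        using e by (simp add: inner_simps norm_eq_1)
      moreover have "(?x - y) \<bullet> e \<le> norm (?x - y) * norm e" by (rule norm_cauchy_schwarz)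
      moreover have "norm (?x - y) * norm e = norm (y - ?x)" using e by (simp add: norm_minus_commute)
      moreover have "norm ?x = 1 - ?d" by (simp add: d_def)
      ultimately show False using ny by linarith
    qed
    let ?z = "(1 / ?d) *\<^sub>R (y - ?x)"
    have "norm ?z \<le> 1/2" using ny d[of "\<kappa> k"] by (simp add: divide_simps)
    then have "?z \<in> ball 0 (5/8)" unfolding mem_ball_0 by linarith
    then have "norm (g (\<kappa> k) ?z) < 1 / 2 ^ N" by (rule small)
    moreover have "?x + ?d *\<^sub>R ?z = y" using d[of "\<kappa> k"] by simp
    ultimately show "norm (h y - h ?x) \<le> ?r / 2 ^ N" using \<rho>[of "\<kappa> k"] unfolding g_def by (simp add: divide_simps mult.commute)
  qed
  then show False using N by simp
qed

section \<open>From the derivative to the co-Lipschitz inequality\<close>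

lemma co_Lipschitz_on_derivative:
  fixes h :: "'a::euclidean_space \<Rightarrow> 'a"
  assumes U: "open U" and inj: "inj_on h U" and der: "\<And>x. x \<in> U \<Longrightarrow> (h has_derivative h' x) (at x)"
    and conv: "convex (h ` U)" and c: "0 < c" and low: "\<And>x v. x \<in> U \<Longrightarrow> c * norm v \<le> norm (h' x v)"
  shows "co_Lipschitz_on U h"
proof -
  let ?g = "inv_into U h"
  have cont: "continuous_on U h"
    by (rule has_derivative_continuous_on) (use der has_derivative_at_withinI in blast)
  have g: "?g (h x) = x" if "x \<in> U" for x by (rule inv_into_f_f[OF inj that])
  have surj: "surj (h' x)" if x: "x \<in> U" for x
  proof -
    have lin: "linear (h' x)" by (rule has_derivative_linear[OF der[OF x]])
    have "inj (h' x)" unfolding linear_injective_0[OF lin]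
    proof (intro allI impI)
      fix v assume "h' x v = 0"
      then have "c * norm v \<le> 0" using low[OF x, of v] by simp
      then show "v = 0" using c by (simp add: mult_le_0_iff)
    qed
    then show ?thesis by (rule linear_inj_imp_surj[OF lin])
  qed
  have dg: "(?g has_derivative inv (h' x)) (at (h x))" if x: "x \<in> U" for x
    by (rule has_derivative_inverse_strong[OF U x cont g der[OF x]]) (use surj[OF x] in \<open>simp_all add: surj_iff\<close>)
  have Lip: "norm (?g a - ?g b) \<le> 1 / c * norm (a - b)" if ab: "a \<in> h ` U" "b \<in> h ` U" for a b
  proof (rule differentiable_bound[OF conv _ _ ab, where f' = "\<lambda>a. inv (h' (?g a))"])
    fix a assume "a \<in> h ` U"
    then obtain x where x: "x \<in> U" "a = h x" by blast
    show "(?g has_derivative inv (h' (?g a))) (at a within h ` U)"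
      using dg[OF x(1)] x g has_derivative_at_withinI by metis
    show "onorm (inv (h' (?g a))) \<le> 1 / c"
    proof (rule onorm_le)
      fix v
      have "c * norm (inv (h' x) v) \<le> norm (h' x (inv (h' x) v))" by (rule low[OF x(1)])
      also have "h' x (inv (h' x) v) = v" by (rule surj_f_inv_f[OF surj[OF x(1)]])
      finally show "norm (inv (h' (?g a)) v) \<le> 1 / c * norm v" using c x g by (simp add: field_simps)
    qed
  qed
  show ?thesis unfolding co_Lipschitz_on_def
  proof (intro exI[of _ c] conjI ballI c)
    fix x y assume "x \<in> U" "y \<in> U"
    then have "norm (x - y) \<le> 1 / c * norm (h x - h y)" using Lip[of "h x" "h y"] g by simp
    then show "c * norm (x - y) \<le> norm (h x - h y)" using c by (simp add: field_simps)
  qed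
qed

text \<open>
  The two quasiconformality inequalities give the bound \<open>K\<^sup>2\<close> for the \<open>n\<close>-th power of the quotient; the
  maximum with \<open>1\<close> avoids the root.
\<close>

lemma quasiconformal_on_max_le_min_stretch:
  fixes h :: "real ^ 'n::finite \<Rightarrow> real ^ 'n"
  assumes q: "quasiconformal_on K U h" and x: "x \<in> U" and diff: "h differentiable (at x)"
  shows "max_stretch h x \<le> max 1 (K\<^sup>2) * min_stretch h x"
proof (rule ccontr)
  let ?n = "CARD('n)" and ?Q = "max 1 (K\<^sup>2)"
  assume "\<not> max_stretch h x \<le> ?Q * min_stretch h x"
  then have less: "?Q * min_stretch h x < max_stretch h x" by simp
  have K: "0 < K" using q by (simp add: quasiconformal_on_def)
  have m0: "0 \<le> min_stretch h x" using stretch_attained(2)[OF diff] by (metis norm_ge_zero)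
  have "max_stretch h x ^ ?n / K \<le> K * min_stretch h x ^ ?n"
    using q x unfolding quasiconformal_on_def by force
  then have "max_stretch h x ^ ?n \<le> K\<^sup>2 * min_stretch h x ^ ?n"
    using K by (simp add: divide_simps power2_eq_square mult_ac)
  also have "\<dots> \<le> ?Q ^ ?n * min_stretch h x ^ ?n"
  proof (rule mult_right_mono)
    have "?Q ^ 1 \<le> ?Q ^ ?n" by (rule power_increasing) auto
    then show "K\<^sup>2 \<le> ?Q ^ ?n" by simp
  qed (use m0 in simp)
  also have "\<dots> = (?Q * min_stretch h x) ^ ?n" by (simp only: power_mult_distrib)
  also have "\<dots> < max_stretch h x ^ ?n" using less m0 by (intro power_strict_mono) auto
  finally show False by simp
qed

theorem theorem2p4:
  fixes h :: "real ^ 'n::finite \<Rightarrow> real ^ 'n"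
    and D :: "(real ^ 'n) set"
    and K R\<^sub>0 :: real
  assumes "CARD('n) \<ge> 2"
    and "harmonic_mapping_on (ball 0 1) h"
    and "quasiconformal_on K (ball 0 1) h"
    and "D = h ` ball 0 1"
    and "open D" and "connected D"
    and "bounded D"
    and "convex D"
    and "R\<^sub>0 > 0"
    and "ball (h 0) R\<^sub>0 \<subseteq> D"
    and "outer_dilatation (ball 0 1) h < 3 ^ (CARD('n) - 1)"
  shows "co_Lipschitz_on (ball 0 1) h"
proof -
  let ?B = "ball (0 :: real ^ 'n) 1" and ?Q = "max 1 (K\<^sup>2)"
  have inj: "inj_on h ?B" and C1: "C1_on ?B h"
    using assms(3) unfolding quasiconformal_on_def by auto
  note dh = C1_onD[OF C1]
  have diff: "h differentiable (at x)" if "x \<in> ?B" for x by (rule differentiableI[OF dh[OF that]])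
  have mv: "mean_value_on ?B h"
    using assms(2) harmonic_on_mean_value[OF open_ball] unfolding harmonic_mapping_on_def
    by (intro mean_value_on_vec) blast
  have "(3::ereal) ^ (CARD('n) - 1) = ereal (3 ^ (CARD('n) - 1))" by simp
  then obtain K' where K': "0 \<le> K'" "K' < 3 ^ (CARD('n) - 1)"
    and ae: "AE x in lebesgue_on ?B. max_stretch h x ^ CARD('n) \<le> K' * \<bar>jacobian_det h x\<bar>"
    using assms(11) unfolding outer_dilatation_def INF_less_iff by auto
  \<comment> \<open>an admissible constant may be enlarged to be positive, still below the bound\<close>
  have "1 < (3::real) ^ (CARD('n) - 1)" using assms(1) by (intro one_less_power) auto
  then have K1: "0 < max 1 K'" "max 1 K' < 3 ^ (CARD('n) - 1)" using K' by auto
  have "AE x in lebesgue_on ?B. max_stretch h x ^ CARD('n) \<le> max 1 K' * \<bar>jacobian_det h x\<bar>"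
    using ae
  proof (rule eventually_mono)
    fix x assume "max_stretch h x ^ CARD('n) \<le> K' * \<bar>jacobian_det h x\<bar>"
    also have "\<dots> \<le> max 1 K' * \<bar>jacobian_det h x\<bar>" by (intro mult_right_mono) auto
    finally show "max_stretch h x ^ CARD('n) \<le> max 1 K' * \<bar>jacobian_det h x\<bar>" .
  qed
  then have dist: "distortion_on (max 1 K') ?B h"
    by (intro distortion_on_AE[where K = "max 1 K'"] open_ball diff C1_on_continuous_fd[OF C1])
  have str: "max_stretch h x \<le> ?Q * min_stretch h x" if "x \<in> ?B" for x
    by (rule quasiconformal_on_max_le_min_stretch[OF assms(3) that diff[OF that]])
  have Q: "norm (fd h y w) \<le> ?Q * norm (fd h y v) * norm w" if y: "y \<in> ?B" and v: "norm v = 1" for y v w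
  proof -
    have "norm (fd h y w) \<le> max_stretch h y * norm w" by (rule max_stretch_bound[OF diff[OF y]])
    also have "\<dots> \<le> ?Q * min_stretch h y * norm w" by (intro mult_right_mono str y) simp
    also have "\<dots> \<le> ?Q * norm (fd h y v) * norm w"
      using max_stretch_bound(2)[OF diff[OF y], of v] v by (intro mult_right_mono mult_left_mono) auto
    finally show ?thesis .
  qed
  obtain c where c: "0 < c" and low: "\<And>x. x \<in> ?B \<Longrightarrow> \<exists>v. c * norm v < norm (fd h x v)"
    by (rule derivative_lower_bound[OF assms(1) mv inj dist K1 _ _ _ assms(9) _ Q]) (use assms in auto)
  have lower: "c / ?Q * norm v \<le> norm (fd h x v)" if x: "x \<in> ?B" for x v
  proof -
    obtain w where "c * norm w < norm (fd h x w)" using low[OF x] by blast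
    also have "\<dots> \<le> max_stretch h x * norm w" by (rule max_stretch_bound[OF diff[OF x]])
    finally have "c < max_stretch h x" by (rule mult_right_less_imp_less) simp
    also have "\<dots> \<le> ?Q * min_stretch h x" by (rule str[OF x])
    finally have "c / ?Q \<le> min_stretch h x" by (simp add: pos_divide_le_eq less_max_iff_disj mult.commute)
    then have "c / ?Q * norm v \<le> min_stretch h x * norm v" by (intro mult_right_mono) auto
    also have "\<dots> \<le> norm (fd h x v)" by (rule max_stretch_bound[OF diff[OF x]])
    finally show ?thesis .
  qed
  show ?thesis
    by (rule co_Lipschitz_on_derivative[OF open_ball inj dh _ _ lower]) (use assms c in \<open>auto simp: less_max_iff_disj\<close>)
qed

end
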